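(* Let the function $\varphi$ and the values $v_1,\dots,v_N>0$ satisfy the assumption of the context, and fix $T_N\le\dots\le T_1$ in $\mathbb T$ and a space-like path $\mathcal S=\{\mathfrak n_1,\dots,\mathfrak n_m\}$, $\mathfrak n_i=(n_i,t_i)$, the time points of which are all greater than $T_1$. Then, for $\vec y\in\mathbb Z^N$ and $\vec a\in\mathbb Z^m$, the function $\mathcal M_{\vec T,\mathcal S}$ of the context can be written as $$\mathcal M_{\vec T,\mathcal S}(\vec y,\vec a)=\det\bigl(I-\bar\chi_aK\bar\chi_a\bigr)_{\ell^2(\mathcal S\times\mathbb Z)},$$ where $\det$ is the Fredholm determinant, $I$ is the identity operator, $\bar\chi_a$ is the multiplication operator $\bar\chi_a((n_j,t_j),x)=\mathbf 1_{x\le a_j}$, and: (1) The kernel $K:(\mathcal S\times\mathbb Z)^2\to\mathbb R$ depends on $\vec T$ and $\vec y$, and is given by $$K(\mathfrak n_i,x_i;\mathfrak n_j,x_j)=-\phi^{(\mathfrak n_i,\mathfrak n_j)}(x_i,x_j)\mathbf 1_{\mathfrak n_i\prec\mathfrak n_j}+\sum_{k=1}^{n_j}\Psi^{\mathfrak n_i}_{n_i-k}(x_i)\Phi^{\mathfrak n_j}_{n_j-k}(x_j)$$ for $\mathfrak n_i=(n_i,t_i)$ and $\mathfrak n_j=(n_j,t_j)$ in $\mathcal S$. (2) For $\mathfrak n_i,\mathfrak n_j$ as before with $\mathfrak n_i\prec\mathfrak n_j$, $$\phi^{(\mathfrak n_i,\mathfrak n_j)}(x_i,x_j)=\frac1{2\pi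 \mathrm i}\oint_{\gamma_\rho}dw\,\frac{\varphi(w)^{t_i-t_j}}{w^{x_i-x_j-n_j+n_i+1}}\prod_{k=n_i+1}^{n_j}(v_k-w)^{-1}.$$ (3) For $\mathfrak n=(n,t)\in\mathcal S$ and $k\in\{1,\dots,n\}$, $$\Psi^{\mathfrak n}_{n-k}(x)=\frac1{2\pi \mathrm i}\oint_{\gamma_\rho}dw\,\frac{\varphi(w)^{t-T_k}}{w^{x-y_k+n-k+1}}\prod_{i=k+1}^n(v_i-w).$$ (4) The functions $\Phi^{\mathfrak n}_{n-k}$, for $k\in\{1,\dots,n\}$ and $\mathfrak n=(n,t)$, are uniquely characterized by: (a) the biorthogonality relation $\sum_{x\in\mathbb Z}\Psi^{\mathfrak n}_\ell(x)\Phi^{\mathfrak n}_k(x)=\mathbf 1_{k=\ell}$ for each $k,\ell=0,\dots,n-1$; (b) $\mathrm{span}\{x\in\mathbb Z\mapsto\Phi^{\mathfrak n}_k(x):0\le k<n\}=\mathbb V_n(\vec v)$.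
   Context: Notation: $\gamma_s$ is the circle of radius $s$ centred at $0$ in the complex plane; $A_{s,S}=\{w\in\mathbb C:s\le|w|\le S\}$; analytic on a closed set means analytic on some open domain containing it. $\mathbb T=\mathbb R$ or $\mathbb T=\mathbb Z$ is the set of times. $\Omega_n=\{\vec x\in\mathbb Z^n:x_1>\dots>x_n\}$. For a vector $\vec x$, $\vec x_{\le n}$ denotes its first $n$ entries. Assumption: $\varphi:U\to\mathbb C$, where the domain $U\subseteq\mathbb C$ contains $0$ and $1$, has at most finitely many singularities in $U$, and is analytic and nowhere zero on an annulus $A_{\rho,\bar\rho}\subseteq U$ with $\rho\in(0,\min_iv_i)$ and $\bar\rho>\max_iv_i$. Definitions: for $1\le k,\ell\le N$ and $t\in\mathbb T$, $$F_{k,\ell}(x_1,x_2;t)=\frac1{2\pi \mathrm i}\oint_{\gamma_{\bar\rho}}dw\,\frac{(w/v_k)^{x_1}}{(w/v_\ell)^{x_2}}\frac{\prod_{i=1}^\ell(w-v_i)}{\prod_{i=1}^k(w-v_i)}\frac{\varphi(w)^t}{w^{\ell-k+1}}.$$ For $n\le N$, $\vec y,\vec x\in\Omega_n$ and $s,t\in\mathbb T$ with $s\le t$, $$G_{s,t}(\vec y,\vec x)=\Bigl(\prod_{i=1}^n\varphi(v_i)^{s-t}\Bigr)\det[F_{k,\ell}(y_k,x_\ell;t-s)]_{k,\ell=1}^n.$$ For pairs in $\{1,\dots,N\}\times\mathbb T$ write $(n_1,t_1)\prec(n_2,t_2)$ if $n_1\le n_2$, $t_1\ge t_2$ and $(n_1,t_1)\ne(n_2,t_2)$.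 A space-like path is a finite sequence $\mathcal S=(\mathfrak n_i)_{i=1}^m$, $m\ge1$, with $\mathfrak n_i=(n_i,t_i)\in\{1,\dots,N\}\times\mathbb T$ and $\mathfrak n_i\prec\mathfrak n_{i+1}$. For such a path, $\vec y\in\Omega_N$ and $\vec x\in\Omega_m$, $$G^+_{\mathcal S}(\vec y,\vec x)=\sum_{\substack{\vec x(t_i)\in\Omega_{n_i}:\\ x_{n_i}(t_i)=x_i,\ i=1,\dots,m}}G_{0,t_m}(\vec y_{\le n_m},\vec x(t_m))\prod_{i=1}^{m-1}G_{t_{i+1},t_i}(\vec x_{\le n_i}(t_{i+1}),\vec x(t_i)),$$ where $\vec x(t_1),\dots,\vec x(t_m)$ are regarded as $m$ different vectors even if some of the times coincide. For $T_N\le\dots\le T_1$, $\vec y\in\mathbb Z^N$ and $\vec x\in\Omega_N$, $$G^-_{\vec T}(\vec y,\vec x)=\Bigl(\prod_{i=1}^N\varphi(v_i)^{T_i}\Bigr)\det[F_{k,\ell}(y_k,x_\ell;-T_k)]_{k,\ell=1}^N .$$ In the case $T_1\le t_m$, $G_{\vec T,\mathcal S}(\vec y,\vec x)=\sum_{\vec z\in\Omega_N}G^-_{\vec T}(\vec y,\vec z)G^+_{\mathcal S}(\vec z,\vec x)$, and for $\vec y\in\mathbb Z^N$, $\vec a\in\mathbb Z^m$, $$\mathcal M_{\vec T,\mathcal S}(\vec y,\vec a)=\sum_{\substack{\vec x\in\Omega_m:\\ x_i>a_i,\ i=1,\dots,m}}G_{\vec T,\mathcal S}(\vec y,\vec x).$$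 Space $\mathbb V_n(\vec v)$: let $u_1<\dots<u_\nu$ be the distinct values among $v_1,\dots,v_n$ and $\beta_k$ the multiplicity of $u_k$ among these entries; then $\mathbb V_n(\vec v)=\mathrm{span}\{x\in\mathbb Z\mapsto x^\ell u_k^x:1\le k\le\nu,\ 0\le\ell<\beta_k\}$. Convention: in the sum in (1), terms with $n_i<k\le n_j$ use the formula of (3) with $\prod_{i=k+1}^{n}(v_i-w)$ read as $\prod_{i=1}^n(v_i-w)\big/\prod_{i=1}^k(v_i-w)$.
   Formalization: The sum defining M runs over all x in Z^m with x_i>a_i (over Omega_m the identity fails, e.g. N=1, phi=1, m=2); K is complex, and real if phi^t commutes with conjugation; for real times phi^t=exp(tL) with L an analytic branch of log phi on the annulus. *)

theory Defs
  imports
    "HOL-Complex_Analysis.Complex_Analysis"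
    "HOL-Library.Function_Algebras"
    "Jordan_Normal_Form.Determinant"
begin

text \<open>
  Vectors are functions on \<^typ>\<open>nat\<close> read at the indices \<open>1, \<dots>, n\<close>; where one sums over vectors they
  are made extensional. The parameters \<open>v\<close>, \<open>\<rho>\<close>, \<open>R\<close> (the outer radius) and \<open>P\<close> are passed explicitly,
  where \<open>P t w\<close> stands for the power \<open>\<phi>(w)\<^sup>t\<close>. Times are real numbers taken from a set \<open>TT\<close>, which is
  \<open>\<real>\<close> or \<open>\<int>\<close>.
\<close>

text \<open>
  For integer times the power is the ordinary one. A non-integer power of \<open>\<phi>\<close> on an annulus needs an
  analytic branch \<open>L\<close> of \<open>log \<phi>\<close> there; the principal branch would not do
  (\<open>\<phi>(w)\<^sup>t = exp (t w)\<close> for \<open>\<phi> = exp\<close> is not the principal power as soon as the annulus leaves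
  \<open>\<bar>Im w\<bar> \<le> \<pi>\<close>).
\<close>

definition phi_power ::
  "real set \<Rightarrow> (complex \<Rightarrow> complex) \<Rightarrow> (complex \<Rightarrow> complex) \<Rightarrow> real \<Rightarrow> complex \<Rightarrow> complex" where
  "phi_power TT \<phi> L t w = (if TT = \<int> then \<phi> w powi \<lfloor>t\<rfloor> else exp (of_real t * L w))"

definition annulus :: "real \<Rightarrow> real \<Rightarrow> complex set" where
  "annulus s S = {w. s \<le> norm w \<and> norm w \<le> S}"

definition circ_avg :: "real \<Rightarrow> (complex \<Rightarrow> complex) \<Rightarrow> complex" where
  "circ_avg r f = 1 / (2 * of_real pi * \<i>) * contour_integral (circlepath 0 r) f"

definition Omega :: "nat \<Rightarrow> (nat \<Rightarrow> int) set" where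
  "Omega n = {x \<in> {1..n} \<rightarrow>\<^sub>E UNIV. \<forall>i\<in>{1..n}. \<forall>j\<in>{1..n}. i < j \<longrightarrow> x j < x i}"

definition det1 :: "nat \<Rightarrow> (nat \<Rightarrow> nat \<Rightarrow> complex) \<Rightarrow> complex" where
  "det1 n A = Determinant.det (Matrix.mat n n (\<lambda>(k, l). A (k + 1) (l + 1)))"

definition F_fun ::
  "(nat \<Rightarrow> real) \<Rightarrow> real \<Rightarrow> (real \<Rightarrow> complex \<Rightarrow> complex) \<Rightarrow> nat \<Rightarrow> nat \<Rightarrow> int \<Rightarrow> int \<Rightarrow> real \<Rightarrow> complex" where
  "F_fun v R P k l x1 x2 t = circ_avg R (\<lambda>w.
     ((w / of_real (v k)) powi x1 / (w / of_real (v l)) powi x2) *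
     ((\<Prod>i=1..l. w - of_real (v i)) / (\<Prod>i=1..k. w - of_real (v i))) *
     (P t w / w powi (int l - int k + 1)))"

definition G_trans ::
  "(nat \<Rightarrow> real) \<Rightarrow> real \<Rightarrow> (real \<Rightarrow> complex \<Rightarrow> complex) \<Rightarrow> nat \<Rightarrow> real \<Rightarrow> real \<Rightarrow>
   (nat \<Rightarrow> int) \<Rightarrow> (nat \<Rightarrow> int) \<Rightarrow> complex" where
  "G_trans v R P n s t y x = (\<Prod>i=1..n. P (s - t) (of_real (v i))) *
     det1 n (\<lambda>k l. F_fun v R P k l (y k) (x l) (t - s))"

definition prec :: "nat \<times> real \<Rightarrow> nat \<times> real \<Rightarrow> bool" (infix "\<prec>" 50) where
  "p \<prec> q \<longleftrightarrow> fst p \<le> fst q \<and> snd p \<ge> snd q \<and> p \<noteq> q"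

definition space_like_path :: "real set \<Rightarrow> nat \<Rightarrow> nat \<Rightarrow> (nat \<Rightarrow> nat \<times> real) \<Rightarrow> bool" where
  "space_like_path TT N m \<nn> \<longleftrightarrow> m \<ge> 1 \<and> (\<forall>i\<in>{1..m}. \<nn> i \<in> {1..N} \<times> TT) \<and>
     (\<forall>i\<in>{1..<m}. \<nn> i \<prec> \<nn> (i + 1))"

text \<open>
  \<open>X i\<close> is the vector \<open>x(t\<^sub>i)\<close>, so that coinciding times still carry different vectors. The last argument
  \<open>x\<close> may be any vector of \<open>\<int>\<^sup>m\<close>: at different times the entries \<open>x\<^sub>i = x\<^bsub>n_i\<^esub>(t\<^sub>i)\<close> need not
  decrease strictly in \<open>i\<close> (a particle may stay put or move either way).
\<close>

definition G_plus ::
  "(nat \<Rightarrow> real) \<Rightarrow> real \<Rightarrow> (real \<Rightarrow> complex \<Rightarrow> complex) \<Rightarrow> nat \<Rightarrow> (nat \<Rightarrow> nat \<times> real) \<Rightarrow>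
   (nat \<Rightarrow> int) \<Rightarrow> (nat \<Rightarrow> int) \<Rightarrow> complex" where
  "G_plus v R P m \<nn> y x =
     (let n = (\<lambda>i. fst (\<nn> i)); t = (\<lambda>i. snd (\<nn> i)) in
      \<Sum>\<^sub>\<infinity>X\<in>{X. X \<in> (\<Pi>\<^sub>E i\<in>{1..m}. Omega (n i)) \<and> (\<forall>i\<in>{1..m}. X i (n i) = x i)}.
        G_trans v R P (n m) 0 (t m) (restrict y {1..n m}) (X m) *
        (\<Prod>i\<in>{1..<m}. G_trans v R P (n i) (t (i + 1)) (t i) (restrict (X (i + 1)) {1..n i}) (X i)))"

definition G_minus ::
  "(nat \<Rightarrow> real) \<Rightarrow> real \<Rightarrow> (real \<Rightarrow> complex \<Rightarrow> complex) \<Rightarrow> nat \<Rightarrow> (nat \<Rightarrow> real) \<Rightarrow>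
   (nat \<Rightarrow> int) \<Rightarrow> (nat \<Rightarrow> int) \<Rightarrow> complex" where
  "G_minus v R P N T y x = (\<Prod>i=1..N. P (T i) (of_real (v i))) *
     det1 N (\<lambda>k l. F_fun v R P k l (y k) (x l) (- T k))"

definition G_path ::
  "(nat \<Rightarrow> real) \<Rightarrow> real \<Rightarrow> (real \<Rightarrow> complex \<Rightarrow> complex) \<Rightarrow> nat \<Rightarrow> (nat \<Rightarrow> real) \<Rightarrow> nat \<Rightarrow>
   (nat \<Rightarrow> nat \<times> real) \<Rightarrow> (nat \<Rightarrow> int) \<Rightarrow> (nat \<Rightarrow> int) \<Rightarrow> complex" where
  "G_path v R P N T m \<nn> y x =
     (\<Sum>\<^sub>\<infinity>z\<in>Omega N. G_minus v R P N T y z * G_plus v R P m \<nn> z x)"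

definition M_fun ::
  "(nat \<Rightarrow> real) \<Rightarrow> real \<Rightarrow> (real \<Rightarrow> complex \<Rightarrow> complex) \<Rightarrow> nat \<Rightarrow> (nat \<Rightarrow> real) \<Rightarrow> nat \<Rightarrow>
   (nat \<Rightarrow> nat \<times> real) \<Rightarrow> (nat \<Rightarrow> int) \<Rightarrow> (nat \<Rightarrow> int) \<Rightarrow> complex" where
  "M_fun v R P N T m \<nn> y a =
     (\<Sum>\<^sub>\<infinity>x\<in>{x \<in> {1..m} \<rightarrow>\<^sub>E UNIV. \<forall>i\<in>{1..m}. x i > a i}. G_path v R P N T m \<nn> y x)"

text \<open>
  Linear spans are over \<open>\<complex>\<close>, with pointwise operations on functions.
\<close>

definition cspan :: "(int \<Rightarrow> complex) set \<Rightarrow> (int \<Rightarrow> complex) set" where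
  "cspan = Modules.module.span (\<lambda>c f x. c * f x)"

definition V_space :: "(nat \<Rightarrow> real) \<Rightarrow> nat \<Rightarrow> (int \<Rightarrow> complex) set" where
  "V_space v n = cspan {(\<lambda>x. of_int x ^ l * of_real u powi x) | u l.
     u \<in> v ` {1..n} \<and> l < card {i \<in> {1..n}. v i = u}}"

definition phi_kernel ::
  "(nat \<Rightarrow> real) \<Rightarrow> real \<Rightarrow> (real \<Rightarrow> complex \<Rightarrow> complex) \<Rightarrow> nat \<times> real \<Rightarrow> nat \<times> real \<Rightarrow>
   int \<Rightarrow> int \<Rightarrow> complex" where
  "phi_kernel v \<rho> P p q x x' = circ_avg \<rho> (\<lambda>w.
     P (snd p - snd q) w / w powi (x - x' - int (fst q) + int (fst p) + 1) *
     (\<Prod>k=fst p + 1..fst q. inverse (of_real (v k) - w)))"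

text \<open>
  \<open>Psi \<dots> (n, t) k\<close> is \<open>\<Psi>\<^bsub>n-k\<^esub>\<close> at the point \<open>(n, t)\<close>; it is indexed by \<open>k\<close> because \<open>n - k\<close> may be negative.
\<close>

definition Psi ::
  "(nat \<Rightarrow> real) \<Rightarrow> real \<Rightarrow> (real \<Rightarrow> complex \<Rightarrow> complex) \<Rightarrow> (nat \<Rightarrow> real) \<Rightarrow> (nat \<Rightarrow> int) \<Rightarrow>
   nat \<times> real \<Rightarrow> nat \<Rightarrow> int \<Rightarrow> complex" where
  "Psi v \<rho> P T y p k x = (let n = fst p; t = snd p in
     circ_avg \<rho> (\<lambda>w.
       P (t - T k) w / w powi (x - y k + int n - int k + 1) *
       (if k \<le> n then (\<Prod>i=k + 1..n. of_real (v i) - w)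
        else (\<Prod>i=1..n. of_real (v i) - w) / (\<Prod>i=1..k. of_real (v i) - w))))"

text \<open>
  \<open>\<Phi> k\<close>, for \<open>k < n\<close>, is the function \<open>\<Phi>\<^sub>k\<close> at the point \<open>(n, t)\<close>.
\<close>

definition is_Phi ::
  "(nat \<Rightarrow> real) \<Rightarrow> real \<Rightarrow> (real \<Rightarrow> complex \<Rightarrow> complex) \<Rightarrow> (nat \<Rightarrow> real) \<Rightarrow> (nat \<Rightarrow> int) \<Rightarrow>
   nat \<times> real \<Rightarrow> (nat \<Rightarrow> int \<Rightarrow> complex) \<Rightarrow> bool" where
  "is_Phi v \<rho> P T y p \<Phi> \<longleftrightarrow>
     (\<forall>k<fst p. \<forall>l<fst p.
        ((\<lambda>x. Psi v \<rho> P T y p (fst p - l) x * \<Phi> k x) has_sum (if k = l then 1 else 0)) UNIV) \<and>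
     cspan (\<Phi> ` {..<fst p}) = V_space v (fst p)"

definition K_kernel ::
  "(nat \<Rightarrow> real) \<Rightarrow> real \<Rightarrow> (real \<Rightarrow> complex \<Rightarrow> complex) \<Rightarrow> (nat \<Rightarrow> real) \<Rightarrow> (nat \<Rightarrow> int) \<Rightarrow>
   (nat \<times> real \<Rightarrow> nat \<Rightarrow> int \<Rightarrow> complex) \<Rightarrow> (nat \<times> real) \<times> int \<Rightarrow> (nat \<times> real) \<times> int \<Rightarrow> complex" where
  "K_kernel v \<rho> P T y \<Phi> = (\<lambda>(p, x) (q, x').
     - (if p \<prec> q then phi_kernel v \<rho> P p q x x' else 0) +
     (\<Sum>k=1..fst q. Psi v \<rho> P T y p k x * \<Phi> q (fst q - k) x'))"

definition chi_bar :: "nat \<Rightarrow> (nat \<Rightarrow> nat \<times> real) \<Rightarrow> (nat \<Rightarrow> int) \<Rightarrow> (nat \<times> real) \<times> int \<Rightarrow> complex" where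
  "chi_bar m \<nn> a = (\<lambda>(p, x). if \<exists>j\<in>{1..m}. \<nn> j = p \<and> x \<le> a j then 1 else 0)"

text \<open>
  The Fredholm determinant \<open>det (I - A)\<close> on \<open>\<ell>\<^sup>2(X)\<close> of a kernel \<open>A\<close> on a countable set \<open>X\<close>, given by its
  Fredholm series, and the absolute convergence of that series. The series is unchanged when \<open>A(u, u')\<close> is
  replaced by \<open>f(u) A(u, u') / f(u')\<close>, and so applies to kernels that are trace class only after
  such a conjugation.
\<close>

definition fredholm_minor :: "('a \<Rightarrow> 'a \<Rightarrow> complex) \<Rightarrow> 'a list \<Rightarrow> complex" where
  "fredholm_minor A us =
     Determinant.det (Matrix.mat (length us) (length us) (\<lambda>(i, j). A (us ! i) (us ! j)))"

definition tuples :: "'a set \<Rightarrow> nat \<Rightarrow> 'a list set" where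
  "tuples X n = {us. length us = n \<and> set us \<subseteq> X}"

definition fredholm_convergent :: "'a set \<Rightarrow> ('a \<Rightarrow> 'a \<Rightarrow> complex) \<Rightarrow> bool" where
  "fredholm_convergent X A \<longleftrightarrow>
     (\<forall>n. (\<lambda>us. norm (fredholm_minor A us)) summable_on tuples X n) \<and>
     summable (\<lambda>n. (\<Sum>\<^sub>\<infinity>us\<in>tuples X n. norm (fredholm_minor A us)) / fact n)"

definition fredholm_det_I_minus :: "'a set \<Rightarrow> ('a \<Rightarrow> 'a \<Rightarrow> complex) \<Rightarrow> complex" where
  "fredholm_det_I_minus X A =
     (\<Sum>n. (-1) ^ n / fact n * (\<Sum>\<^sub>\<infinity>us\<in>tuples X n. fredholm_minor A us))"

end

theory Submission
  imports Defs "HOL-Combinatorics.Multiset_Permutations"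
begin

text \<open>
  Let \<open>D\<^sub>k\<close> be the difference operator with symbol \<open>(v\<^sub>k - w) / w\<close> and \<open>C\<^sub>t\<close> the convolution with the Laurent
  coefficients of \<open>\<phi>\<^sup>t\<close>. The space \<open>V\<^sub>n\<close> is the kernel of \<open>D\<^sub>1 \<dots> D\<^sub>n\<close>, and pairing with \<open>\<Psi>\<close> is the
  functional \<open>f \<mapsto> (C D\<^bsub>k+1\<^esub> \<dots> D\<^sub>n f)(y\<^sub>k)\<close> with \<open>C = C\<^bsub>t-T_k\<^esub>\<close>. These functionals are triangular on \<open>V\<^sub>n\<close>,
  whence the existence and uniqueness of \<open>\<Phi>\<close>.

  A Cauchy-Binet identity for difference operators on \<open>\<Omega>\<^sub>n\<close> shows that the transition kernels map
  determinants \<open>det[v\<^sub>k\<^sup>-\<^sup>x (D\<^bsub>k+1\<^esub> \<dots> D\<^sub>n f\<^sub>j)(x)]\<close>, \<open>x = x\<^sub>k\<close>, to such determinants with \<open>f\<^sub>j\<close> replaced by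
  \<open>C f\<^sub>j\<close>. The constraint \<open>x\<^sub>n > a\<close> truncates the \<open>f\<^sub>j\<close>, and a larger \<open>n\<close> adds functions \<open>\<Phi>\<close>. Iterating along the
  path turns \<open>M\<close> into a determinant of size \<open>n\<^sub>m\<close>.

  On the other side \<open>1 - \<chi> K \<chi> = (1 - \<Psi> \<lambda>)(1 + U)\<close>, where \<open>U\<close> is strictly triangular along the path and
  \<open>\<lambda>\<^sub>j = \<Phi>\<^sub>j - (\<Sum>i<j. (\<chi> \<lambda>\<^sub>i) \<phi>\<^sup>i\<^sup>j)\<close>. So the Fredholm determinant is the one of size \<open>n\<^sub>m\<close> with entries
  \<open>\<delta> - \<langle>\<lambda>, \<Psi>\<rangle>\<close>. The truncations of \<open>\<lambda>\<close> satisfy the recursion of the \<open>f\<^sub>j\<close> up to a unitriangular change of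
  basis, and the two determinants agree. The Fredholm series converges because the kernel, conjugated with
  weights \<open>s\<^sub>i\<^sup>x\<close> that decrease in \<open>i\<close>, decays at \<open>-\<infinity>\<close> in both variables.
\<close>

section \<open>Determinants\<close>

text \<open>The transition kernels integrate over the outer circle \<open>R\<close>, so they act on
  functions cut to \<open>x > a\<close> of growth at most \<open>hi powi x\<close>. The kernels
  \<phi> and \<Psi> integrate over the inner circle \<rho>, so they act on functions cut to
  \<open>x \<le> a\<close> of size \<open>lo powi x\<close>. Accordingly the difference operators
  between two levels have two right inverses, one with a contour beyond all \<open>v i\<close>
  (\<open>QQ\<close>) and one with a contour below them (inside \<open>Cop\<close>). Functions
  obtained from the two inverses with the same image under the difference operators differ by an
  element of \<open>V_space\<close>, and this is the difference that the unitriangular change of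
  basis absorbs. The infinite sums are \<open>infsum\<close>s, so every interchange rests on
  absolute convergence; the radii \<open>rad\<close> above \<open>hi\<close> and \<open>slo\<close>
  below \<open>lo\<close> are spread over the nodes of the path so that each step has a ratio
  different from 1 to spare. The delicate bound is that of the initial kernel
  \<open>G_minus\<close>, whose argument \<open>y\<close> need not be ordered. Identities are proved
  on finite windows or for truncated functions, and dominated convergence carries them to the
  limit.\<close>

lemma det1_perm:
  "det1 n A = (\<Sum>p | p permutes {0..<n}. of_int (sign p) * (\<Prod>i=0..<n. A (i + 1) (p i + 1)))"
proof -
  have "det1 n A = (\<Sum>p | p permutes {0..<n}. of_int (sign p) *
     (\<Prod>i=0..<n. Matrix.mat n n (\<lambda>(k, l). A (k + 1) (l + 1)) $$ (i, p i)))"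
    unfolding det1_def by (subst Determinant.det_def'[of _ n]) auto
  also have "\<dots> = (\<Sum>p | p permutes {0..<n}. of_int (sign p) * (\<Prod>i=0..<n. A (i + 1) (p i + 1)))"
  proof (intro sum.cong refl arg_cong2[of _ _ _ _ "(*)"] prod.cong)
    fix p i assume p: "p \<in> {p. p permutes {0..<n}}" and i: "i \<in> {0..<n}"
    have "p i \<in> {0..<n}" using p i permutes_in_image[of p "{0..<n}" i] by auto
    then show "Matrix.mat n n (\<lambda>(k, l). A (k + 1) (l + 1)) $$ (i, p i) = A (i + 1) (p i + 1)"
      using i by simp
  qed
  finally show ?thesis .
qed

lemma det1_cong:
  assumes "\<And>k l. k \<in> {1..n} ==> l \<in> {1..n} ==> A k l = B k l"
  shows "det1 n A = det1 n B"
  unfolding det1_def using assms by (intro arg_cong[of _ _ Determinant.det] eq_matI) auto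

lemma det1_transpose: "det1 n (\<lambda>k l. A l k) = det1 n A"
proof -
  have "transpose_mat (Matrix.mat n n (\<lambda>(k, l). A (k + 1) (l + 1))) = Matrix.mat n n (\<lambda>(k, l). A (l + 1) (k + 1))"
    by (intro eq_matI) auto
  then show ?thesis
    using Determinant.det_transpose[OF mat_carrier, of n "\<lambda>(k, l). A (k + 1) (l + 1)"]
    unfolding det1_def by simp
qed

lemma det1_mult:
  "det1 n (\<lambda>k l. \<Sum>i=1..n. A k i * B i l) = det1 n A * det1 n B"
proof -
  let ?M = "\<lambda>A. Matrix.mat n n (\<lambda>(k, l). A (k + 1) (l + 1)) :: complex mat"
  have "?M (\<lambda>k l. \<Sum>i=1..n. A k i * B i l) = ?M A * ?M B"
  proof (intro eq_matI)
    fix i j assume "i < dim_row (?M A * ?M B)" "j < dim_col (?M A * ?M B)"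
    then have ij: "i < n" "j < n" by auto
    have "(\<Sum>k=1..n. A (i + 1) k * B k (j + 1)) = (\<Sum>k=0..<n. A (i + 1) (k + 1) * B (k + 1) (j + 1))"
      by (rule sum.reindex_bij_witness[of _ Suc "\<lambda>k. k - 1"]) auto
    then show "?M (\<lambda>k l. \<Sum>i=1..n. A k i * B i l) $$ (i, j) = (?M A * ?M B) $$ (i, j)"
      using ij by (simp add: scalar_prod_def)
  qed auto
  then show ?thesis
    unfolding det1_def by (simp only: Determinant.det_mult[OF mat_carrier mat_carrier])
qed

lemma prod_shift: "(\<Prod>i=0..<n. a (Suc i)) = (\<Prod>i=1..n. a i)"
  by (rule prod.reindex_bij_witness[of _ "\<lambda>k. k - 1" Suc]) auto

lemma prod_perm_shift:
  assumes "p permutes {0..<n}"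
  shows "(\<Prod>i=0..<n. a (Suc (p i))) = (\<Prod>i=1..n. a i)"
  using prod.permute[OF assms, of "\<lambda>i. a (Suc i)"] prod_shift[of a n] by (simp add: o_def)

lemma det1_scale:
  "det1 n (\<lambda>k l. a k * b l * A k l) = (\<Prod>k=1..n. a k) * (\<Prod>l=1..n. b l) * det1 n A"
proof -
  have "det1 n (\<lambda>k l. a k * b l * A k l) = (\<Sum>p | p permutes {0..<n}.
      ((\<Prod>k=1..n. a k) * (\<Prod>l=1..n. b l)) * (of_int (sign p) * (\<Prod>i=0..<n. A (i + 1) (p i + 1))))"
    unfolding det1_perm
    by (intro sum.cong) (auto simp: prod.distrib prod_perm_shift prod_shift)
  also have "\<dots> = (\<Prod>k=1..n. a k) * (\<Prod>l=1..n. b l) * det1 n A"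
    unfolding det1_perm by (simp add: sum_distrib_left)
  finally show ?thesis .
qed

lemma det1_eq_cols:
  assumes "i \<in> {1..n}" "j \<in> {1..n}" "i \<noteq> j" "\<And>k. k \<in> {1..n} ==> A k i = A k j"
  shows "det1 n A = 0"
  unfolding det1_def
  by (rule Determinant.det_identical_columns[of _ n "i - 1" "j - 1"])
    (use assms in \<open>auto intro!: eq_vecI\<close>)

lemma det1_eq_rows:
  assumes "i \<in> {1..n}" "j \<in> {1..n}" "i \<noteq> j" "\<And>k. k \<in> {1..n} ==> A i k = A j k"
  shows "det1 n A = 0"
  using det1_eq_cols[of i n j "\<lambda>k l. A l k"] assms det1_transpose[of n A] by auto

lemma det1_row_sum:
  assumes "finite I"
  shows "det1 n (\<lambda>k l. \<Sum>c\<in>I. X k c l) =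
    (\<Sum>f\<in>{1..n} \<rightarrow>\<^sub>E I. det1 n (\<lambda>k l. X k (f k) l))"
proof -
  have "(\<Prod>i=0..<n. \<Sum>c\<in>I. X (i + 1) c (p i + 1)) =
      (\<Sum>f\<in>{1..n} \<rightarrow>\<^sub>E I. \<Prod>i=0..<n. X (i + 1) (f (i + 1)) (p i + 1))" for p :: "nat => nat"
    using prod_sum_PiE[of "{1..n}" "\<lambda>_. I" "\<lambda>i c. X i c (p (i - 1) + 1)"] assms
      prod_shift[of "\<lambda>i. \<Sum>c\<in>I. X i c (p (i - 1) + 1)" n]
      prod_shift[of "\<lambda>i. X i (f i) (p (i - 1) + 1)" n for f]
    by simp
  then show ?thesis
    unfolding det1_perm by (simp add: sum_distrib_left) (rule sum.swap)
qed

text \<open>The cofactors along column \<open>j\<close> do not see that column, so they may be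
  computed with zeros in it. In this form a determinant is a linear functional of one column, which
  is how summation by parts gets at it.\<close>

lemma det1_col_cofactor:
  assumes "j \<in> {1..n}"
  obtains \<alpha> where "\<And>u. det1 n (\<lambda>k l. if l = j then u k else A k l) = (\<Sum>k=1..n. u k * \<alpha> k)"
proof
  let ?M = "\<lambda>u. Matrix.mat n n (\<lambda>(k, l). if l + 1 = j then u (k + 1) else A (k + 1) (l + 1))"
  let ?c = "\<lambda>i. cofactor (?M (\<lambda>_. 0)) i (j - 1)"
  fix u
  have "det1 n (\<lambda>k l. if l = j then u k else A k l) = (\<Sum>i<n. ?M u $$ (i, j - 1) * cofactor (?M u) i (j - 1))"
    unfolding det1_def by (rule laplace_expansion_column) (use assms in auto)
  also have "\<dots> = (\<Sum>i<n. u (i + 1) * ?c i)"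
  proof (rule sum.cong[OF refl])
    fix i assume "i \<in> {..<n}"
    have "mat_delete (?M u) i (j - 1) = mat_delete (?M (\<lambda>_. 0)) i (j - 1)"
      by (rule eq_matI) (use assms in \<open>auto simp: mat_delete_def\<close>)
    then have "cofactor (?M u) i (j - 1) = ?c i" by (simp only: cofactor_def)
    moreover have "i < n" "j - 1 < n" "Suc (j - 1) = j" using assms \<open>i \<in> {..<n}\<close> by auto
    then have "?M u $$ (i, j - 1) = u (i + 1)" by simp
    ultimately show "?M u $$ (i, j - 1) * cofactor (?M u) i (j - 1) = u (i + 1) * ?c i" by (simp only:)
  qed
  also have "\<dots> = (\<Sum>k=1..n. u k * ?c (k - 1))"
    by (rule sum.reindex_bij_witness[of _ "\<lambda>k. k - 1" Suc]) auto
  finally show "det1 n (\<lambda>k l. if l = j then u k else A k l) = (\<Sum>k=1..n. u k * ?c (k - 1))" .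
qed

lemma det1_row_cofactor:
  assumes "j \<in> {1..n}"
  obtains \<beta> where "\<And>u. det1 n (\<lambda>k l. if k = j then u l else A k l) = (\<Sum>l=1..n. u l * \<beta> l)"
proof -
  obtain \<alpha> where \<alpha>: "\<And>u. det1 n (\<lambda>k l. if l = j then u k else A l k) = (\<Sum>k=1..n. u k * \<alpha> k)"
    by (rule det1_col_cofactor[OF assms, of "\<lambda>k l. A l k"]) (rule that)
  have "det1 n (\<lambda>k l. if k = j then u l else A k l) = (\<Sum>l=1..n. u l * \<alpha> l)" for u
    using \<alpha>[of u] det1_transpose[of n "\<lambda>k l. if k = j then u l else A k l"] by simp
  then show ?thesis by (rule that)
qed

lemma det1_last_col:
  assumes "\<And>k. k \<in> {1..n} ==> A k (Suc n) = 0"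
  shows "det1 (Suc n) A = det1 n A * A (Suc n) (Suc n)"
proof -
  let ?A1 = "Matrix.mat n n (\<lambda>(k, l). A (k + 1) (l + 1)) :: complex mat"
  let ?A3 = "Matrix.mat 1 n (\<lambda>(k, l). A (n + 1) (l + 1)) :: complex mat"
  let ?A4 = "Matrix.mat 1 1 (\<lambda>(k, l). A (n + 1) (n + 1)) :: complex mat"
  have "Matrix.mat (Suc n) (Suc n) (\<lambda>(k, l). A (k + 1) (l + 1)) = four_block_mat ?A1 (0\<^sub>m n 1) ?A3 ?A4"
    using assms by (intro eq_matI) (auto simp: less_Suc_eq)
  then have "det1 (Suc n) A = Determinant.det (four_block_mat ?A1 (0\<^sub>m n 1) ?A3 ?A4)"
    unfolding det1_def by simp
  also have "\<dots> = Determinant.det ?A1 * Determinant.det ?A4"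
    by (rule Determinant.det_four_block_mat_upper_right_zero_col) auto
  also have "Determinant.det ?A4 = A (Suc n) (Suc n)"
    by (subst Determinant.det_single) auto
  finally show ?thesis by (simp add: det1_def)
qed

text \<open>The columns beyond \<open>n\<close> vanish above the diagonal, so they split off from
  the right one at a time, each leaving its diagonal entry.\<close>

lemma det1_lower_block:
  assumes "n \<le> n'" "\<And>k l. k \<in> {1..n'} ==> l \<in> {n+1..n'} ==> k < l ==> A k l = 0"
  shows "det1 n' A = det1 n A * (\<Prod>l=n+1..n'. A l l)"
  using assms
proof (induction n' rule: dec_induct)
  case (step m)
  have "det1 (Suc m) A = det1 m A * A (Suc m) (Suc m)"
    by (rule det1_last_col) (use step in auto)
  also have "det1 m A = det1 n A * (\<Prod>l=n+1..m. A l l)" using step by auto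
  finally show ?case using step.hyps by simp
qed simp

lemma det1_0 [simp]: "det1 0 A = 1"
  by (simp add: det1_def)

lemma det1_upper_triangular:
  assumes "\<And>k l. k \<in> {1..n} ==> l \<in> {1..n} ==> l < k ==> A k l = 0"
  shows "det1 n A = (\<Prod>l=1..n. A l l)"
  using det1_lower_block[of 0 n "\<lambda>k l. A l k"] assms det1_transpose[of n A] by simp

lemma det1_zero_row:
  assumes "j \<in> {1..n}" "\<And>l. l \<in> {1..n} ==> A j l = 0"
  shows "det1 n A = 0"
proof -
  obtain \<beta> where \<beta>: "\<And>u. det1 n (\<lambda>k l. if k = j then u l else A k l) = (\<Sum>l=1..n. u l * \<beta> l)"
    by (rule det1_row_cofactor[OF assms(1), of A]) (rule that)
  have "det1 n A = det1 n (\<lambda>k l. if k = j then 0 else A k l)"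
    using assms by (intro det1_cong) auto
  then show ?thesis using \<beta>[of "\<lambda>_. 0"] by simp
qed

lemma norm_det1_le:
  "norm (det1 n A) \<le> (\<Sum>p | p permutes {0..<n}. \<Prod>i=0..<n. norm (A (i + 1) (p i + 1)))"
proof -
  have "norm (det1 n A) \<le> (\<Sum>p | p permutes {0..<n}. norm (of_int (sign p) * (\<Prod>i=0..<n. A (i + 1) (p i + 1))))"
    unfolding det1_perm by (rule norm_sum)
  also have "\<dots> = (\<Sum>p | p permutes {0..<n}. \<Prod>i=0..<n. norm (A (i + 1) (p i + 1)))"
    by (intro sum.cong refl) (simp add: norm_mult prod_norm sign_def)
  finally show ?thesis .
qed

lemma tendsto_det1:
  assumes "\<And>k l. k \<in> {1..n} ==> l \<in> {1..n} ==> ((\<lambda>x. A x k l) \<longlongrightarrow> B k l) F"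
  shows "((\<lambda>x. det1 n (A x)) \<longlongrightarrow> det1 n B) F"
  unfolding det1_perm
proof (intro tendsto_intros)
  fix p i assume "p \<in> {p. p permutes {0..<n}}" "i \<in> {0..<n}"
  then show "((\<lambda>x. A x (i + 1) (p i + 1)) \<longlongrightarrow> B (i + 1) (p i + 1)) F"
    using permutes_in_image[of p "{0..<n}" i] by (intro assms) (auto simp: Suc_le_eq)
qed

section \<open>Cauchy-Binet identities on the Weyl chamber\<close>

text \<open>Confining the entries to a window makes the chamber finite, so that the Cauchy-Binet
  identities can first be proved for finite sums.\<close>

definition OmegaI :: "nat => int set => (nat => int) set" where
  "OmegaI n I = {x \<in> {1..n} \<rightarrow>\<^sub>E I. \<forall>i\<in>{1..n}. \<forall>j\<in>{1..n}. i < j \<longrightarrow> x j < x i}"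

lemma Omega_eq: "Omega n = OmegaI n UNIV"
  by (simp add: Omega_def OmegaI_def)

lemma finite_OmegaI: "finite I ==> finite (OmegaI n I)"
  unfolding OmegaI_def by (rule finite_subset[of _ "{1..n} \<rightarrow>\<^sub>E I"]) (auto intro: finite_PiE)

lemma OmegaI_less: "x \<in> OmegaI n I ==> i \<in> {1..n} ==> j \<in> {1..n} ==> i < j ==> x j < x i"
  by (simp add: OmegaI_def)

lemma OmegaI_inj_on:
  assumes "x \<in> OmegaI n I"
  shows "inj_on x {1..n}"
proof (rule linorder_inj_onI')
  fix i j assume "i \<in> {1..n}" "j \<in> {1..n}" "i < j"
  from OmegaI_less[OF assms this] show "x i \<noteq> x j" by simp
qed

lemma OmegaI_image_unique:
  assumes "x \<in> OmegaI n I" "y \<in> OmegaI n I" "x ` {1..n} = y ` {1..n}"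
  shows "x = y"
proof -
  have s: "sorted (map z (rev [1..<Suc n]))" "distinct (map z (rev [1..<Suc n]))" if "z \<in> OmegaI n I" for z
  proof -
    have "z (Suc j) \<le> z (Suc i)" if "i < j" "j < n" for i j
      using \<open>z \<in> OmegaI n I\<close> that by (auto simp: OmegaI_def less_imp_le)
    then show "sorted (map z (rev [1..<Suc n]))"
      by (auto simp: rev_map[symmetric] sorted_wrt_iff_nth_less rev_nth simp del: upt_Suc)
    show "distinct (map z (rev [1..<Suc n]))"
      using OmegaI_inj_on[OF that] by (simp add: distinct_map atLeastLessThanSuc_atLeastAtMost del: upt_Suc)
  qed
  have "map x (rev [1..<Suc n]) = map y (rev [1..<Suc n])"
    using s[OF assms(1)] s[OF assms(2)] assms(3)
    by (intro sorted_distinct_set_unique) (auto simp: atLeastLessThanSuc_atLeastAtMost simp del: upt_Suc)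
  then have "x i = y i" if "i \<in> {1..n}" for i
    using that by (auto simp del: upt_Suc)
  moreover have "x i = y i" if "i \<notin> {1..n}" for i
    using that assms by (auto simp: OmegaI_def PiE_def extensional_def)
  ultimately show ?thesis by blast
qed

lemma OmegaI_exists:
  assumes "finite A" "card A = n" "A \<subseteq> I"
  obtains x where "x \<in> OmegaI n I" "x ` {1..n} = A"
proof -
  define xs where "xs = rev (sorted_list_of_set A)"
  have len: "length xs = n" using assms by (simp add: xs_def)
  have "sorted_wrt (\<lambda>a b. a > b) xs"
    unfolding xs_def sorted_wrt_rev using assms by simp
  then have dec: "xs ! j < xs ! i" if "i < j" "j < n" for i j
    using that len by (auto simp: sorted_wrt_iff_nth_less)
  define x where "x = (\<lambda>i\<in>{1..n}. xs ! (i - 1))"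
  have "x ` {1..n} = set xs"
  proof (intro equalityI subsetI)
    fix a assume "a \<in> set xs"
    then obtain i where "i < n" "a = xs ! i" using len by (auto simp: in_set_conv_nth)
    then show "a \<in> x ` {1..n}" by (intro image_eqI[of _ _ "Suc i"]) (auto simp: x_def)
  qed (use len in \<open>auto simp: x_def\<close>)
  also have "\<dots> = A" using assms by (simp add: xs_def)
  finally have img: "x ` {1..n} = A" .
  moreover have "x \<in> OmegaI n I"
    using dec img assms(3) unfolding OmegaI_def by (auto simp: x_def image_subset_iff)
  ultimately show ?thesis using that by blast
qed

lemma det1_permute_rows:
  assumes q: "q permutes {0..<n}"
  shows "det1 n (\<lambda>k l. B (q (k - 1) + 1) l) = of_int (sign q) * det1 n B"
proof -
  let ?M = "Matrix.mat n n (\<lambda>(k, l). B (k + 1) (l + 1)) :: complex mat"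
  have "q i < n" if "i < n" for i
    using permutes_in_image[OF q, of i] that by auto
  then have "det1 n (\<lambda>k l. B (q (k - 1) + 1) l) = Determinant.det (Matrix.mat n n (\<lambda>(i, j). ?M $$ (q i, j)))"
    unfolding det1_def by (intro arg_cong[of _ _ Determinant.det] eq_matI) auto
  also have "\<dots> = of_int (sign q) * Determinant.det ?M"
    by (rule Determinant.det_permute_rows[OF mat_carrier q])
  finally show ?thesis by (simp add: det1_def)
qed

text \<open>Multilinearity in the rows gives a sum over all tuples of points; tuples with a
  repetition have two equal rows, and the injective ones are chamber vectors up to a unique
  permutation, whose sign rebuilds the first determinant.\<close>

lemma cauchy_binet_Omega:
  assumes I: "finite I"
  shows "(\<Sum>x\<in>OmegaI n I. det1 n (\<lambda>k j. h k (x j)) * det1 n (\<lambda>i j. f i (x j))) =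
    det1 n (\<lambda>k i. \<Sum>z\<in>I. h k z * f i z)"
proof -
  let ?X = "{1..n} \<rightarrow>\<^sub>E I" and ?Q = "{q. q permutes {0..<n}}"
  define t where "t x = (\<Prod>k=1..n. h k (x k)) * det1 n (\<lambda>k i. f i (x k))" for x
  define c where "c = (\<lambda>(y :: nat => int, q :: nat => nat). \<lambda>k\<in>{1..n}. y (q (k - 1) + 1))"
  have "det1 n (\<lambda>k i. \<Sum>z\<in>I. h k z * f i z) = (\<Sum>x\<in>?X. det1 n (\<lambda>k i. h k (x k) * f i (x k)))"
    by (rule det1_row_sum[OF I])
  also have "\<dots> = (\<Sum>x\<in>?X. t x)"
    unfolding t_def using det1_scale[of n "\<lambda>k. h k (x k)" "\<lambda>_. 1" "\<lambda>k i. f i (x k)" for x] by simp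
  also have "\<dots> = (\<Sum>x\<in>{x \<in> ?X. inj_on x {1..n}}. t x)"
  proof (rule sum.mono_neutral_right)
    show "\<forall>x\<in>?X - {x \<in> ?X. inj_on x {1..n}}. t x = 0"
    proof
      fix x assume "x \<in> ?X - {x \<in> ?X. inj_on x {1..n}}"
      then obtain i j where "i \<in> {1..n}" "j \<in> {1..n}" "i \<noteq> j" "x i = x j"
        by (auto simp: inj_on_def)
      then show "t x = 0" unfolding t_def by (subst det1_eq_rows[of i n j]) auto
    qed
  qed (use I in \<open>auto intro: finite_PiE\<close>)
  \<comment> \<open>Each injective tuple is sorted into a decreasing vector \<open>y\<close>; the
    sorting permutation \<open>q\<close> acts on \<open>{0..<n}\<close>, hence the shifts by one in
    \<open>c\<close>.\<close>
  also have "{x \<in> ?X. inj_on x {1..n}} = c ` (OmegaI n I \<times> ?Q)"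
  proof (intro equalityI subsetI)
    fix x assume "x \<in> c ` (OmegaI n I \<times> ?Q)"
    then obtain y q where y: "y \<in> OmegaI n I" and q: "q permutes {0..<n}" and x: "x = c (y, q)" by auto
    have qin: "q (k - 1) + 1 \<in> {1..n}" if "k \<in> {1..n}" for k
      using permutes_in_image[OF q, of "k - 1"] that by auto
    have "inj_on x {1..n}"
    proof (rule inj_onI)
      fix k l assume kl: "k \<in> {1..n}" "l \<in> {1..n}" "x k = x l"
      then have "q (k - 1) + 1 = q (l - 1) + 1"
        using inj_on_eq_iff[OF OmegaI_inj_on[OF y] qin[of k] qin[of l]] by (simp add: x c_def)
      then have "k - 1 = l - 1" using permutes_inj[OF q] by (simp add: inj_eq)
      then show "k = l" using kl by auto
    qed
    moreover have "x \<in> ?X" using y qin by (auto simp: x c_def OmegaI_def)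
    ultimately show "x \<in> {x \<in> ?X. inj_on x {1..n}}" by simp
  next
    fix x assume "x \<in> {x \<in> ?X. inj_on x {1..n}}"
    then have x: "x \<in> ?X" "inj_on x {1..n}" by auto
    obtain y where y: "y \<in> OmegaI n I" "y ` {1..n} = x ` {1..n}"
      using OmegaI_exists[of "x ` {1..n}" n I] x by (auto simp: card_image)
    define g where "g = inv_into {1..n} y"
    have g: "g (x k) \<in> {1..n}" "y (g (x k)) = x k" if "k \<in> {1..n}" for k
    proof -
      have "x k \<in> y ` {1..n}" using y(2) that by blast
      then show "g (x k) \<in> {1..n}" "y (g (x k)) = x k"
        unfolding g_def by (rule inv_into_into, rule f_inv_into_f)
    qed
    define q where "q i = (if i < n then g (x (i + 1)) - 1 else i)" for i
    have "q permutes {0..<n}"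
    proof (rule bij_imp_permutes)
      have "inj_on q {0..<n}"
      proof (rule inj_onI)
        fix i j assume ij: "i \<in> {0..<n}" "j \<in> {0..<n}" "q i = q j"
        then have "g (x (i + 1)) = g (x (j + 1))"
          using g[of "i + 1"] g[of "j + 1"] by (auto simp: q_def)
        moreover have "y (g (x (i + 1))) = x (i + 1)" "y (g (x (j + 1))) = x (j + 1)"
          by (rule g(2), use ij in simp)+
        ultimately have "x (i + 1) = x (j + 1)" by metis
        then show "i = j" using inj_on_eq_iff[OF x(2), of "i + 1" "j + 1"] ij by simp
      qed
      moreover have "q ` {0..<n} \<subseteq> {0..<n}"
      proof safe
        fix i assume "i \<in> {0..<n}"
        then show "q i \<in> {0..<n}" using g(1)[of "i + 1"] by (auto simp: q_def)
      qed
      ultimately show "bij_betw q {0..<n} {0..<n}" by (simp add: bij_betw_def endo_inj_surj)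
    qed (auto simp: q_def)
    moreover have "x = c (y, q)"
    proof
      fix k show "x k = c (y, q) k"
        using g[of k] x(1) by (cases "k \<in> {1..n}") (auto simp: c_def q_def PiE_def extensional_def)
    qed
    ultimately show "x \<in> c ` (OmegaI n I \<times> ?Q)" using y by auto
  qed
  also have "(\<Sum>x\<in>c ` (OmegaI n I \<times> ?Q). t x) = (\<Sum>z\<in>OmegaI n I \<times> ?Q. t (c z))"
  proof (rule sum.reindex[unfolded o_def])
    show "inj_on c (OmegaI n I \<times> ?Q)"
    proof (rule inj_onI, clarify)
      fix y q y' q' assume y: "y \<in> OmegaI n I" "y' \<in> OmegaI n I" and q: "q permutes {0..<n}" "q' permutes {0..<n}"
        and eq: "c (y, q) = c (y', q')"
      have e: "y (q i + 1) = y' (q' i + 1)" if "i < n" for i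
        using fun_cong[OF eq, of "i + 1"] that by (simp add: c_def)
      have im: "y ` {1..n} = (\<lambda>i. y (q i + 1)) ` {0..<n}" if "q permutes {0..<n}" for q and y :: "nat => int"
      proof -
        have "(\<lambda>i. y (q i + 1)) ` {0..<n} = (\<lambda>i. y (i + 1)) ` (q ` {0..<n})" by (simp add: image_image)
        also have "q ` {0..<n} = {0..<n}" by (rule permutes_image[OF that])
        also have "(\<lambda>i. y (i + 1)) ` {0..<n} = y ` {1..n}"
          by (simp add: image_image[of y Suc, symmetric] atLeastLessThanSuc_atLeastAtMost)
        finally show ?thesis by simp
      qed
      have "y ` {1..n} = y' ` {1..n}"
        unfolding im[OF q(1), of y] im[OF q(2), of y'] using e by (intro image_cong) auto
      then have yy: "y = y'" by (rule OmegaI_image_unique[OF y])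
      have "q i = q' i" for i
      proof (cases "i < n")
        case True
        then have "q i + 1 \<in> {1..n}" "q' i + 1 \<in> {1..n}"
          using permutes_in_image[OF q(1), of i] permutes_in_image[OF q(2), of i] by auto
        then show ?thesis using e[OF True] inj_on_eq_iff[OF OmegaI_inj_on[OF y(1)]] yy by auto
      next
        case False
        then show ?thesis using permutes_not_in[OF q(1)] permutes_not_in[OF q(2)] by auto
      qed
      then show "y = y' \<and> q = q'" using yy by auto
    qed
  qed
  also have "\<dots> = (\<Sum>y\<in>OmegaI n I. \<Sum>q\<in>?Q. t (c (y, q)))"
    by (simp add: sum.cartesian_product)
  also have "\<dots> = (\<Sum>y\<in>OmegaI n I. det1 n (\<lambda>k j. h k (y j)) * det1 n (\<lambda>i j. f i (y j)))"
  proof (rule sum.cong[OF refl])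
    fix y assume "y \<in> OmegaI n I"
    have "t (c (y, q)) = of_int (sign q) * (\<Prod>i=0..<n. h (i + 1) (y (q i + 1))) * det1 n (\<lambda>i j. f i (y j))"
      if q: "q permutes {0..<n}" for q
    proof -
      have "det1 n (\<lambda>k i. f i (c (y, q) k)) = det1 n (\<lambda>k i. f i (y (q (k - 1) + 1)))"
        by (rule det1_cong) (simp add: c_def)
      also have "\<dots> = of_int (sign q) * det1 n (\<lambda>k i. f i (y k))"
        by (rule det1_permute_rows[OF q, of "\<lambda>k i. f i (y k)"])
      also have "det1 n (\<lambda>k i. f i (y k)) = det1 n (\<lambda>i j. f i (y j))"
        by (rule det1_transpose)
      finally show ?thesis
        using prod_shift[of "\<lambda>k. h k (c (y, q) k)" n] by (simp add: t_def) (simp add: c_def)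
    qed
    then have "(\<Sum>q\<in>?Q. t (c (y, q))) = (\<Sum>q\<in>?Q. of_int (sign q) * (\<Prod>i=0..<n. h (i + 1) (y (q i + 1))) * det1 n (\<lambda>i j. f i (y j)))"
      by (intro sum.cong) auto
    also have "\<dots> = det1 n (\<lambda>k j. h k (y j)) * det1 n (\<lambda>i j. f i (y j))"
      by (simp only: det1_perm[of n "\<lambda>k j. h k (y j)"] sum_distrib_right)
    finally show "(\<Sum>q\<in>?Q. t (c (y, q))) = det1 n (\<lambda>k j. h k (y j)) * det1 n (\<lambda>i j. f i (y j))" .
  qed
  finally show ?thesis by simp
qed

text \<open>Induction on the right end. The boundary terms contain \<open>e hi\<close> and
  \<open>f lo\<close>, and these two values are the ones that \<open>Omega_move\<close> shows to
  vanish.\<close>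

lemma sum_by_parts_int:
  fixes e f :: "int => complex"
  assumes "lo < hi"
  shows "(\<Sum>z\<in>{lo<..<hi}. (c * e (z + 1) - e z) * f z) =
    (\<Sum>z\<in>{lo<..<hi}. e z * (c * f (z - 1) - f z)) + c * e hi * f (hi - 1) - c * e (lo + 1) * f lo"
  using assms
proof (induction hi rule: int_gr_induct)
  case base
  have "{lo<..<lo + 1} = {}" by auto
  then show ?case by simp
next
  case (step hi)
  have "{lo<..<hi + 1} = insert hi {lo<..<hi}" using step.hyps by auto
  then show ?case using step.IH by (simp add: algebra_simps)
qed

text \<open>Fubini with coordinate \<open>l\<close> innermost: once the others are fixed, it ranges
  over the open interval between its two neighbours, the ends of the window replacing a missing
  neighbour.\<close>

lemma sum_OmegaI_slice:
  fixes W :: "(nat => int) => complex"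
  assumes l: "l \<in> {1..n}" and ab: "a < b"
  defines "D \<equiv> {x \<in> ({1..n} - {l}) \<rightarrow>\<^sub>E {a<..<b}. \<forall>i\<in>{1..n} - {l}. \<forall>j\<in>{1..n} - {l}. i < j \<longrightarrow> x j < x i}"
  shows "(\<Sum>x\<in>OmegaI n {a<..<b}. W x) =
    (\<Sum>x\<in>D. \<Sum>z\<in>{(if l = n then a else x (l + 1))<..<(if l = 1 then b else x (l - 1))}. W (x(l := z)))"
proof -
  let ?lo = "\<lambda>x. if l = n then a else x (l + 1)" and ?hi = "\<lambda>x. if l = 1 then b else x (l - 1)"
  have finD: "finite D"
    unfolding D_def by (rule finite_subset[of _ "({1..n} - {l}) \<rightarrow>\<^sub>E {a<..<b}"]) (auto intro: finite_PiE)
  have D1: "x i \<in> {a<..<b}" if "x \<in> D" "i \<in> {1..n} - {l}" for x i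
    using that by (auto simp: D_def PiE_def Pi_def)
  have l1: "l - 1 \<in> {1..n} - {l}" if "l \<noteq> 1" using that l by simp presburger
  have l2: "l + 1 \<in> {1..n} - {l}" if "l \<noteq> n" using that l by simp
  have D2: "x j < x i" if "x \<in> D" "i \<in> {1..n} - {l}" "j \<in> {1..n} - {l}" "i < j" for x i j
    using that by (simp add: D_def)
  have "(\<Sum>x\<in>D. \<Sum>z\<in>{?lo x<..<?hi x}. W (x(l := z))) =
    (\<Sum>(x, z)\<in>Sigma D (\<lambda>x. {?lo x<..<?hi x}). W (x(l := z)))"
    using finD by (intro sum.Sigma) auto
  also have "\<dots> = (\<Sum>x\<in>OmegaI n {a<..<b}. W x)"
  proof (rule sum.reindex_bij_witness[of _ "\<lambda>x. (restrict x ({1..n} - {l}), x l)" "\<lambda>(x, z). x(l := z)"])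
    fix w assume "w \<in> Sigma D (\<lambda>x. {?lo x<..<?hi x})"
    then obtain x z where w: "w = (x, z)" and x: "x \<in> D" and z: "?lo x < z" "z < ?hi x" by auto
    have xl: "x l = undefined" "x i = undefined" if "i \<notin> {1..n}" for i
      using x that by (auto simp: D_def PiE_def extensional_def)
    show "(restrict (case w of (x, z) => x(l := z)) ({1..n} - {l}), (case w of (x, z) => x(l := z)) l) = w"
      using x by (auto simp: w D_def PiE_def extensional_def restrict_def fun_eq_iff)
    have lo: "x j < z" if "j \<in> {1..n}" "l < j" for j
    proof -
      have "x j \<le> x (l + 1)"
        using D2[OF x, of "l + 1" j] that l by (cases "j = l + 1") auto
      then show ?thesis using z that by auto
    qed
    have hi: "z < x i" if "i \<in> {1..n}" "i < l" for i
    proof (cases "i = l - 1")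
      case False
      then have "x (l - 1) < x i" using D2[OF x, of i "l - 1"] l1 that by force
      then show ?thesis using z that by auto
    qed (use z that in auto)
    have "a \<le> ?lo x" "?hi x \<le> b"
      using D1[OF x l2] D1[OF x l1] l by auto
    then have zI: "z \<in> {a<..<b}" using z by auto
    have "(x(l := z)) \<in> {1..n} \<rightarrow>\<^sub>E {a<..<b}"
      using x l zI by (auto simp: D_def PiE_def extensional_def Pi_def)
    moreover have "(x(l := z)) j < (x(l := z)) i" if "i \<in> {1..n}" "j \<in> {1..n}" "i < j" for i j
      using that lo[of j] hi[of i] D2[OF x, of i j] by auto
    ultimately show "(case w of (x, z) => x(l := z)) \<in> OmegaI n {a<..<b}"
      by (simp add: w OmegaI_def)
    show "W (case w of (x, z) => x(l := z)) = (case w of (x, z) => W (x(l := z)))"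
      by (simp add: w)
  next
    fix x assume x: "x \<in> OmegaI n {a<..<b}"
    show "(case (restrict x ({1..n} - {l}), x l) of (x, z) => x(l := z)) = x"
      using x l by (auto simp: OmegaI_def PiE_def extensional_def restrict_def fun_eq_iff)
    have xI: "a < x i" "x i < b" if "i \<in> {1..n}" for i
      using x that by (auto simp: OmegaI_def PiE_def Pi_def)
    have "restrict x ({1..n} - {l}) \<in> D"
      using xI OmegaI_less[OF x] by (simp add: D_def)
    moreover have "?lo (restrict x ({1..n} - {l})) < x l"
      using l l2 xI[of l] OmegaI_less[OF x, of l "l + 1"] by auto
    moreover have "x l < ?hi (restrict x ({1..n} - {l}))"
    proof (cases "l = 1")
      case False
      have "x l < x (l - 1)" by (rule OmegaI_less[OF x]) (use l l1[OF False] False in auto)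
      then show ?thesis using l1[OF False] False by simp
    qed (use l xI[of l] in simp)
    ultimately show "(restrict x ({1..n} - {l}), x l) \<in> Sigma D (\<lambda>x. {?lo x<..<?hi x})"
      by (simp only: mem_Sigma_iff greaterThanLessThan_iff)
  qed
  finally show ?thesis ..
qed

text \<open>One elementary move: the difference operator is taken from the \<open>l\<close>-th column of the first
  determinant to that of the second one. The boundary terms of the summation by parts are
  determinants with two equal columns.\<close>

lemma Omega_move:
  fixes H F :: "nat => nat => int => complex" and e g :: "nat => int => complex"
  assumes l: "l \<in> {1..n}" and ab: "a < b"
    and H: "\<And>k z. k \<in> {1..n} ==> H k l z = c * e k (z + 1) - e k z"
    and g: "\<And>i z. i \<in> {1..n} ==> g i z = c * F i l (z - 1) - F i l z"
    and up: "\<And>k z. k \<in> {1..n} ==> (if l = 1 then e k b = 0 else H k (l - 1) z = e k z)"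
    and low: "\<And>i z. i \<in> {1..n} ==> (if l = n then F i n a = 0 else F i (l + 1) z = F i l z)"
  shows "(\<Sum>x\<in>OmegaI n {a<..<b}. det1 n (\<lambda>k j. H k j (x j)) * det1 n (\<lambda>i j. F i j (x j))) =
    (\<Sum>x\<in>OmegaI n {a<..<b}. det1 n (\<lambda>k j. if j = l then e k (x j) else H k j (x j)) *
       det1 n (\<lambda>i j. if j = l then g i (x j) else F i j (x j)))"
  unfolding sum_OmegaI_slice[OF l ab]
proof (rule sum.cong[OF refl])
  fix x
  assume x: "x \<in> {x \<in> ({1..n} - {l}) \<rightarrow>\<^sub>E {a<..<b}. \<forall>i\<in>{1..n} - {l}. \<forall>j\<in>{1..n} - {l}. i < j \<longrightarrow> x j < x i}"
  define lo hi where "lo = (if l = n then a else x (l + 1))" and "hi = (if l = 1 then b else x (l - 1))"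
  have D1: "a < x i \<and> x i < b" if "i \<in> {1..n} - {l}" for i
    using x that by (auto simp: PiE_def Pi_def)
  have D2: "x j < x i" if "i \<in> {1..n} - {l}" "j \<in> {1..n} - {l}" "i < j" for i j
    using x that by simp
  have lohi: "lo < hi"
  proof -
    have l1: "l - 1 \<in> {1..n} - {l}" if "l \<noteq> 1" using that l by simp presburger
    have l2: "l + 1 \<in> {1..n} - {l}" if "l \<noteq> n" using that l by simp
    have "x (l + 1) < x (l - 1)" if "l \<noteq> 1" "l \<noteq> n"
      by (rule D2[OF l1 l2]) (use that in auto)
    then show ?thesis using D1[OF l1] D1[OF l2] ab by (auto simp: lo_def hi_def)
  qed
  \<comment> \<open>With the other columns frozen, both determinants become scalar functions
    \<open>E\<close> and \<open>G\<close> of the position in column \<open>l\<close>, and ordinary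
    summation by parts applies.\<close>
  obtain \<alpha> where \<alpha>: "\<And>u. det1 n (\<lambda>k j. if j = l then u k else H k j (x j)) = (\<Sum>k=1..n. u k * \<alpha> k)"
    by (rule det1_col_cofactor[OF l, of "\<lambda>k j. H k j (x j)"]) (rule that)
  obtain \<beta> where \<beta>: "\<And>u. det1 n (\<lambda>k j. if j = l then u k else F k j (x j)) = (\<Sum>k=1..n. u k * \<beta> k)"
    by (rule det1_col_cofactor[OF l, of "\<lambda>k j. F k j (x j)"]) (rule that)
  define E where "E z = (\<Sum>k=1..n. e k z * \<alpha> k)" for z
  define G where "G z = (\<Sum>k=1..n. F k l z * \<beta> k)" for z
  have 1: "det1 n (\<lambda>k j. H k j ((x(l := z)) j)) = c * E (z + 1) - E z" for z
  proof -
    have "det1 n (\<lambda>k j. H k j ((x(l := z)) j)) = det1 n (\<lambda>k j. if j = l then H k l z else H k j (x j))"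
      by (rule det1_cong) auto
    also have "\<dots> = (\<Sum>k=1..n. H k l z * \<alpha> k)" by (rule \<alpha>)
    also have "\<dots> = (\<Sum>k=1..n. c * (e k (z + 1) * \<alpha> k) - e k z * \<alpha> k)"
      by (intro sum.cong) (simp_all add: H algebra_simps)
    finally show ?thesis by (simp add: E_def sum_subtractf sum_distrib_left)
  qed
  have 2: "det1 n (\<lambda>k j. F k j ((x(l := z)) j)) = G z" for z
  proof -
    have "det1 n (\<lambda>k j. F k j ((x(l := z)) j)) = det1 n (\<lambda>k j. if j = l then F k l z else F k j (x j))"
      by (rule det1_cong) auto
    also have "\<dots> = G z" unfolding G_def by (rule \<beta>)
    finally show ?thesis .
  qed
  have 3: "det1 n (\<lambda>k j. if j = l then e k ((x(l := z)) j) else H k j ((x(l := z)) j)) = E z" for z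
  proof -
    have "det1 n (\<lambda>k j. if j = l then e k ((x(l := z)) j) else H k j ((x(l := z)) j)) =
        det1 n (\<lambda>k j. if j = l then e k z else H k j (x j))"
      by (rule det1_cong) auto
    also have "\<dots> = E z" unfolding E_def by (rule \<alpha>)
    finally show ?thesis .
  qed
  have 4: "det1 n (\<lambda>k j. if j = l then g k ((x(l := z)) j) else F k j ((x(l := z)) j)) = c * G (z - 1) - G z" for z
  proof -
    have "det1 n (\<lambda>k j. if j = l then g k ((x(l := z)) j) else F k j ((x(l := z)) j)) =
        det1 n (\<lambda>k j. if j = l then g k z else F k j (x j))"
      by (rule det1_cong) auto
    also have "\<dots> = (\<Sum>k=1..n. g k z * \<beta> k)" by (rule \<beta>)
    also have "\<dots> = (\<Sum>k=1..n. c * (F k l (z - 1) * \<beta> k) - F k l z * \<beta> k)"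
      by (intro sum.cong) (simp_all add: g algebra_simps)
    finally show ?thesis by (simp add: G_def sum_subtractf sum_distrib_left)
  qed
  have E0: "E hi = 0"
  proof (cases "l = 1")
    case True
    then show ?thesis using up by (auto simp: E_def hi_def intro!: sum.neutral)
  next
    case False
    have "E hi = det1 n (\<lambda>k j. if j = l then e k hi else H k j (x j))"
      unfolding E_def by (rule \<alpha>[symmetric])
    also have "\<dots> = 0"
      by (rule det1_eq_cols[of l n "l - 1"]) (use False l up in \<open>auto simp: hi_def\<close>)
    finally show ?thesis .
  qed
  have G0: "G lo = 0"
  proof (cases "l = n")
    case True
    then show ?thesis using low by (auto simp: G_def lo_def intro!: sum.neutral)
  next
    case False
    have "G lo = det1 n (\<lambda>k j. if j = l then F k l lo else F k j (x j))"
      unfolding G_def by (rule \<beta>[symmetric])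
    also have "\<dots> = 0"
      by (rule det1_eq_cols[of l n "l + 1"]) (use False l low in \<open>auto simp: lo_def\<close>)
    finally show ?thesis .
  qed
  show "(\<Sum>z\<in>{(if l = n then a else x (l + 1))<..<(if l = 1 then b else x (l - 1))}.
      det1 n (\<lambda>k j. H k j ((x(l := z)) j)) * det1 n (\<lambda>i j. F i j ((x(l := z)) j))) =
    (\<Sum>z\<in>{(if l = n then a else x (l + 1))<..<(if l = 1 then b else x (l - 1))}.
      det1 n (\<lambda>k j. if j = l then e k ((x(l := z)) j) else H k j ((x(l := z)) j)) *
      det1 n (\<lambda>i j. if j = l then g i ((x(l := z)) j) else F i j ((x(l := z)) j)))"
    unfolding 1 2 3 4 lo_def[symmetric] hi_def[symmetric]
    using sum_by_parts_int[OF lohi, of c E G] E0 G0 by simp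
qed

text \<open>The operators are carried from the first determinant to the second by elementary moves
  until every column has index 0; then all columns use the same functions and the plain Cauchy-Binet
  identity applies. The function \<tau> records the current index of each column.\<close>

lemma Omega_cauchy_binet_finite:
  fixes hh ff :: "nat => nat => int => complex"
  assumes ab: "a < b"
    and rech: "\<And>k t z. k \<in> {1..n} ==> t < n ==> hh k (Suc t) z = v (Suc t) * hh k t (z + 1) - hh k t z"
    and recf: "\<And>i t z. i \<in> {1..n} ==> t < n ==> ff i t z = v (Suc t) * ff i (Suc t) (z - 1) - ff i (Suc t) z"
    and hb: "\<And>k t. k \<in> {1..n} ==> t < n ==> hh k t b = 0"
    and fa: "\<And>i t. i \<in> {1..n} ==> t \<le> n ==> ff i t a = 0"
  shows "(\<Sum>x\<in>OmegaI n {a<..<b}. det1 n (\<lambda>k j. hh k j (x j)) * det1 n (\<lambda>i j. ff i j (x j))) =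
    det1 n (\<lambda>k i. \<Sum>z\<in>{a<..<b}. hh k 0 z * ff i 0 z)"
proof -
  define S where "S \<tau> = (\<Sum>x\<in>OmegaI n {a<..<b}. det1 n (\<lambda>k j. hh k (\<tau> j) (x j)) * det1 n (\<lambda>i j. ff i (\<tau> j) (x j)))"
    for \<tau> :: "nat => nat"
  \<comment> \<open>A column may be lowered only if its left neighbour is already at
    \<open>t\<close> and its right neighbour is still at \<open>Suc t\<close>; otherwise the
    boundary determinants would not have equal columns. This forces the order of the moves.\<close>
  have move: "S \<tau> = S (\<tau>(l := t))"
    if l: "l \<in> {1..n}" and t: "t < n" "\<tau> l = Suc t" "l = 1 \<or> \<tau> (l - 1) = t" "l = n \<or> \<tau> (l + 1) = Suc t" for \<tau> l t
  proof -
    have "S \<tau> = (\<Sum>x\<in>OmegaI n {a<..<b}. det1 n (\<lambda>k j. if j = l then hh k t (x j) else hh k (\<tau> j) (x j)) *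
       det1 n (\<lambda>i j. if j = l then ff i t (x j) else ff i (\<tau> j) (x j)))"
      unfolding S_def
      by (rule Omega_move[OF l ab, of "\<lambda>k j. hh k (\<tau> j)" "v (Suc t)" "\<lambda>k. hh k t" "\<lambda>i. ff i t" "\<lambda>k j. ff k (\<tau> j)"])
        (use l t rech recf hb fa in auto)
    also have "\<dots> = S (\<tau>(l := t))"
      unfolding S_def by (intro sum.cong refl arg_cong2[of _ _ _ _ "(*)"] det1_cong) auto
    finally show ?thesis .
  qed
  have S_cong: "S \<tau> = S \<tau>'" if "\<And>j. j \<in> {1..n} ==> \<tau> j = \<tau>' j" for \<tau> \<tau>'
    unfolding S_def using that by (intro sum.cong refl arg_cong2[of _ _ _ _ "(*)"] det1_cong) auto
  \<comment> \<open>State in the middle of round \<open>r\<close>, which lowers the columns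
    \<open>r..n\<close> from \<open>r\<close> to \<open>r - 1\<close>, left to right: the columns
    before \<open>p\<close> are done. The end of round \<open>r\<close> is the start of round
    \<open>r - 1\<close>.\<close>
  define st where "st r p j = (if j < r then j else if j < p then r - 1 else r)" for r p j :: nat
  have round: "S (st r r) = S (st r p)" if r: "1 \<le> r" "r \<le> n" and p: "r \<le> p" "p \<le> Suc n" for r p
    using p
  proof (induction p rule: dec_induct)
    case (step p)
    have "S (st r p) = S ((st r p)(p := r - 1))"
      by (rule move) (use r step in \<open>auto simp: st_def\<close>)
    also have "(st r p)(p := r - 1) = st r (Suc p)"
      using step.hyps by (auto simp: st_def fun_eq_iff)
    finally show ?case using step by simp
  qed simp
  have "S (st n n) = S (st (n - d) (n - d))" if "d \<le> n" for d
    using that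
  proof (induction d)
    case (Suc d)
    have "S (st (n - d) (n - d)) = S (st (n - d) (Suc n))"
      by (rule round) (use Suc in auto)
    also have "\<dots> = S (st (n - Suc d) (n - Suc d))"
      by (rule S_cong) (use Suc in \<open>auto simp: st_def\<close>)
    finally show ?case using Suc by simp
  qed simp
  from this[of n] have "S (st n n) = S (st 0 0)" by simp
  moreover have "S (st n n) = S (\<lambda>j. j)" by (rule S_cong) (auto simp: st_def)
  moreover have "S (st 0 0) = S (\<lambda>_. 0)" by (rule S_cong) (auto simp: st_def)
  ultimately have "S (\<lambda>j. j) = S (\<lambda>_. 0)" by simp
  also have "\<dots> = det1 n (\<lambda>k i. \<Sum>z\<in>{a<..<b}. hh k 0 z * ff i 0 z)"
    unfolding S_def by (rule cauchy_binet_Omega) simp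
  finally show ?thesis by (simp only: S_def)
qed

section \<open>Dominated convergence, geometric sums and determinant bounds\<close>

lemma infsum_dominated:
  fixes f :: "nat => 'a => complex"
  assumes le: "\<And>n x. x \<in> A ==> norm (f n x) \<le> g x"
    and g: "g summable_on A"
    and lim: "\<And>x. x \<in> A ==> (\<lambda>n. f n x) \<longlonglongrightarrow> F x"
  shows "(\<lambda>n. infsum (f n) A) \<longlonglongrightarrow> infsum F A"
proof -
  have gn: "0 \<le> g x" if "x \<in> A" for x
    by (rule order_trans[OF norm_ge_zero le[OF that]])
  \<comment> \<open>Sums are read as integrals over the counting measure, where Lebesgue's dominated
    convergence is available; domination by \<open>g\<close> makes the two notions of sum
    agree.\<close>
  have gi: "integrable (count_space A) g"
  proof -
    have "(\<lambda>x. norm (g x)) summable_on A"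
      using g by (rule summable_on_cong[THEN iffD1, rotated]) (use gn in auto)
    then have "Infinite_Set_Sum.abs_summable_on g A" by (rule abs_summable_equivalent[THEN iffD1])
    then show ?thesis by (simp add: Infinite_Set_Sum.abs_summable_on_def)
  qed
  have eq: "infsum h A = lebesgue_integral (count_space A) h" if "\<And>x. x \<in> A ==> norm (h x) \<le> g x" for h :: "'a => complex"
  proof -
    have "(\<lambda>x. norm (h x)) summable_on A"
      by (rule summable_on_comparison_test[OF g]) (use that in auto)
    then have "Infinite_Set_Sum.abs_summable_on h A" by (rule abs_summable_equivalent[THEN iffD1])
    then show ?thesis using infsetsum_infsum[of h A] by (simp add: infsetsum_def)
  qed
  have Fle: "norm (F x) \<le> g x" if "x \<in> A" for x
    by (rule tendsto_upperbound[OF tendsto_norm[OF lim[OF that]]]) (use le[OF that] in auto)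
  have "(\<lambda>n. lebesgue_integral (count_space A) (f n)) \<longlonglongrightarrow> lebesgue_integral (count_space A) F"
    by (rule integral_dominated_convergence[OF _ _ gi])
      (use le lim in \<open>auto simp: AE_count_space\<close>)
  then show ?thesis using eq[OF le] eq[OF Fle] by simp
qed

lemma summable_prod_PiE:
  fixes f :: "'a => 'b => real"
  assumes "finite A" "\<And>x. x \<in> A ==> f x summable_on B x"
    "\<And>x y. x \<in> A ==> y \<in> B x ==> 0 \<le> f x y"
  shows "(\<lambda>g. \<Prod>x\<in>A. f x (g x)) summable_on PiE A B"
  using assms
proof (induction A rule: finite_induct)
  case (insert x F)
  have pi: "PiE (insert x F) B = (\<lambda>(y, g). g(x := y)) ` (B x \<times> PiE F B)"
    by (rule PiE_insert_eq)
  have inj: "inj_on (\<lambda>(y, g). g(x := y)) (B x \<times> PiE F B)"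
    using insert.hyps by (rule_tac inj_combinator) auto
  have "(\<lambda>(y, g). f x y * (\<Prod>z\<in>F. f z (g z))) summable_on (B x \<times> PiE F B)"
  proof (rule summable_on_SigmaI)
    fix y assume y: "y \<in> B x"
    have "((\<lambda>g. \<Prod>z\<in>F. f z (g z)) has_sum infsum (\<lambda>g. \<Prod>z\<in>F. f z (g z)) (PiE F B)) (PiE F B)"
      using insert by (intro has_sum_infsum) auto
    from has_sum_cmult_right[OF this, of "f x y"]
    show "((\<lambda>g. case (y, g) of (y, g) => f x y * (\<Prod>z\<in>F. f z (g z))) has_sum
      f x y * infsum (\<lambda>g. \<Prod>z\<in>F. f z (g z)) (PiE F B)) (PiE F B)" by simp
  next
    show "(\<lambda>y. f x y * infsum (\<lambda>g. \<Prod>z\<in>F. f z (g z)) (PiE F B)) summable_on B x"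
      using insert by (intro summable_on_cmult_left) auto
  next
    fix y g assume "y \<in> B x" "g \<in> PiE F B"
    then show "0 \<le> (case (y, g) of (y, g) => f x y * (\<Prod>z\<in>F. f z (g z)))"
      using insert.prems(2) by (auto intro!: mult_nonneg_nonneg prod_nonneg simp: PiE_def Pi_def)
  qed
  moreover have "(\<lambda>(y, g). f x y * (\<Prod>z\<in>F. f z (g z))) =
     (\<lambda>g. \<Prod>z\<in>insert x F. f z (g z)) \<circ> (\<lambda>(y, g). g(x := y))"
  proof
    fix w :: "'b \<times> ('a => 'b)"
    obtain y g where w: "w = (y, g)" by force
    have "(\<Prod>z\<in>F. f z ((g(x := y)) z)) = (\<Prod>z\<in>F. f z (g z))"
      using insert.hyps by (intro prod.cong) auto
    then show "(\<lambda>(y, g). f x y * (\<Prod>z\<in>F. f z (g z))) w =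
      ((\<lambda>g. \<Prod>z\<in>insert x F. f z (g z)) \<circ> (\<lambda>(y, g). g(x := y))) w"
      using insert.hyps by (simp add: w)
  qed
  ultimately show ?case
    by (simp only: pi summable_on_reindex[OF inj])
qed simp

lemma powi_summable_gt:
  fixes q :: real
  assumes "0 < q" "q < 1"
  shows "(\<lambda>z. q powi z) summable_on {a<..}"
proof -
  have bij: "bij_betw (\<lambda>n. a + 1 + int n) UNIV {a<..}"
    by (rule bij_betw_byWitness[of _ "\<lambda>z. nat (z - a - 1)"]) auto
  have "(\<lambda>n. q powi (a + 1) * q ^ n) summable_on UNIV"
    using assms by (intro summable_on_cmult_right) (simp add: summable_on_UNIV_nonneg_real_iff summable_geometric)
  then have "(\<lambda>n. q powi (a + 1 + int n)) summable_on UNIV"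
    using assms by (simp add: power_int_add)
  then show ?thesis using summable_on_reindex_bij_betw[OF bij, of "\<lambda>z. q powi z"] by simp
qed

lemma powi_summable_le:
  fixes q :: real
  assumes "1 < q"
  shows "(\<lambda>z. q powi z) summable_on {..a}"
proof -
  have bij: "bij_betw (\<lambda>z::int. - z) {- a - 1<..} {..a}"
    by (rule bij_betw_byWitness[of _ "\<lambda>z. - z"]) auto
  have "(\<lambda>z. (1 / q) powi z) summable_on {- a - 1<..}"
    using assms by (intro powi_summable_gt) auto
  then have "(\<lambda>z. q powi (- z)) summable_on {- a - 1<..}"
    using assms by (simp add: power_int_minus power_int_divide_distrib inverse_eq_divide)
  then show ?thesis using summable_on_reindex_bij_betw[OF bij, of "\<lambda>z. q powi z"] by simp
qed

text \<open>The common constant is the sum of the absolute values of the individual ones, which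
  unlike a maximum also makes sense for an empty index set.\<close>

lemma uniform_bound_on:
  fixes f g :: "'i => 'z => real"
  assumes "finite I" "\<And>i z. i \<in> I ==> 0 \<le> g i z" "\<And>i. i \<in> I ==> \<exists>C. \<forall>z. Q i z \<longrightarrow> f i z \<le> C * g i z"
  shows "\<exists>C\<ge>0. \<forall>i\<in>I. \<forall>z. Q i z \<longrightarrow> f i z \<le> C * g i z"
proof -
  have "\<forall>i\<in>I. \<exists>C. \<forall>z. Q i z \<longrightarrow> f i z \<le> C * g i z" using assms(3) by blast
  from bchoice[OF this] obtain C where C: "\<forall>i\<in>I. \<forall>z. Q i z \<longrightarrow> f i z \<le> C i * g i z" by blast
  have "f i z \<le> (\<Sum>i\<in>I. \<bar>C i\<bar>) * g i z" if i: "i \<in> I" "Q i z" for i z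
  proof -
    have "\<bar>C i\<bar> \<le> (\<Sum>i\<in>I. \<bar>C i\<bar>)" using assms(1) i by (intro member_le_sum) auto
    then have "C i * g i z \<le> (\<Sum>i\<in>I. \<bar>C i\<bar>) * g i z" using assms(2)[OF i(1)] by (intro mult_right_mono) auto
    then show ?thesis using C i by fastforce
  qed
  moreover have "0 \<le> (\<Sum>i\<in>I. \<bar>C i\<bar>)" by (simp add: sum_nonneg)
  ultimately show ?thesis by blast
qed

lemmas uniform_bound = uniform_bound_on[where Q = "\<lambda>_ _. True", simplified]

text \<open>Each Leibniz term uses every row and every column once, so all \<open>fact n\<close>
  terms obey the same bound.\<close>

lemma norm_det1_le_rank1:
  assumes "\<And>k j. k \<in> {1..n} ==> j \<in> {1..n} ==> norm (A k j) \<le> a k * b j"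
  shows "norm (det1 n A) \<le> fact n * ((\<Prod>k=1..n. a k) * (\<Prod>j=1..n. b j))"
proof -
  let ?p = "\<lambda>p. \<Prod>i=0..<n. norm (A (i + 1) (p i + 1))"
  have "norm (det1 n A) \<le> (\<Sum>p | p permutes {0..<n}. \<Prod>i=0..<n. norm (A (i + 1) (p i + 1)))" by (rule norm_det1_le)
  also have "\<dots> \<le> (\<Sum>p | p permutes {0..<n}. (\<Prod>k=1..n. a k) * (\<Prod>j=1..n. b j))"
  proof (rule sum_mono)
    fix p assume "p \<in> {p. p permutes {0..<n}}"
    then have p: "p permutes {0..<n}" by simp
    have "(?p p) \<le> (\<Prod>i=0..<n. a (Suc i) * b (Suc (p i)))"
    proof (rule prod_mono, rule conjI)
      fix i assume "i \<in> {0..<n}"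
      then show "norm (A (i + 1) (p i + 1)) \<le> a (Suc i) * b (Suc (p i))"
        using assms[of "i + 1" "p i + 1"] permutes_in_image[OF p, of i] by auto
    qed simp
    also have "\<dots> = (\<Prod>k=1..n. a k) * (\<Prod>j=1..n. b j)"
      by (simp only: prod.distrib prod_perm_shift[OF p] prod_shift)
    finally show "(?p p) \<le> (\<Prod>k=1..n. a k) * (\<Prod>j=1..n. b j)" .
  qed
  also have "\<dots> = fact n * ((\<Prod>k=1..n. a k) * (\<Prod>j=1..n. b j))" by (simp add: card_permutations)
  finally show ?thesis .
qed

lemma norm_det1_le_cols:
  assumes "\<And>k j. k \<in> {1..n} ==> j \<in> {1..n} ==> norm (A k j) \<le> B j"
  shows "norm (det1 n A) \<le> fact n * (\<Prod>j=1..n. B j)"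
  using norm_det1_le_rank1[of n A "\<lambda>_. 1" B] assms by simp

lemma det1_zero_col:
  assumes "j \<in> {1..n}" "\<And>k. k \<in> {1..n} ==> A k j = 0"
  shows "det1 n A = 0"
  using det1_zero_row[of j n "\<lambda>k l. A l k"] assms det1_transpose[of n A] by auto

text \<open>The recursion of the rows \<open>hh\<close> started from an arbitrary function: rows
  have to be truncated at index 0, after which the recursion must be run again.\<close>

primrec rdiff :: "(nat => complex) => (int => complex) => nat => int => complex" where
  "rdiff v h 0 = h"
| "rdiff v h (Suc t) = (\<lambda>z. v (Suc t) * rdiff v h t (z + 1) - rdiff v h t z)"

text \<open>\<open>K\<close> is chosen before \<open>h\<close> and \<open>C\<close>, so that one
  constant serves all truncations of a row.\<close>

lemma rdiff_bound:
  assumes q: "0 < q"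
  shows "\<exists>K\<ge>0. \<forall>h C. (\<forall>z. norm (h z) \<le> C * q powi z) \<longrightarrow> (\<forall>z. norm (rdiff v h t z) \<le> K * C * q powi z)"
proof (induction t)
  case 0
  show ?case by (rule exI[of _ 1]) simp
next
  case (Suc t)
  then obtain K where K: "K \<ge> 0" and
    K2: "\<forall>h C. (\<forall>z. norm (h z) \<le> C * q powi z) \<longrightarrow> (\<forall>z. norm (rdiff v h t z) \<le> K * C * q powi z)"
    by blast
  have "norm (rdiff v h (Suc t) z) \<le> ((norm (v (Suc t)) * q + 1) * K) * C * q powi z"
    if "\<forall>z. norm (h z) \<le> C * q powi z" for h C z
  proof -
    have "norm (rdiff v h (Suc t) z) \<le> norm (v (Suc t)) * norm (rdiff v h t (z + 1)) + norm (rdiff v h t z)"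
      unfolding rdiff.simps norm_mult[symmetric] by (rule norm_triangle_ineq4)
    also have "\<dots> \<le> norm (v (Suc t)) * (K * C * q powi (z + 1)) + K * C * q powi z"
      using K2[rule_format, OF that[rule_format]] by (intro add_mono mult_left_mono) auto
    also have "\<dots> = ((norm (v (Suc t)) * q + 1) * K) * C * q powi z"
      using q by (simp add: power_int_add algebra_simps)
    finally show ?thesis .
  qed
  moreover have "(norm (v (Suc t)) * q + 1) * K \<ge> 0" using K q by simp
  ultimately show ?case by blast
qed

lemma rdiff_cong:
  assumes "\<And>y. y < b ==> h y = h' y" "z + int t < b"
  shows "rdiff v h t z = rdiff v h' t z"
  using assms(2) by (induction t arbitrary: z) (auto simp: assms(1))

lemma rdiff_zero:
  assumes "\<And>y. b \<le> y ==> h y = 0" "b \<le> z"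
  shows "rdiff v h t z = 0"
  using assms(2) by (induction t arbitrary: z) (auto simp: assms(1))

lemma rdiff_eq:
  assumes "\<And>t z. t < n ==> hh (Suc t) z = v (Suc t) * hh t (z + 1) - hh t z" "t \<le> n"
  shows "hh t = rdiff v (hh 0) t"
  using assms(2) by (induction t) (auto simp: assms(1))

lemma infsum_by_parts_int:
  fixes e f :: "int => complex"
  assumes 1: "(\<lambda>z. e z * f z) summable_on UNIV" and 2: "(\<lambda>z. e (z + 1) * f z) summable_on UNIV"
  shows "(\<Sum>\<^sub>\<infinity>z. (c * e (z + 1) - e z) * f z) = (\<Sum>\<^sub>\<infinity>z. e z * (c * f (z - 1) - f z))"
proof -
  have bij: "bij_betw (\<lambda>z::int. z + 1) UNIV UNIV"
    by (rule bij_betw_byWitness[of _ "\<lambda>z. z - 1"]) auto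
  have 3: "(\<lambda>z. e z * f (z - 1)) summable_on UNIV"
    using summable_on_reindex_bij_betw[OF bij, of "\<lambda>z. e z * f (z - 1)"] 2 by simp
  have 4: "(\<Sum>\<^sub>\<infinity>z. e (z + 1) * f z) = (\<Sum>\<^sub>\<infinity>z. e z * f (z - 1))"
    using infsum_reindex_bij_betw[OF bij, of "\<lambda>z. e z * f (z - 1)"] by simp
  have "(\<Sum>\<^sub>\<infinity>z. (c * e (z + 1) - e z) * f z) = (\<Sum>\<^sub>\<infinity>z. c * (e (z + 1) * f z) + (- 1) * (e z * f z))"
    by (intro infsum_cong) (simp add: algebra_simps)
  also have "\<dots> = c * (\<Sum>\<^sub>\<infinity>z. e (z + 1) * f z) + (- 1) * (\<Sum>\<^sub>\<infinity>z. e z * f z)"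
    using 1 2 by (subst infsum_add) (auto simp only: infsum_cmult_right intro!: summable_on_cmult_right)
  also have "\<dots> = c * (\<Sum>\<^sub>\<infinity>z. e z * f (z - 1)) + (- 1) * (\<Sum>\<^sub>\<infinity>z. e z * f z)"
    by (simp only: 4)
  also have "\<dots> = (\<Sum>\<^sub>\<infinity>z. c * (e z * f (z - 1)) + (- 1) * (e z * f z))"
    using 1 3 by (subst infsum_add) (auto simp only: infsum_cmult_right intro!: summable_on_cmult_right)
  also have "\<dots> = (\<Sum>\<^sub>\<infinity>z. e z * (c * f (z - 1) - f z))"
    by (intro infsum_cong) (simp add: algebra_simps)
  finally show ?thesis .
qed

section \<open>Functions of geometric growth and their pairings\<close>

definition pow_bounded :: "real => (int => complex) => bool" where
  "pow_bounded q f \<longleftrightarrow> (\<exists>C. \<forall>z. norm (f z) \<le> C * q powi z)"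

lemma pow_boundedI: "(\<And>z. norm (f z) \<le> C * q powi z) ==> pow_bounded q f"
  unfolding pow_bounded_def by blast

lemma pow_boundedE:
  assumes "pow_bounded q f"
  obtains C where "C \<ge> 0" "\<And>z. norm (f z) \<le> C * q powi z"
proof -
  obtain C where C: "\<And>z. norm (f z) \<le> C * q powi z" using assms unfolding pow_bounded_def by blast
  have "0 \<le> C" using order_trans[OF norm_ge_zero C[of 0]] by simp
  then show ?thesis using C that by blast
qed

lemma pow_bounded_add: "pow_bounded q f ==> pow_bounded q g ==> pow_bounded q (\<lambda>z. f z + g z)"
proof -
  assume "pow_bounded q f" "pow_bounded q g"
  then obtain C D where "\<And>z. norm (f z) \<le> C * q powi z" "\<And>z. norm (g z) \<le> D * q powi z"
    unfolding pow_bounded_def by blast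
  then have "norm (f z + g z) \<le> (C + D) * q powi z" for z
    by (intro order_trans[OF norm_triangle_ineq]) (simp add: distrib_right add_mono)
  then show ?thesis by (rule pow_boundedI)
qed

lemma pow_bounded_cmult: "pow_bounded q f ==> pow_bounded q (\<lambda>z. c * f z)"
proof -
  assume "pow_bounded q f"
  then obtain C where "\<And>z. norm (f z) \<le> C * q powi z"
    unfolding pow_bounded_def by blast
  then have "norm (c * f z) \<le> (norm c * C) * q powi z" for z
    by (simp add: norm_mult mult_left_mono mult.assoc)
  then show ?thesis by (rule pow_boundedI)
qed

lemma pow_bounded_diff: "pow_bounded q f ==> pow_bounded q g ==> pow_bounded q (\<lambda>z. f z - g z)"
  using pow_bounded_add[of q f "\<lambda>z. (- 1) * g z"] pow_bounded_cmult[of q g "- 1"] by simp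

lemma pow_bounded_shift:
  assumes "0 < q" "pow_bounded q f"
  shows "pow_bounded q (\<lambda>z. f (z + d))"
proof -
  obtain C where C: "\<And>z. norm (f z) \<le> C * q powi z" using assms(2) unfolding pow_bounded_def by blast
  have "norm (f (z + d)) \<le> (C * q powi d) * q powi z" for z
    using C[of "z + d"] assms(1) by (simp add: power_int_add mult_ac)
  then show ?thesis by (rule pow_boundedI)
qed

lemma half_line_summable:
  fixes r R :: real
  assumes "0 < r" "r < R"
  shows "(\<lambda>z. if z \<le> a then 0 else (r / R) powi z) summable_on (UNIV :: int set)"
proof -
  have "(\<lambda>z. (r / R) powi z) summable_on {a<..}" using assms by (intro powi_summable_gt) auto
  then show ?thesis
    by (rule summable_on_cong_neutral[THEN iffD1, rotated -1]) auto
qed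

text \<open>The product decays like \<open>(r / R) powi z\<close> to the right, and the support of
  \<open>f\<close> takes care of the left end.\<close>

lemma half_line_pairing_bound:
  assumes r: "0 < r" "r < R" and f: "pow_bounded r f" "\<And>z. z \<le> a ==> f z = 0" and e: "pow_bounded (1 / R) e"
  shows "\<exists>C. \<forall>z. norm (e z * f z) \<le> C * (if z \<le> a then 0 else (r / R) powi z)"
proof -
  obtain C where C: "C \<ge> 0" "\<And>z. norm (f z) \<le> C * r powi z" by (rule pow_boundedE[OF f(1)]) (rule that)
  obtain D where D: "D \<ge> 0" "\<And>z. norm (e z) \<le> D * (1 / R) powi z" by (rule pow_boundedE[OF e]) (rule that)
  have "norm (e z * f z) \<le> (D * C) * (if z \<le> a then 0 else (r / R) powi z)" for z
  proof (cases "z \<le> a")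
    case False
    have "norm (e z * f z) \<le> (D * (1 / R) powi z) * (C * r powi z)"
      unfolding norm_mult using C D r by (intro mult_mono) auto
    also have "\<dots> = (D * C) * (r / R) powi z" by (simp add: power_int_divide_distrib)
    finally show ?thesis using False by simp
  qed (use f(2) in simp)
  then show ?thesis by blast
qed

lemma half_line_pairing_summable:
  assumes "0 < r" "r < R" "pow_bounded r f" "\<And>z. z \<le> a ==> f z = 0" "pow_bounded (1 / R) e"
  shows "(\<lambda>z. e z * f z) summable_on UNIV"
proof -
  obtain C where C: "\<And>z. norm (e z * f z) \<le> C * (if z \<le> a then 0 else (r / R) powi z)"
    using half_line_pairing_bound[OF assms] by blast
  have "(\<lambda>z. C * (if z \<le> a then 0 else (r / R) powi z)) summable_on UNIV"
    by (intro summable_on_cmult_right half_line_summable assms(1,2))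
  then have "(\<lambda>z. norm (e z * f z)) summable_on UNIV"
    by (rule summable_on_comparison_test) (rule C, rule norm_ge_zero)
  then show ?thesis by (rule abs_summable_summable)
qed

text \<open>The finite identity needs rows vanishing at the right end, so the index-0 rows are
  truncated there, and both sides converge as the truncation is removed. The right-hand side is then
  rewritten with index \<open>n\<close>, because at that index the poles in the symbols of the rows
  cancel (see \<open>HH_top\<close>).\<close>

theorem Omega_cauchy_binet:
  fixes hh ff :: "nat => nat => int => complex"
  assumes r: "0 < r" "r < R"
    and rech: "\<And>k t z. k \<in> {1..n} ==> t < n ==> hh k (Suc t) z = v (Suc t) * hh k t (z + 1) - hh k t z"
    and recf: "\<And>i t z. i \<in> {1..n} ==> t < n ==> ff i t z = v (Suc t) * ff i (Suc t) (z - 1) - ff i (Suc t) z"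
    and supp: "\<And>i z. i \<in> {1..n} ==> z \<le> a ==> ff i n z = 0"
    and bh: "\<And>k. k \<in> {1..n} ==> pow_bounded (1 / R) (hh k 0)"
    and bf: "\<And>i. i \<in> {1..n} ==> pow_bounded r (ff i n)"
  shows "((\<lambda>x. det1 n (\<lambda>k j. hh k j (x j)) * det1 n (\<lambda>i j. ff i j (x j))) has_sum
    det1 n (\<lambda>k i. \<Sum>\<^sub>\<infinity>z. hh k n z * ff i n z)) (Omega n)"
proof -
  have R: "0 < R" using r by simp
  have ff_bd: "pow_bounded r (ff i t)" if i: "i \<in> {1..n}" and t: "t \<le> n" for i t
    using t
  proof (induction t rule: inc_induct)
    case (step t)
    have "pow_bounded r (\<lambda>z. v (Suc t) * ff i (Suc t) (z + (- 1)) - ff i (Suc t) z)"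
      using step by (intro pow_bounded_diff pow_bounded_cmult pow_bounded_shift r) auto
    moreover have "ff i t = (\<lambda>z. v (Suc t) * ff i (Suc t) (z + (- 1)) - ff i (Suc t) z)"
      using step recf[OF i, of t] by auto
    ultimately show ?case by simp
  qed (rule bf[OF i])
  have ff_0: "ff i t z = 0" if i: "i \<in> {1..n}" and t: "t \<le> n" and z: "z \<le> a" for i t z
    using t z
  proof (induction t arbitrary: z rule: inc_induct)
    case (step t)
    then show ?case using recf[OF i, of t z] by simp
  qed (rule supp[OF i])
  have hh_eq: "hh k t = rdiff v (hh k 0) t" if "k \<in> {1..n}" "t \<le> n" for k t
    by (rule rdiff_eq[of n]) (use rech that in auto)
  have hh_bd: "pow_bounded (1 / R) (hh k t)" if k: "k \<in> {1..n}" "t \<le> n" for k t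
  proof -
    obtain C where C: "\<And>z. norm (hh k 0 z) \<le> C * (1 / R) powi z" using bh[OF k(1)] unfolding pow_bounded_def by blast
    obtain K where "\<forall>h C. (\<forall>z. norm (h z) \<le> C * (1 / R) powi z) \<longrightarrow> (\<forall>z. norm (rdiff v h t z) \<le> K * C * (1 / R) powi z)"
      using rdiff_bound[of "1 / R" v t] R by auto
    then have "norm (rdiff v (hh k 0) t z) \<le> (K * C) * (1 / R) powi z" for z using C by blast
    then show ?thesis unfolding hh_eq[OF k] by (rule pow_boundedI)
  qed
  \<comment> \<open>Only the index-0 row is truncated; far to the left of \<open>b\<close> the
    recursion reproduces the original rows by \<open>rdiff_cong\<close>, and from \<open>b\<close>
    on everything vanishes by \<open>rdiff_zero\<close>.\<close>
  define h where "h b k z = (if z < b then hh k 0 z else 0)" for b k z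
  define g where "g z = (if z \<le> a then 0 else (r / R) powi z)" for z
  have g0: "0 \<le> g z" for z using r by (simp add: g_def)
  have gsum: "g summable_on UNIV" unfolding g_def by (rule half_line_summable[OF r])
  have "\<exists>C\<ge>0. \<forall>i\<in>{1..n} \<times> {..n}. \<forall>z. norm (ff (fst i) (snd i) z) \<le> C * r powi z"
    by (rule uniform_bound) (use r ff_bd in \<open>auto simp: pow_bounded_def\<close>)
  then obtain Kf where Kf: "Kf \<ge> 0" "\<And>i t z. i \<in> {1..n} ==> t \<le> n ==> norm (ff i t z) \<le> Kf * r powi z"
    by force
  have "\<exists>C\<ge>0. \<forall>i\<in>{1..n} \<times> {..n}. \<forall>bz. norm (rdiff v (h (fst bz) (fst i)) (snd i) (snd bz)) \<le> C * (1 / R) powi snd bz"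
  proof (rule uniform_bound)
    fix i assume i: "i \<in> {1..n} \<times> {..n}"
    have "pow_bounded (1 / R) (hh (fst i) 0)" using bh[of "fst i"] i by auto
    then obtain C where C: "C \<ge> 0" "\<And>z. norm (hh (fst i) 0 z) \<le> C * (1 / R) powi z" by (rule pow_boundedE) (rule that)
    obtain K where K: "\<forall>h C. (\<forall>z. norm (h z) \<le> C * (1 / R) powi z) \<longrightarrow> (\<forall>z. norm (rdiff v h (snd i) z) \<le> K * C * (1 / R) powi z)"
      using rdiff_bound[of "1 / R" v "snd i"] R by auto
    have "norm (h b (fst i) z) \<le> C * (1 / R) powi z" for b z
      using C R by (simp add: h_def)
    then have "norm (rdiff v (h b (fst i)) (snd i) z) \<le> (K * C) * (1 / R) powi z" for b z
      using K by blast
    then show "\<exists>C. \<forall>bz. norm (rdiff v (h (fst bz) (fst i)) (snd i) (snd bz)) \<le> C * (1 / R) powi snd bz"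
      by blast
  qed (use R in auto)
  then obtain Kh where Kh: "Kh \<ge> 0" "\<And>b k t z. k \<in> {1..n} ==> t \<le> n ==> norm (rdiff v (h b k) t z) \<le> Kh * (1 / R) powi z"
    by force
  let ?D = "\<lambda>N x. det1 n (\<lambda>k j. rdiff v (h (a + 1 + int N) k) j (x j))"
  let ?F = "\<lambda>x. det1 n (\<lambda>i j. ff i j (x j))"
  define s where "s N x = ?D N x * ?F x"
    for N :: nat and x
  \<comment> \<open>The majorant, uniform in \<open>N\<close>: one factorial for each determinant,
    and one factor per coordinate that vanishes for \<open>x j \<le> a\<close> and is summable to
    the right.\<close>
  define D where "D x = (fact n * fact n) * (\<Prod>j\<in>{1..n}. Kh * Kf * g (x j))" for x :: "nat => int"
  have sD: "norm (s N x) \<le> D x" for N x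
  proof (cases "\<exists>j\<in>{1..n}. x j \<le> a")
    case True
    then obtain j where "j \<in> {1..n}" "x j \<le> a" by blast
    then have "?F x = 0" using ff_0 by (intro det1_zero_col[of j]) auto
    then show ?thesis unfolding s_def D_def using g0 Kh Kf by (auto intro!: mult_nonneg_nonneg prod_nonneg)
  next
    case False
    have 1: "norm (?D N x) \<le> fact n * (\<Prod>j=1..n. Kh * (1 / R) powi x j)"
      by (rule norm_det1_le_cols) (use Kh in auto)
    have 2: "norm (?F x) \<le> fact n * (\<Prod>j=1..n. Kf * r powi x j)"
      by (rule norm_det1_le_cols) (use Kf in auto)
    have "norm (s N x) \<le> (fact n * (\<Prod>j=1..n. Kh * (1 / R) powi x j)) * (fact n * (\<Prod>j=1..n. Kf * r powi x j))"
      unfolding s_def norm_mult using 1 2 Kh R by (intro mult_mono mult_nonneg_nonneg prod_nonneg) auto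
    also have "\<dots> = (fact n * fact n) * (\<Prod>j=1..n. (Kh * (1 / R) powi x j) * (Kf * r powi x j))"
      by (simp add: prod.distrib)
    also have "(\<Prod>j=1..n. (Kh * (1 / R) powi x j) * (Kf * r powi x j)) = (\<Prod>j=1..n. Kh * Kf * g (x j))"
      using False by (intro prod.cong) (auto simp: g_def power_int_divide_distrib)
    finally show ?thesis by (simp add: D_def)
  qed
  have Dsum: "D summable_on Omega n"
  proof -
    have "(\<lambda>x. \<Prod>j\<in>{1..n}. Kh * Kf * g (x j)) summable_on ({1..n} \<rightarrow>\<^sub>E UNIV)"
      by (rule summable_prod_PiE) (use g0 Kh Kf gsum in \<open>auto intro: summable_on_cmult_right\<close>)
    then have "D summable_on ({1..n} \<rightarrow>\<^sub>E UNIV)"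
      unfolding D_def by (rule summable_on_cmult_right)
    then show ?thesis by (rule summable_on_subset) (auto simp: Omega_def)
  qed
  define F where "F x = det1 n (\<lambda>k j. hh k j (x j)) * ?F x" for x
  have sF: "(\<lambda>N. s N x) \<longlonglongrightarrow> F x" for x
    unfolding s_def F_def
  proof (intro tendsto_mult tendsto_det1 tendsto_const)
    fix k j assume kj: "k \<in> {1..n}" "j \<in> {1..n}"
    have "rdiff v (h (a + 1 + int N) k) j (x j) = hh k j (x j)" if "N \<ge> nat (x j + int j - a)" for N
    proof -
      have "rdiff v (h (a + 1 + int N) k) j (x j) = rdiff v (hh k 0) j (x j)"
        by (rule rdiff_cong[of "a + 1 + int N"]) (use that in \<open>auto simp: h_def\<close>)
      then show ?thesis using hh_eq[of k j] kj by simp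
    qed
    then have "\<forall>\<^sub>F N in sequentially. rdiff v (h (a + 1 + int N) k) j (x j) = hh k j (x j)"
      using eventually_sequentially by blast
    then show "(\<lambda>N. rdiff v (h (a + 1 + int N) k) j (x j)) \<longlonglongrightarrow> hh k j (x j)"
      by (rule tendsto_eventually)
  qed
  have lim1: "(\<lambda>N. infsum (s N) (Omega n)) \<longlonglongrightarrow> infsum F (Omega n)"
    by (rule infsum_dominated[OF sD Dsum sF])
  have fin: "infsum (s N) (Omega n) = det1 n (\<lambda>k i. \<Sum>z\<in>{a<..<a + 1 + int N}. hh k 0 z * ff i 0 z)" for N
  proof -
    let ?b = "a + 1 + int N"
    have "infsum (s N) (Omega n) = infsum (s N) (OmegaI n {a<..<?b})"
    proof (rule infsum_cong_neutral)
      fix x assume x: "x \<in> Omega n - OmegaI n {a<..<?b}"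
      then obtain j where j: "j \<in> {1..n}" "x j \<notin> {a<..<?b}"
        by (auto simp: Omega_eq OmegaI_def PiE_def Pi_def)
      show "s N x = 0"
      proof (cases "x j \<le> a")
        case True
        then have "?F x = 0" using ff_0 j by (intro det1_zero_col[of j]) auto
        then show ?thesis by (simp add: s_def)
      next
        case False
        have "det1 n (\<lambda>k j. rdiff v (h ?b k) j (x j)) = 0"
        proof (rule det1_zero_col[OF j(1)])
          fix k show "rdiff v (h ?b k) j (x j) = 0"
            by (rule rdiff_zero[of ?b]) (use j False in \<open>auto simp: h_def\<close>)
        qed
        then show ?thesis by (simp add: s_def)
      qed
    qed (auto simp: Omega_eq OmegaI_def)
    also have "\<dots> = (\<Sum>x\<in>OmegaI n {a<..<?b}. s N x)" by (intro infsum_finite finite_OmegaI) auto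
    also have "\<dots> = det1 n (\<lambda>k i. \<Sum>z\<in>{a<..<?b}. rdiff v (h ?b k) 0 z * ff i 0 z)"
      unfolding s_def
      by (rule Omega_cauchy_binet_finite[of a ?b n "\<lambda>k. rdiff v (h ?b k)" v])
        (auto simp: recf ff_0 intro!: rdiff_zero[of ?b], simp_all add: h_def)
    also have "\<dots> = det1 n (\<lambda>k i. \<Sum>z\<in>{a<..<?b}. hh k 0 z * ff i 0 z)"
      by (intro det1_cong sum.cong) (auto simp: h_def)
    finally show ?thesis .
  qed
  let ?h = "\<lambda>N k i z. if z \<in> {a<..<a + 1 + int N} then hh k 0 z * ff i 0 z else 0"
  have lim2: "(\<lambda>N. det1 n (\<lambda>k i. \<Sum>z\<in>{a<..<a + 1 + int N}. hh k 0 z * ff i 0 z)) \<longlonglongrightarrow>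
      det1 n (\<lambda>k i. \<Sum>\<^sub>\<infinity>z. hh k 0 z * ff i 0 z)"
  proof (rule tendsto_det1)
    fix k i assume ki: "k \<in> {1..n}" "i \<in> {1..n}"
    obtain C where C: "\<And>z. norm (hh k 0 z * ff i 0 z) \<le> C * g z"
      using half_line_pairing_bound[OF r ff_bd[OF ki(2) le0] ff_0[OF ki(2) le0] bh[OF ki(1)], of a] unfolding g_def by auto
    have "(\<lambda>N. \<Sum>\<^sub>\<infinity>z. if z \<in> {a<..<a + 1 + int N} then hh k 0 z * ff i 0 z else 0) \<longlonglongrightarrow>
        (\<Sum>\<^sub>\<infinity>z. hh k 0 z * ff i 0 z)"
    proof (rule infsum_dominated[of _ _ "\<lambda>z. C * g z"])
      fix N z show "norm (?h N k i z) \<le> C * g z"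
        using C[of z] order_trans[OF norm_ge_zero C[of z]] by auto
    next
      show "(\<lambda>z. C * g z) summable_on UNIV" using gsum by (rule summable_on_cmult_right)
    next
      fix z
      have "(?h N k i z) = hh k 0 z * ff i 0 z"
        if "N \<ge> nat (z - a)" for N
        using that ff_0[OF ki(2), of 0 z] by auto
      then have "\<forall>\<^sub>F N in sequentially. (?h N k i z) = hh k 0 z * ff i 0 z"
        using eventually_sequentially by blast
      then show "(\<lambda>N. if z \<in> {a<..<a + 1 + int N} then hh k 0 z * ff i 0 z else 0) \<longlonglongrightarrow> hh k 0 z * ff i 0 z"
        by (rule tendsto_eventually)
    qed
    moreover have "(\<Sum>\<^sub>\<infinity>z. if z \<in> {a<..<a + 1 + int N} then hh k 0 z * ff i 0 z else 0) =
        (\<Sum>z\<in>{a<..<a + 1 + int N}. hh k 0 z * ff i 0 z)" for N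
    proof -
      have "(\<Sum>\<^sub>\<infinity>z. if z \<in> {a<..<a + 1 + int N} then hh k 0 z * ff i 0 z else 0) =
          (\<Sum>\<^sub>\<infinity>z\<in>{a<..<a + 1 + int N}. hh k 0 z * ff i 0 z)"
        by (rule infsum_cong_neutral) auto
      then show ?thesis by simp
    qed
    ultimately show "(\<lambda>N. \<Sum>z\<in>{a<..<a + 1 + int N}. hh k 0 z * ff i 0 z) \<longlonglongrightarrow> (\<Sum>\<^sub>\<infinity>z. hh k 0 z * ff i 0 z)"
      by simp
  qed
  have val: "infsum F (Omega n) = det1 n (\<lambda>k i. \<Sum>\<^sub>\<infinity>z. hh k 0 z * ff i 0 z)"
    using LIMSEQ_unique[OF lim1] lim2 unfolding fin by blast
  \<comment> \<open>On the whole line summation by parts has no boundary terms, so the operators can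
    be moved back from \<open>ff\<close> to \<open>hh\<close> inside each entry.\<close>
  have parts: "(\<Sum>\<^sub>\<infinity>z. hh k t z * ff i t z) = (\<Sum>\<^sub>\<infinity>z. hh k 0 z * ff i 0 z)"
    if ki: "k \<in> {1..n}" "i \<in> {1..n}" and t: "t \<le> n" for k i t
    using t
  proof (induction t)
    case (Suc t)
    have t: "t \<le> n" "Suc t \<le> n" using Suc by auto
    have s: "(\<lambda>z. e z * ff i (Suc t) z) summable_on UNIV" if "pow_bounded (1 / R) e" for e
      by (rule half_line_pairing_summable[OF r ff_bd[OF ki(2) t(2)] ff_0[OF ki(2) t(2)] that])
    have "(\<Sum>\<^sub>\<infinity>z. hh k (Suc t) z * ff i (Suc t) z) =
        (\<Sum>\<^sub>\<infinity>z. (v (Suc t) * hh k t (z + 1) - hh k t z) * ff i (Suc t) z)"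
      using rech[OF ki(1), of t] Suc by simp
    also have "\<dots> = (\<Sum>\<^sub>\<infinity>z. hh k t z * (v (Suc t) * ff i (Suc t) (z - 1) - ff i (Suc t) z))"
      by (rule infsum_by_parts_int) (rule s hh_bd[OF ki(1) t(1)] pow_bounded_shift | use R in simp)+
    also have "\<dots> = (\<Sum>\<^sub>\<infinity>z. hh k t z * ff i t z)"
      using recf[OF ki(2), of t] Suc by simp
    finally show ?case using Suc by simp
  qed simp
  have "(\<lambda>x. norm (F x)) summable_on Omega n"
  proof (rule summable_on_comparison_test[OF Dsum])
    fix x show "norm (F x) \<le> D x"
      by (rule tendsto_upperbound[OF tendsto_norm[OF sF]]) (use sD in auto)
  qed auto
  then have "F summable_on Omega n" by (rule abs_summable_summable)
  then have "(F has_sum infsum F (Omega n)) (Omega n)" by (rule has_sum_infsum)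
  moreover have "infsum F (Omega n) = det1 n (\<lambda>k i. \<Sum>\<^sub>\<infinity>z. hh k n z * ff i n z)"
    unfolding val by (rule det1_cong) (simp add: parts[of _ _ n])
  ultimately show ?thesis by (simp add: F_def[abs_def])
qed

section \<open>Laurent coefficients\<close>

definition lcoeff :: "real => (complex => complex) => int => complex" where
  "lcoeff r g d = circ_avg r (\<lambda>w. g w / w powi (d + 1))"

lemma circ_avg_cong:
  assumes "0 < r" "\<And>w. norm w = r ==> f w = g w"
  shows "circ_avg r f = circ_avg r g"
  unfolding circ_avg_def using assms
  by (intro arg_cong[of _ _ "\<lambda>x. _ * x"] contour_integral_cong) auto

lemma circ_avg_cmult:
  assumes "0 < r" "continuous_on (sphere 0 r) f"
  shows "circ_avg r (\<lambda>w. c * f w) = c * circ_avg r f"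
proof -
  have "f contour_integrable_on circlepath 0 r"
    using assms by (intro contour_integrable_continuous_circlepath) simp
  then show ?thesis unfolding circ_avg_def by (simp add: contour_integral_lmul)
qed

lemma circ_avg_diff:
  assumes "0 < r" "continuous_on (sphere 0 r) f" "continuous_on (sphere 0 r) g"
  shows "circ_avg r (\<lambda>w. f w - g w) = circ_avg r f - circ_avg r g"
proof -
  have "f contour_integrable_on circlepath 0 r" "g contour_integrable_on circlepath 0 r"
    using assms by (auto intro: contour_integrable_continuous_circlepath)
  then show ?thesis unfolding circ_avg_def by (simp add: contour_integral_diff algebra_simps)
qed

lemma norm_circ_avg_le:
  assumes "0 < r" "continuous_on (sphere 0 r) f" "\<And>w. norm w = r ==> norm (f w) \<le> B"
  shows "norm (circ_avg r f) \<le> B * r"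
proof -
  have "f contour_integrable_on circlepath 0 r"
    using assms by (intro contour_integrable_continuous_circlepath) simp
  then have "(f has_contour_integral contour_integral (circlepath 0 r) f) (circlepath 0 r)"
    by (rule has_contour_integral_integral)
  moreover have "0 \<le> B" using order_trans[OF norm_ge_zero assms(3)[of "of_real r"]] assms(1) by simp
  ultimately have "norm (contour_integral (circlepath 0 r) f) \<le> B * (2 * pi * r)"
    by (rule has_contour_integral_bound_circlepath) (use assms in auto)
  then show ?thesis unfolding circ_avg_def
    by (simp add: norm_mult norm_divide field_simps)
qed

lemma circ_avg_infsum:
  fixes f :: "'a => complex => complex"
  assumes r: "0 < r" and cont: "\<And>d. d \<in> X ==> continuous_on (sphere 0 r) (f d)"
    and le: "\<And>d w. d \<in> X ==> norm w = r ==> norm (f d w) \<le> M d" and M: "M summable_on X"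
  shows "((\<lambda>d. circ_avg r (f d)) has_sum circ_avg r (\<lambda>w. \<Sum>\<^sub>\<infinity>d\<in>X. f d w)) X"
proof -
  have int: "f d contour_integrable_on circlepath 0 r" if "d \<in> X" for d
    using r cont[OF that] by (intro contour_integrable_continuous_circlepath) simp
  have "uniform_limit (sphere 0 r) (\<lambda>X w. \<Sum>d\<in>X. f d w) (\<lambda>w. \<Sum>\<^sub>\<infinity>d\<in>X. f d w) (finite_subsets_at_top X)"
    by (rule Weierstrass_m_test_general[OF _ M]) (use le in auto)
  moreover have ev: "\<forall>\<^sub>F Y in finite_subsets_at_top X. finite Y \<and> Y \<subseteq> X"
    by (rule eventually_finite_subsets_at_top_weakI) auto
  then have "\<forall>\<^sub>F Y in finite_subsets_at_top X. (\<lambda>w. \<Sum>d\<in>Y. f d w) contour_integrable_on circlepath 0 r"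
    by eventually_elim (auto intro!: contour_integrable_sum int)
  ultimately have "((\<lambda>Y. contour_integral (circlepath 0 r) (\<lambda>w. \<Sum>d\<in>Y. f d w)) \<longlongrightarrow>
      contour_integral (circlepath 0 r) (\<lambda>w. \<Sum>\<^sub>\<infinity>d\<in>X. f d w)) (finite_subsets_at_top X)"
    using r by (intro contour_integral_uniform_limit_circlepath) auto
  then have "((\<lambda>Y. circ_avg r (\<lambda>w. \<Sum>d\<in>Y. f d w)) \<longlongrightarrow> circ_avg r (\<lambda>w. \<Sum>\<^sub>\<infinity>d\<in>X. f d w)) (finite_subsets_at_top X)"
    unfolding circ_avg_def by (intro tendsto_mult tendsto_const)
  moreover have "\<forall>\<^sub>F Y in finite_subsets_at_top X. circ_avg r (\<lambda>w. \<Sum>d\<in>Y. f d w) = (\<Sum>d\<in>Y. circ_avg r (f d))"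
    using ev
  proof eventually_elim
    case (elim Y)
    then show ?case unfolding circ_avg_def
      by (subst contour_integral_sum) (auto intro: int simp: sum_distrib_left)
  qed
  ultimately show ?thesis
    unfolding has_sum_def by (rule Lim_transform_eventually)
qed

lemma in_annulus: "w \<in> annulus s S \<longleftrightarrow> s \<le> norm w \<and> norm w \<le> S"
  by (simp add: annulus_def)

lemma annulus_mono: "s' \<le> s ==> S \<le> S' ==> annulus s S \<subseteq> annulus s' S'"
  by (auto simp: annulus_def)

lemma compact_annulus: "compact (annulus s S)"
proof -
  have "annulus s S = cball 0 S - ball 0 s" by (auto simp: annulus_def)
  then show ?thesis by (simp add: compact_diff)
qed

text \<open>Compactness of the closed annulus. The gain in radius is what yields genuine geometric
  decay of the Laurent coefficients on the boundary circles themselves, even if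
  \<open>r1 = r2\<close>.\<close>

lemma annulus_extend:
  assumes g: "g analytic_on annulus r1 r2" and r: "0 < r1" "r1 \<le> r2"
  obtains e where "0 < e" "e < r1" "g analytic_on annulus (r1 - e) (r2 + e)"
proof -
  obtain S where S: "open S" "annulus r1 r2 \<subseteq> S" "g holomorphic_on S"
    using g analytic_on_holomorphic by metis
  obtain e where e: "e > 0" "(\<Union>x\<in>annulus r1 r2. cball x e) \<subseteq> S"
    using compact_subset_open_imp_cball_epsilon_subset[OF compact_annulus S(1,2)] by blast
  define e' where "e' = min e (r1 / 2)"
  have e': "0 < e'" "e' < r1" "e' \<le> e" using e r by (auto simp: e'_def)
  have "annulus (r1 - e') (r2 + e') \<subseteq> S"
  proof
    fix w assume "w \<in> annulus (r1 - e') (r2 + e')"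
    then have w: "r1 - e' \<le> norm w" "norm w \<le> r2 + e'" by (auto simp: in_annulus)
    then have nz: "norm w > 0" using e' by linarith
    \<comment> \<open>The norm of \<open>w\<close> is clamped to \<open>[r1, r2]\<close>;
      \<open>x\<close> is then the radial projection of \<open>w\<close> to the smaller annulus, at
      distance at most \<open>e'\<close>. The choice \<open>e' \<le> r1 / 2\<close> keeps 0
      away.\<close>
    define s where "s = max r1 (min r2 (norm w))"
    have s: "r1 \<le> s" "s \<le> r2" "\<bar>s - norm w\<bar> \<le> e'" using w r e' by (auto simp: s_def)
    define x where "x = of_real (s / norm w) * w"
    have "norm x = s" using nz s r by (simp add: x_def norm_mult norm_divide)
    then have "x \<in> annulus r1 r2" using s by (simp add: in_annulus)
    moreover have "dist x w \<le> e"
    proof -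
      have "x - w = of_real ((s - norm w) / norm w) * w"
        using nz by (simp add: x_def field_simps)
      then have "norm (x - w) = \<bar>s - norm w\<bar>"
        using nz by (simp only: norm_mult norm_of_real abs_divide) simp
      then show ?thesis using s e' by (simp add: dist_norm)
    qed
    ultimately have "w \<in> (\<Union>x\<in>annulus r1 r2. cball x e)" by auto
    then show "w \<in> S" using e by blast
  qed
  then have "g analytic_on annulus (r1 - e') (r2 + e')"
    using S analytic_on_holomorphic by blast
  then show ?thesis using that e' by blast
qed

text \<open>The straight homotopy between the two circles is radial and therefore stays in the
  annulus.\<close>

lemma circ_avg_eq:
  assumes f: "f analytic_on annulus r1 r2" and r: "0 < r1" "r1 \<le> r2"
  shows "circ_avg r1 f = circ_avg r2 f"
proof -
  obtain S where S: "open S" "annulus r1 r2 \<subseteq> S" "f holomorphic_on S"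
    using f analytic_on_holomorphic by metis
  have "homotopic_loops S (circlepath 0 r1) (circlepath 0 r2)"
  proof (rule homotopic_loops_linear)
    fix t :: real
    show "closed_segment (circlepath 0 r1 t) (circlepath 0 r2 t) \<subseteq> S"
    proof
      fix x assume "x \<in> closed_segment (circlepath 0 r1 t) (circlepath 0 r2 t)"
      then obtain u where u: "0 \<le> u" "u \<le> 1" and
        x: "x = (1 - u) *\<^sub>R circlepath 0 r1 t + u *\<^sub>R circlepath 0 r2 t"
        by (auto simp: closed_segment_def)
      have "x = of_real ((1 - u) * r1 + u * r2) * exp (2 * of_real pi * \<i> * of_real t)"
        unfolding x circlepath by (simp add: scaleR_conv_of_real algebra_simps)
      then have "norm x = \<bar>(1 - u) * r1 + u * r2\<bar>" by (simp only: norm_mult norm_of_real) simp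
      moreover have "r1 \<le> (1 - u) * r1 + u * r2" "(1 - u) * r1 + u * r2 \<le> r2"
        using u r mult_left_mono[of r1 r2 u] mult_left_mono[of r1 r2 "1 - u"] by (auto simp: algebra_simps)
      ultimately show "x \<in> S" using S(2) r by (auto simp: in_annulus)
    qed
  qed auto
  then show ?thesis
    unfolding circ_avg_def by (simp add: Cauchy_theorem_homotopic_loops[OF _ S(1,3)])
qed

lemma continuous_on_sphere:
  assumes "g analytic_on annulus r1 r2" "r1 \<le> s" "s \<le> r2"
  shows "continuous_on (sphere 0 s) g"
  by (rule continuous_on_subset[OF holomorphic_on_imp_continuous_on[OF analytic_imp_holomorphic[OF assms(1)]]])
    (use assms in \<open>auto simp: in_annulus\<close>)

lemma analytic_powi_annulus: "0 < r1 ==> (\<lambda>w. w powi n) analytic_on annulus r1 r2"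
  by (intro analytic_intros) (auto simp: in_annulus)

lemma lcoeff_indep:
  assumes g: "g analytic_on annulus r1 r2" and r: "0 < r1" "r1 \<le> s" "s \<le> r2"
  shows "lcoeff s g d = lcoeff r1 g d"
  unfolding lcoeff_def
proof (rule circ_avg_eq[symmetric])
  show "(\<lambda>w. g w / w powi (d + 1)) analytic_on annulus r1 s"
    by (intro analytic_on_divide analytic_powi_annulus analytic_on_subset[OF g] annulus_mono)
      (use r in \<open>auto simp: in_annulus\<close>)
qed (use r in auto)

lemma continuous_on_sphere_powi: "0 < r ==> continuous_on (sphere (0::complex) r) (\<lambda>w. w powi n)"
  by (rule continuous_on_sphere[OF analytic_powi_annulus[of r n r]]) auto

lemma lcoeff_bound:
  assumes r: "0 < r" and g: "continuous_on (sphere 0 r) g"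
  obtains B where "0 \<le> B" "\<And>d. norm (lcoeff r g d) * r powi d \<le> B"
proof -
  have "compact (g ` sphere 0 r)" by (intro compact_continuous_image g compact_sphere)
  then obtain B where B: "\<And>w. norm w = r ==> norm (g w) \<le> B"
    by (force dest!: compact_imp_bounded simp: bounded_iff)
  have B0: "0 \<le> B" using order_trans[OF norm_ge_zero B[of "of_real r"]] r by simp
  have "norm (lcoeff r g d) * r powi d \<le> B" for d
  proof -
    have "norm (lcoeff r g d) \<le> (B / r powi (d + 1)) * r"
      unfolding lcoeff_def
    proof (rule norm_circ_avg_le[OF r])
      show "continuous_on (sphere 0 r) (\<lambda>w. g w / w powi (d + 1))"
        using r by (intro continuous_on_divide g continuous_on_sphere_powi) auto
      fix w :: complex assume w: "norm w = r"
      show "norm (g w / w powi (d + 1)) \<le> B / r powi (d + 1)"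
        using B[OF w] r w by (auto simp: norm_divide norm_power_int intro!: divide_right_mono)
    qed
    also have "\<dots> = B / r powi d" using r by (simp add: power_int_add)
    finally show ?thesis using r by (simp add: field_simps)
  qed
  then show ?thesis using that B0 by blast
qed

definition ann_summable :: "(int => complex) => real => bool" where
  "ann_summable a s \<longleftrightarrow> (\<lambda>d. norm (a d) * s powi d) summable_on UNIV"

text \<open>Cauchy estimates on a slightly smaller circle control the negative indices, on a
  slightly larger one the positive indices; the coefficients are the same on all these
  circles.\<close>

lemma ann_summable_lcoeff:
  assumes g: "g analytic_on annulus r1 r2" and r: "0 < r1" "r1 \<le> s" "s \<le> r2" "r1 \<le> s'" "s' \<le> r2"
  shows "ann_summable (lcoeff s' g) s"
proof -
  obtain e where e: "0 < e" "e < r1" and ge: "g analytic_on annulus (r1 - e) (r2 + e)"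
    using annulus_extend[OF g] r by auto
  have eq: "lcoeff (r1 - e) g = lcoeff s' g" "lcoeff (r2 + e) g = lcoeff s' g"
    using lcoeff_indep[OF ge, of "r2 + e"] lcoeff_indep[OF ge, of s'] e r by auto
  obtain B1 where B1: "0 \<le> B1" "\<And>d. norm (lcoeff s' g d) * (r1 - e) powi d \<le> B1"
    using lcoeff_bound[of "r1 - e" g] continuous_on_sphere[OF ge, of "r1 - e"] e r unfolding eq by auto
  obtain B2 where B2: "0 \<le> B2" "\<And>d. norm (lcoeff s' g d) * (r2 + e) powi d \<le> B2"
    using lcoeff_bound[of "r2 + e" g] continuous_on_sphere[OF ge, of "r2 + e"] e r unfolding eq by auto
  have 1: "norm (lcoeff s' g d) * s powi d \<le> B1 * (s / (r1 - e)) powi d" for d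
  proof -
    have "norm (lcoeff s' g d) * s powi d = (norm (lcoeff s' g d) * (r1 - e) powi d) * (s / (r1 - e)) powi d"
      using e r by (simp add: power_int_divide_distrib)
    also have "\<dots> \<le> B1 * (s / (r1 - e)) powi d"
      using B1 e r by (intro mult_right_mono) auto
    finally show ?thesis .
  qed
  have 2: "norm (lcoeff s' g d) * s powi d \<le> B2 * (s / (r2 + e)) powi d" for d
  proof -
    have "norm (lcoeff s' g d) * s powi d = (norm (lcoeff s' g d) * (r2 + e) powi d) * (s / (r2 + e)) powi d"
      using e r by (simp add: power_int_divide_distrib)
    also have "\<dots> \<le> B2 * (s / (r2 + e)) powi d"
      using B2 e r by (intro mult_right_mono) auto
    finally show ?thesis .
  qed
  have "(\<lambda>d. norm (lcoeff s' g d) * s powi d) summable_on {..0}"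
  proof (rule summable_on_comparison_test)
    show "(\<lambda>d. B1 * (s / (r1 - e)) powi d) summable_on {..0}"
      by (intro summable_on_cmult_right powi_summable_le) (use e r in auto)
  qed (use 1 r in auto)
  moreover have "(\<lambda>d. norm (lcoeff s' g d) * s powi d) summable_on {0<..}"
  proof (rule summable_on_comparison_test)
    show "(\<lambda>d. B2 * (s / (r2 + e)) powi d) summable_on {0<..}"
      by (intro summable_on_cmult_right powi_summable_gt) (use e r in auto)
  qed (use 2 r in auto)
  ultimately have "(\<lambda>d. norm (lcoeff s' g d) * s powi d) summable_on ({..0} \<union> {0<..})"
    by (rule summable_on_Un_disjoint) auto
  also have "{..0} \<union> {0<..} = (UNIV :: int set)" by auto
  finally show ?thesis by (simp add: ann_summable_def)
qed

lemma circ_avg_pole_inside: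
  assumes "norm z < r"
  shows "circ_avg r (\<lambda>w. 1 / (w - z)) = 1"
  using Cauchy_integral_circlepath_simple[of "\<lambda>_. 1" 0 r z] assms
  by (auto simp: circ_avg_def dest: contour_integral_unique)

lemma circ_avg_pole_outside:
  assumes "0 < r" "r < norm z"
  shows "circ_avg r (\<lambda>w. 1 / (w - z)) = 0"
proof -
  have "((\<lambda>w. 1 / (w - z)) has_contour_integral 0) (circlepath 0 r)"
    by (rule Cauchy_theorem_convex_simple[of _ "ball 0 (norm z)"])
      (use assms in \<open>auto intro!: holomorphic_intros\<close>)
  then show ?thesis by (simp add: circ_avg_def contour_integral_unique)
qed

text \<open>The difference quotient \<open>F\<close> has a removable singularity at
  \<open>z\<close>, hence the same average on both circles; what remains is the pole, which
  contributes 1 outside and 0 inside.\<close>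

lemma cauchy_annulus:
  assumes g: "g analytic_on annulus r1 r2" and z: "0 < r1" "r1 < norm z" "norm z < r2"
  shows "g z = circ_avg r2 (\<lambda>w. g w / (w - z)) - circ_avg r1 (\<lambda>w. g w / (w - z))"
proof -
  obtain S where S: "open S" "annulus r1 r2 \<subseteq> S" "g holomorphic_on S"
    using g analytic_on_holomorphic by metis
  define F where "F w = (if w = z then deriv g z else (g w - g z) / (w - z))" for w
  have "F holomorphic_on S" unfolding F_def by (rule pole_lemma_open[OF S(3,1)])
  then have "F analytic_on annulus r1 r2" using S analytic_on_holomorphic by blast
  then have eq: "circ_avg r1 F = circ_avg r2 F" using z by (intro circ_avg_eq) auto
  have "circ_avg s F = circ_avg s (\<lambda>w. g w / (w - z)) - g z * circ_avg s (\<lambda>w. 1 / (w - z))"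
    if s: "s = r1 \<or> s = r2" for s
  proof -
    have s0: "s > 0" "z \<notin> sphere 0 s" using s z by auto
    have c: "continuous_on (sphere 0 s) (\<lambda>w. g w / (w - z))" "continuous_on (sphere 0 s) (\<lambda>w. 1 / (w - z))"
      using s0 s z by (auto intro!: continuous_intros continuous_on_sphere[OF g])
    have "circ_avg s F = circ_avg s (\<lambda>w. g w / (w - z) - g z * (1 / (w - z)))"
      by (rule circ_avg_cong) (use s0 in \<open>auto simp: F_def diff_divide_distrib\<close>)
    also have "\<dots> = circ_avg s (\<lambda>w. g w / (w - z)) - circ_avg s (\<lambda>w. g z * (1 / (w - z)))"
      by (rule circ_avg_diff[OF s0(1) c(1)]) (intro continuous_on_mult continuous_on_const c)
    also have "circ_avg s (\<lambda>w. g z * (1 / (w - z))) = g z * circ_avg s (\<lambda>w. 1 / (w - z))"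
      by (rule circ_avg_cmult[OF s0(1) c(2)])
    finally show ?thesis .
  qed
  from this[of r1] this[of r2] eq show ?thesis
    using circ_avg_pole_inside[of z r2] circ_avg_pole_outside[of r1 z] z by (simp add: diff_eq_eq)
qed

lemma has_sum_int_split:
  fixes f :: "int => complex"
  assumes "((\<lambda>n. f (int n)) has_sum a) UNIV" "((\<lambda>n. f (- int n - 1)) has_sum b) UNIV"
  shows "(f has_sum (a + b)) UNIV"
proof -
  have "(f has_sum a) {0..}"
  proof -
    have "bij_betw int UNIV {0..}" by (rule bij_betw_byWitness[of _ nat]) auto
    then show ?thesis using has_sum_reindex_bij_betw[of int UNIV "{0..}" f a] assms(1) by simp
  qed
  moreover have "bij_betw (\<lambda>n. - int n - 1) UNIV {..<0}"
    by (rule bij_betw_byWitness[of _ "\<lambda>d. nat (- d - 1)"]) auto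
  then have "(f has_sum b) {..<0}"
    using has_sum_reindex_bij_betw[of "\<lambda>n. - int n - 1" UNIV "{..<0}" f b] assms(2) by simp
  ultimately have "(f has_sum (a + b)) ({0..} \<union> {..<0})"
    by (rule has_sum_Un_disjoint) auto
  also have "{0..} \<union> {..<0} = (UNIV :: int set)" by auto
  finally show ?thesis .
qed

lemma geometric_infsum:
  fixes q :: complex
  assumes "norm q < 1"
  shows "((\<lambda>n. q ^ n) has_sum 1 / (1 - q)) UNIV"
proof -
  have "(\<lambda>n. norm (q ^ n)) summable_on UNIV"
    using assms by (simp add: norm_power summable_on_UNIV_nonneg_real_iff summable_geometric)
  then have "(\<lambda>n. q ^ n) summable_on UNIV" by (rule abs_summable_summable)
  then have "((\<lambda>n. q ^ n) has_sum infsum (\<lambda>n. q ^ n) UNIV) UNIV" by (rule has_sum_infsum)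
  moreover from has_sum_imp_sums[OF this] have "infsum (\<lambda>n. q ^ n) UNIV = 1 / (1 - q)"
    using geometric_sums[OF assms] sums_unique2 by blast
  ultimately show ?thesis by simp
qed

text \<open>In Cauchy's formula between \<open>r - e\<close> and \<open>r + e\<close> the kernel is
  expanded into a geometric series: the outer circle yields the indices \<open>d \<ge> 0\<close>,
  the inner one the negative indices.\<close>

lemma laurent_has_sum:
  assumes g: "g analytic_on annulus r r" and r: "0 < r" and z: "norm z = r"
  shows "((\<lambda>d. lcoeff r g d * z powi d) has_sum g z) UNIV"
proof -
  let ?m = "\<lambda>n w. (1 / z ^ (n + 1)) * (g w / w powi (- int n - 1 + 1))"
  obtain e where e: "0 < e" "e < r" and ge: "g analytic_on annulus (r - e) (r + e)"
    using annulus_extend[OF g] r by auto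
  have eq: "lcoeff (r - e) g = lcoeff r g" "lcoeff (r + e) g = lcoeff r g"
    using lcoeff_indep[OF ge, of "r + e"] lcoeff_indep[OF ge, of r] e r by auto
  have nz: "z \<noteq> 0" using z r by auto
  have bd: "\<exists>B. \<forall>w. norm w = s \<longrightarrow> norm (g w) \<le> B" if s: "r - e \<le> s" "s \<le> r + e" for s
  proof -
    have "compact (g ` sphere 0 s)"
      using continuous_on_sphere[OF ge s] by (intro compact_continuous_image compact_sphere)
    then show ?thesis by (force dest!: compact_imp_bounded simp: bounded_iff)
  qed
  have 1: "((\<lambda>n. lcoeff r g (int n) * z powi (int n)) has_sum circ_avg (r + e) (\<lambda>w. g w / (w - z))) UNIV"
  proof -
    obtain B where B: "\<And>w. norm w = r + e ==> norm (g w) \<le> B" using bd[of "r + e"] e by auto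
    have "((\<lambda>n. circ_avg (r + e) (\<lambda>w. z ^ n * (g w / w powi (int n + 1)))) has_sum
        circ_avg (r + e) (\<lambda>w. \<Sum>\<^sub>\<infinity>n. z ^ n * (g w / w powi (int n + 1)))) UNIV"
    proof (rule circ_avg_infsum)
      fix n :: nat
      show "continuous_on (sphere 0 (r + e)) (\<lambda>w. z ^ n * (g w / w powi (int n + 1)))"
        using e r by (intro continuous_on_mult continuous_on_const continuous_on_divide
          continuous_on_sphere[OF ge] continuous_on_sphere_powi) auto
      fix w :: complex assume w: "norm w = r + e"
      have "norm (z ^ n * (g w / w powi (int n + 1))) = norm (g w) * (r ^ n / ((r + e) ^ n * (r + e)))"
        using w z e r by (simp add: norm_mult norm_divide norm_power norm_power_int power_int_add)
      also have "\<dots> \<le> B * (r ^ n / ((r + e) ^ n * (r + e)))"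
        using B[OF w] e r by (intro mult_right_mono) auto
      also have "\<dots> = (B / (r + e)) * (r / (r + e)) ^ n" by (simp add: power_divide)
      finally show "norm (z ^ n * (g w / w powi (int n + 1))) \<le> (B / (r + e)) * (r / (r + e)) ^ n" .
    next
      show "(\<lambda>n. (B / (r + e)) * (r / (r + e)) ^ n) summable_on UNIV"
        using e r by (intro summable_on_cmult_right) (simp add: summable_on_UNIV_nonneg_real_iff summable_geometric)
    qed (use e r in auto)
    moreover have "circ_avg (r + e) (\<lambda>w. z ^ n * (g w / w powi (int n + 1))) = lcoeff r g (int n) * z powi (int n)" for n
    proof -
      have "circ_avg (r + e) (\<lambda>w. z ^ n * (g w / w powi (int n + 1))) = z ^ n * lcoeff (r + e) g (int n)"
        unfolding lcoeff_def
        by (rule circ_avg_cmult) (use e r in \<open>auto intro!: continuous_on_divide continuous_on_sphere[OF ge] continuous_on_sphere_powi\<close>)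
      then show ?thesis by (simp add: eq)
    qed
    moreover have "circ_avg (r + e) (\<lambda>w. \<Sum>\<^sub>\<infinity>n. z ^ n * (g w / w powi (int n + 1))) = circ_avg (r + e) (\<lambda>w. g w / (w - z))"
    proof (rule circ_avg_cong)
      fix w :: complex assume w: "norm w = r + e"
      have w0: "w \<noteq> 0" "w \<noteq> z" using w e r z by auto
      have "((\<lambda>n. (g w / w) * (z / w) ^ n) has_sum (g w / w) * (1 / (1 - z / w))) UNIV"
        by (intro has_sum_cmult_right geometric_infsum) (use w z e r in \<open>simp add: norm_divide\<close>)
      moreover have "(g w / w) * (1 / (1 - z / w)) = g w / (w - z)" using w0 by (simp add: field_simps)
      moreover have "(g w / w) * (z / w) ^ n = z ^ n * (g w / w powi (int n + 1))" for n
        using w0 by (simp add: power_int_add power_divide mult_ac)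
      ultimately show "(\<Sum>\<^sub>\<infinity>n. z ^ n * (g w / w powi (int n + 1))) = g w / (w - z)"
        by (simp add: infsumI)
    qed (use e r in auto)
    ultimately show ?thesis by simp
  qed
  have 2: "((\<lambda>n. lcoeff r g (- int n - 1) * z powi (- int n - 1)) has_sum - circ_avg (r - e) (\<lambda>w. g w / (w - z))) UNIV"
  proof -
    obtain B where B: "\<And>w. norm w = r - e ==> norm (g w) \<le> B" using bd[of "r - e"] e by auto
    have "((\<lambda>n. circ_avg (r - e) (\<lambda>w. (1 / z ^ (n + 1)) * (g w / w powi (- int n - 1 + 1)))) has_sum
        circ_avg (r - e) (\<lambda>w. \<Sum>\<^sub>\<infinity>n. (1 / z ^ (n + 1)) * (g w / w powi (- int n - 1 + 1)))) UNIV"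
    proof (rule circ_avg_infsum)
      fix n :: nat
      show "continuous_on (sphere 0 (r - e)) (\<lambda>w. (1 / z ^ (n + 1)) * (g w / w powi (- int n - 1 + 1)))"
        using e r by (intro continuous_on_mult continuous_on_const continuous_on_divide
          continuous_on_sphere[OF ge] continuous_on_sphere_powi) auto
      fix w :: complex assume w: "norm w = r - e"
      have "norm (?m n w) = norm (g w) * ((r - e) ^ n / (r ^ n * r))"
        using e r by (simp add: w z norm_mult norm_divide norm_power norm_power_int power_int_minus) (simp add: w norm_divide norm_power field_simps)
      also have "\<dots> \<le> B * ((r - e) ^ n / (r ^ n * r))"
        using B[OF w] e r by (intro mult_right_mono) auto
      also have "\<dots> = (B / r) * ((r - e) / r) ^ n" by (simp add: power_divide)
      finally show "norm (?m n w) \<le> (B / r) * ((r - e) / r) ^ n" .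
    next
      show "(\<lambda>n. (B / r) * ((r - e) / r) ^ n) summable_on UNIV"
        using e r by (intro summable_on_cmult_right) (simp add: summable_on_UNIV_nonneg_real_iff summable_geometric)
    qed (use e r in auto)
    moreover have "circ_avg (r - e) (\<lambda>w. (1 / z ^ (n + 1)) * (g w / w powi (- int n - 1 + 1))) = lcoeff r g (- int n - 1) * z powi (- int n - 1)" for n
    proof -
      have "circ_avg (r - e) (\<lambda>w. (1 / z ^ (n + 1)) * (g w / w powi (- int n - 1 + 1))) = (1 / z ^ (n + 1)) * lcoeff (r - e) g (- int n - 1)"
        unfolding lcoeff_def
        by (rule circ_avg_cmult) (use e r in \<open>auto intro!: continuous_on_divide continuous_on_sphere[OF ge] continuous_on_sphere_powi\<close>)
      moreover have "z powi (- int n - 1) = 1 / z ^ (n + 1)"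
        using nz by (simp add: power_int_diff power_int_minus field_simps)
      ultimately show ?thesis by (simp add: eq)
    qed
    moreover have "circ_avg (r - e) (\<lambda>w. \<Sum>\<^sub>\<infinity>n. (1 / z ^ (n + 1)) * (g w / w powi (- int n - 1 + 1))) = circ_avg (r - e) (\<lambda>w. (- 1) * (g w / (w - z)))"
    proof (rule circ_avg_cong)
      fix w :: complex assume w: "norm w = r - e"
      have w0: "w \<noteq> 0" "w \<noteq> z" using w e r z by auto
      have "((\<lambda>n. (g w / z) * (w / z) ^ n) has_sum (g w / z) * (1 / (1 - w / z))) UNIV"
        by (intro has_sum_cmult_right geometric_infsum) (use w z e r in \<open>simp add: norm_divide\<close>)
      moreover have "(g w / z) * (1 / (1 - w / z)) = (- 1) * (g w / (w - z))" using w0 nz by (simp add: field_simps)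
      moreover have "(g w / z) * (w / z) ^ n = (1 / z ^ (n + 1)) * (g w / w powi (- int n - 1 + 1))" for n
        using w0 nz by (simp add: power_int_minus power_divide field_simps)
      ultimately show "(\<Sum>\<^sub>\<infinity>n. (1 / z ^ (n + 1)) * (g w / w powi (- int n - 1 + 1))) = (- 1) * (g w / (w - z))"
        by (simp add: infsumI)
    qed (use e r in auto)
    moreover have "circ_avg (r - e) (\<lambda>w. (- 1) * (g w / (w - z))) = (- 1) * circ_avg (r - e) (\<lambda>w. g w / (w - z))"
      by (rule circ_avg_cmult) (use e r z in \<open>auto intro!: continuous_on_divide continuous_on_sphere[OF ge] continuous_intros\<close>)
    ultimately show ?thesis by simp
  qed
  have "g z = circ_avg (r + e) (\<lambda>w. g w / (w - z)) + - circ_avg (r - e) (\<lambda>w. g w / (w - z))"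
    using cauchy_annulus[OF ge, of z] e r z by simp
  then show ?thesis using has_sum_int_split[OF 1 2] by simp
qed

text \<open>The Laurent series of \<open>g\<close> is inserted under the integral and integrated
  term by term.\<close>

lemma lcoeff_mult:
  assumes g: "g analytic_on annulus r r" and h: "h analytic_on annulus r r" and r: "0 < r"
  shows "((\<lambda>d. lcoeff r g d * lcoeff r h (e - d)) has_sum lcoeff r (\<lambda>w. g w * h w) e) UNIV"
proof -
  let ?f = "\<lambda>d w. lcoeff r g d * (h w / w powi (e - d + 1))"
  have ch: "continuous_on (sphere 0 r) h" by (rule continuous_on_sphere[OF h]) auto
  then have "compact (h ` sphere 0 r)" by (intro compact_continuous_image compact_sphere)
  then obtain B where B: "\<And>w. norm w = r ==> norm (h w) \<le> B"
    by (force dest!: compact_imp_bounded simp: bounded_iff)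
  have "((\<lambda>d. circ_avg r (\<lambda>w. lcoeff r g d * (h w / w powi (e - d + 1)))) has_sum
      circ_avg r (\<lambda>w. \<Sum>\<^sub>\<infinity>d. lcoeff r g d * (h w / w powi (e - d + 1)))) UNIV"
  proof (rule circ_avg_infsum[OF r])
    fix d :: int
    show "continuous_on (sphere 0 r) (\<lambda>w. lcoeff r g d * (h w / w powi (e - d + 1)))"
      using r by (intro continuous_on_mult continuous_on_const continuous_on_divide ch continuous_on_sphere_powi) auto
    fix w :: complex assume w: "norm w = r"
    have "norm (?f d w) = (norm (lcoeff r g d) * r powi d) * norm (h w) / r powi (e + 1)"
      using w r by (simp add: norm_mult norm_divide norm_power_int power_int_add power_int_diff field_simps)
    also have "\<dots> \<le> (norm (lcoeff r g d) * r powi d) * B / r powi (e + 1)"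
      using B[OF w] r by (intro divide_right_mono mult_left_mono) auto
    also have "\<dots> = (B / r powi (e + 1)) * (norm (lcoeff r g d) * r powi d)" by simp
    finally show "norm (?f d w) \<le> (B / r powi (e + 1)) * (norm (lcoeff r g d) * r powi d)" .
  next
    show "(\<lambda>d. (B / r powi (e + 1)) * (norm (lcoeff r g d) * r powi d)) summable_on UNIV"
      using ann_summable_lcoeff[OF g r] by (intro summable_on_cmult_right) (simp add: ann_summable_def)
  qed
  moreover have "circ_avg r (\<lambda>w. lcoeff r g d * (h w / w powi (e - d + 1))) = lcoeff r g d * lcoeff r h (e - d)" for d
    unfolding lcoeff_def[of r h]
    by (rule circ_avg_cmult[OF r]) (use r in \<open>auto intro!: continuous_on_divide ch continuous_on_sphere_powi\<close>)
  moreover have "circ_avg r (\<lambda>w. \<Sum>\<^sub>\<infinity>d. lcoeff r g d * (h w / w powi (e - d + 1))) = lcoeff r (\<lambda>w. g w * h w) e"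
    unfolding lcoeff_def[of r "\<lambda>w. g w * h w"]
  proof (rule circ_avg_cong[OF r])
    fix w :: complex assume w: "norm w = r"
    then have w0: "w \<noteq> 0" using r by auto
    have "((\<lambda>d. (h w / w powi (e + 1)) * (lcoeff r g d * w powi d)) has_sum (h w / w powi (e + 1)) * g w) UNIV"
      by (intro has_sum_cmult_right laurent_has_sum g r w)
    moreover have "(h w / w powi (e + 1)) * (lcoeff r g d * w powi d) = lcoeff r g d * (h w / w powi (e - d + 1))" for d
      using w0 by (simp add: power_int_add power_int_diff field_simps)
    ultimately show "(\<Sum>\<^sub>\<infinity>d. lcoeff r g d * (h w / w powi (e - d + 1))) = g w * h w / w powi (e + 1)"
      by (simp add: infsumI mult.commute)
  qed
  ultimately show ?thesis by simp
qed

section \<open>Convolution and difference operators\<close>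

text \<open>For \<open>s < r\<close> the sum behaves like \<open>s powi x\<close> at minus infinity
  and like \<open>r powi x\<close> at plus infinity. This class contains \<open>V_space\<close> when
  \<open>s\<close> and \<open>r\<close> enclose all \<open>v i\<close>, and it is stable under
  convolution with symbols analytic on both circles.\<close>

definition two_bounded :: "real => real => (int => complex) => bool" where
  "two_bounded s r f \<longleftrightarrow> (\<exists>C. \<forall>x. norm (f x) \<le> C * (s powi x + r powi x))"

text \<open>The index \<open>x - y\<close> is chosen so that, for the Laurent coefficients of
  \<open>g\<close>, the power \<open>u powi x\<close> is an eigenfunction with eigenvalue
  \<open>g u\<close>; composition then multiplies symbols.\<close>

definition conv_op :: "(int => complex) => (int => complex) => int => complex" where
  "conv_op a f y = (\<Sum>\<^sub>\<infinity>x. a (x - y) * f x)"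

definition dop :: "complex => (int => complex) => int => complex" where
  "dop c f x = c * f (x - 1) - f x"

lemma two_boundedI: "(\<And>x. norm (f x) \<le> C * (s powi x + r powi x)) ==> two_bounded s r f"
  unfolding two_bounded_def by blast

lemma two_boundedE:
  assumes "two_bounded s r f"
  obtains C where "C \<ge> 0" "\<And>x. norm (f x) \<le> C * (s powi x + r powi x)"
proof -
  obtain C where C: "\<And>x. norm (f x) \<le> C * (s powi x + r powi x)" using assms unfolding two_bounded_def by blast
  have "0 \<le> C" using order_trans[OF norm_ge_zero C[of 0]] by simp
  then show ?thesis using C that by blast
qed

lemma two_bounded_self: "two_bounded r r f \<longleftrightarrow> pow_bounded r f"
proof
  assume "two_bounded r r f"
  then obtain C where "\<And>x. norm (f x) \<le> C * (r powi x + r powi x)" unfolding two_bounded_def by blast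
  then show "pow_bounded r f" by (intro pow_boundedI[of _ "2 * C"]) (simp add: algebra_simps)
next
  assume "pow_bounded r f"
  then obtain C where "\<And>x. norm (f x) \<le> C * r powi x" unfolding pow_bounded_def by blast
  then show "two_bounded r r f" by (intro two_boundedI[of _ "C / 2"]) (simp add: algebra_simps)
qed

lemma two_bounded_add: "two_bounded s r f ==> two_bounded s r g ==> two_bounded s r (\<lambda>z. f z + g z)"
proof -
  assume "two_bounded s r f" "two_bounded s r g"
  then obtain C D where CD: "\<And>z. norm (f z) \<le> C * (s powi z + r powi z)" "\<And>z. norm (g z) \<le> D * (s powi z + r powi z)"
    unfolding two_bounded_def by blast
  have "norm (f z + g z) \<le> (C + D) * (s powi z + r powi z)" for z
    using order_trans[OF norm_triangle_ineq add_mono[OF CD]] by (simp only: distrib_right)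
  then show ?thesis by (rule two_boundedI)
qed

lemma two_bounded_cmult: "two_bounded s r f ==> two_bounded s r (\<lambda>z. c * f z)"
proof -
  assume "two_bounded s r f"
  then obtain C where C: "\<And>z. norm (f z) \<le> C * (s powi z + r powi z)"
    unfolding two_bounded_def by blast
  have "norm (c * f z) \<le> (norm c * C) * (s powi z + r powi z)" for z
    using mult_left_mono[OF C[of z], of "norm c"] by (simp only: norm_mult mult.assoc norm_ge_zero)
  then show ?thesis by (rule two_boundedI)
qed

lemma two_bounded_diff: "two_bounded s r f ==> two_bounded s r g ==> two_bounded s r (\<lambda>z. f z - g z)"
  using two_bounded_add[of s r f "\<lambda>z. (- 1) * g z"] two_bounded_cmult[of s r g "- 1"] by simp

lemma two_bounded_shift:
  assumes "0 < s" "0 < r" "two_bounded s r f"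
  shows "two_bounded s r (\<lambda>z. f (z + d))"
proof -
  obtain C where C: "C \<ge> 0" "\<And>z. norm (f z) \<le> C * (s powi z + r powi z)"
    by (rule two_boundedE[OF assms(3)]) (rule that)
  have "norm (f (z + d)) \<le> (C * (s powi d + r powi d)) * (s powi z + r powi z)" for z
  proof -
    have "s powi (z + d) + r powi (z + d) \<le> (s powi d + r powi d) * (s powi z + r powi z)"
      using assms by (simp add: power_int_add algebra_simps)
    then have "C * (s powi (z + d) + r powi (z + d)) \<le> C * ((s powi d + r powi d) * (s powi z + r powi z))"
      using C(1) by (rule mult_left_mono)
    then show ?thesis using C(2)[of "z + d"] by simp
  qed
  then show ?thesis by (rule two_boundedI)
qed

lemma two_bounded_dop:
  assumes "0 < s" "0 < r" "two_bounded s r f"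
  shows "two_bounded s r (dop c f)"
proof -
  have "two_bounded s r (\<lambda>z. c * f (z + (- 1)) - f z)"
    using assms by (intro two_bounded_diff two_bounded_cmult two_bounded_shift)
  then show ?thesis by (simp add: dop_def[abs_def])
qed

lemma two_bounded_mono_left: "0 < r ==> pow_bounded s f ==> two_bounded s r f"
proof -
  assume r: "0 < r" and "pow_bounded s f"
  then obtain C where C: "C \<ge> 0" "\<And>z. norm (f z) \<le> C * s powi z" by (auto elim: pow_boundedE)
  have "norm (f z) \<le> C * (s powi z + r powi z)" for z
  proof -
    have "C * s powi z \<le> C * (s powi z + r powi z)" using r C(1) by (intro mult_left_mono) auto
    then show ?thesis using C(2)[of z] by simp
  qed
  then show ?thesis by (rule two_boundedI)
qed

lemma two_bounded_mono_right: "0 < s ==> pow_bounded r f ==> two_bounded s r f"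
  using two_bounded_mono_left[of s r f] by (simp add: two_bounded_def add.commute)

lemma summable_shift_int:
  fixes f :: "int => 'b :: {comm_monoid_add, t2_space}"
  shows "(\<lambda>x. f (x + c)) summable_on UNIV \<longleftrightarrow> f summable_on UNIV"
proof -
  have "bij_betw (\<lambda>x::int. x + c) UNIV UNIV"
    by (rule bij_betw_byWitness[of _ "\<lambda>x. x - c"]) auto
  from summable_on_reindex_bij_betw[OF this] show ?thesis .
qed

lemma infsum_shift_int:
  fixes f :: "int => 'b :: {comm_monoid_add, t2_space}"
  shows "(\<Sum>\<^sub>\<infinity>x. f (x + c)) = infsum f UNIV"
proof -
  have "bij_betw (\<lambda>x::int. x + c) UNIV UNIV"
    by (rule bij_betw_byWitness[of _ "\<lambda>x. x - c"]) auto
  from infsum_reindex_bij_betw[OF this] show ?thesis .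
qed

text \<open>Summability on the two circles makes the convolution act on
  \<open>two_bounded s r\<close> and map this class to itself.\<close>

locale conv_kernel =
  fixes s r :: real and a :: "int => complex"
  assumes s: "0 < s" and r: "0 < r" and as: "ann_summable a s" and ar: "ann_summable a r"
begin

lemma weight_summable: "(\<lambda>x. norm (a (x - y)) * (s powi x + r powi x)) summable_on UNIV"
proof -
  have "(\<lambda>d. s powi y * (norm (a d) * s powi d) + r powi y * (norm (a d) * r powi d)) summable_on UNIV"
    using as ar unfolding ann_summable_def by (intro summable_on_add summable_on_cmult_right)
  moreover have "s powi y * (norm (a d) * s powi d) + r powi y * (norm (a d) * r powi d) =
      norm (a ((d + y) - y)) * (s powi (d + y) + r powi (d + y))" for d
    using s r by (simp add: power_int_add algebra_simps)
  ultimately show ?thesis using summable_shift_int[of "\<lambda>x. norm (a (x - y)) * (s powi x + r powi x)" y] by simp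
qed

lemma weight_infsum:
  obtains K where "K \<ge> 0" "\<And>y. (\<Sum>\<^sub>\<infinity>x. norm (a (x - y)) * (s powi x + r powi x)) \<le> K * (s powi y + r powi y)"
proof -
  let ?s = "\<lambda>r. \<Sum>\<^sub>\<infinity>d. norm (a d) * r powi d"
  let ?w = "\<lambda>y. \<Sum>\<^sub>\<infinity>x. norm (a (x - y)) * (s powi x + r powi x)"
  define A where "A = (?s s) + (?s r)"
  have nn: "0 \<le> (?s s)" "0 \<le> (?s r)"
    using s r by (auto intro!: infsum_nonneg)
  have "(?w y) \<le> A * (s powi y + r powi y)" for y
  proof -
    have "(?w y) =
        (\<Sum>\<^sub>\<infinity>d. norm (a ((d + y) - y)) * (s powi (d + y) + r powi (d + y)))"
      by (rule infsum_shift_int[symmetric])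
    also have "\<dots> = (\<Sum>\<^sub>\<infinity>d. s powi y * (norm (a d) * s powi d) + r powi y * (norm (a d) * r powi d))"
      using s r by (intro infsum_cong) (simp add: power_int_add algebra_simps)
    also have "\<dots> = s powi y * (?s s) + r powi y * (?s r)"
      using as ar unfolding ann_summable_def
      by (subst infsum_add) (auto simp only: infsum_cmult_right intro!: summable_on_cmult_right)
    also have "\<dots> \<le> A * (s powi y + r powi y)"
      using nn s r by (simp add: A_def algebra_simps)
    finally show ?thesis .
  qed
  moreover have "0 \<le> A" using nn by (simp add: A_def)
  ultimately show ?thesis using that by blast
qed

lemma conv_abs_summable:
  assumes f: "two_bounded s r f"
  shows "(\<lambda>x. norm (a (x - y) * f x)) summable_on UNIV"
proof -
  obtain C where C: "C \<ge> 0" "\<And>x. norm (f x) \<le> C * (s powi x + r powi x)"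
    by (rule two_boundedE[OF f]) (rule that)
  have "(\<lambda>x. C * (norm (a (x - y)) * (s powi x + r powi x))) summable_on UNIV"
    by (rule summable_on_cmult_right[OF weight_summable])
  then show ?thesis
  proof (rule summable_on_comparison_test)
    fix x show "norm (a (x - y) * f x) \<le> C * (norm (a (x - y)) * (s powi x + r powi x))"
      using mult_left_mono[OF C(2)[of x], of "norm (a (x - y))"] by (simp add: norm_mult mult_ac)
  qed auto
qed

lemma conv_summable: "two_bounded s r f ==> (\<lambda>x. a (x - y) * f x) summable_on UNIV"
  by (rule abs_summable_summable[OF conv_abs_summable])

lemma conv_abs_bound:
  assumes f: "two_bounded s r f"
  obtains K where "K \<ge> 0" "\<And>y. (\<Sum>\<^sub>\<infinity>x. norm (a (x - y) * f x)) \<le> K * (s powi y + r powi y)"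
proof -
  let ?v = "\<lambda>y. \<Sum>\<^sub>\<infinity>x. norm (a (x - y)) * (s powi x + r powi x)"
  let ?w = "\<lambda>y. \<Sum>\<^sub>\<infinity>x. norm (a (x - y) * f x)"
  obtain C where C: "C \<ge> 0" "\<And>x. norm (f x) \<le> C * (s powi x + r powi x)"
    by (rule two_boundedE[OF f]) (rule that)
  obtain K where K: "K \<ge> 0" "\<And>y. (?v y) \<le> K * (s powi y + r powi y)"
    by (rule weight_infsum) (rule that)
  have "(?w y) \<le> (C * K) * (s powi y + r powi y)" for y
  proof -
    have "(?w y) \<le> (\<Sum>\<^sub>\<infinity>x. C * (norm (a (x - y)) * (s powi x + r powi x)))"
    proof (rule infsum_mono)
      show "(\<lambda>x. C * (norm (a (x - y)) * (s powi x + r powi x))) summable_on UNIV"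
        by (rule summable_on_cmult_right[OF weight_summable])
      fix x show "norm (a (x - y) * f x) \<le> C * (norm (a (x - y)) * (s powi x + r powi x))"
        using mult_left_mono[OF C(2)[of x], of "norm (a (x - y))"] by (simp add: norm_mult mult_ac)
    qed (rule conv_abs_summable[OF f])
    also have "\<dots> = C * (?v y)"
      by (rule infsum_cmult_right) (rule weight_summable)
    also have "\<dots> \<le> C * (K * (s powi y + r powi y))"
      using K C by (intro mult_left_mono) auto
    finally show ?thesis by simp
  qed
  moreover have "0 \<le> C * K" using C K by simp
  ultimately show ?thesis using that by blast
qed

lemma two_bounded_conv:
  assumes f: "two_bounded s r f"
  shows "two_bounded s r (conv_op a f)"
proof -
  obtain K where K: "K \<ge> 0" "\<And>y. (\<Sum>\<^sub>\<infinity>x. norm (a (x - y) * f x)) \<le> K * (s powi y + r powi y)"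
    by (rule conv_abs_bound[OF f]) (rule that)
  have "norm (conv_op a f y) \<le> K * (s powi y + r powi y)" for y
    unfolding conv_op_def
    by (rule order_trans[OF norm_infsum_bound[OF conv_abs_summable[OF f]] K(2)])
  then show ?thesis by (rule two_boundedI)
qed

lemma conv_add:
  assumes "two_bounded s r f" "two_bounded s r g"
  shows "conv_op a (\<lambda>x. f x + g x) y = conv_op a f y + conv_op a g y"
  unfolding conv_op_def using infsum_add[OF conv_summable[OF assms(1)] conv_summable[OF assms(2)]]
  by (simp add: distrib_left)

lemma conv_cmult:
  assumes "two_bounded s r f"
  shows "conv_op a (\<lambda>x. c * f x) y = c * conv_op a f y"
  unfolding conv_op_def using infsum_cmult_right[OF conv_summable[OF assms], of c]
  by (simp add: mult_ac)

lemma conv_diff: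
  assumes "two_bounded s r f" "two_bounded s r g"
  shows "conv_op a (\<lambda>x. f x - g x) y = conv_op a f y - conv_op a g y"
  using conv_add[OF assms(1) two_bounded_cmult[OF assms(2), of "- 1"], of y] conv_cmult[OF assms(2), of "- 1" y]
  by simp

lemma conv_shift: "conv_op a (\<lambda>x. f (x + c)) y = conv_op a f (y + c)"
  unfolding conv_op_def using infsum_shift_int[of "\<lambda>x. a (x - (y + c)) * f x" c] by (simp add: algebra_simps)

lemma conv_dop:
  assumes "two_bounded s r f"
  shows "conv_op a (dop c f) = dop c (conv_op a f)"
proof
  fix y
  have f1: "two_bounded s r (\<lambda>x. f (x - 1))"
    using two_bounded_shift[OF s r assms, of "- 1"] by simp
  have "conv_op a (dop c f) y = c * conv_op a (\<lambda>x. f (x - 1)) y - conv_op a f y"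
    unfolding dop_def[abs_def] using f1 assms
    by (simp add: conv_diff two_bounded_cmult conv_cmult)
  then show "conv_op a (dop c f) y = dop c (conv_op a f) y"
    using conv_shift[of f "- 1" y] by (simp add: dop_def)
qed

text \<open>The coefficients on the left belong to the symbol multiplied by
  \<open>(c - w) / w\<close> (see \<open>lcoeff_dop\<close>), so a factor of the symbol is traded
  for a difference operator on the argument.\<close>

lemma conv_by_parts:
  assumes f: "two_bounded s r f"
  shows "conv_op (\<lambda>d. c * a (d + 1) - a d) f = conv_op a (dop c f)"
proof
  fix y
  have 1: "(\<lambda>z. a (z - y) * f z) summable_on UNIV" by (rule conv_summable[OF f])
  have "(\<lambda>z. a (z - (y - 1)) * f z) summable_on UNIV" by (rule conv_summable[OF f])
  then have 2: "(\<lambda>z. a (z + 1 - y) * f z) summable_on UNIV" by (simp add: algebra_simps)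
  from infsum_by_parts_int[OF 1 2, of c] show "conv_op (\<lambda>d. c * a (d + 1) - a d) f y = conv_op a (dop c f) y"
    by (simp add: conv_op_def dop_def algebra_simps)
qed

text \<open>Lets artificial half-line supports be removed at the end; the Cauchy-Binet identity is
  available only for functions vanishing on the left.\<close>

lemma conv_truncate:
  assumes f: "two_bounded s r f"
  shows "(\<lambda>n. conv_op a (\<lambda>x. if x > - int n then f x else 0) y) \<longlonglongrightarrow> conv_op a f y"
  unfolding conv_op_def
proof (rule infsum_dominated[of _ _ "\<lambda>x. norm (a (x - y) * f x)"])
  show "(\<lambda>x. norm (a (x - y) * f x)) summable_on UNIV" by (rule conv_abs_summable[OF f])
  fix x
  have "\<forall>\<^sub>F n in sequentially. a (x - y) * (if x > - int n then f x else 0) = a (x - y) * f x"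
    unfolding eventually_sequentially by (rule exI[of _ "nat (1 - x)"]) auto
  then show "(\<lambda>n. a (x - y) * (if x > - int n then f x else 0)) \<longlonglongrightarrow> a (x - y) * f x"
    by (rule tendsto_eventually)
qed auto

end

text \<open>Fubini; absolute summability of the double sum comes from applying the weight bound once
  for each kernel.\<close>

lemma conv_conv:
  assumes "conv_kernel s r a" "conv_kernel s r b"
    and c: "\<And>e. ((\<lambda>d. a d * b (e - d)) has_sum c e) UNIV" and f: "two_bounded s r f"
  shows "conv_op a (conv_op b f) = conv_op c f"
proof
  fix y
  interpret a: conv_kernel s r a by fact
  interpret b: conv_kernel s r b by fact
  define T where "T x z = a (x - y) * (b (z - x) * f z)" for x z
  let ?t = "\<lambda>x. \<Sum>\<^sub>\<infinity>z. norm (T x z)"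
  let ?b = "\<lambda>x. \<Sum>\<^sub>\<infinity>z. norm (b (z - x) * f z)"
  obtain K where K: "K \<ge> 0" "\<And>x. (?b x) \<le> K * (s powi x + r powi x)"
    by (rule b.conv_abs_bound[OF f]) (rule that)
  have "(\<lambda>w. norm (case w of (x, z) => T x z)) summable_on Sigma UNIV (\<lambda>_. UNIV)"
  proof (rule Infinite_Sum.abs_summable_on_Sigma_iff[THEN iffD2], intro conjI ballI)
    fix x
    show "(\<lambda>z. norm (case (x, z) of (x, z) => T x z)) summable_on UNIV"
      unfolding T_def norm_mult[of "a _"] case_prod_conv
      by (intro summable_on_cmult_right b.conv_abs_summable[OF f])
  next
    have "(\<lambda>x. K * (norm (a (x - y)) * (s powi x + r powi x))) summable_on UNIV"
      by (intro summable_on_cmult_right a.weight_summable)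
    then show "(\<lambda>x. norm (\<Sum>\<^sub>\<infinity>z. norm (case (x, z) of (x, z) => T x z))) summable_on UNIV"
    proof (rule summable_on_comparison_test)
      fix x
      have "(?t x) = norm (a (x - y)) * (?b x)"
        unfolding T_def norm_mult[of "a _"] by (rule infsum_cmult_right[OF b.conv_abs_summable[OF f]])
      also have "\<dots> \<le> norm (a (x - y)) * (K * (s powi x + r powi x))"
        using K by (intro mult_left_mono) auto
      finally have "(?t x) \<le> K * (norm (a (x - y)) * (s powi x + r powi x))" by (simp add: mult_ac)
      moreover have "0 \<le> (?t x)" by (rule infsum_nonneg) simp
      ultimately show "norm (\<Sum>\<^sub>\<infinity>z. norm (case (x, z) of (x, z) => T x z)) \<le> K * (norm (a (x - y)) * (s powi x + r powi x))"
        by simp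
    qed simp
  qed
  then have "(\<lambda>(x, z). T x z) summable_on Sigma UNIV (\<lambda>_. UNIV)" by (rule abs_summable_summable)
  then have swap: "(\<Sum>\<^sub>\<infinity>x. \<Sum>\<^sub>\<infinity>z. T x z) = (\<Sum>\<^sub>\<infinity>z. \<Sum>\<^sub>\<infinity>x. T x z)"
    by (intro infsum_swap_banach)
  have "(\<Sum>\<^sub>\<infinity>z. T x z) = a (x - y) * conv_op b f x" for x
    unfolding T_def conv_op_def by (rule infsum_cmult_right[OF b.conv_summable[OF f]])
  moreover have "(\<Sum>\<^sub>\<infinity>x. T x z) = c (z - y) * f z" for z
  proof -
    have "((\<lambda>d. a d * b (z - y - d) * f z) has_sum c (z - y) * f z) UNIV"
      by (rule has_sum_cmult_left[OF c])
    then have "(\<Sum>\<^sub>\<infinity>d. a d * b (z - y - d) * f z) = c (z - y) * f z" by (rule infsumI)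
    then show ?thesis
      using infsum_shift_int[of "\<lambda>x. T x z" y] by (simp add: T_def algebra_simps)
  qed
  ultimately show "conv_op a (conv_op b f) y = conv_op c f y"
    using swap by (simp add: conv_op_def)
qed

lemma dop_commute: "dop a (dop b f) = dop b (dop a f)"
  by (auto simp: dop_def algebra_simps)

lemma dop_add: "dop c (\<lambda>x. f x + g x) = (\<lambda>x. dop c f x + dop c g x)"
  by (auto simp: dop_def algebra_simps)

lemma dop_cmult: "dop c (\<lambda>x. a * f x) = (\<lambda>x. a * dop c f x)"
  by (auto simp: dop_def algebra_simps)

lemma dop_zero [simp]: "dop c (\<lambda>x. 0) = (\<lambda>x. 0)"
  by (auto simp: dop_def)

text \<open>This is the product \<open>D (i + 1) ... D n\<close>, which is the identity for
  \<open>n \<le> i\<close>. Since the operators commute, factors can be split off at either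
  end.\<close>

primrec DD :: "(nat => complex) => nat => nat => (int => complex) => int => complex" where
  "DD v i 0 f = f"
| "DD v i (Suc n) f = (if i \<le> n then DD v i n (dop (v (Suc n)) f) else f)"

lemma DD_id: "n \<le> i ==> DD v i n f = f"
  by (cases n) auto

lemma DD_dop: "DD v i n (dop c f) = dop c (DD v i n f)"
proof (induction n arbitrary: f)
  case (Suc n)
  then show ?case using Suc[of "dop (v (Suc n)) f"] dop_commute[of "v (Suc n)" c f] by simp
qed simp

lemma DD_split: "i \<le> j ==> j \<le> n ==> DD v i n f = DD v i j (DD v j n f)"
proof (induction n arbitrary: f)
  case (Suc n)
  show ?case
  proof (cases "j = Suc n")
    case True
    then show ?thesis by (simp add: DD_id)
  next
    case False
    then show ?thesis using Suc by simp
  qed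
qed simp

lemma DD_Suc_left:
  assumes "k < n"
  shows "DD v k n f = dop (v (Suc k)) (DD v (Suc k) n f)"
proof -
  have "DD v k n f = DD v k (Suc k) (DD v (Suc k) n f)" using assms by (intro DD_split) auto
  then show ?thesis by (simp add: DD_id)
qed

lemma DD_add: "DD v i n (\<lambda>x. f x + g x) = (\<lambda>x. DD v i n f x + DD v i n g x)"
  by (induction n arbitrary: f g) (auto simp: dop_add)

lemma DD_cmult: "DD v i n (\<lambda>x. a * f x) = (\<lambda>x. a * DD v i n f x)"
  by (induction n arbitrary: f) (auto simp: dop_cmult)

lemma DD_zero [simp]: "DD v i n (\<lambda>x. 0) = (\<lambda>x. 0)"
  by (induction n) auto

lemma DD_diff: "DD v i n (\<lambda>x. f x - g x) = (\<lambda>x. DD v i n f x - DD v i n g x)"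
  using DD_add[of v i n f "\<lambda>x. (- 1) * g x"] DD_cmult[of v i n "- 1" g] by (simp add: fun_eq_iff)

lemma DD_sum: "finite I ==> DD v i n (\<lambda>x. \<Sum>j\<in>I. f j x) = (\<lambda>x. \<Sum>j\<in>I. DD v i n (f j) x)"
  by (induction I rule: finite_induct) (auto simp: DD_add)

lemma two_bounded_DD: "0 < s ==> 0 < r ==> two_bounded s r f ==> two_bounded s r (DD v i n f)"
  by (induction n arbitrary: f) (auto intro: two_bounded_dop)

lemma pow_bounded_DD: "0 < r ==> pow_bounded r f ==> pow_bounded r (DD v i n f)"
  using two_bounded_DD[of r r f] by (simp add: two_bounded_self)

text \<open>Each \<open>dop\<close> looks one step to the left, hence \<open>DD v i n\<close> looks
  back \<open>n - i\<close> steps. Together with the gaps of a chamber vector this makes a cut at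
  \<open>a\<close> invisible as soon as the last entry exceeds \<open>a\<close>.\<close>

lemma DD_local:
  "(\<And>z. a < z ==> f z = g z) ==> a + int (n - i) < x ==> DD v i n f x = DD v i n g x"
proof (induction n arbitrary: f g a)
  case (Suc n)
  show ?case
  proof (cases "i \<le> n")
    case True
    have "DD v i n (dop (v (Suc n)) f) x = DD v i n (dop (v (Suc n)) g) x"
      by (rule Suc.IH[of "a + 1"]) (use Suc.prems True in \<open>auto simp: dop_def Suc_diff_le\<close>)
    then show ?thesis using True by simp
  qed (use Suc.prems in simp)
qed simp

lemma conv_kernel_DD:
  assumes "conv_kernel s r a" "two_bounded s r f"
  shows "conv_op a (DD v i n f) = DD v i n (conv_op a f)"
proof -
  interpret conv_kernel s r a by fact
  show ?thesis using assms(2)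
    by (induction n arbitrary: f) (auto simp: conv_dop two_bounded_dop s r)
qed

text \<open>Division by \<open>c powi x\<close> turns \<open>dop c\<close> into a plain difference,
  which is inverted by the signed partial sums \<open>H\<close>.\<close>

lemma dop_surj:
  assumes "c \<noteq> 0"
  obtains f where "dop c f = g"
proof -
  define G where "G x = g x / c powi x" for x
  define H where "H x = (\<Sum>i\<in>{x<..0}. G i) - (\<Sum>i\<in>{0<..x}. G i)" for x :: int
  have H: "H (x - 1) - H x = G x" for x
  proof (cases "x \<ge> 1")
    case True
    then have "{0<..x} = insert x {0<..x - 1}" "{x - 1<..0} = {}" "{x<..0} = {}" by auto
    then show ?thesis by (simp add: H_def)
  next
    case False
    then have "{x - 1<..0} = insert x {x<..0}" "{0<..x} = {}" "{0<..x - 1} = {}" by auto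
    then show ?thesis by (simp add: H_def)
  qed
  have "dop c (\<lambda>x. c powi x * H x) x = g x" for x
  proof -
    have "dop c (\<lambda>x. c powi x * H x) x = c powi x * (H (x - 1) - H x)"
      using assms by (simp add: dop_def power_int_diff algebra_simps)
    then show ?thesis using assms by (simp add: H G_def)
  qed
  then show ?thesis using that by blast
qed

lemma dop_kernel:
  assumes "c \<noteq> 0" "dop c f = (\<lambda>x. 0)"
  shows "f x = f 0 * c powi x"
proof -
  have step: "c * f (x - 1) = f x" for x
    using fun_cong[OF assms(2), of x] by (simp add: dop_def)
  show ?thesis
  proof (induction x rule: int_induct[of _ 0])
    case (step1 i)
    have "f (i + 1) = c * f i" using step[of "i + 1"] by simp
    then show ?case using step1 assms(1) by (simp add: power_int_add)
  next
    case (step2 i)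
    have "c * f (i - 1) = c * (f 0 * c powi (i - 1))"
      using step2 step[of i] assms(1) by (simp add: power_int_diff)
    then show ?case using assms(1) by simp
  qed simp
qed

section \<open>The space spanned by exponential polynomials\<close>

interpretation fvec: vector_space "\<lambda>(c :: complex) (f :: int => complex) x. c * f x"
  by unfold_locales (auto simp: fun_eq_iff algebra_simps)

lemma cspan_eq: "cspan = fvec.span"
  by (simp add: cspan_def)

lemma V_space_add: "f \<in> V_space v n ==> g \<in> V_space v n ==> (\<lambda>x. f x + g x) \<in> V_space v n"
  using fvec.span_add[of f _ g] by (simp add: V_space_def cspan_eq plus_fun_def)

lemma V_space_cmult: "f \<in> V_space v n ==> (\<lambda>x. c * f x) \<in> V_space v n"
  using fvec.span_scale[of f _ c] by (simp add: V_space_def cspan_eq)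

lemma V_space_zero: "(\<lambda>x. 0) \<in> V_space v n"
  using fvec.span_zero by (simp add: V_space_def cspan_eq zero_fun_def)

lemma V_space_diff: "f \<in> V_space v n ==> g \<in> V_space v n ==> (\<lambda>x. f x - g x) \<in> V_space v n"
  using V_space_add[of f v n "\<lambda>x. (- 1) * g x"] V_space_cmult[of g v n "- 1"] by simp

lemma V_space_sum: "finite I ==> (\<And>i. i \<in> I ==> f i \<in> V_space v n) ==> (\<lambda>x. \<Sum>i\<in>I. f i x) \<in> V_space v n"
  by (induction I rule: finite_induct) (auto simp: V_space_zero V_space_add)

definition mult_upto :: "(nat => real) => nat => real => nat" where
  "mult_upto v n u = card {i \<in> {1..n}. v i = u}"

definition pow_exp :: "nat => real => int => complex" where
  "pow_exp l u x = of_int x ^ l * of_real u powi x"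

lemma mult_upto_Suc: "mult_upto v (Suc n) u = mult_upto v n u + (if v (Suc n) = u then 1 else 0)"
proof -
  have "{i \<in> {1..Suc n}. v i = u} = {i \<in> {1..n}. v i = u} \<union> (if v (Suc n) = u then {Suc n} else {})"
    by (auto simp: le_Suc_eq)
  then show ?thesis by (auto simp: mult_upto_def)
qed

lemma mult_upto_pos: "l < mult_upto v n u ==> u \<in> v ` {1..n}"
proof -
  assume "l < mult_upto v n u"
  then have "{i \<in> {1..n}. v i = u} \<noteq> {}" unfolding mult_upto_def by (metis card.empty not_less_zero)
  then show ?thesis by auto
qed

lemma V_space_eq: "V_space v n = fvec.span {pow_exp l u | u l. l < mult_upto v n u}"
proof -
  have pe: "(\<lambda>x. of_int x ^ l * of_real u powi x) = pow_exp l u" for l u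
    by (auto simp: pow_exp_def fun_eq_iff)
  have "{(\<lambda>x. of_int x ^ l * of_real u powi x) | u l. u \<in> v ` {1..n} \<and> l < card {i \<in> {1..n}. v i = u}} =
    {pow_exp l u | u l. l < mult_upto v n u}"
    unfolding pe mult_upto_def[symmetric] by (intro Collect_cong iff_exI) (use mult_upto_pos in blast)
  then show ?thesis by (simp add: V_space_def cspan_eq)
qed

lemma V_space_base: "l < mult_upto v n u ==> pow_exp l u \<in> V_space v n"
  unfolding V_space_eq by (rule fvec.span_base) blast

lemma V_space_subspaceI:
  assumes "\<And>l u. l < mult_upto v n u ==> P (pow_exp l u)" "P (\<lambda>x. 0)"
    "\<And>f g. P f ==> P g ==> P (\<lambda>x. f x + g x)" "\<And>c f. P f ==> P (\<lambda>x. c * f x)"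
    and f: "f \<in> V_space v n"
  shows "P f"
proof -
  have "fvec.subspace (Collect P)"
    unfolding fvec.subspace_def using assms(2-4) by (auto simp: plus_fun_def zero_fun_def)
  then have "fvec.span {pow_exp l u | u l. l < mult_upto v n u} \<subseteq> Collect P"
    using assms(1) by (intro fvec.span_minimal) auto
  then show ?thesis using f unfolding V_space_eq by blast
qed

lemma V_space_mono: "f \<in> V_space v n ==> f \<in> V_space v (Suc n)"
  by (rule V_space_subspaceI[of v n "\<lambda>f. f \<in> V_space v (Suc n)"])
    (auto intro: V_space_add V_space_cmult V_space_zero V_space_base simp: mult_upto_Suc)

text \<open>Binomial expansion of \<open>(x - 1) ^ l\<close>. The top coefficient
  \<open>c / u - 1\<close> vanishes when \<open>u = c\<close>, so \<open>dop c\<close> lowers the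
  degree exactly at the frequency \<open>c\<close>; this is why multiplicities enter.\<close>

lemma dop_pow_exp:
  assumes "u \<noteq> 0"
  shows "dop c (pow_exp l u) = (\<lambda>x. (c / of_real u - 1) * pow_exp l u x +
    (c / of_real u) * (\<Sum>j<l. (of_nat (l choose j) * (- 1) ^ (l - j)) * pow_exp j u x))"
proof
  let ?s = "\<lambda>x. \<Sum>j<l. of_nat (l choose j) * of_int x ^ j * (- 1) ^ (l - j)"
  fix x :: int
  have "(of_int (x - 1) :: complex) ^ l = (\<Sum>j\<le>l. of_nat (l choose j) * of_int x ^ j * (- 1) ^ (l - j))"
    using binomial_ring[of "of_int x :: complex" "- 1" l] by simp
  also have "\<dots> = (?s x) + of_int x ^ l"
    by (simp add: lessThan_Suc_atMost[symmetric])
  finally have *: "(of_int (x - 1) :: complex) ^ l = (?s x) + of_int x ^ l" .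
  have "dop c (pow_exp l u) x = c * (of_int (x - 1) ^ l * (of_real u powi x / of_real u)) - pow_exp l u x"
    using assms by (simp add: dop_def pow_exp_def power_int_diff)
  also have "\<dots> = (c / of_real u - 1) * pow_exp l u x + (c / of_real u) *
      ((?s x) * of_real u powi x)"
    unfolding * using assms by (simp add: pow_exp_def field_simps)
  also have "(?s x) * of_real u powi x =
      (\<Sum>j<l. (of_nat (l choose j) * (- 1) ^ (l - j)) * pow_exp j u x)"
    unfolding sum_distrib_right by (intro sum.cong) (simp_all add: pow_exp_def mult_ac)
  finally show "dop c (pow_exp l u) x = (c / of_real u - 1) * pow_exp l u x +
    (c / of_real u) * (\<Sum>j<l. (of_nat (l choose j) * (- 1) ^ (l - j)) * pow_exp j u x)" .
qed

lemma dop_V_space: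
  assumes v: "\<And>i. i \<in> {1..Suc n} ==> v i > 0" and f: "f \<in> V_space v (Suc n)"
  shows "dop (of_real (v (Suc n))) f \<in> V_space v n"
  using f
proof (rule V_space_subspaceI[rotated -1])
  fix l u assume lu: "l < mult_upto v (Suc n) u"
  then have "u \<in> v ` {1..Suc n}" by (rule mult_upto_pos)
  then have u: "u > 0" using v by auto
  have 1: "j < mult_upto v n u" if "j < l" for j using lu that by (auto simp: mult_upto_Suc split: if_splits)
  have "(\<lambda>x. (of_real (v (Suc n)) / of_real u - 1) * pow_exp l u x) \<in> V_space v n"
  proof (cases "v (Suc n) = u")
    case True
    then show ?thesis using u by (simp add: V_space_zero)
  next
    case False
    then show ?thesis using lu by (intro V_space_cmult V_space_base) (simp add: mult_upto_Suc)
  qed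
  then show "dop (of_real (v (Suc n))) (pow_exp l u) \<in> V_space v n"
    unfolding dop_pow_exp[OF less_imp_neq[OF u, symmetric]]
    by (rule V_space_add) (intro V_space_cmult V_space_sum V_space_base, use 1 in auto)
qed (auto simp: dop_add dop_cmult V_space_add V_space_cmult V_space_zero)

text \<open>Induction on the degree, solving a triangular system. At the resonant frequency
  \<open>u = v (Suc n)\<close> the preimage has degree \<open>l + 1\<close>, which is allowed since
  the multiplicity of \<open>u\<close> has just grown by one.\<close>

lemma dop_V_space_surj:
  assumes v: "\<And>i. i \<in> {1..Suc n} ==> v i > 0" and f: "g \<in> V_space v n"
  shows "\<exists>f\<in>V_space v (Suc n). dop (of_real (v (Suc n))) f = g"
  using f
proof (rule V_space_subspaceI[rotated -1])
  let ?c = "complex_of_real (v (Suc n))"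
  fix l u assume "l < mult_upto v n u"
  then show "\<exists>f\<in>V_space v (Suc n). dop ?c f = pow_exp l u"
  proof (induction l rule: less_induct)
    case (less l)
    have "u \<in> v ` {1..n}" using less.prems by (rule mult_upto_pos)
    then have u: "u > 0" using v by auto
    have "\<forall>j\<in>{..<l}. \<exists>f. f \<in> V_space v (Suc n) \<and> dop ?c f = pow_exp j u" using less by auto
    from bchoice[OF this] obtain e where e: "\<And>j. j < l ==> e j \<in> V_space v (Suc n)" "\<And>j. j < l ==> dop ?c (e j) = pow_exp j u"
      by auto
    have dop_lin: "dop ?c (\<lambda>x. b * (p x - b' * (\<Sum>j<l. a j * e j x))) =
        (\<lambda>x. b * (dop ?c p x - b' * (\<Sum>j<l. a j * pow_exp j u x)))" for b b' p a
    proof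
      fix x
      have "(\<Sum>j<l. a j * pow_exp j u x) = (\<Sum>j<l. a j * dop ?c (e j) x)" using e by simp
      also have "\<dots> = ?c * (\<Sum>j<l. a j * e j (x - 1)) - (\<Sum>j<l. a j * e j x)"
        by (simp add: dop_def sum_distrib_left sum_subtractf algebra_simps)
      finally have eq: "(\<Sum>j<l. a j * pow_exp j u x) = ?c * (\<Sum>j<l. a j * e j (x - 1)) - (\<Sum>j<l. a j * e j x)" .
      show "dop ?c (\<lambda>x. b * (p x - b' * (\<Sum>j<l. a j * e j x))) x =
        b * (dop ?c p x - b' * (\<Sum>j<l. a j * pow_exp j u x))"
        unfolding eq dop_def by (simp add: algebra_simps)
    qed
    show ?case
    proof (cases "v (Suc n) = u")
      case False
      define b where "b = 1 / (?c / of_real u - 1)"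
      have b: "?c / of_real u - 1 \<noteq> 0" using False u by auto
      let ?f = "\<lambda>x. b * (pow_exp l u x - (?c / of_real u) * (\<Sum>j<l. (of_nat (l choose j) * (- 1) ^ (l - j)) * e j x))"
      have "dop ?c ?f = pow_exp l u"
        unfolding dop_lin dop_pow_exp[OF less_imp_neq[OF u, symmetric]] using b by (simp add: b_def fun_eq_iff)
      moreover have "?f \<in> V_space v (Suc n)"
        using less.prems e
        by (intro V_space_cmult V_space_diff V_space_sum V_space_base) (auto simp: mult_upto_Suc)
      ultimately show ?thesis by blast
    next
      case True
      then have c: "?c / of_real u = 1" using u by simp
      \<comment> \<open>In \<open>dop\<close> of the power of degree \<open>Suc l\<close> the
        coefficient of degree \<open>l\<close> is \<open>- (Suc l)\<close>.\<close>
      define b where "b = - 1 / complex_of_nat (Suc l)"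
      let ?f = "\<lambda>x. b * (pow_exp (Suc l) u x - 1 * (\<Sum>j<l. (of_nat (Suc l choose j) * (- 1) ^ (Suc l - j)) * e j x))"
      have "dop ?c ?f x = pow_exp l u x" for x
      proof -
        have "dop ?c ?f x = b * (of_nat (Suc l choose l) * (- 1) ^ (Suc l - l) * pow_exp l u x)"
          unfolding dop_lin dop_pow_exp[OF less_imp_neq[OF u, symmetric]] c by simp
        also have "\<dots> = pow_exp l u x"
          by (simp only: b_def binomial_Suc_n Suc_diff_le[OF le_refl] diff_self_eq_0) (simp del: of_nat_Suc)
        finally show ?thesis .
      qed
      moreover have "?f \<in> V_space v (Suc n)"
        using less.prems e True
        by (intro V_space_cmult V_space_diff V_space_sum V_space_base) (auto simp: mult_upto_Suc)
      ultimately show ?thesis by blast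
    qed
  qed
next
  show "\<exists>f\<in>V_space v (Suc n). dop (of_real (v (Suc n))) f = (\<lambda>x. 0)"
    using V_space_zero dop_zero by blast
next
  fix f g assume "\<exists>f'\<in>V_space v (Suc n). dop (of_real (v (Suc n))) f' = f" "\<exists>g'\<in>V_space v (Suc n). dop (of_real (v (Suc n))) g' = g"
  then show "\<exists>h\<in>V_space v (Suc n). dop (of_real (v (Suc n))) h = (\<lambda>x. f x + g x)"
    using V_space_add dop_add by (metis (no_types, lifting))
next
  fix c f assume "\<exists>f'\<in>V_space v (Suc n). dop (of_real (v (Suc n))) f' = f"
  then show "\<exists>h\<in>V_space v (Suc n). dop (of_real (v (Suc n))) h = (\<lambda>x. c * f x)"
    using V_space_cmult dop_cmult by (metis (no_types, lifting))
qed

lemma V_space_0: "f \<in> V_space v 0 ==> f = (\<lambda>x. 0)"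
  by (rule V_space_subspaceI[of v 0 "\<lambda>f. f = (\<lambda>x. 0)"]) (auto simp: mult_upto_def)

abbreviation cv :: "(nat => real) => nat => complex" where
  "cv v i \<equiv> of_real (v i)"

lemma V_space_DD: "(\<And>i. i \<in> {1..n} ==> v i > 0) ==> f \<in> V_space v n ==> DD (cv v) 0 n f = (\<lambda>x. 0)"
proof (induction n arbitrary: f)
  case (Suc n)
  have "dop (cv v (Suc n)) f \<in> V_space v n" using Suc.prems by (intro dop_V_space) auto
  then show ?case using Suc by simp
qed (auto dest: V_space_0)

text \<open>With \<open>Q = {0}\<close> this says that \<open>V_space\<close> is the kernel of the iterated difference operator; with
  \<open>Q\<close> the sequences of a given decay at infinity it is a partial fraction decomposition.\<close>

lemma DD_decompose:
  assumes v: "\<And>i. i \<in> {1..n} ==> v i > 0"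
    and Q: "\<And>i q. i \<in> {1..n} ==> q \<in> Q ==> \<exists>q'\<in>Q. dop (cv v i) q' = q"
    and g: "DD (cv v) 0 n g \<in> Q"
  shows "\<exists>f\<in>V_space v n. \<exists>q\<in>Q. g = (\<lambda>x. f x + q x)"
  using assms
proof (induction n arbitrary: g)
  case 0
  then show ?case by (intro bexI[of _ "\<lambda>x. 0"] bexI[of _ g] V_space_zero) auto
next
  case (Suc n)
  let ?c = "cv v (Suc n)"
  have c: "?c \<noteq> 0" using Suc.prems(1)[of "Suc n"] by simp
  have "\<exists>f\<in>V_space v n. \<exists>q\<in>Q. dop ?c g = (\<lambda>x. f x + q x)"
    by (rule Suc.IH) (use Suc.prems in auto)
  then obtain f q where f: "f \<in> V_space v n" and q: "q \<in> Q" and eq: "dop ?c g = (\<lambda>x. f x + q x)" by blast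
  obtain f' where f': "f' \<in> V_space v (Suc n)" "dop ?c f' = f"
    using dop_V_space_surj[OF _ f] Suc.prems(1) by blast
  obtain q' where q': "q' \<in> Q" "dop ?c q' = q" using Suc.prems(2)[of "Suc n" q] q by auto
  define h where "h x = g x - (f' x + q' x)" for x
  have "dop ?c h = (\<lambda>x. 0)"
  proof
    fix x
    have "dop ?c h x = dop ?c g x - (dop ?c f' x + dop ?c q' x)" by (simp add: h_def dop_def algebra_simps)
    then show "dop ?c h x = 0" by (simp add: eq f' q')
  qed
  then have h: "h x = h 0 * ?c powi x" for x using dop_kernel[OF c] by blast
  have "(\<lambda>x. h 0 * pow_exp 0 (v (Suc n)) x) \<in> V_space v (Suc n)"
    by (intro V_space_cmult V_space_base) (simp add: mult_upto_Suc)
  moreover have "(\<lambda>x. h 0 * pow_exp 0 (v (Suc n)) x) = h"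
  proof
    fix x show "h 0 * pow_exp 0 (v (Suc n)) x = h x" using h[of x] by (simp add: pow_exp_def)
  qed
  ultimately have "h \<in> V_space v (Suc n)" by simp
  then have "(\<lambda>x. f' x + h x) \<in> V_space v (Suc n)" using f' by (intro V_space_add)
  moreover have "g = (\<lambda>x. (f' x + h x) + q' x)" by (simp add: h_def fun_eq_iff)
  ultimately show ?case using q'(1) by (intro bexI[of _ "\<lambda>x. f' x + h x"] bexI[of _ q'])
qed

lemma V_space_iff_kernel:
  assumes v: "\<And>i. i \<in> {1..n} ==> v i > 0"
  shows "f \<in> V_space v n \<longleftrightarrow> DD (cv v) 0 n f = (\<lambda>x. 0)"
proof
  assume "DD (cv v) 0 n f = (\<lambda>x. 0)"
  then have "\<exists>f'\<in>V_space v n. \<exists>q\<in>{\<lambda>x. 0}. f = (\<lambda>x. f' x + q x)"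
    by (intro DD_decompose v) auto
  then show "f \<in> V_space v n" by auto
next
  assume "f \<in> V_space v n"
  then show "DD (cv v) 0 n f = (\<lambda>x. 0)" by (rule V_space_DD[rotated]) (rule v)
qed

text \<open>A basis adapted to the increasing spaces \<open>V_space v n\<close>: the
  \<open>i\<close>-th function is the one that appears when \<open>v i\<close> is added. Hence
  \<open>D 1 ... D l\<close> kills it as soon as \<open>i \<le> l\<close>.\<close>

definition V_basis :: "(nat => real) => nat => int => complex" where
  "V_basis v i = pow_exp (mult_upto v (i - 1) (v i)) (v i)"

lemma V_basis_in: "i \<ge> 1 ==> i \<le> n ==> V_basis v i \<in> V_space v n"
proof (induction n)
  case (Suc n)
  show ?case
  proof (cases "i = Suc n")
    case True
    then show ?thesis by (auto simp: V_basis_def mult_upto_Suc intro!: V_space_base)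
  next
    case False
    then show ?thesis using Suc by (auto intro: V_space_mono)
  qed
qed simp

lemma V_space_basis_sum:
  assumes "f \<in> V_space v n"
  shows "\<exists>\<alpha>. \<forall>x. f x = (\<Sum>i=1..n. \<alpha> i * V_basis v i x)"
  using assms
proof (rule V_space_subspaceI[rotated -1])
  fix l u assume "l < mult_upto v n u"
  then have "\<exists>i\<in>{1..n}. pow_exp l u = V_basis v i"
  proof (induction n)
    case 0
    then show ?case by (simp add: mult_upto_def)
  next
    case (Suc n)
    show ?case
    proof (cases "l < mult_upto v n u")
      case True
      then show ?thesis using Suc.IH by force
    next
      case False
      then have "v (Suc n) = u" "l = mult_upto v n u" using Suc.prems by (auto simp: mult_upto_Suc split: if_splits)
      then have "pow_exp l u = V_basis v (Suc n)" by (simp add: V_basis_def)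
      then show ?thesis by force
    qed
  qed
  then obtain i where i: "i \<in> {1..n}" "pow_exp l u = V_basis v i" by blast
  have "(\<Sum>k=1..n. (if k = i then 1 else 0) * V_basis v k x) = V_basis v i x" for x
    using i(1) by (simp add: if_distrib[of "\<lambda>a. a * _"] sum.delta cong: if_cong)
  then show "\<exists>\<alpha>. \<forall>x. pow_exp l u x = (\<Sum>i=1..n. \<alpha> i * V_basis v i x)"
    using i(2) by (intro exI[of _ "\<lambda>k. if k = i then 1 else 0"]) simp
next
  show "\<exists>\<alpha>. \<forall>x. 0 = (\<Sum>i=1..n. \<alpha> i * V_basis v i x)" by (rule exI[of _ "\<lambda>_. 0"]) simp
next
  fix f g assume "\<exists>\<alpha>. \<forall>x. f x = (\<Sum>i=1..n. \<alpha> i * V_basis v i x)" "\<exists>\<alpha>. \<forall>x. g x = (\<Sum>i=1..n. \<alpha> i * V_basis v i x)"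
  then obtain \<alpha> \<beta> where "\<forall>x. f x = (\<Sum>i=1..n. \<alpha> i * V_basis v i x)" "\<forall>x. g x = (\<Sum>i=1..n. \<beta> i * V_basis v i x)" by blast
  then show "\<exists>\<alpha>. \<forall>x. f x + g x = (\<Sum>i=1..n. \<alpha> i * V_basis v i x)"
    by (intro exI[of _ "\<lambda>i. \<alpha> i + \<beta> i"]) (simp add: distrib_right sum.distrib)
next
  fix c f assume "\<exists>\<alpha>. \<forall>x. f x = (\<Sum>i=1..n. \<alpha> i * V_basis v i x)"
  then obtain \<alpha> where "\<forall>x. f x = (\<Sum>i=1..n. \<alpha> i * V_basis v i x)" by blast
  then show "\<exists>\<alpha>. \<forall>x. c * f x = (\<Sum>i=1..n. \<alpha> i * V_basis v i x)"
    by (intro exI[of _ "\<lambda>i. c * \<alpha> i"]) (simp add: sum_distrib_left mult.assoc)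
qed

text \<open>Write \<open>q\<close> as the square of its root and spend one root on one factor
  \<open>n\<close>.\<close>

lemma pow_geometric_bounded:
  fixes q :: real
  assumes "0 < q" "q < 1"
  shows "\<exists>C. \<forall>n. real n ^ l * q ^ n \<le> C"
  using assms
proof (induction l arbitrary: q)
  case 0
  then show ?case by (intro exI[of _ 1]) (simp add: power_le_one)
next
  case (Suc l)
  have s: "0 < sqrt q" "sqrt q < 1" using Suc.prems by auto
  obtain C where C: "\<And>n. real n ^ l * sqrt q ^ n \<le> C" using Suc.IH[OF s] by blast
  have "(\<lambda>n. of_nat n * sqrt q ^ n) \<longlonglongrightarrow> 0" by (rule powser_times_n_limit_0) (use s in simp)
  then have "Bseq (\<lambda>n. of_nat n * sqrt q ^ n)" by (intro convergent_imp_Bseq convergentI)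
  then obtain D where D: "\<And>n. norm (of_nat n * sqrt q ^ n) \<le> D" unfolding Bseq_def by blast
  have "real n ^ Suc l * q ^ n \<le> C * D" for n
  proof -
    have "q ^ n = sqrt q ^ n * sqrt q ^ n" using Suc.prems by (simp add: power_mult_distrib[symmetric])
    then have "real n ^ Suc l * q ^ n = (real n ^ l * sqrt q ^ n) * (real n * sqrt q ^ n)" by simp
    also have "\<dots> \<le> C * D"
    proof (rule mult_mono[OF C])
      show "real n * sqrt q ^ n \<le> D" using D[of n] s by simp
      have "sqrt q \<le> C" using C[of 1] by simp
      then show "0 \<le> C" using s(1) by linarith
    qed (use s in auto)
    finally show ?thesis .
  qed
  then show ?case by blast
qed

lemma pow_exp_bound_right:
  assumes "0 < u" "u < r"
  shows "\<exists>C\<ge>0. \<forall>x\<ge>0. norm (pow_exp l u x) \<le> C * r powi x"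
proof -
  obtain C where C: "\<And>n. real n ^ l * (u / r) ^ n \<le> C"
    using pow_geometric_bounded[of "u / r" l] assms by auto
  have "norm (pow_exp l u x) \<le> C * r powi x" if "x \<ge> 0" for x
  proof -
    have "norm (pow_exp l u x) = (real (nat x) ^ l * (u / r) ^ nat x) * r powi x"
      using that assms by (simp add: pow_exp_def norm_mult norm_power norm_power_int power_int_def power_divide)
    also have "\<dots> \<le> C * r powi x" using C assms by (intro mult_right_mono) auto
    finally show ?thesis .
  qed
  moreover have "0 \<le> C" using order_trans[OF _ C[of 0]] by simp
  ultimately show ?thesis by blast
qed

lemma two_bounded_pow_exp:
  assumes "0 < s" "s < u" "u < r"
  shows "two_bounded s r (pow_exp l u)"
proof -
  obtain C where C: "C \<ge> 0" "\<And>x. x \<ge> 0 ==> norm (pow_exp l u x) \<le> C * r powi x"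
    using pow_exp_bound_right[of u r l] assms by auto
  obtain D where D: "D \<ge> 0" "\<And>x. x \<ge> 0 ==> norm (pow_exp l (1 / u) x) \<le> D * (1 / s) powi x"
    using pow_exp_bound_right[of "1 / u" "1 / s" l] assms by (auto simp: divide_strict_left_mono)
  have "norm (pow_exp l u x) \<le> (C + D) * (s powi x + r powi x)" for x
  proof (cases "x \<ge> 0")
    case True
    have "C * r powi x \<le> (C + D) * (s powi x + r powi x)"
      using C(1) D(1) assms by (intro mult_mono) auto
    then show ?thesis using C(2)[OF True] by simp
  next
    case False
    have "norm (pow_exp l u x) = norm (pow_exp l (1 / u) (- x))"
      using assms by (simp add: pow_exp_def norm_mult norm_power norm_power_int power_int_minus power_int_divide_distrib field_simps)
    also have "\<dots> \<le> D * (1 / s) powi (- x)" using D(2)[of "- x"] False by simp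
    also have "\<dots> = D * s powi x" using assms by (simp add: power_int_minus power_int_divide_distrib)
    also have "\<dots> \<le> (C + D) * (s powi x + r powi x)"
      using C(1) D(1) assms by (intro mult_mono) auto
    finally show ?thesis .
  qed
  then show ?thesis by (rule two_boundedI)
qed

lemma two_bounded_V_space:
  assumes "0 < s" "\<And>i. i \<in> {1..n} ==> s < v i \<and> v i < r" "0 < r" and f: "f \<in> V_space v n"
  shows "two_bounded s r f"
  using f
proof (rule V_space_subspaceI[rotated -1])
  fix l u assume "l < mult_upto v n u"
  then have "u \<in> v ` {1..n}" by (rule mult_upto_pos)
  then show "two_bounded s r (pow_exp l u)" using assms by (intro two_bounded_pow_exp) auto
next
  show "two_bounded s r (\<lambda>x. 0)" by (rule two_boundedI[of _ 0]) simp
qed (auto intro: two_bounded_add two_bounded_cmult)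

lemma fvec_span_sum: "finite I ==> (\<And>i. i \<in> I ==> f i \<in> fvec.span A) ==> (\<lambda>x. \<Sum>i\<in>I. f i x) \<in> fvec.span A"
proof (induction I rule: finite_induct)
  case empty
  then show ?case using fvec.span_zero by (simp add: zero_fun_def)
next
  case (insert i I)
  then show ?case using fvec.span_add[of "f i" A "\<lambda>x. \<Sum>i\<in>I. f i x"] by (simp add: plus_fun_def)
qed

lemma lcoeff_cong: "0 < r ==> (\<And>w. norm w = r ==> g w = h w) ==> lcoeff r g = lcoeff r h"
  unfolding lcoeff_def[abs_def] by (intro ext circ_avg_cong) auto

lemma lcoeff_dop:
  assumes r: "0 < r" and g: "continuous_on (sphere 0 r) g"
  shows "lcoeff r (\<lambda>w. g w * ((c - w) / w)) = (\<lambda>d. c * lcoeff r g (d + 1) - lcoeff r g d)"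
proof
  fix d
  have cont: "continuous_on (sphere 0 r) (\<lambda>w. g w / w powi k)" for k
    using r by (intro continuous_on_divide g continuous_on_sphere_powi) auto
  have "lcoeff r (\<lambda>w. g w * ((c - w) / w)) d = circ_avg r (\<lambda>w. c * (g w / w powi (d + 1 + 1)) - g w / w powi (d + 1))"
    unfolding lcoeff_def
  proof (rule circ_avg_cong[OF r])
    fix w :: complex assume "norm w = r"
    then have "w \<noteq> 0" using r by auto
    then show "g w * ((c - w) / w) / w powi (d + 1) = c * (g w / w powi (d + 1 + 1)) - g w / w powi (d + 1)"
      by (simp add: power_int_add field_simps power2_eq_square)
  qed
  also have "\<dots> = circ_avg r (\<lambda>w. c * (g w / w powi (d + 1 + 1))) - circ_avg r (\<lambda>w. g w / w powi (d + 1))"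
    by (intro circ_avg_diff r continuous_on_mult continuous_on_const cont)
  also have "circ_avg r (\<lambda>w. c * (g w / w powi (d + 1 + 1))) = c * circ_avg r (\<lambda>w. g w / w powi (d + 1 + 1))"
    by (intro circ_avg_cmult r cont)
  finally show "lcoeff r (\<lambda>w. g w * ((c - w) / w)) d = c * lcoeff r g (d + 1) - lcoeff r g d"
    by (simp add: lcoeff_def)
qed

lemma prod_symbol_analytic: "0 < r1 ==> g analytic_on annulus r1 r2 ==>
  (\<lambda>w. g w * (\<Prod>i=k + 1..n. (c i - w) / w)) analytic_on annulus r1 r2"
  by (intro analytic_intros) (auto simp: in_annulus)

lemma conv_kernel_lcoeff:
  assumes "g analytic_on annulus r1 r2" "0 < r1" "r1 \<le> s" "s \<le> r2" "r1 \<le> q" "q \<le> r2"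
  shows "conv_kernel s q (lcoeff r1 g)"
  by unfold_locales (use assms in \<open>auto intro: ann_summable_lcoeff\<close>)

text \<open>One factor of the symbol at a time becomes a difference operator on the argument, by
  \<open>lcoeff_dop\<close> and \<open>conv_by_parts\<close>.\<close>

lemma conv_op_DD:
  assumes g: "g analytic_on annulus r1 r2" and r: "0 < r1" "r1 \<le> s" "s \<le> r2" "r1 \<le> q" "q \<le> r2" "r1 \<le> r2"
    and f: "two_bounded s q f" and k: "k \<le> n"
  shows "conv_op (lcoeff r1 (\<lambda>w. g w * (\<Prod>i=k + 1..n. (c i - w) / w))) f = conv_op (lcoeff r1 g) (DD c k n f)"
  using k f
proof (induction n arbitrary: f rule: dec_induct)
  case base
  then show ?case by (simp add: DD_id)
next
  case (step n)
  let ?g = "\<lambda>w. g w * (\<Prod>i=k + 1..n. (c i - w) / w)"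
  have an: "?g analytic_on annulus r1 r2" by (intro prod_symbol_analytic r g)
  have l: "lcoeff r1 (\<lambda>w. ?g w * ((c (Suc n) - w) / w)) = (\<lambda>d. c (Suc n) * lcoeff r1 ?g (d + 1) - lcoeff r1 ?g d)"
    by (rule lcoeff_dop[OF r(1) continuous_on_sphere[OF an]]) (use r in auto)
  interpret conv_kernel s q "lcoeff r1 ?g"
    by (rule conv_kernel_lcoeff[OF an]) (use r in auto)
  have "(\<lambda>w. g w * (\<Prod>i=k + 1..Suc n. (c i - w) / w)) = (\<lambda>w. ?g w * ((c (Suc n) - w) / w))"
    using step.hyps by (simp add: mult.assoc)
  then have "conv_op (lcoeff r1 (\<lambda>w. g w * (\<Prod>i=k + 1..Suc n. (c i - w) / w))) f =
      conv_op (\<lambda>d. c (Suc n) * lcoeff r1 ?g (d + 1) - lcoeff r1 ?g d) f"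
    by (simp only: l)
  also have "\<dots> = conv_op (lcoeff r1 ?g) (dop (c (Suc n)) f)" by (rule conv_by_parts[OF step.prems])
  also have "\<dots> = conv_op (lcoeff r1 g) (DD c k n (dop (c (Suc n)) f))"
    by (rule step.IH) (intro two_bounded_dop step.prems s r)
  finally show ?case using step.hyps by simp
qed

lemma conv_op_lcoeff_mult:
  assumes g: "g analytic_on annulus r1 r2" and h: "h analytic_on annulus r1 r2"
    and r: "0 < r1" "r1 \<le> s" "s \<le> r2" "r1 \<le> q" "q \<le> r2" "r1 \<le> r2" and f: "two_bounded s q f"
  shows "conv_op (lcoeff r1 g) (conv_op (lcoeff r1 h) f) = conv_op (lcoeff r1 (\<lambda>w. g w * h w)) f"
proof (rule conv_conv[OF _ _ _ f])
  show "conv_kernel s q (lcoeff r1 g)" "conv_kernel s q (lcoeff r1 h)"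
    by (intro conv_kernel_lcoeff[OF g] conv_kernel_lcoeff[OF h] r)+
  have "annulus r1 r1 \<subseteq> annulus r1 r2" using r by (intro annulus_mono) auto
  then show "((\<lambda>d. lcoeff r1 g d * lcoeff r1 h (e - d)) has_sum lcoeff r1 (\<lambda>w. g w * h w) e) UNIV" for e
    by (intro lcoeff_mult r analytic_on_subset[OF g] analytic_on_subset[OF h])
qed

lemma conv_op_lcoeff_power:
  assumes g: "g analytic_on annulus r1 r2" and u: "0 < r1" "r1 \<le> u" "u \<le> r2"
  shows "conv_op (lcoeff r1 g) (\<lambda>x. of_real u powi x) y = g (of_real u) * of_real u powi y"
proof -
  have "annulus u u \<subseteq> annulus r1 r2" using u by (intro annulus_mono) auto
  then have "((\<lambda>d. lcoeff u g d * of_real u powi d) has_sum g (of_real u)) UNIV"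
    by (intro laurent_has_sum analytic_on_subset[OF g]) (use u in auto)
  moreover have "lcoeff u g = lcoeff r1 g" using lcoeff_indep[OF g] u by auto
  ultimately have "((\<lambda>d. lcoeff r1 g d * of_real u powi d * of_real u powi y) has_sum g (of_real u) * of_real u powi y) UNIV"
    by (intro has_sum_cmult_left) simp
  then have "(\<Sum>\<^sub>\<infinity>d. lcoeff r1 g d * of_real u powi d * of_real u powi y) = g (of_real u) * of_real u powi y"
    by (rule infsumI)
  then show ?thesis
    unfolding conv_op_def using infsum_shift_int[of "\<lambda>x. lcoeff r1 g (x - y) * of_real u powi x" y] u
    by (simp add: power_int_add mult.assoc)
qed

section \<open>Biorthogonality\<close>

text \<open>The powers of the function \<phi> enter only through analyticity, absence of zeros and
  additivity in time, so that integer and real times can be treated together; \<open>TT\<close> only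
  has to be an additive group.\<close>

locale contour_setting =
  fixes TT :: "real set" and v :: "nat => real" and N :: nat and R \<rho> :: real
    and P :: "real => complex => complex" and T :: "nat => real" and y :: "nat => int"
  assumes N: "1 \<le> N" and rho: "0 < \<rho>" and v: "\<And>i. i \<in> {1..N} ==> \<rho> < v i \<and> v i < R"
    and P_an: "\<And>t. t \<in> TT ==> P t analytic_on annulus \<rho> R"
    and P_nz: "\<And>t w. t \<in> TT ==> w \<in> annulus \<rho> R ==> P t w \<noteq> 0"
    and P_add: "\<And>s t w. s \<in> TT ==> t \<in> TT ==> w \<in> annulus \<rho> R ==> P s w * P t w = P (s + t) w"
    and TT_0: "0 \<in> TT" and TT_add: "\<And>s t. s \<in> TT ==> t \<in> TT ==> s + t \<in> TT"
    and TT_diff: "\<And>s t. s \<in> TT ==> t \<in> TT ==> s - t \<in> TT"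
    and T_in: "\<And>i. i \<in> {1..N} ==> T i \<in> TT"
begin

abbreviation "Gt \<equiv> G_trans v R P"
abbreviation "Gm \<equiv> G_minus v R P N T y"
abbreviation "Ff \<equiv> F_fun v R P"
abbreviation "PsiN n t \<equiv> Psi v \<rho> P T y (n, t)"
abbreviation "fac k n w \<equiv> \<Prod>i=k + 1..n. (cv v i - w) / w"
abbreviation "fac0 n w \<equiv> \<Prod>i=1..n. (cv v i - w) / w"

text \<open>Midpoints that leave room on both sides: \<rho> < \<open>lo\<close> < all
  \<open>v i\<close> < \<open>hi\<close> < \<open>R\<close>. Functions in \<open>VV n\<close> are
  \<open>two_bounded lo hi\<close>, while kernels decay at the rates of the outer radii, so pairings
  converge geometrically.\<close>

definition lo :: real where "lo = (\<rho> + Min (v ` {1..N})) / 2"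
definition hi :: real where "hi = (Max (v ` {1..N}) + R) / 2"

lemma lo_hi: "0 < lo" "\<rho> < lo" "\<And>i. i \<in> {1..N} ==> lo < v i" "\<And>i. i \<in> {1..N} ==> v i < hi"
  "hi < R" "0 < hi" "lo < hi" "\<rho> < R" "lo < R" "\<rho> < hi" "0 < R"
proof -
  have ne: "v ` {1..N} \<noteq> {}" using N by auto
  have "Min (v ` {1..N}) \<in> v ` {1..N}" "Max (v ` {1..N}) \<in> v ` {1..N}" using ne by (auto intro!: Min_in Max_in)
  then have 1: "\<rho> < Min (v ` {1..N})" "Max (v ` {1..N}) < R" using v by auto
  have 2: "Min (v ` {1..N}) \<le> v i" "v i \<le> Max (v ` {1..N})" if "i \<in> {1..N}" for i using that by auto
  have gen: "0 < (\<rho> + a) / 2 \<and> \<rho> < (\<rho> + a) / 2 \<and> (\<rho> + a) / 2 < a \<and> b < (b + R) / 2 \<and> (b + R) / 2 < R"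
    if "\<rho> < a" "b < R" for a b using that rho by auto
  have 3: "0 < lo" "\<rho> < lo" "lo < Min (v ` {1..N})" "Max (v ` {1..N}) < hi" "hi < R"
    using gen[OF 1, folded lo_def hi_def] by blast+
  show *: "0 < lo" "\<rho> < lo" "\<And>i. i \<in> {1..N} ==> lo < v i" "\<And>i. i \<in> {1..N} ==> v i < hi" "hi < R"
    using 3 less_le_trans[OF 3(3) 2(1)] le_less_trans[OF 2(2) 3(4)] by blast+
  have "1 \<in> {1..N}" using N by simp
  from *(3)[OF this] *(4)[OF this] show "lo < hi" by simp
  then show "0 < hi" "\<rho> < R" "lo < R" "\<rho> < hi" "0 < R" using * rho by auto
qed

lemma v_pos: "i \<in> {1..N} ==> 0 < v i"
  using v rho by force

lemma v_annulus: "i \<in> {1..N} ==> complex_of_real (v i) \<in> annulus \<rho> R"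
  using v v_pos by (force simp: in_annulus)

definition CC :: "real => (int => complex) => int => complex" where
  "CC t = conv_op (lcoeff \<rho> (P t))"

lemma kernel_P:
  assumes "t \<in> TT" "\<rho> \<le> s" "s \<le> R" "\<rho> \<le> q" "q \<le> R"
  shows "conv_kernel s q (lcoeff \<rho> (P t))"
  by (rule conv_kernel_lcoeff[OF P_an]) (use assms rho in auto)

lemma kernel_lo_hi: "t \<in> TT ==> conv_kernel lo hi (lcoeff \<rho> (P t))"
  using lo_hi by (intro kernel_P) auto

lemma kernel_hi: "t \<in> TT ==> conv_kernel hi hi (lcoeff \<rho> (P t))"
  using lo_hi by (intro kernel_P) auto

lemma CC_CC:
  assumes "s \<in> TT" "t \<in> TT" "\<rho> \<le> a" "a \<le> R" "\<rho> \<le> b" "b \<le> R" "two_bounded a b f"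
  shows "CC s (CC t f) = CC (s + t) f"
proof -
  have "CC s (CC t f) = conv_op (lcoeff \<rho> (\<lambda>w. P s w * P t w)) f"
    unfolding CC_def by (rule conv_op_lcoeff_mult[OF P_an P_an]) (use assms rho lo_hi in auto)
  also have "lcoeff \<rho> (\<lambda>w. P s w * P t w) = lcoeff \<rho> (P (s + t))"
    using assms rho lo_hi by (intro lcoeff_cong P_add) (auto simp: in_annulus)
  finally show ?thesis by (simp add: CC_def)
qed

lemma CC_power: "t \<in> TT ==> i \<in> {1..N} ==> CC t (\<lambda>x. cv v i powi x) z = P t (cv v i) * cv v i powi z"
  unfolding CC_def using v rho by (intro conv_op_lcoeff_power[OF P_an]) (auto simp: less_imp_le)

definition VV :: "nat => (int => complex) set" where
  "VV n = V_space v n"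

lemma VV_iff: "n \<le> N ==> f \<in> VV n \<longleftrightarrow> DD (cv v) 0 n f = (\<lambda>x. 0)"
  unfolding VV_def using v_pos by (intro V_space_iff_kernel) auto

lemma VV_bounded: "n \<le> N ==> f \<in> VV n ==> two_bounded lo hi f"
  unfolding VV_def using lo_hi by (intro two_bounded_V_space) auto

definition LL :: "nat => real => nat => (int => complex) => complex" where
  "LL n t k f = CC (t - T k) (DD (cv v) k n f) (y k)"

lemma Psi_eq:
  assumes "k \<le> n" "1 \<le> k" "n \<le> N"
  shows "PsiN n t k x =
    lcoeff \<rho> (\<lambda>w. P (t - T k) w * (fac k n w)) (x - y k)"
  unfolding Psi_def lcoeff_def Let_def fst_conv snd_conv
proof (rule circ_avg_cong[OF rho])
  fix w :: complex assume "norm w = \<rho>"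
  then have w: "w \<noteq> 0" using rho by auto
  have "w powi (x - y k + int n - int k + 1) = w powi (x - y k + 1) * w ^ (n - k)"
    using assms(1) w by (simp add: power_int_add power_int_diff of_nat_diff[symmetric] power_diff field_simps)
  moreover have "(fac k n w) = (\<Prod>i=k + 1..n. cv v i - w) / w ^ (n - k)"
    by (simp add: prod_dividef)
  ultimately show "P (t - T k) w / w powi (x - y k + int n - int k + 1) *
      (if k \<le> n then \<Prod>i = k + 1..n. complex_of_real (v i) - w
       else (\<Prod>i = 1..n. complex_of_real (v i) - w) / (\<Prod>i = 1..k. complex_of_real (v i) - w)) =
      P (t - T k) w * (\<Prod>i = k + 1..n. (complex_of_real (v i) - w) / w) / w powi (x - y k + 1)"
    using assms(1) by (simp add: field_simps)
qed

lemma Psi_pairing: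
  assumes k: "k \<in> {1..n}" and n: "n \<le> N" and t: "t \<in> TT" and f: "two_bounded a b f"
    and ab: "\<rho> \<le> a" "a \<le> R" "\<rho> \<le> b" "b \<le> R"
  shows "(\<lambda>x. norm (PsiN n t k x * f x)) summable_on UNIV"
    and "((\<lambda>x. PsiN n t k x * f x) has_sum LL n t k f) UNIV"
proof -
  have tT: "t - T k \<in> TT" using T_in[of k] t k n by (intro TT_diff) auto
  let ?g = "\<lambda>w. P (t - T k) w * (fac k n w)"
  have an: "?g analytic_on annulus \<rho> R" by (intro prod_symbol_analytic rho P_an tT)
  interpret conv_kernel a b "lcoeff \<rho> ?g"
    by (rule conv_kernel_lcoeff[OF an]) (use rho ab lo_hi in auto)
  have eq: "PsiN n t k = (\<lambda>x. lcoeff \<rho> ?g (x - y k))"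
    using k n by (intro ext Psi_eq) auto
  show 1: "(\<lambda>x. norm (PsiN n t k x * f x)) summable_on UNIV"
    unfolding eq by (rule conv_abs_summable[OF f])
  have "conv_op (lcoeff \<rho> ?g) f (y k) = LL n t k f"
    unfolding LL_def CC_def
    by (rule fun_cong[OF conv_op_DD[OF P_an[OF tT]]]) (use rho ab lo_hi f k in auto)
  then have "(\<Sum>\<^sub>\<infinity>x. PsiN n t k x * f x) = LL n t k f" by (simp add: eq conv_op_def)
  then show "((\<lambda>x. PsiN n t k x * f x) has_sum LL n t k f) UNIV"
    using has_sum_infsum[OF abs_summable_summable[OF 1]] by simp
qed

lemma
  assumes t: "t \<in> TT" and k: "k \<in> {1..n}" "n \<le> N"
  shows LL_add: "two_bounded lo hi f ==> two_bounded lo hi g ==> LL n t k (\<lambda>x. f x + g x) = LL n t k f + LL n t k g"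
    and LL_cmult: "two_bounded lo hi f ==> LL n t k (\<lambda>x. c * f x) = c * LL n t k f"
    and LL_diff: "two_bounded lo hi f ==> two_bounded lo hi g ==> LL n t k (\<lambda>x. f x - g x) = LL n t k f - LL n t k g"
    and LL_zero: "LL n t k (\<lambda>x. 0) = 0"
proof -
  have "t - T k \<in> TT" using T_in[of k] t k by (intro TT_diff) auto
  then interpret conv_kernel lo hi "lcoeff \<rho> (P (t - T k))" by (rule kernel_lo_hi)
  show "two_bounded lo hi f ==> two_bounded lo hi g ==> LL n t k (\<lambda>x. f x + g x) = LL n t k f + LL n t k g"
    by (simp add: LL_def CC_def DD_add conv_add two_bounded_DD lo_hi)
  show "two_bounded lo hi f ==> LL n t k (\<lambda>x. c * f x) = c * LL n t k f"
    by (simp add: LL_def CC_def DD_cmult conv_cmult two_bounded_DD lo_hi)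
  show "two_bounded lo hi f ==> two_bounded lo hi g ==> LL n t k (\<lambda>x. f x - g x) = LL n t k f - LL n t k g"
    by (simp add: LL_def CC_def DD_diff conv_diff two_bounded_DD lo_hi)
  show "LL n t k (\<lambda>x. 0) = 0" by (simp add: LL_def CC_def conv_op_def)
qed

lemma LL_sum:
  assumes "t \<in> TT" "k \<in> {1..n}" "n \<le> N" "finite I" "\<And>i. i \<in> I ==> two_bounded lo hi (f i)"
  shows "LL n t k (\<lambda>x. \<Sum>i\<in>I. f i x) = (\<Sum>i\<in>I. LL n t k (f i))"
proof -
  have "LL n t k (\<lambda>x. \<Sum>i\<in>I. f i x) = (\<Sum>i\<in>I. LL n t k (f i)) \<and> two_bounded lo hi (\<lambda>x. \<Sum>i\<in>I. f i x)"
    using assms(4,5)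
  proof (induction I rule: finite_induct)
    case empty
    have "two_bounded lo hi (\<lambda>x. 0)" by (rule two_boundedI[of _ 0]) simp
    then show ?case using assms by (simp add: LL_zero)
  next
    case (insert i I)
    then show ?case using assms by (auto simp: LL_add intro!: two_bounded_add)
  qed
  then show ?thesis by simp
qed

text \<open>The exponential is an eigenfunction of \<open>CC\<close>. The value is the diagonal
  entry of the triangular system formed by the functionals \<open>LL\<close>.\<close>

lemma LL_power:
  assumes "t \<in> TT" "k \<in> {1..N}" "k \<le> n" "DD (cv v) k n f = (\<lambda>x. \<theta> * cv v k powi x)"
  shows "LL n t k f = \<theta> * (P (t - T k) (cv v k) * cv v k powi y k)"
proof -
  have tT: "t - T k \<in> TT" using assms T_in by (intro TT_diff)
  interpret conv_kernel lo hi "lcoeff \<rho> (P (t - T k))" using tT by (rule kernel_lo_hi)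
  have "two_bounded lo hi (pow_exp 0 (v k))" using assms lo_hi by (intro two_bounded_pow_exp) auto
  then have "two_bounded lo hi (\<lambda>x. cv v k powi x)" by (simp add: pow_exp_def[abs_def])
  then show ?thesis
    unfolding LL_def assms(4) CC_def using CC_power[OF tT assms(2), unfolded CC_def] by (simp add: conv_cmult)
qed

text \<open>Forward elimination: once \<open>DD\<close> from level \<open>k\<close> vanishes,
  \<open>DD\<close> from level \<open>Suc k\<close> is a multiple of an exponential, and the
  functional with index \<open>Suc k\<close> detects the multiple.\<close>

lemma LL_zero_DD:
  assumes t: "t \<in> TT" and n: "n \<le> N" and f: "f \<in> VV n" and L: "\<And>k. 1 \<le> k ==> k < j ==> LL n t k f = 0"
    and j: "j \<le> Suc n" and k: "k < j"
  shows "DD (cv v) k n f = (\<lambda>x. 0)"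
  using k
proof (induction k)
  case 0
  then show ?case using VV_iff n f by simp
next
  case (Suc k)
  have k: "Suc k \<in> {1..N}" "Suc k \<le> n" using Suc.prems n j by auto
  have c: "cv v (Suc k) \<noteq> 0" using v_pos[OF k(1)] by simp
  have "dop (cv v (Suc k)) (DD (cv v) (Suc k) n f) = (\<lambda>x. 0)"
    using Suc k DD_Suc_left[of k n "cv v" f] by simp
  then have D: "DD (cv v) (Suc k) n f = (\<lambda>x. DD (cv v) (Suc k) n f 0 * cv v (Suc k) powi x)"
    using dop_kernel[OF c] by blast
  have "t - T (Suc k) \<in> TT" using t T_in[OF k(1)] by (intro TT_diff)
  then have "DD (cv v) (Suc k) n f 0 = 0"
    using LL_power[OF t k D] L[of "Suc k"] Suc.prems P_nz v_annulus[OF k(1)] c by simp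
  then show ?case using D by simp
qed

lemma LL_inj:
  assumes "t \<in> TT" "n \<le> N" "f \<in> VV n" "\<And>k. k \<in> {1..n} ==> LL n t k f = 0"
  shows "f = (\<lambda>x. 0)"
  using LL_zero_DD[of t n f "Suc n" n] assms by (simp add: DD_id)

text \<open>For a dual function the elimination stops at \<open>j\<close>, leaving an exponential
  with coefficient \<theta>, the reciprocal of the diagonal entry. These coefficients normalise the
  columns added along the path.\<close>

lemma LL_first:
  assumes t: "t \<in> TT" and n: "n \<le> N" and f: "f \<in> VV n" and j: "1 \<le> j" "j \<le> n"
    and L: "\<And>k. k \<in> {1..n} ==> LL n t k f = (if k = j then 1 else 0)"
  obtains \<theta> where "DD (cv v) j n f = (\<lambda>x. \<theta> * cv v j powi x)" "\<theta> * (P (t - T j) (cv v j) * cv v j powi y j) = 1"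
proof -
  have jN: "j \<in> {1..N}" using j n by auto
  have c: "cv v j \<noteq> 0" using v_pos[OF jN] by simp
  have "DD (cv v) (j - 1) n f = (\<lambda>x. 0)"
    by (rule LL_zero_DD[OF t n f, of j]) (use j L in auto)
  then have "dop (cv v j) (DD (cv v) j n f) = (\<lambda>x. 0)"
    using DD_Suc_left[of "j - 1" n "cv v" f] j by simp
  then have D: "DD (cv v) j n f = (\<lambda>x. DD (cv v) j n f 0 * cv v j powi x)"
    using dop_kernel[OF c] by blast
  then show ?thesis using that LL_power[OF t jN j(2) D] L[of j] j by simp
qed

text \<open>Induction on the level: solve \<open>dop\<close> for the lower functionals, then add a
  multiple of the new exponential. That exponential is killed by \<open>dop\<close>, so it adjusts
  the last functional without disturbing the others.\<close>

lemma LL_surj: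
  assumes t: "t \<in> TT" and n: "n \<le> N"
  shows "\<exists>f\<in>VV n. \<forall>k\<in>{1..n}. LL n t k f = z k"
  using n
proof (induction n)
  case 0
  have "(\<lambda>x. 0) \<in> VV 0" by (simp add: VV_def V_space_zero)
  then show ?case by auto
next
  case (Suc n)
  let ?c = "cv v (Suc n)"
  have Sn: "Suc n \<in> {1..N}" using Suc.prems by simp
  have c: "?c \<noteq> 0" using v_pos[OF Sn] by simp
  obtain f where f: "f \<in> VV n" "\<And>k. k \<in> {1..n} ==> LL n t k f = z k" using Suc by auto
  obtain g where g: "dop ?c g = f" by (rule dop_surj[OF c])
  define h where "h x = ?c powi x" for x
  have dh: "dop ?c h = (\<lambda>x. 0)" using c by (simp add: h_def dop_def fun_eq_iff power_int_diff)
  have inV: "g \<in> VV (Suc n)" "h \<in> VV (Suc n)"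
    using VV_iff[OF Suc.prems] VV_iff[of n f] f(1) Suc.prems by (auto simp: g dh)
  have bd: "two_bounded lo hi g" "two_bounded lo hi h" using inV VV_bounded Suc.prems by auto
  define w where "w = P (t - T (Suc n)) ?c * ?c powi y (Suc n)"
  have w: "w \<noteq> 0" unfolding w_def using c P_nz[of "t - T (Suc n)"] v_annulus[OF Sn] t T_in[OF Sn] TT_diff by auto
  have "DD (cv v) (Suc n) (Suc n) h = (\<lambda>x. 1 * ?c powi x)" by (simp add: DD_id h_def fun_eq_iff)
  from LL_power[OF t Sn le_refl this] have Lh: "LL (Suc n) t (Suc n) h = w" by (simp add: w_def)
  define \<theta> where "\<theta> = (z (Suc n) - LL (Suc n) t (Suc n) g) / w"
  define f' where "f' x = g x + \<theta> * h x" for x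
  have "f' \<in> VV (Suc n)" unfolding f'_def VV_def using inV by (intro V_space_add V_space_cmult) (auto simp: VV_def)
  moreover have "LL (Suc n) t k f' = z k" if k: "k \<in> {1..Suc n}" for k
  proof (cases "k = Suc n")
    case True
    have "LL (Suc n) t (Suc n) f' = LL (Suc n) t (Suc n) g + \<theta> * LL (Suc n) t (Suc n) h"
      unfolding f'_def using bd t Suc.prems by (simp add: LL_add LL_cmult two_bounded_cmult)
    then show ?thesis using w True by (simp add: Lh \<theta>_def)
  next
    case False
    then have "k \<in> {1..n}" using k by auto
    moreover have "dop ?c f' = f"
      unfolding f'_def by (simp add: dop_add dop_cmult dh g)
    ultimately show ?thesis using f(2)[of k] by (simp add: LL_def)
  qed
  ultimately show ?case by blast
qed

text \<open>Biorthogonality becomes duality to the functionals, the index being reversed to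
  \<open>l = n - k\<close>. The dual functions span because \<open>f\<close> and its expansion have
  the same functionals and these separate points of \<open>VV n\<close>.\<close>

lemma is_Phi_iff:
  assumes t: "t \<in> TT" and n: "n \<le> N"
  shows "is_Phi v \<rho> P T y (n, t) \<Phi> \<longleftrightarrow>
    (\<forall>k<n. \<Phi> k \<in> VV n \<and> (\<forall>l\<in>{1..n}. LL n t l (\<Phi> k) = (if k + l = n then 1 else 0)))"
proof
  assume Phi: "is_Phi v \<rho> P T y (n, t) \<Phi>"
  then have sp: "cspan (\<Phi> ` {..<n}) = V_space v n" by (simp add: is_Phi_def)
  show "\<forall>k<n. \<Phi> k \<in> VV n \<and> (\<forall>l\<in>{1..n}. LL n t l (\<Phi> k) = (if k + l = n then 1 else 0))"
  proof (intro allI impI conjI ballI)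
    fix k assume k: "k < n"
    show V: "\<Phi> k \<in> VV n"
      unfolding VV_def sp[symmetric] cspan_eq using k by (intro fvec.span_base) auto
    fix l assume l: "l \<in> {1..n}"
    have "((\<lambda>x. PsiN n t (n - (n - l)) x * \<Phi> k x) has_sum (if k = n - l then 1 else 0)) UNIV"
    proof -
      have "n - l < n" using l by auto
      then show ?thesis using Phi k unfolding is_Phi_def fst_conv by blast
    qed
    moreover have "n - (n - l) = l" using l by auto
    ultimately have "((\<lambda>x. PsiN n t l x * \<Phi> k x) has_sum (if k = n - l then 1 else 0)) UNIV" by simp
    moreover have "((\<lambda>x. PsiN n t l x * \<Phi> k x) has_sum LL n t l (\<Phi> k)) UNIV"
      using VV_bounded[OF n V] l n t lo_hi by (intro Psi_pairing(2)) auto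
    ultimately have "LL n t l (\<Phi> k) = (if k = n - l then 1 else 0)" by (rule has_sum_unique[rotated])
    also have "k = n - l \<longleftrightarrow> k + l = n" using l k by auto
    finally show "LL n t l (\<Phi> k) = (if k + l = n then 1 else 0)" .
  qed
next
  assume *: "\<forall>k<n. \<Phi> k \<in> VV n \<and> (\<forall>l\<in>{1..n}. LL n t l (\<Phi> k) = (if k + l = n then 1 else 0))"
  have bd: "two_bounded lo hi (\<Phi> k)" if "k < n" for k using * VV_bounded[OF n] that by auto
  have "cspan (\<Phi> ` {..<n}) = V_space v n"
  proof
    show "cspan (\<Phi> ` {..<n}) \<subseteq> V_space v n"
      unfolding cspan_eq V_space_def
      by (rule fvec.span_minimal) (use * in \<open>auto simp: VV_def V_space_def cspan_eq\<close>)
    show "V_space v n \<subseteq> cspan (\<Phi> ` {..<n})"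
    proof
      fix f assume "f \<in> V_space v n"
      then have f: "f \<in> VV n" by (simp add: VV_def)
      define g where "g x = (\<Sum>k<n. LL n t (n - k) f * \<Phi> k x)" for x
      have g: "g \<in> VV n" unfolding g_def VV_def
        using * by (intro V_space_sum V_space_cmult) (auto simp: VV_def)
      have "(\<lambda>x. f x - g x) = (\<lambda>x. 0)"
      proof (rule LL_inj[OF t n])
        show "(\<lambda>x. f x - g x) \<in> VV n" using f g unfolding VV_def by (rule V_space_diff)
        fix l assume l: "l \<in> {1..n}"
        have "LL n t l g = (\<Sum>k<n. LL n t l (\<lambda>x. LL n t (n - k) f * \<Phi> k x))"
          unfolding g_def using l n t bd by (intro LL_sum two_bounded_cmult) auto
        also have "\<dots> = (\<Sum>k<n. LL n t (n - k) f * (if k + l = n then 1 else 0))"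
          using l n t bd * by (intro sum.cong) (auto simp: LL_cmult)
        also have "\<dots> = (\<Sum>k\<in>{n - l}. LL n t (n - k) f * (if k + l = n then 1 else 0))"
          using l by (intro sum.mono_neutral_right) auto
        also have "\<dots> = LL n t l f" using l by auto
        finally show "LL n t l (\<lambda>x. f x - g x) = 0"
          using l n t VV_bounded[OF n f] VV_bounded[OF n g] by (simp add: LL_diff)
      qed
      then have "f = g" by (simp add: fun_eq_iff)
      also have "g \<in> cspan (\<Phi> ` {..<n})"
        unfolding cspan_eq g_def by (intro fvec_span_sum fvec.span_scale fvec.span_base) auto
      finally show "f \<in> cspan (\<Phi> ` {..<n})" .
    qed
  qed
  moreover have "((\<lambda>x. PsiN n t (n - l) x * \<Phi> k x) has_sum (if k = l then 1 else 0)) UNIV"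
    if kl: "k < n" "l < n" for k l
  proof -
    have "((\<lambda>x. PsiN n t (n - l) x * \<Phi> k x) has_sum LL n t (n - l) (\<Phi> k)) UNIV"
      using bd[OF kl(1)] kl n t lo_hi by (intro Psi_pairing(2)) auto
    moreover have "LL n t (n - l) (\<Phi> k) = (if k = l then 1 else 0)" using * kl by auto
    ultimately show ?thesis by simp
  qed
  ultimately show "is_Phi v \<rho> P T y (n, t) \<Phi>" by (simp add: is_Phi_def)
qed

lemma is_Phi_unique:
  assumes t: "t \<in> TT" and n: "n \<le> N" and "is_Phi v \<rho> P T y (n, t) \<Phi>" "is_Phi v \<rho> P T y (n, t) \<Phi>'" "k < n"
  shows "\<Phi> k = \<Phi>' k"
proof -
  have *: "\<Phi> k \<in> VV n" "\<Phi>' k \<in> VV n" "\<And>l. l \<in> {1..n} ==> LL n t l (\<Phi> k) = LL n t l (\<Phi>' k)"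
    using assms(3-5) unfolding is_Phi_iff[OF t n] by auto
  have "(\<lambda>x. \<Phi> k x - \<Phi>' k x) = (\<lambda>x. 0)"
  proof (rule LL_inj[OF t n])
    show "(\<lambda>x. \<Phi> k x - \<Phi>' k x) \<in> VV n" using * unfolding VV_def by (intro V_space_diff)
    fix l assume "l \<in> {1..n}"
    then show "LL n t l (\<lambda>x. \<Phi> k x - \<Phi>' k x) = 0"
      using * VV_bounded[OF n] n t by (simp add: LL_diff)
  qed
  then show ?thesis by (simp add: fun_eq_iff)
qed

lemma is_Phi_exists:
  assumes t: "t \<in> TT" and n: "n \<le> N"
  shows "\<exists>\<Phi>\<in>{..<n} \<rightarrow>\<^sub>E UNIV. is_Phi v \<rho> P T y (n, t) \<Phi>"
proof -
  have "\<forall>k\<in>{..<n}. \<exists>f. f \<in> VV n \<and> (\<forall>l\<in>{1..n}. LL n t l f = (if k + l = n then 1 else 0))"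
  proof
    fix k show "\<exists>f. f \<in> VV n \<and> (\<forall>l\<in>{1..n}. LL n t l f = (if k + l = n then 1 else 0))"
      using LL_surj[OF t n, of "\<lambda>l. if k + l = n then 1 else 0"] by blast
  qed
  from bchoice[OF this] obtain \<Phi> where "\<forall>k\<in>{..<n}. \<Phi> k \<in> VV n \<and> (\<forall>l\<in>{1..n}. LL n t l (\<Phi> k) = (if k + l = n then 1 else 0))"
    by blast
  then have "is_Phi v \<rho> P T y (n, t) (restrict \<Phi> {..<n})" unfolding is_Phi_iff[OF t n] by simp
  then show ?thesis by (intro bexI[of _ "restrict \<Phi> {..<n}"]) auto
qed

end

text \<open>The coefficient is independent of the radius, so for \<open>d \<noteq> 0\<close> it can
  be made small by sending the radius to 0 or to infinity.\<close>

lemma lcoeff_one: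
  assumes r: "0 < r"
  shows "lcoeff r (\<lambda>_. 1) d = (if d = 0 then 1 else 0)"
proof -
  have bd: "norm (lcoeff s (\<lambda>_. 1) d) * s powi d \<le> 1" if s: "0 < s" for s
  proof -
    have "norm (lcoeff s (\<lambda>_. 1) d) \<le> (1 / s powi (d + 1)) * s"
      unfolding lcoeff_def
      by (rule norm_circ_avg_le[OF s])
        (use s in \<open>auto intro!: continuous_on_divide continuous_on_sphere_powi simp: norm_divide norm_power_int\<close>)
    also have "\<dots> = 1 / s powi d" using s by (simp add: power_int_add)
    finally show ?thesis using s by (simp add: field_simps)
  qed
  have an: "(\<lambda>_. 1) analytic_on annulus s s'" for s s' by (rule analytic_on_const)
  have ind: "lcoeff s (\<lambda>_. 1) d = lcoeff s' (\<lambda>_. 1) d" if "0 < s" "0 < s'" for s s'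
    using lcoeff_indep[OF an, of "min s s'" s "max s s'" d] lcoeff_indep[OF an, of "min s s'" s' "max s s'" d] that by auto
  show ?thesis
  proof (cases "d = 0")
    case True
    then show ?thesis using circ_avg_pole_inside[of 0 r] r by (simp add: lcoeff_def)
  next
    case False
    have "norm (lcoeff r (\<lambda>_. 1) d) \<le> e" if e: "0 < e" "e < 1" for e
    proof -
      \<comment> \<open>With this radius the bound \<open>s powi (- d)\<close> is
        \<open>e ^ nat \<bar>d\<bar>\<close>, hence at most \<open>e\<close>, for either sign of
        \<open>d\<close>.\<close>
      define s where "s = (if d > 0 then 1 / e else e)"
      have s: "0 < s" using e by (simp add: s_def)
      have "norm (lcoeff r (\<lambda>_. 1) d) \<le> s powi (- d)"
        using bd[OF s] ind[OF r s] s by (simp add: power_int_minus field_simps)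
      also have "\<dots> = e ^ nat \<bar>d\<bar>"
        using False e by (auto simp: s_def power_int_def power_one_over field_simps)
      also have "\<dots> \<le> e ^ 1" using False e by (intro power_decreasing) auto
      finally show ?thesis by simp
    qed
    from this[of "min (norm (lcoeff r (\<lambda>_. 1) d) / 2) (1 / 2)"]
    have "norm (lcoeff r (\<lambda>_. 1) d) \<le> 0" by (rule_tac ccontr) (auto simp: min_less_iff_disj)
    then show ?thesis using False by simp
  qed
qed

lemma conv_op_one:
  assumes "0 < r"
  shows "conv_op (lcoeff r (\<lambda>_. 1)) f = f"
proof
  fix z
  have "conv_op (lcoeff r (\<lambda>_. 1)) f z = (\<Sum>\<^sub>\<infinity>x. if x = z then f x else 0)"
    unfolding conv_op_def lcoeff_one[OF assms] by (intro infsum_cong) auto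
  also have "\<dots> = (\<Sum>\<^sub>\<infinity>x\<in>{z}. f x)" by (rule infsum_cong_neutral) auto
  finally show "conv_op (lcoeff r (\<lambda>_. 1)) f z = f z" by simp
qed

text \<open>On an annulus free of the points \<open>c i\<close> the factors of the symbol can be
  divided out. Annuli on different sides of the \<open>c i\<close> give different inverses, and both
  sides are used.\<close>

lemma DD_right_inverse:
  assumes h: "h analytic_on annulus r1 r2" and r: "0 < r1" "r1 \<le> s" "s \<le> r2" "r1 \<le> q" "q \<le> r2" "r1 \<le> r2"
    and c: "\<And>i. i \<in> {k + 1..n} ==> c i \<notin> annulus r1 r2" and kn: "k \<le> n" and f: "two_bounded s q f"
  shows "DD c k n (conv_op (lcoeff r1 (\<lambda>w. h w / (\<Prod>i=k + 1..n. (c i - w) / w))) f) = conv_op (lcoeff r1 h) f"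
proof -
  let ?g = "\<lambda>w. h w / (\<Prod>i=k + 1..n. (c i - w) / w)"
  have nz: "(\<Prod>i=k + 1..n. (c i - w) / w) \<noteq> 0" if "w \<in> annulus r1 r2" for w
    using c that r by (auto simp: in_annulus)
  have an: "?g analytic_on annulus r1 r2"
    using nz by (intro analytic_on_divide h) (auto intro!: analytic_intros simp: in_annulus r, use r in auto)
  have ker: "conv_kernel s q (lcoeff r1 ?g)" by (rule conv_kernel_lcoeff[OF an]) (use r in auto)
  have "DD c k n (conv_op (lcoeff r1 ?g) f) = conv_op (lcoeff r1 ?g) (DD c k n f)"
    by (rule conv_kernel_DD[OF ker f, symmetric])
  also have "\<dots> = conv_op (lcoeff r1 (\<lambda>w. ?g w * (\<Prod>i=k + 1..n. (c i - w) / w))) f"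
    by (rule conv_op_DD[OF an r f kn, symmetric])
  also have "lcoeff r1 (\<lambda>w. ?g w * (\<Prod>i=k + 1..n. (c i - w) / w)) = lcoeff r1 h"
    by (rule lcoeff_cong[OF r(1)]) (use nz r in \<open>auto simp: in_annulus\<close>)
  finally show ?thesis .
qed

lemma Omega_gap:
  assumes "x \<in> Omega n" "k \<in> {1..n}"
  shows "x n + int (n - k) \<le> x k"
proof -
  have "x n + int d \<le> x (n - d)" if "d < n" for d
    using that
  proof (induction d)
    case (Suc d)
    have "x (n - d) < x (n - Suc d)"
      using assms(1) unfolding Omega_eq by (rule OmegaI_less) (use Suc.prems in auto)
    then show ?case using Suc by simp
  qed simp
  from this[of "n - k"] show ?thesis using assms(2) by simp
qed

definition restr_gt :: "int => (int => complex) => int => complex" where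
  "restr_gt a f x = (if a < x then f x else 0)"

text \<open>The slower rate \<open>s\<close> matters only at minus infinity, and there the function
  has been cut off.\<close>

lemma restr_gt_bounded:
  assumes "two_bounded s r f" "0 < s" "s \<le> r"
  shows "pow_bounded r (restr_gt a f)"
proof -
  obtain C where C: "C \<ge> 0" "\<And>x. norm (f x) \<le> C * (s powi x + r powi x)"
    by (rule two_boundedE[OF assms(1)]) (rule that)
  have q: "0 < s / r" "s / r \<le> 1" using assms by auto
  have "norm (restr_gt a f x) \<le> (C * ((s / r) powi a + 1)) * r powi x" for x
  proof (cases "a < x")
    case True
    have "(s / r) powi x = (s / r) powi (a + int (nat (x - a)))" using True by simp
    also have "\<dots> = (s / r) powi a * (s / r) ^ nat (x - a)"
      by (simp only: power_int_add[OF disjI1[OF less_imp_neq[OF q(1), symmetric]]] power_int_of_nat)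
    also have "\<dots> \<le> (s / r) powi a * 1" using q by (intro mult_left_mono power_le_one) auto
    finally have "(s / r) powi x * r powi x \<le> (s / r) powi a * r powi x"
      using assms by (intro mult_right_mono) auto
    then have "s powi x + r powi x \<le> ((s / r) powi a + 1) * r powi x"
      using assms by (simp add: power_int_divide_distrib algebra_simps)
    then have "C * (s powi x + r powi x) \<le> C * (((s / r) powi a + 1) * r powi x)"
      using C(1) by (rule mult_left_mono)
    then show ?thesis using True C(2)[of x] by (simp add: restr_gt_def)
  next
    case False
    then show ?thesis using C assms by (simp add: restr_gt_def)
  qed
  then show ?thesis by (rule pow_boundedI)
qed

section \<open>Action of the transition kernels on determinants\<close>

context contour_setting
begin

text \<open>The entries of \<open>F_fun\<close> without their signs and powers of \<open>v\<close>
  (see \<open>F_fun_eq\<close>). Raising \<open>l\<close> adds a factor to the symbol, which is the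
  recursion that \<open>Omega_cauchy_binet\<close> asks of the rows.\<close>

definition HH :: "real => int => nat => nat => int => complex" where
  "HH t x k l z = lcoeff R (\<lambda>w. P t w / (fac0 k w) * (fac0 l w)) (z - x)"

lemma cont_P_R: "t \<in> TT ==> continuous_on (sphere 0 R) (P t)"
  by (rule continuous_on_sphere[OF P_an]) (use lo_hi in auto)

lemma cont_symbol:
  assumes "t \<in> TT" "k \<le> N"
  shows "continuous_on (sphere 0 R) (\<lambda>w. P t w / (fac0 k w) * (fac0 l w))"
proof -
  have 1: "w \<noteq> 0" if "w \<in> sphere 0 R" for w :: complex using that lo_hi by auto
  have "cv v i \<noteq> w" if "w \<in> sphere 0 R" "i \<in> {1..k}" for w i
  proof -
    have "norm (cv v i) < R" using v[of i] v_pos[of i] that assms by auto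
    then show ?thesis using that by auto
  qed
  then show ?thesis using 1 assms(1)
    by (intro continuous_on_mult continuous_on_divide cont_P_R continuous_on_prod continuous_on_diff
        continuous_on_const continuous_on_id) (auto simp: prod_zero_iff)
qed

lemma HH_Suc:
  assumes "t \<in> TT" "k \<le> N"
  shows "HH t x k (Suc l) z = cv v (Suc l) * HH t x k l (z + 1) - HH t x k l z"
proof -
  define S where "S w = P t w / (fac0 k w) * (fac0 l w)" for w
  have "(\<lambda>w. P t w / (fac0 k w) * (\<Prod>i=1..Suc l. (cv v i - w) / w)) =
      (\<lambda>w. S w * ((cv v (Suc l) - w) / w))"
    by (simp add: S_def fun_eq_iff)
  moreover have "lcoeff R (\<lambda>w. S w * ((cv v (Suc l) - w) / w)) =
      (\<lambda>d. cv v (Suc l) * lcoeff R S (d + 1) - lcoeff R S d)"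
    by (rule lcoeff_dop) (use cont_symbol[OF assms, of l] lo_hi in \<open>auto simp: S_def[abs_def]\<close>)
  moreover have "z - x + 1 = z + 1 - x" by simp
  ultimately show ?thesis unfolding HH_def S_def[abs_def, symmetric] by (simp only:)
qed

lemma HH_bounded:
  assumes "t \<in> TT" "k \<le> N"
  shows "pow_bounded (1 / R) (HH t x k l)"
proof -
  have R: "0 < R" using lo_hi by auto
  obtain B where B: "0 \<le> B" "\<And>d. norm (lcoeff R (\<lambda>w. P t w / (fac0 k w) * (fac0 l w)) d) * R powi d \<le> B"
    by (rule lcoeff_bound[OF R cont_symbol[OF assms]]) (rule that)
  have "norm (HH t x k l z) \<le> (B * R powi x) * (1 / R) powi z" for z
    using B(2)[of "z - x"] R by (simp add: HH_def power_int_diff power_int_divide_distrib field_simps)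
  then show ?thesis by (rule pow_boundedI)
qed

text \<open>For \<open>l = n \<ge> k\<close> the denominator cancels, so no poles are left between
  the two circles and the contour may shrink to \<rho>.\<close>

lemma HH_top:
  assumes "t \<in> TT" "k \<le> n" "n \<le> N"
  shows "HH t x k n z = lcoeff \<rho> (\<lambda>w. P t w * (fac k n w)) (z - x)"
proof -
  have R: "0 < R" using lo_hi by auto
  have "lcoeff R (\<lambda>w. P t w / (fac0 k w) * (fac0 n w)) =
      lcoeff R (\<lambda>w. P t w * (fac k n w))"
  proof (rule lcoeff_cong[OF R])
    fix w :: complex assume w: "norm w = R"
    have "cv v i \<noteq> w" if "i \<in> {1..k}" for i
    proof -
      have "norm (cv v i) < R" using v[of i] v_pos[of i] that assms by auto
      then show ?thesis using w by auto
    qed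
    then have "(fac0 k w) \<noteq> 0" using w R by (auto simp: prod_zero_iff)
    moreover have "(fac0 n w) = (fac0 k w) * (fac k n w)"
      using prod.ub_add_nat[of 1 k "\<lambda>i. (cv v i - w) / w" "n - k"] assms(2) by simp
    ultimately show "P t w / (fac0 k w) * (fac0 n w) =
        P t w * (fac k n w)" by simp
  qed
  moreover have "lcoeff R (\<lambda>w. P t w * (fac k n w)) d = lcoeff \<rho> (\<lambda>w. P t w * (fac k n w)) d" for d
    by (rule lcoeff_indep[OF prod_symbol_analytic[OF rho P_an[OF assms(1)]]]) (use rho lo_hi in auto)
  ultimately show ?thesis by (simp add: HH_def)
qed

lemma HH_pairing:
  assumes "t \<in> TT" "k \<le> n" "n \<le> N" "pow_bounded hi f"
  shows "(\<Sum>\<^sub>\<infinity>z. HH t x k n z * f z) = CC t (DD (cv v) k n f) x"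
  unfolding HH_top[OF assms(1-3)] CC_def conv_op_def[symmetric]
  by (rule fun_cong[OF conv_op_DD[OF P_an[OF assms(1)], where s = hi and q = hi]])
    (use assms rho lo_hi in \<open>auto simp: two_bounded_self\<close>)

text \<open>Each \<open>w - v i\<close> is \<open>- w\<close> times the symbol
  \<open>(v i - w) / w\<close>; the collected powers of \<open>w\<close> leave precisely the
  exponent of a Laurent coefficient.\<close>

lemma F_fun_eq:
  assumes t: "t \<in> TT" and k: "k \<in> {1..N}" and l: "l \<in> {1..N}"
  shows "Ff k l x z t = ((- 1) ^ k * cv v k powi (- x)) * ((- 1) ^ l * cv v l powi z) * HH t x k l z"
proof -
  have R: "0 < R" using lo_hi by auto
  have vv: "cv v k \<noteq> 0" "cv v l \<noteq> 0" using v_pos[OF k] v_pos[OF l] by auto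
  let ?s = "\<lambda>w. P t w / (fac0 k w) * (fac0 l w)"
  let ?c = "((- 1) ^ k * cv v k powi (- x)) * ((- 1) ^ l * cv v l powi z)"
  have "Ff k l x z t = circ_avg R (\<lambda>w. ?c * (?s w / w powi (z - x + 1)))"
    unfolding F_fun_def
  proof (rule circ_avg_cong[OF R])
    fix w :: complex assume w: "norm w = R"
    then have w0: "w \<noteq> 0" using R by auto
    have 1: "(\<Prod>i=1..k. w - cv v i) = (- 1) ^ k * w ^ k * (fac0 k w)" for k
    proof -
      have "(\<Prod>i=1..k. w - cv v i) = (\<Prod>i=1..k. (- 1) * (w * ((cv v i - w) / w)))"
        using w0 by (intro prod.cong) auto
      then show ?thesis by (simp only: prod.distrib prod_constant card_atLeastAtMost diff_Suc_1) simp
    qed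
    have 2: "(- 1) ^ l * w ^ l * b / ((- 1) ^ k * w ^ k * a) = (- 1) ^ k * (- 1) ^ l * (w powi (int l - int k)) * (b / a)" for a b
      using w0 by (cases "even k"; cases "even l") (simp_all add: power_int_diff)
    have 3: "(w / cv v k) powi x / (w / cv v l) powi z = cv v k powi (- x) * cv v l powi z * w powi (x - z)"
      using w0 vv by (simp add: power_int_divide_distrib power_int_diff power_int_minus field_simps)
    have 4: "w powi (x - z) * w powi (int l - int k) / w powi (int l - int k + 1) = 1 / w powi (z - x + 1)"
      using w0 by (simp add: power_int_diff power_int_add field_simps)
    have "(w / cv v k) powi x / (w / cv v l) powi z * ((\<Prod>i = 1..l. w - cv v i) / (\<Prod>i = 1..k. w - cv v i)) *
         (P t w / w powi (int l - int k + 1)) =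
      ?c * ((fac0 l w) / (fac0 k w)) * P t w *
        (w powi (x - z) * w powi (int l - int k) / w powi (int l - int k + 1))"
      unfolding 1[of l] 1[of k] 2 3 by (simp add: mult_ac)
    then show "(w / cv v k) powi x / (w / cv v l) powi z * ((\<Prod>i = 1..l. w - cv v i) / (\<Prod>i = 1..k. w - cv v i)) *
         (P t w / w powi (int l - int k + 1)) = ?c * (?s w / w powi (z - x + 1))"
      unfolding 4 by (simp add: mult_ac)
  qed
  also have "\<dots> = ?c * circ_avg R (\<lambda>w. ?s w / w powi (z - x + 1))"
    by (rule circ_avg_cmult[OF R])
      (intro continuous_on_divide cont_symbol t continuous_on_sphere_powi R, use k R in auto)
  finally show ?thesis by (simp add: HH_def lcoeff_def)
qed

text \<open>The determinants of the overview that the kernels preserve. Only the entries 1 to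
  \<open>n\<close> of \<open>x\<close> are read, so a longer chamber vector may be inserted without
  restriction.\<close>

definition cost :: "nat => (nat => int => complex) => (nat => int) => complex" where
  "cost n f x = det1 n (\<lambda>k j. cv v k powi (- x k) * DD (cv v) k n (f j) (x k))"

lemma det_step:
  assumes n: "n \<le> N" and \<tau>: "\<And>k. k \<in> {1..n} ==> \<tau> k \<in> TT"
    and f: "\<And>j. j \<in> {1..n} ==> pow_bounded hi (f j)" and a: "\<And>j z. j \<in> {1..n} ==> z \<le> a ==> f j z = 0"
  shows "((\<lambda>x. det1 n (\<lambda>k l. Ff k l (u k) (x l) (\<tau> k)) * cost n f x) has_sum
    det1 n (\<lambda>k j. cv v k powi (- u k) * CC (\<tau> k) (DD (cv v) k n (f j)) (u k))) (Omega n)"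
proof -
  let ?F = "\<lambda>x. \<lambda>k l. Ff k l (u k) (x l) (\<tau> k)"
  define hh where "hh k l z = HH (\<tau> k) (u k) k l z" for k l z
  define ff where "ff j l z = DD (cv v) l n (f j) z" for j l z
  have "((\<lambda>x. det1 n (\<lambda>k j. hh k j (x j)) * det1 n (\<lambda>i j. ff i j (x j))) has_sum
    det1 n (\<lambda>k i. \<Sum>\<^sub>\<infinity>z. hh k n z * ff i n z)) (Omega n)"
  proof (rule Omega_cauchy_binet[of hi R n hh "cv v" ff a])
    show "0 < hi" "hi < R" using lo_hi by auto
    show "hh k (Suc t) z = cv v (Suc t) * hh k t (z + 1) - hh k t z" if "k \<in> {1..n}" for k t z
      unfolding hh_def using that n \<tau> by (intro HH_Suc) auto
    show "ff i t z = cv v (Suc t) * ff i (Suc t) (z - 1) - ff i (Suc t) z" if "t < n" for i t z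
      unfolding ff_def using DD_Suc_left[OF that, of "cv v" "f i"] by (simp add: dop_def)
    show "pow_bounded (1 / R) (hh k 0)" if "k \<in> {1..n}" for k
      unfolding hh_def[abs_def] using that n \<tau> by (intro HH_bounded) auto
    show "pow_bounded hi (ff i n)" if "i \<in> {1..n}" for i
      using f[OF that] by (simp add: ff_def[abs_def] DD_id)
    show "ff i n z = 0" if "i \<in> {1..n}" "z \<le> a" for i z
      using a[OF that] by (simp add: ff_def DD_id)
  qed
  moreover have "det1 n (\<lambda>k i. \<Sum>\<^sub>\<infinity>z. hh k n z * ff i n z) = det1 n (\<lambda>k i. CC (\<tau> k) (DD (cv v) k n (f i)) (u k))"
  proof (rule det1_cong)
    fix k i assume "k \<in> {1..n}" "i \<in> {1..n}"
    then show "(\<Sum>\<^sub>\<infinity>z. hh k n z * ff i n z) = CC (\<tau> k) (DD (cv v) k n (f i)) (u k)"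
      unfolding hh_def ff_def using HH_pairing[of "\<tau> k" k n "f i" "u k"] n \<tau> f by (simp add: DD_id)
  qed
  ultimately have hs: "((\<lambda>x. det1 n (\<lambda>k j. hh k j (x j)) * det1 n (\<lambda>i j. ff i j (x j))) has_sum
    det1 n (\<lambda>k i. CC (\<tau> k) (DD (cv v) k n (f i)) (u k))) (Omega n)" by simp
  define c where "c = (\<Prod>k=1..n. cv v k powi (- u k))"
  have sq: "(\<Prod>k=1..n. (- 1) ^ k) * (\<Prod>k=1..n. (- 1) ^ k) = (1 :: complex)"
    by (simp add: prod.distrib[symmetric] flip: power_mult_distrib)
  have "det1 n (?F x) * cost n f x =
      c * (det1 n (\<lambda>k j. hh k j (x j)) * det1 n (\<lambda>i j. ff i j (x j)))" for x
  proof -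
    have "det1 n (?F x) =
        det1 n (\<lambda>k l. ((- 1) ^ k * cv v k powi (- u k)) * ((- 1) ^ l * cv v l powi x l) * hh k l (x l))"
      unfolding hh_def using n \<tau> by (intro det1_cong F_fun_eq) auto
    also have "\<dots> = (\<Prod>k=1..n. (- 1) ^ k * cv v k powi (- u k)) * (\<Prod>l=1..n. (- 1) ^ l * cv v l powi x l) *
        det1 n (\<lambda>k l. hh k l (x l))" by (rule det1_scale)
    also have "\<dots> = c * (\<Prod>l=1..n. cv v l powi x l) * det1 n (\<lambda>k l. hh k l (x l)) *
        ((\<Prod>k=1..n. (- 1) ^ k) * (\<Prod>k=1..n. (- 1) ^ k))"
      by (simp only: prod.distrib c_def mult_ac)
    finally have 1: "det1 n (?F x) = c * (\<Prod>l=1..n. cv v l powi x l) * det1 n (\<lambda>k l. hh k l (x l))"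
      by (simp only: sq mult_1_right)
    have "cost n f x = det1 n (\<lambda>k j. cv v k powi (- x k) * 1 * ff j k (x k))"
      unfolding cost_def ff_def by simp
    also have "\<dots> = (\<Prod>k=1..n. cv v k powi (- x k)) * det1 n (\<lambda>k j. ff j k (x k))"
      by (subst det1_scale) simp
    also have "det1 n (\<lambda>k j. ff j k (x k)) = det1 n (\<lambda>i j. ff i j (x j))" by (rule det1_transpose)
    finally have 2: "cost n f x = (\<Prod>k=1..n. cv v k powi (- x k)) * det1 n (\<lambda>i j. ff i j (x j))" .
    have "(\<Prod>l=1..n. cv v l powi x l) * (\<Prod>k=1..n. cv v k powi (- x k)) = (\<Prod>k=1..n. 1)"
      unfolding prod.distrib[symmetric]
    proof (rule prod.cong[OF refl])
      fix k assume "k \<in> {1..n}"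
      then have "cv v k \<noteq> 0" using v_pos[of k] n by auto
      then show "cv v k powi x k * cv v k powi (- x k) = 1" by (simp add: power_int_minus)
    qed
    then have 3: "(\<Prod>l=1..n. cv v l powi x l) * (\<Prod>k=1..n. cv v k powi (- x k)) = 1" by simp
    have "det1 n (?F x) * cost n f x =
      c * (det1 n (\<lambda>k j. hh k j (x j)) * det1 n (\<lambda>i j. ff i j (x j))) *
        ((\<Prod>l=1..n. cv v l powi x l) * (\<Prod>k=1..n. cv v k powi (- x k)))"
      unfolding 1 2 by (simp only: mult_ac)
    then show ?thesis by (simp only: 3 mult_1_right)
  qed
  moreover have "det1 n (\<lambda>k j. cv v k powi (- u k) * CC (\<tau> k) (DD (cv v) k n (f j)) (u k)) =
      c * det1 n (\<lambda>k i. CC (\<tau> k) (DD (cv v) k n (f i)) (u k))"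
    using det1_scale[of n "\<lambda>k. cv v k powi (- u k)" "\<lambda>_. 1" "\<lambda>k j. CC (\<tau> k) (DD (cv v) k n (f j)) (u k)"]
    by (simp add: c_def)
  ultimately show ?thesis using has_sum_cmult_right[OF hs, of c] by simp
qed

lemma G_step:
  assumes n: "n \<le> N" and st: "s \<in> TT" "t \<in> TT"
    and f: "\<And>j. j \<in> {1..n} ==> pow_bounded hi (f j)" and a: "\<And>j z. j \<in> {1..n} ==> z \<le> a ==> f j z = 0"
  shows "((\<lambda>x. Gt n s t u x * cost n f x) has_sum
    (\<Prod>i=1..n. P (s - t) (cv v i)) * cost n (\<lambda>j. CC (t - s) (f j)) u) (Omega n)"
proof -
  have ts: "t - s \<in> TT" using st by (intro TT_diff)
  have "det1 n (\<lambda>k j. cv v k powi (- u k) * CC (t - s) (DD (cv v) k n (f j)) (u k)) = cost n (\<lambda>j. CC (t - s) (f j)) u"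
    unfolding cost_def CC_def
  proof (rule det1_cong)
    fix k j assume "j \<in> {1..n}"
    then show "cv v k powi (- u k) * conv_op (lcoeff \<rho> (P (t - s))) (DD (cv v) k n (f j)) (u k) =
      cv v k powi (- u k) * DD (cv v) k n (conv_op (lcoeff \<rho> (P (t - s))) (f j)) (u k)"
      using conv_kernel_DD[OF kernel_hi[OF ts], of "f j"] f by (simp add: two_bounded_self)
  qed
  moreover have ds: "((\<lambda>x. det1 n (\<lambda>k l. Ff k l (u k) (x l) (t - s)) * cost n f x) has_sum
    det1 n (\<lambda>k j. cv v k powi (- u k) * CC (t - s) (DD (cv v) k n (f j)) (u k))) (Omega n)"
    by (rule det_step[OF n _ f a]) (use ts in auto)
  ultimately show ?thesis
    using has_sum_cmult_right[OF ds, of "\<Prod>i=1..n. P (s - t) (cv v i)"] by (simp add: G_trans_def mult.assoc)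
qed

text \<open>One identity for the constraint and for the change of level. If
  \<open>x n' \<le> a\<close> the last row vanishes; otherwise no entry can see the cut. The new
  columns vanish above the diagonal and have constant diagonal entries \<theta>, so the determinant
  factors.\<close>

lemma cost_raise:
  assumes n: "1 \<le> n'" "n \<le> n'" "n' \<le> N" and x: "x \<in> Omega n'"
    and q: "\<And>j. j \<in> {1..n} ==> DD (cv v) n n' (q j) = g j"
    and \<theta>: "\<And>j. j \<in> {n+1..n'} ==> DD (cv v) j n' (q j) = (\<lambda>x. \<theta> j * cv v j powi x)"
    and z: "\<And>j k. j \<in> {n+1..n'} ==> k < j ==> DD (cv v) k n' (q j) = (\<lambda>x. 0)"
  shows "cost n' (\<lambda>j. restr_gt a (q j)) x = (if a < x n' then cost n g x * (\<Prod>j=n+1..n'. \<theta> j) else 0)"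
proof (cases "a < x n'")
  case False
  have "cost n' (\<lambda>j. restr_gt a (q j)) x = 0"
    unfolding cost_def by (rule det1_zero_row[of n']) (use n False in \<open>auto simp: DD_id restr_gt_def\<close>)
  then show ?thesis using False by simp
next
  case True
  have "cost n' (\<lambda>j. restr_gt a (q j)) x = det1 n' (\<lambda>k j. cv v k powi (- x k) * DD (cv v) k n' (q j) (x k))"
    unfolding cost_def
  proof (rule det1_cong)
    fix k j assume k: "k \<in> {1..n'}"
    have "DD (cv v) k n' (restr_gt a (q j)) (x k) = DD (cv v) k n' (q j) (x k)"
      by (rule DD_local[of a]) (use Omega_gap[OF x k] True in \<open>auto simp: restr_gt_def\<close>)
    then show "cv v k powi (- x k) * DD (cv v) k n' (restr_gt a (q j)) (x k) =
      cv v k powi (- x k) * DD (cv v) k n' (q j) (x k)" by simp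
  qed
  also have "\<dots> = det1 n (\<lambda>k j. cv v k powi (- x k) * DD (cv v) k n' (q j) (x k)) *
      (\<Prod>l=n+1..n'. cv v l powi (- x l) * DD (cv v) l n' (q l) (x l))"
    by (rule det1_lower_block) (use n z in auto)
  also have "det1 n (\<lambda>k j. cv v k powi (- x k) * DD (cv v) k n' (q j) (x k)) = cost n g x"
    unfolding cost_def
  proof (rule det1_cong)
    fix k j assume kj: "k \<in> {1..n}" "j \<in> {1..n}"
    then show "cv v k powi (- x k) * DD (cv v) k n' (q j) (x k) = cv v k powi (- x k) * DD (cv v) k n (g j) (x k)"
      using DD_split[of k n n' "cv v" "q j"] n q by simp
  qed
  also have "(\<Prod>l=n+1..n'. cv v l powi (- x l) * DD (cv v) l n' (q l) (x l)) = (\<Prod>j=n+1..n'. \<theta> j)"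
  proof (rule prod.cong[OF refl])
    fix l assume l: "l \<in> {n+1..n'}"
    then have "cv v l \<noteq> 0" using v_pos[of l] n by auto
    then show "cv v l powi (- x l) * DD (cv v) l n' (q l) (x l) = \<theta> l"
      unfolding \<theta>[OF l] by (simp add: power_int_minus)
  qed
  finally show ?thesis using True by simp
qed

end

section \<open>Summation along the path\<close>

text \<open>Fubini after sorting the configurations by their image under \<pi>.\<close>

lemma infsum_fibres:
  fixes f :: "'z \<times> 'x => complex" and \<pi> :: "'x => 'b"
  assumes sm: "(\<lambda>w. norm (f w)) summable_on Z \<times> W" and \<pi>: "\<And>X. X \<in> W ==> \<pi> X \<in> A"
  shows "(\<Sum>\<^sub>\<infinity>x\<in>A. \<Sum>\<^sub>\<infinity>z\<in>Z. \<Sum>\<^sub>\<infinity>X\<in>{X \<in> W. \<pi> X = x}. f (z, X)) = (\<Sum>\<^sub>\<infinity>z\<in>Z. \<Sum>\<^sub>\<infinity>X\<in>W. f (z, X))"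
proof -
  define S where "S = Sigma A (\<lambda>x. Z \<times> {X \<in> W. \<pi> X = x})"
  define h where "h = (\<lambda>(z, X). (\<pi> X, (z :: 'z, X)))"
  define f' where "f' = (\<lambda>(x :: 'b, w). f w)"
  have bij: "bij_betw h (Z \<times> W) S"
    by (rule bij_betw_byWitness[of _ snd]) (use \<pi> in \<open>auto simp: h_def S_def\<close>)
  have fh: "f' (h w) = f w" for w by (cases w) (simp add: f'_def h_def)
  have "(\<lambda>w. norm (f' w)) summable_on S"
    using summable_on_reindex_bij_betw[OF bij, of "\<lambda>w. norm (f' w)"] sm by (simp add: fh)
  then have s1: "f' summable_on S" by (rule abs_summable_summable)
  have sub: "f summable_on Z \<times> W'" if "W' \<subseteq> W" for W'
    by (rule summable_on_subset_banach[OF abs_summable_summable[OF sm]]) (use that in auto)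
  have "(\<Sum>\<^sub>\<infinity>x\<in>A. \<Sum>\<^sub>\<infinity>z\<in>Z. \<Sum>\<^sub>\<infinity>X\<in>{X \<in> W. \<pi> X = x}. f (z, X)) =
      (\<Sum>\<^sub>\<infinity>x\<in>A. \<Sum>\<^sub>\<infinity>w\<in>Z \<times> {X \<in> W. \<pi> X = x}. f' (x, w))"
    unfolding f'_def by (intro infsum_cong) (simp add: infsum_Sigma_banach[OF sub])
  also have "\<dots> = infsum f' S"
    unfolding S_def by (rule infsum_Sigma_banach) (use s1 in \<open>simp add: S_def\<close>)
  also have "\<dots> = infsum f (Z \<times> W)"
    using infsum_reindex_bij_betw[OF bij, of f'] by (simp add: fh)
  also have "\<dots> = (\<Sum>\<^sub>\<infinity>z\<in>Z. \<Sum>\<^sub>\<infinity>X\<in>W. f (z, X))"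
    by (rule infsum_Sigma_banach[symmetric]) (rule sub, simp)
  finally show ?thesis .
qed

context contour_setting
begin

lemma symbol_analytic:
  assumes "t \<in> TT" "k \<le> N"
  shows "(\<lambda>w. P t w / (fac0 k w) * (fac0 l w)) analytic_on annulus hi R"
proof -
  have 0: "w \<noteq> 0" if "w \<in> annulus hi R" for w using that lo_hi by (auto simp: in_annulus)
  have 1: "cv v i \<noteq> w" if "w \<in> annulus hi R" "i \<in> {1..k}" for w i
  proof -
    have "norm (cv v i) < hi" using lo_hi(4)[of i] v_pos[of i] that assms by auto
    then show ?thesis using that by (auto simp: in_annulus)
  qed
  have P: "P t analytic_on annulus hi R"
    by (rule analytic_on_subset[OF P_an[OF assms(1)] annulus_mono]) (use lo_hi in auto)
  have pr: "(\<lambda>w. \<Prod>i=1..j. (cv v i - w) / w) analytic_on annulus hi R" for j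
    using 0 by (intro analytic_intros) auto
  show ?thesis
    by (intro analytic_on_mult analytic_on_divide P pr) (use 0 1 in \<open>auto simp: prod_zero_iff\<close>)
qed

lemma HH_bound:
  assumes "t \<in> TT" "k \<le> N" "hi \<le> r" "r \<le> R"
  shows "\<exists>B\<ge>0. \<forall>x z. norm (HH t x k l z) * r powi (z - x) \<le> B"
proof -
  let ?S = "\<lambda>w. P t w / (fac0 k w) * (fac0 l w)"
  have r: "0 < r" using assms lo_hi by auto
  have an: "?S analytic_on annulus r R"
    by (rule analytic_on_subset[OF symbol_analytic[OF assms(1,2)] annulus_mono]) (use assms in auto)
  obtain B where B: "0 \<le> B" "\<And>d. norm (lcoeff r ?S d) * r powi d \<le> B"
    by (rule lcoeff_bound[OF r, of ?S]) (use continuous_on_sphere[OF an, of r] assms in auto)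
  have "lcoeff R ?S d = lcoeff r ?S d" for d
    by (rule lcoeff_indep[OF an r]) (use assms in auto)
  then show ?thesis using B unfolding HH_def by auto
qed

text \<open>The contour of each entry may be moved to any radius \<open>r\<close> between
  \<open>hi\<close> and \<open>R\<close>, which bounds the matrix by one of rank one. The free
  choice of \<open>r\<close> is what makes sums over several nodes converge.\<close>

lemma G_trans_bound:
  assumes n: "n \<le> N" and st: "s \<in> TT" "t \<in> TT" and r: "hi \<le> r" "r \<le> R"
  shows "\<exists>C\<ge>0. \<forall>u x. norm (Gt n s t u x) \<le>
    C * (\<Prod>k=1..n. (r / v k) powi u k) * (\<Prod>k=1..n. (v k / r) powi x k)"
proof -
  have ts: "t - s \<in> TT" using st by (intro TT_diff)
  have r0: "0 < r" using r lo_hi by auto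
  have vk: "0 < v k" if "k \<in> {1..n}" for k using v_pos that n by auto
  have "\<exists>B\<ge>0. \<forall>kl\<in>{1..n} \<times> {1..n}. \<forall>xz. norm (HH (t - s) (fst xz) (fst kl) (snd kl) (snd xz)) \<le> B * r powi (fst xz - snd xz)"
  proof (rule uniform_bound)
    fix kl assume "kl \<in> {1..n} \<times> {1..n}"
    then have "fst kl \<le> N" using n by auto
    from HH_bound[OF ts this r] obtain B where "\<forall>x z. norm (HH (t - s) x (fst kl) (snd kl) z) * r powi (z - x) \<le> B"
      by blast
    then show "\<exists>B. \<forall>xz. norm (HH (t - s) (fst xz) (fst kl) (snd kl) (snd xz)) \<le> B * r powi (fst xz - snd xz)"
      using r0 by (intro exI[of _ B]) (simp add: power_int_diff field_simps)
  qed (use r0 in auto)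
  then obtain B where B: "0 \<le> B" "\<And>k l x z. k \<in> {1..n} ==> l \<in> {1..n} ==> norm (HH (t - s) x k l z) \<le> B * r powi (x - z)"
    by force
  define c where "c = norm (\<Prod>i=1..n. P (s - t) (cv v i))"
  have "norm (Gt n s t u x) \<le> (c * (fact n * B ^ n)) * (\<Prod>k=1..n. (r / v k) powi u k) * (\<Prod>k=1..n. (v k / r) powi x k)" for u x
  proof -
    have "norm (Ff k l (u k) (x l) (t - s)) \<le> (B * (r / v k) powi u k) * (v l / r) powi x l"
      if kl: "k \<in> {1..n}" "l \<in> {1..n}" for k l
    proof -
      have "k \<in> {1..N}" "l \<in> {1..N}" using kl n by auto
      from F_fun_eq[OF ts this, of "u k" "x l"]
      have "norm (Ff k l (u k) (x l) (t - s)) = v k powi (- u k) * v l powi x l * norm (HH (t - s) (u k) k l (x l))"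
        using vk[OF kl(1)] vk[OF kl(2)] by (simp add: norm_mult norm_power norm_power_int)
      also have "\<dots> \<le> v k powi (- u k) * v l powi x l * (B * r powi (u k - x l))"
        using B(2)[OF kl] vk[OF kl(1)] vk[OF kl(2)] by (intro mult_left_mono) auto
      also have "\<dots> = (B * (r / v k) powi u k) * (v l / r) powi x l"
        using r0 by (simp add: power_int_divide_distrib power_int_diff power_int_minus field_simps)
      finally show ?thesis .
    qed
    then have "norm (det1 n (\<lambda>k l. Ff k l (u k) (x l) (t - s))) \<le>
        fact n * ((\<Prod>k=1..n. B * (r / v k) powi u k) * (\<Prod>l=1..n. (v l / r) powi x l))"
      by (rule norm_det1_le_rank1)
    from mult_left_mono[OF this, of c] show ?thesis
      unfolding G_trans_def norm_mult c_def by (simp add: prod.distrib mult_ac)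
  qed
  moreover have "0 \<le> c * (fact n * B ^ n)" using B by (simp add: c_def)
  ultimately show ?thesis by blast
qed

lemma G_trans_cong:
  assumes "\<And>k. k \<in> {1..n} ==> u k = u' k"
  shows "Gt n s t u x = Gt n s t u' x"
  unfolding G_trans_def using assms by (intro arg_cong2[of _ _ _ _ "(*)"] refl det1_cong) auto

text \<open>Right inverse of \<open>D (n + 1) ... D n'\<close> taken on the circle
  \<open>hi\<close>, beyond all \<open>v i\<close>; it keeps functions of growth
  \<open>hi powi x\<close> in their class.\<close>

definition QQ :: "nat => nat => (int => complex) => int => complex" where
  "QQ n n' = conv_op (lcoeff hi (\<lambda>w. 1 / (fac n n' w)))"

lemma v_not_hi: "i \<in> {1..N} ==> cv v i \<notin> annulus hi hi"
  using lo_hi(4)[of i] v_pos[of i] by (auto simp: in_annulus)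

lemma DD_QQ:
  assumes "n \<le> n'" "n' \<le> N" "pow_bounded hi g"
  shows "DD (cv v) n n' (QQ n n' g) = g"
proof -
  have "DD (cv v) n n' (QQ n n' g) = conv_op (lcoeff hi (\<lambda>_. 1)) g"
    unfolding QQ_def
    by (rule DD_right_inverse[where s = hi and q = hi and ?r2.0 = hi])
      (use assms lo_hi v_not_hi in \<open>auto simp: two_bounded_self\<close>)
  then show ?thesis using conv_op_one lo_hi by simp
qed

lemma QQ_bounded:
  assumes "n' \<le> N" "pow_bounded hi g"
  shows "pow_bounded hi (QQ n n' g)"
proof -
  have nz: "w \<noteq> 0" "cv v i \<noteq> w" if "w \<in> annulus hi hi" "i \<in> {n + 1..n'}" for w i
    using that v_not_hi[of i] lo_hi assms by (auto simp: in_annulus)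
  have z0: "0 \<notin> annulus hi hi" using lo_hi by (simp add: in_annulus)
  have "conv_kernel hi hi (lcoeff hi (\<lambda>w. 1 / (fac n n' w)))"
    by (rule conv_kernel_lcoeff[where ?r2.0 = hi])
      (use lo_hi nz z0 in \<open>auto intro!: analytic_intros simp: prod_zero_iff\<close>)
  then interpret conv_kernel hi hi "lcoeff hi (\<lambda>w. 1 / (fac n n' w))" .
  show ?thesis using two_bounded_conv[of g] assms(2) by (simp add: QQ_def two_bounded_self)
qed

lemma CC_bounded: "t \<in> TT ==> pow_bounded hi g ==> pow_bounded hi (CC t g)"
  using conv_kernel.two_bounded_conv[OF kernel_hi, of t g] by (simp add: CC_def two_bounded_self)

end

locale path_setting = contour_setting +
  fixes m :: nat and \<nn> :: "nat => nat \<times> real" and \<Phi> :: "nat \<times> real => nat => int => complex" and a :: "nat => int"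
  assumes m: "1 \<le> m" and nn_in: "\<And>i. i \<in> {1..m} ==> \<nn> i \<in> {1..N} \<times> TT"
    and nn_step: "\<And>i. i \<in> {1..<m} ==> \<nn> i \<prec> \<nn> (Suc i)"
    and Phi: "\<And>i. i \<in> {1..m} ==> is_Phi v \<rho> P T y (\<nn> i) (\<Phi> (\<nn> i))"
begin

abbreviation "phiP i j \<equiv> phi_kernel v \<rho> P (\<nn> i) (\<nn> j)"
abbreviation "PsiP i \<equiv> Psi v \<rho> P T y (\<nn> i)"

text \<open>The value 0 at index 0 makes the system empty there, so that inductions along the path
  start from a determinant of size 0.\<close>

definition nl :: "nat => nat" where "nl i = (if i = 0 then 0 else fst (\<nn> i))"
definition tl :: "nat => real" where "tl i = snd (\<nn> i)"
text \<open>Reindexed so that \<open>kap i j\<close> is dual to the functional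
  \<open>LL (nl i) (tl i) j\<close>.\<close>

definition kap :: "nat => nat => int => complex" where "kap i j = \<Phi> (\<nn> i) (nl i - j)"

lemma nl_range: "i \<in> {1..m} ==> 1 \<le> nl i \<and> nl i \<le> N"
  using nn_in[of i] by (auto simp: nl_def mem_Times_iff)

lemma tl_in: "i \<in> {1..m} ==> tl i \<in> TT"
  using nn_in[of i] by (auto simp: tl_def mem_Times_iff)

lemma nl_le_N: "i \<le> m ==> nl i \<le> N"
  using nl_range[of i] by (cases "i = 0") (auto simp: nl_def)

lemma nl_Suc: "Suc i \<le> m ==> nl i \<le> nl (Suc i)"
  using nn_step[of i] by (cases "i = 0") (auto simp: nl_def prec_def)

lemma nl_mono: "i \<le> j ==> j \<le> m ==> nl i \<le> nl j"
proof (induction j rule: dec_induct)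
  case (step j)
  then show ?case using nl_Suc[of j] by simp
qed simp

lemma nn_eq: "i \<in> {1..m} ==> \<nn> i = (nl i, tl i)"
  by (simp add: nl_def tl_def)

lemma kap_props:
  assumes "i \<in> {1..m}" "j \<in> {1..nl i}"
  shows "kap i j \<in> VV (nl i)" "l \<in> {1..nl i} ==> LL (nl i) (tl i) l (kap i j) = (if l = j then 1 else 0)"
proof -
  have *: "\<forall>k<nl i. \<Phi> (\<nn> i) k \<in> VV (nl i) \<and> (\<forall>l\<in>{1..nl i}. LL (nl i) (tl i) l (\<Phi> (\<nn> i) k) = (if k + l = nl i then 1 else 0))"
    using Phi[OF assms(1)] is_Phi_iff[OF tl_in[OF assms(1)] nl_le_N, of i "\<Phi> (\<nn> i)"] assms(1)
    by (simp add: nn_eq[OF assms(1), symmetric])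
  have lt: "nl i - j < nl i" using assms by auto
  show "kap i j \<in> VV (nl i)" using * lt by (simp add: kap_def)
  show "LL (nl i) (tl i) l (kap i j) = (if l = j then 1 else 0)" if "l \<in> {1..nl i}"
  proof -
    have "LL (nl i) (tl i) l (kap i j) = (if nl i - j + l = nl i then 1 else 0)" using * lt that by (simp add: kap_def)
    also have "nl i - j + l = nl i \<longleftrightarrow> l = j" using assms that by auto
    finally show ?thesis .
  qed
qed

text \<open>The functions \<open>f\<close> of the overview: old ones are moved to the new time by
  \<open>CC\<close> and to the new level by \<open>QQ\<close>, new indices start with the dual
  functions, and the constraint at the node cuts all of them.\<close>

primrec fs :: "nat => nat => int => complex" where
  "fs 0 j = (\<lambda>_. 0)"
| "fs (Suc i) j = restr_gt (a (Suc i))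
     (if j \<le> nl i then QQ (nl i) (nl (Suc i)) (CC (tl i - tl (Suc i)) (fs i j)) else kap (Suc i) j)"

lemma fs_support: "z \<le> a i ==> fs i j z = 0"
  by (cases i) (auto simp: restr_gt_def)

lemma fs_bounded: "i \<le> m ==> j \<in> {1..nl i} ==> pow_bounded hi (fs i j)"
proof (induction i arbitrary: j)
  case 0
  then show ?case by (simp add: nl_def)
next
  case (Suc i)
  show ?case
  proof (cases "j \<le> nl i")
    case True
    then have i: "i \<in> {1..m}" "Suc i \<in> {1..m}" using Suc.prems by (auto simp: nl_def split: if_splits)
    have "pow_bounded hi (QQ (nl i) (nl (Suc i)) (CC (tl i - tl (Suc i)) (fs i j)))"
      by (intro QQ_bounded CC_bounded TT_diff tl_in i nl_le_N Suc.prems Suc.IH) (use True Suc.prems i in auto)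
    then have "pow_bounded hi (restr_gt (a (Suc i)) (QQ (nl i) (nl (Suc i)) (CC (tl i - tl (Suc i)) (fs i j))))"
      using lo_hi by (intro restr_gt_bounded[of hi]) (auto simp: two_bounded_self)
    then show ?thesis using True by simp
  next
    case False
    have "two_bounded lo hi (kap (Suc i) j)"
      by (rule VV_bounded[OF nl_le_N kap_props(1)]) (use Suc.prems in auto)
    then have "pow_bounded hi (restr_gt (a (Suc i)) (kap (Suc i) j))"
      using lo_hi by (intro restr_gt_bounded) auto
    then show ?thesis using False by simp
  qed
qed

text \<open>Reciprocals of the normalisations \<theta> from \<open>LL_first\<close> for all columns
  present at node \<open>i\<close>, all expressed at the time of that node.\<close>

definition con :: "nat => complex" where
  "con i = (\<Prod>j=1..nl i. cv v j powi y j * P (tl i - T j) (cv v j))"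

definition OmegaA :: "nat => (nat => int) set" where
  "OmegaA i = {x \<in> Omega (nl i). a i < x (nl i)}"

definition XX :: "nat => (nat => nat => int) set" where
  "XX i = (\<Pi>\<^sub>E j\<in>{1..i}. OmegaA j)"

text \<open>Weight of a configuration of the nodes \<open>i\<close>, \<open>i - 1\<close>, ..., 1,
  visited in this order because times do not increase with the index. The start \<open>u\<close> at
  time \<open>s\<close> is kept as a parameter for the induction.\<close>

primrec pwr :: "nat => (nat => int) => real => (nat => nat => int) => complex" where
  "pwr 0 u s X = 1"
| "pwr (Suc i) u s X = Gt (nl (Suc i)) s (tl (Suc i)) u (X (Suc i)) * pwr i (X (Suc i)) (tl (Suc i)) X"

lemma pwr_cong: "(\<And>j. j \<le> i ==> X j = X' j) ==> pwr i u s X = pwr i u s X'"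
  by (induction i arbitrary: u s) auto

lemma XX_Suc: "XX (Suc i) = (\<lambda>(x, X). X(Suc i := x)) ` (OmegaA (Suc i) \<times> XX i)"
proof -
  have "{1..Suc i} = insert (Suc i) {1..i}" by auto
  then show ?thesis unfolding XX_def by (simp only: PiE_insert_eq)
qed

lemma XX_inj: "inj_on (\<lambda>(x, X). X(Suc i := x)) (OmegaA (Suc i) \<times> XX i)"
  unfolding XX_def by (rule inj_combinator) simp

lemma pwr_Suc_upd: "pwr (Suc i) u s (X(Suc i := x)) = Gt (nl (Suc i)) s (tl (Suc i)) u x * pwr i x (tl (Suc i)) X"
  using pwr_cong[of i "X(Suc i := x)" X] by simp

text \<open>Radii increasing strictly with the node inside the interval from \<open>hi\<close> to
  \<open>R\<close>: the kernel into node \<open>Suc i\<close> is bounded at radius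
  \<open>rad (Suc i)\<close>, the rest of the path at \<open>rad i\<close>, and the ratio makes the
  sum over that node converge.\<close>

definition rad :: "nat => real" where "rad i = hi + (R - hi) * (real i / real (Suc m))"

lemma rad: "i \<le> m ==> hi \<le> rad i \<and> rad i < R" "rad i < rad (Suc i)" "0 < rad i"
proof -
  have d: "0 < R - hi" using lo_hi by simp
  show "i \<le> m ==> hi \<le> rad i \<and> rad i < R"
  proof
    assume "i \<le> m"
    then have "real i / real (Suc m) < 1" by simp
    then have "(R - hi) * (real i / real (Suc m)) < (R - hi) * 1" using d by (rule mult_strict_left_mono)
    then show "rad i < R" by (simp add: rad_def)
    show "hi \<le> rad i" using d by (simp add: rad_def)
  qed
  show "rad i < rad (Suc i)" unfolding rad_def using d by (intro add_strict_left_mono mult_strict_left_mono divide_strict_right_mono) auto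
  have "0 \<le> (R - hi) * (real i / real (Suc m))" using d by simp
  then show "0 < rad i" using lo_hi unfolding rad_def by linarith
qed

lemma OmegaA_subset: "OmegaA i \<subseteq> {1..nl i} \<rightarrow>\<^sub>E {a i<..}"
proof
  fix x assume x: "x \<in> OmegaA i"
  then have xo: "x \<in> Omega (nl i)" and "a i < x (nl i)" by (auto simp: OmegaA_def)
  then have "a i < x k" if "k \<in> {1..nl i}" for k using Omega_gap[OF xo that] by auto
  then show "x \<in> {1..nl i} \<rightarrow>\<^sub>E {a i<..}" using xo by (auto simp: Omega_def PiE_def Pi_def)
qed

definition wt :: "nat => (nat => int) => real" where "wt i u = (\<Prod>k=1..nl i. (rad i / v k) powi u k)"

lemma wt_nonneg: "i \<le> m ==> 0 \<le> wt i u"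
proof -
  assume i: "i \<le> m"
  show ?thesis unfolding wt_def
  proof (intro prod_nonneg ballI)
    fix k assume "k \<in> {1..nl i}"
    then have "0 < v k" using v_pos[of k] nl_le_N[OF i] by auto
    then show "0 \<le> (rad i / v k) powi u k" using rad(3)[of i] by simp
  qed
qed

lemma wt_step_summable:
  assumes i: "Suc i \<le> m"
  shows "(\<lambda>x. (\<Prod>k=1..nl (Suc i). (v k / rad (Suc i)) powi x k) * wt i x) summable_on OmegaA (Suc i)"
proof -
  \<comment> \<open>Coordinates up to \<open>nl i\<close> are passed on and carry the weight of node
    \<open>i\<close>; the others end here. Both bases are below 1, the second since
    \<open>v k < hi\<close>.\<close>
  define q where "q k = (if k \<le> nl i then rad i / rad (Suc i) else v k / rad (Suc i))" for k
  have vk: "0 < v k" "v k < rad (Suc i)" if "k \<in> {1..nl (Suc i)}" for k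
    using v_pos[of k] lo_hi(4)[of k] that nl_le_N[OF i] rad(1)[OF i] by auto
  have q: "0 < q k" "q k < 1" if "k \<in> {1..nl (Suc i)}" for k
    using vk[OF that] rad(2)[of i] rad(3)[of i] rad(3)[of "Suc i"] by (auto simp: q_def)
  have "(\<lambda>x. \<Prod>k\<in>{1..nl (Suc i)}. q k powi x k) summable_on ({1..nl (Suc i)} \<rightarrow>\<^sub>E {a (Suc i)<..})"
    by (rule summable_prod_PiE) (use q in \<open>auto intro!: powi_summable_gt simp: less_imp_le\<close>)
  then have "(\<lambda>x. \<Prod>k\<in>{1..nl (Suc i)}. q k powi x k) summable_on OmegaA (Suc i)"
    by (rule summable_on_subset) (rule OmegaA_subset)
  moreover have "(\<Prod>k\<in>{1..nl (Suc i)}. q k powi x k) = (\<Prod>k=1..nl (Suc i). (v k / rad (Suc i)) powi x k) * wt i x" for x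
  proof -
    have "wt i x = (\<Prod>k=1..nl (Suc i). if k \<le> nl i then (rad i / v k) powi x k else 1)"
      unfolding wt_def using nl_Suc[OF i] by (intro prod.mono_neutral_cong_left) auto
    then have "(\<Prod>k=1..nl (Suc i). (v k / rad (Suc i)) powi x k) * wt i x =
        (\<Prod>k=1..nl (Suc i). (v k / rad (Suc i)) powi x k * (if k \<le> nl i then (rad i / v k) powi x k else 1))"
      by (simp only: prod.distrib)
    also have "\<dots> = (\<Prod>k\<in>{1..nl (Suc i)}. q k powi x k)"
    proof (rule prod.cong[OF refl])
      fix k assume "k \<in> {1..nl (Suc i)}"
      then have "v k \<noteq> 0" using vk[of k] by auto
      then show "(v k / rad (Suc i)) powi x k * (if k \<le> nl i then (rad i / v k) powi x k else 1) = q k powi x k"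
        by (auto simp: q_def power_int_divide_distrib)
    qed
    finally show ?thesis ..
  qed
  ultimately show ?thesis by simp
qed

text \<open>The bound has to keep track of the starting configuration, through the weight
  \<open>wt i u\<close> with one constant \<open>C\<close>, since that configuration is summed over
  at the next node.\<close>

lemma path_abs:
  assumes "i \<le> m" "s \<in> TT"
  shows "\<exists>C\<ge>0. \<forall>u. (\<lambda>X. norm (pwr i u s X)) summable_on XX i \<and> (\<Sum>\<^sub>\<infinity>X\<in>XX i. norm (pwr i u s X)) \<le> C * wt i u"
  using assms
proof (induction i arbitrary: s)
  case 0
  have "XX 0 = {\<lambda>_. undefined}" by (simp add: XX_def)
  then show ?case by (intro exI[of _ 1]) (simp add: wt_def nl_def)
next
  case (Suc i)
  have Si: "Suc i \<in> {1..m}" "Suc i \<le> m" "i \<le> m" using Suc.prems by auto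
  note tS = tl_in[OF Si(1)]
  obtain C where C: "0 \<le> C" "\<And>u. (\<lambda>X. norm (pwr i u (tl (Suc i)) X)) summable_on XX i"
    "\<And>u. (\<Sum>\<^sub>\<infinity>X\<in>XX i. norm (pwr i u (tl (Suc i)) X)) \<le> C * wt i u"
    using Suc.IH[OF Si(3) tS] by blast
  let ?G = "\<lambda>u x. Gt (nl (Suc i)) s (tl (Suc i)) u x"
  let ?p = "\<lambda>x. \<Sum>\<^sub>\<infinity>X\<in>XX i. norm (pwr i x (tl (Suc i)) X)"
  have "hi \<le> rad (Suc i)" "rad (Suc i) \<le> R" using rad(1)[OF Si(2)] by auto
  from G_trans_bound[OF nl_le_N[OF Si(2)] Suc.prems(2) tS this]
  obtain D where D: "0 \<le> D" "\<And>u x. norm (?G u x) \<le>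
      D * wt (Suc i) u * (\<Prod>k=1..nl (Suc i). (v k / rad (Suc i)) powi x k)"
    unfolding wt_def by blast
  define b where "b x = (\<Prod>k=1..nl (Suc i). (v k / rad (Suc i)) powi x k)" for x
  have b0: "0 \<le> b x" for x
    unfolding b_def
  proof (intro prod_nonneg ballI)
    fix k assume "k \<in> {1..nl (Suc i)}"
    then have "0 < v k" using v_pos[of k] nl_le_N[OF Si(2)] by auto
    then show "0 \<le> (v k / rad (Suc i)) powi x k" using rad(3)[of "Suc i"] by simp
  qed
  have bs: "(\<lambda>x. b x * wt i x) summable_on OmegaA (Suc i)" unfolding b_def by (rule wt_step_summable[OF Si(2)])
  define K where "K = (\<Sum>\<^sub>\<infinity>x\<in>OmegaA (Suc i). b x * wt i x)"
  have K0: "0 \<le> K" unfolding K_def by (intro infsum_nonneg mult_nonneg_nonneg b0 wt_nonneg Si)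
  define h where "h u = (\<lambda>(x, X). norm (Gt (nl (Suc i)) s (tl (Suc i)) u x * pwr i x (tl (Suc i)) X))" for u
  have in_sum: "((\<lambda>X. h u (x, X)) has_sum norm (?G u x) *
      (?p x)) (XX i)" for u x
    unfolding h_def case_prod_conv norm_mult by (intro has_sum_cmult_right has_sum_infsum C(2))
  have le: "norm (?G u x) * (?p x) \<le>
      (D * C * wt (Suc i) u) * (b x * wt i x)" for u x
  proof -
    have "norm (?G u x) * (?p x) \<le>
        (D * wt (Suc i) u * b x) * (C * wt i x)"
      by (intro mult_mono D(2)[folded b_def] C(3) mult_nonneg_nonneg D(1) b0 wt_nonneg Si infsum_nonneg) auto
    then show ?thesis by (simp only: mult_ac)
  qed
  have sum1: "(\<lambda>x. norm (?G u x) * (?p x))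
      summable_on OmegaA (Suc i)" for u
    by (rule summable_on_comparison_test[OF summable_on_cmult_right[OF bs, of "D * C * wt (Suc i) u"]])
      (use le in \<open>auto intro!: mult_nonneg_nonneg infsum_nonneg\<close>)
  have sm: "h u summable_on (OmegaA (Suc i) \<times> XX i)" for u
    by (rule summable_on_SigmaI[OF in_sum sum1]) (auto simp: h_def)
  have "infsum (h u) (OmegaA (Suc i) \<times> XX i) \<le> (D * C * K) * wt (Suc i) u" for u
  proof -
    have "infsum (h u) (OmegaA (Suc i) \<times> XX i) = (\<Sum>\<^sub>\<infinity>x\<in>OmegaA (Suc i). \<Sum>\<^sub>\<infinity>X\<in>XX i. h u (x, X))"
      by (rule infsum_Sigma_banach[OF sm, symmetric])
    also have "\<dots> = (\<Sum>\<^sub>\<infinity>x\<in>OmegaA (Suc i). norm (?G u x) * (?p x))"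
      by (intro infsum_cong infsumI in_sum)
    also have "\<dots> \<le> (\<Sum>\<^sub>\<infinity>x\<in>OmegaA (Suc i). (D * C * wt (Suc i) u) * (b x * wt i x))"
      by (intro infsum_mono sum1 summable_on_cmult_right bs le)
    also have "\<dots> = (D * C * wt (Suc i) u) * K" unfolding K_def by (rule infsum_cmult_right) (rule bs)
    finally show ?thesis by (simp only: mult_ac)
  qed
  moreover have hp: "h u = (\<lambda>X. norm (pwr (Suc i) u s X)) \<circ> (\<lambda>(x, X). X(Suc i := x))" for u
    by (auto simp: h_def fun_eq_iff pwr_Suc_upd simp del: pwr.simps)
  ultimately have "infsum (\<lambda>X. norm (pwr (Suc i) u s X)) (XX (Suc i)) \<le> (D * C * K) * wt (Suc i) u" for u
    unfolding XX_Suc infsum_reindex[OF XX_inj] hp[symmetric] by blast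
  moreover have "(\<lambda>X. norm (pwr (Suc i) u s X)) summable_on XX (Suc i)" for u
    unfolding XX_Suc summable_on_reindex[OF XX_inj] hp[symmetric] by (rule sm)
  moreover have "0 \<le> D * C * K" using D C K0 by simp
  ultimately show ?case by blast
qed

text \<open>At each node \<open>cost_raise\<close> brings in the constraint and the new columns, and
  \<open>G_step\<close> then sums over the configuration; all constants are gathered in
  \<open>con\<close>.\<close>

lemma path_sum:
  assumes "i \<le> m" "s \<in> TT"
  shows "(\<Sum>\<^sub>\<infinity>X\<in>XX i. pwr i u s X) =
    con i * (\<Prod>j=1..nl i. P (s - tl i) (cv v j)) * cost (nl i) (\<lambda>j. CC (tl i - s) (fs i j)) u"
  using assms
proof (induction i arbitrary: s u)
  case 0
  have "XX 0 = {\<lambda>_. undefined}" by (simp add: XX_def)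
  then show ?case by (simp add: nl_def con_def cost_def)
next
  case (Suc i)
  have Si: "Suc i \<in> {1..m}" "Suc i \<le> m" "i \<le> m" using Suc.prems by auto
  note tS = tl_in[OF Si(1)]
  let ?n = "nl i" and ?n' = "nl (Suc i)" and ?t = "tl (Suc i)"
  have n': "1 \<le> ?n'" "?n \<le> ?n'" "?n' \<le> N" using nl_range[OF Si(1)] nl_Suc[OF Si(2)] by auto
  let ?G = "\<lambda>x. Gt ?n' s ?t u x"
  let ?p = "\<lambda>j. P (?t - T j) (cv v j) * cv v j powi y j"
  define g where "g j = CC (tl i - ?t) (fs i j)" for j
  define q where "q j = (if j \<le> ?n then QQ ?n ?n' (g j) else kap (Suc i) j)" for j
  have fsq: "fs (Suc i) j = restr_gt (a (Suc i)) (q j)" for j by (simp add: q_def g_def)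
  \<comment> \<open>The new columns are dual functions, so after elimination each is an exponential
    with the normalisation given by \<open>LL_first\<close>.\<close>
  have "\<forall>j\<in>{?n+1..?n'}. \<exists>\<theta>. DD (cv v) j ?n' (q j) = (\<lambda>x. \<theta> * cv v j powi x) \<and> \<theta> * (?p j) = 1"
  proof
    fix j assume j: "j \<in> {?n+1..?n'}"
    then have j': "j \<in> {1..?n'}" by auto
    obtain \<theta> where "DD (cv v) j ?n' (kap (Suc i) j) = (\<lambda>x. \<theta> * cv v j powi x)" "\<theta> * (?p j) = 1"
      by (rule LL_first[OF tS n'(3) kap_props(1)[OF Si(1) j'], of j]) (use j kap_props(2)[OF Si(1) j'] in auto)
    then show "\<exists>\<theta>. DD (cv v) j ?n' (q j) = (\<lambda>x. \<theta> * cv v j powi x) \<and> \<theta> * (?p j) = 1"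
      using j by (auto simp: q_def)
  qed
  from bchoice[OF this] obtain \<theta> where \<theta>: "\<And>j. j \<in> {?n+1..?n'} ==> DD (cv v) j ?n' (q j) = (\<lambda>x. \<theta> j * cv v j powi x)"
    "\<And>j. j \<in> {?n+1..?n'} ==> \<theta> j * (?p j) = 1" by blast
  let ?c = "\<lambda>x. if a (Suc i) < x ?n' then cost ?n g x * (\<Prod>j=?n+1..?n'. \<theta> j) else 0"
  have raise: "cost ?n' (fs (Suc i)) x = (?c x)"
    if x: "x \<in> Omega ?n'" for x
  proof -
    have "cost ?n' (\<lambda>j. restr_gt (a (Suc i)) (q j)) x = (?c x)"
    proof (rule cost_raise[OF n' x])
      show "DD (cv v) ?n ?n' (q j) = g j" if "j \<in> {1..?n}" for j
      proof -
        have i: "i \<in> {1..m}" using that Si by (auto simp: nl_def split: if_splits)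
        have "pow_bounded hi (g j)"
          unfolding g_def by (intro CC_bounded TT_diff tl_in i tS fs_bounded that Si)
        then show ?thesis using that DD_QQ n' by (simp add: q_def)
      qed
      show "DD (cv v) j ?n' (q j) = (\<lambda>x. \<theta> j * cv v j powi x)" if "j \<in> {?n+1..?n'}" for j by (rule \<theta>(1)[OF that])
      show "DD (cv v) k ?n' (q j) = (\<lambda>x. 0)" if j: "j \<in> {?n+1..?n'}" and k: "k < j" for j k
      proof -
        have j': "j \<in> {1..?n'}" using j by auto
        have "DD (cv v) k ?n' (kap (Suc i) j) = (\<lambda>x. 0)"
          by (rule LL_zero_DD[OF tS n'(3) kap_props(1)[OF Si(1) j'] _ _ k]) (use j kap_props(2)[OF Si(1) j'] in auto)
        then show ?thesis using j by (simp add: q_def)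
      qed
    qed
    then show ?thesis by (simp only: fsq[abs_def])
  qed
  let ?h = "\<lambda>j. cv v j powi y j * P (?t - T j) (cv v j)"
  \<comment> \<open>The new factors of \<open>con\<close> cancel the \<theta>; in the old ones the
    passage from time \<open>tl i\<close> to \<open>tl (Suc i)\<close> produces the power of \<phi>
    that the induction hypothesis carries.\<close>
  have con: "con (Suc i) * (\<Prod>j=?n+1..?n'. \<theta> j) = con i * (\<Prod>j=1..?n. P (?t - tl i) (cv v j))"
  proof -
    have "con (Suc i) = (\<Prod>j=1..?n. ?h j) * (\<Prod>j=?n+1..?n'. ?h j)"
      unfolding con_def using prod.ub_add_nat[of 1 ?n "\<lambda>j. ?h j" "?n' - ?n"] n' by simp
    then have "con (Suc i) * (\<Prod>j=?n+1..?n'. \<theta> j) = (\<Prod>j=1..?n. ?h j) *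
        (\<Prod>j=?n+1..?n'. \<theta> j * (?p j))"
      by (simp only: prod.distrib mult_ac)
    also have "(\<Prod>j=?n+1..?n'. \<theta> j * (?p j)) = (\<Prod>j=?n+1..?n'. 1)"
      by (rule prod.cong[OF refl]) (rule \<theta>(2))
    also have "(\<Prod>j=1..?n. ?h j) = (\<Prod>j=1..?n. (cv v j powi y j * P (tl i - T j) (cv v j)) * P (?t - tl i) (cv v j))"
    proof (rule prod.cong[OF refl])
      fix j assume j: "j \<in> {1..?n}"
      then have i: "i \<in> {1..m}" using Si by (auto simp: nl_def split: if_splits)
      have jN: "j \<in> {1..N}" using j n' by auto
      have "P (tl i - T j) (cv v j) * P (?t - tl i) (cv v j) = P (tl i - T j + (?t - tl i)) (cv v j)"
        by (intro P_add TT_diff tl_in i tS T_in jN v_annulus)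
      then show "?h j = (cv v j powi y j * P (tl i - T j) (cv v j)) * P (?t - tl i) (cv v j)"
        by (simp add: mult.assoc)
    qed
    finally show ?thesis by (simp only: prod.distrib con_def prod.neutral_const mult_1_right)
  qed
  define W where "W = (\<lambda>(x, X). ?G x * pwr i x ?t X)"
  have Wp: "W = pwr (Suc i) u s \<circ> (\<lambda>(x, X). X(Suc i := x))"
    by (auto simp: W_def fun_eq_iff pwr_Suc_upd simp del: pwr.simps)
  have "(\<lambda>X. norm (pwr (Suc i) u s X)) summable_on XX (Suc i)" using path_abs[OF Si(2) Suc.prems(2)] by blast
  then have "pwr (Suc i) u s summable_on XX (Suc i)" by (rule abs_summable_summable)
  then have sm: "W summable_on (OmegaA (Suc i) \<times> XX i)"
    unfolding XX_Suc summable_on_reindex[OF XX_inj] Wp .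
  have "(\<Sum>\<^sub>\<infinity>X\<in>XX (Suc i). pwr (Suc i) u s X) = infsum W (OmegaA (Suc i) \<times> XX i)"
    unfolding XX_Suc infsum_reindex[OF XX_inj] Wp ..
  also have "\<dots> = (\<Sum>\<^sub>\<infinity>x\<in>OmegaA (Suc i). \<Sum>\<^sub>\<infinity>X\<in>XX i. W (x, X))"
    by (rule infsum_Sigma_banach[OF sm, symmetric])
  also have "\<dots> = (\<Sum>\<^sub>\<infinity>x\<in>OmegaA (Suc i). con (Suc i) * (?G x * cost ?n' (fs (Suc i)) x))"
  proof (rule infsum_cong)
    fix x assume x: "x \<in> OmegaA (Suc i)"
    have sx: "pwr i x ?t summable_on XX i"
      using path_abs[OF Si(3) tS] abs_summable_summable by blast
    have "(\<Sum>\<^sub>\<infinity>X\<in>XX i. W (x, X)) = ?G x * (\<Sum>\<^sub>\<infinity>X\<in>XX i. pwr i x ?t X)"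
      unfolding W_def case_prod_conv by (rule infsum_cmult_right[OF sx])
    also have "(\<Sum>\<^sub>\<infinity>X\<in>XX i. pwr i x ?t X) = con i * (\<Prod>j=1..?n. P (?t - tl i) (cv v j)) * cost ?n g x"
      unfolding g_def by (rule Suc.IH[OF Si(3) tS])
    also have "\<dots> = con (Suc i) * cost ?n' (fs (Suc i)) x"
      using raise[of x] x unfolding con[symmetric] by (simp add: OmegaA_def)
    finally show "(\<Sum>\<^sub>\<infinity>X\<in>XX i. W (x, X)) = con (Suc i) * (?G x * cost ?n' (fs (Suc i)) x)"
      by simp
  qed
  also have "\<dots> = (\<Sum>\<^sub>\<infinity>x\<in>Omega ?n'. con (Suc i) * (?G x * cost ?n' (fs (Suc i)) x))"
    by (rule infsum_cong_neutral) (use raise in \<open>auto simp: OmegaA_def\<close>)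
  also have "\<dots> = con (Suc i) * ((\<Prod>j=1..?n'. P (s - ?t) (cv v j)) * cost ?n' (\<lambda>j. CC (?t - s) (fs (Suc i) j)) u)"
  proof (rule infsumI)
    show "((\<lambda>x. con (Suc i) * (?G x * cost ?n' (fs (Suc i)) x)) has_sum
      con (Suc i) * ((\<Prod>j=1..?n'. P (s - ?t) (cv v j)) * cost ?n' (\<lambda>j. CC (?t - s) (fs (Suc i) j)) u)) (Omega ?n')"
      by (intro has_sum_cmult_right G_step[where a = "a (Suc i)"] n' Suc.prems tS fs_bounded Si fs_support)
  qed
  finally show ?case by (simp only: mult.assoc)
qed

end

text \<open>Summation by parts for products: only the products over the tails \<open>{j..n}\<close> have to be small.\<close>

lemma abel_prod_le:
  fixes \<kappa> :: "nat => real" and \<zeta> :: "nat => nat"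
  assumes j: "1 \<le> j" "j \<le> n" and pos: "\<And>l. l \<in> {1..n} ==> 0 < \<kappa> l"
    and tail: "\<And>i. i \<in> {1..n} ==> (\<Prod>l=i..n. \<kappa> l) \<le> \<eta>"
    and mono: "\<And>i. 1 \<le> i ==> i < n ==> \<zeta> i \<le> \<zeta> (Suc i)" and c: "c \<le> \<zeta> j"
  shows "(\<Prod>l=j..n. \<kappa> l ^ (\<zeta> l - c)) \<le> \<eta> ^ (\<zeta> n - c)"
  using j(2) c j(1)
proof (induction j arbitrary: c rule: inc_induct)
  case base
  have "\<kappa> n \<le> \<eta>" using tail[of n] j by auto
  moreover have "0 < \<kappa> n" using pos[of n] j by auto
  ultimately show ?case using base by (simp add: power_mono)
next
  case (step i)
  have mono': "\<zeta> i \<le> \<zeta> l" if "i \<le> l" "l \<le> n" for l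
    using that
  proof (induction l rule: dec_induct)
    case (step l)
    then show ?case using mono[of l] \<open>1 \<le> i\<close> by auto
  qed simp
  have p0: "0 < (\<Prod>l=i..n. \<kappa> l)" using pos step.prems by (intro prod_pos) auto
  have "(\<Prod>l=i..n. \<kappa> l ^ (\<zeta> l - c)) = (\<Prod>l=i..n. \<kappa> l ^ (\<zeta> i - c) * \<kappa> l ^ (\<zeta> l - \<zeta> i))"
  proof (rule prod.cong[OF refl])
    fix l assume "l \<in> {i..n}"
    then have "\<zeta> l - c = (\<zeta> i - c) + (\<zeta> l - \<zeta> i)" using mono'[of l] step.prems by auto
    then show "\<kappa> l ^ (\<zeta> l - c) = \<kappa> l ^ (\<zeta> i - c) * \<kappa> l ^ (\<zeta> l - \<zeta> i)" by (simp add: power_add)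
  qed
  also have "\<dots> = (\<Prod>l=i..n. \<kappa> l) ^ (\<zeta> i - c) * (\<Prod>l=i..n. \<kappa> l ^ (\<zeta> l - \<zeta> i))"
    by (simp add: prod.distrib prod_power_distrib)
  also have "(\<Prod>l=i..n. \<kappa> l ^ (\<zeta> l - \<zeta> i)) = (\<Prod>l=Suc i..n. \<kappa> l ^ (\<zeta> l - \<zeta> i))"
    using step.hyps by (subst prod.atLeast_Suc_atMost) auto
  also have "(\<Prod>l=i..n. \<kappa> l) ^ (\<zeta> i - c) * \<dots> \<le> \<eta> ^ (\<zeta> i - c) * \<eta> ^ (\<zeta> n - \<zeta> i)"
  proof (rule mult_mono)
    show "(\<Prod>l=i..n. \<kappa> l) ^ (\<zeta> i - c) \<le> \<eta> ^ (\<zeta> i - c)"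
      using tail[of i] p0 step by (intro power_mono) auto
    show "(\<Prod>l=Suc i..n. \<kappa> l ^ (\<zeta> l - \<zeta> i)) \<le> \<eta> ^ (\<zeta> n - \<zeta> i)"
      by (rule step.IH) (use step mono'[of "Suc i"] in auto)
    have "0 \<le> \<eta>" using tail[of i] p0 step by auto
    then show "0 \<le> \<eta> ^ (\<zeta> i - c)" by simp
    show "0 \<le> (\<Prod>l=Suc i..n. \<kappa> l ^ (\<zeta> l - \<zeta> i))" using pos step.prems by (intro prod_nonneg) (auto simp: less_imp_le)
  qed
  also have "\<dots> = \<eta> ^ (\<zeta> n - c)"
    using mono'[of n] step by (simp add: power_add[symmetric])
  finally show ?case .
qed

section \<open>Summability of the initial kernel\<close>

definition right_bounded :: "real => (int => complex) => bool" where
  "right_bounded r f \<longleftrightarrow> (\<exists>C\<ge>0. \<forall>x\<ge>0. norm (f x) \<le> C * r powi x)"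

lemma right_bounded_dop:
  assumes r: "0 < r" and f: "right_bounded r f"
  shows "right_bounded r (dop c f)"
proof -
  obtain C where C: "0 \<le> C" "\<And>x. 0 \<le> x ==> norm (f x) \<le> C * r powi x" using f unfolding right_bounded_def by blast
  \<comment> \<open>At \<open>x = 0\<close> the operator reads \<open>f (- 1)\<close>, which the
    one-sided bound does not cover and which therefore enters the constant.\<close>
  define D where "D = norm c * (C / r + norm (f (- 1))) + C"
  have "norm (dop c f x) \<le> D * r powi x" if x: "0 \<le> x" for x
  proof -
    have 1: "norm (f (x - 1)) \<le> (C / r + norm (f (- 1))) * r powi x"
    proof (cases "x = 0")
      case True
      then show ?thesis using C r by simp
    next
      case False
      then have "norm (f (x - 1)) \<le> C * r powi (x - 1)" using C(2)[of "x - 1"] x by auto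
      also have "\<dots> = (C / r) * r powi x" using r by (simp add: power_int_diff)
      also have "\<dots> \<le> (C / r + norm (f (- 1))) * r powi x" using r by (intro mult_right_mono) auto
      finally show ?thesis .
    qed
    have "norm (dop c f x) \<le> norm c * norm (f (x - 1)) + norm (f x)"
      unfolding dop_def norm_mult[symmetric] by (rule norm_triangle_ineq4)
    also have "\<dots> \<le> norm c * ((C / r + norm (f (- 1))) * r powi x) + C * r powi x"
      using 1 C(2)[OF x] by (intro add_mono mult_left_mono) auto
    finally show ?thesis by (simp add: D_def algebra_simps)
  qed
  moreover have "0 \<le> D" using C r by (simp add: D_def)
  ultimately show ?thesis unfolding right_bounded_def by blast
qed

lemma right_bounded_DD: "0 < r ==> right_bounded r f ==> right_bounded r (DD c i n f)"
  by (induction n arbitrary: f) (auto intro: right_bounded_dop)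

lemma pow_bounded_right: "pow_bounded r f ==> right_bounded r f"
  unfolding right_bounded_def by (erule pow_boundedE) blast

context contour_setting
begin

text \<open>Inversion on the circle \<rho>, below all \<open>v i\<close>, stays in the class of
  growth \<rho>. This is the hypothesis of \<open>DD_decompose\<close> with \<open>Q\<close> the
  functions of that class.\<close>

lemma dop_inverse_rho:
  assumes i: "i \<in> {1..N}" and q: "pow_bounded \<rho> q"
  shows "\<exists>q'. pow_bounded \<rho> q' \<and> dop (cv v i) q' = q"
proof -
  have c: "cv v i \<notin> annulus \<rho> \<rho>" using v[OF i] v_pos[OF i] by (auto simp: in_annulus)
  have an: "(\<lambda>w. 1 / (\<Prod>j=(i - 1) + 1..i. (cv v j - w) / w)) analytic_on annulus \<rho> \<rho>"
  proof -
    have "{(i - 1) + 1..i} = {i}" using i by auto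
    moreover have "w \<noteq> 0" "cv v i \<noteq> w" if "w \<in> annulus \<rho> \<rho>" for w using that c rho by (auto simp: in_annulus)
    ultimately show ?thesis by (auto intro!: analytic_intros)
  qed
  let ?q = "conv_op (lcoeff \<rho> (\<lambda>w. 1 / (\<Prod>j=(i - 1) + 1..i. (cv v j - w) / w))) q"
  have "conv_kernel \<rho> \<rho> (lcoeff \<rho> (\<lambda>w. 1 / (\<Prod>j=(i - 1) + 1..i. (cv v j - w) / w)))"
    by (rule conv_kernel_lcoeff[OF an]) (use rho in auto)
  from conv_kernel.two_bounded_conv[OF this, of q] have "pow_bounded \<rho> ?q" using q by (simp add: two_bounded_self)
  moreover have "DD (cv v) (i - 1) i ?q = conv_op (lcoeff \<rho> (\<lambda>_. 1)) q"
  proof (rule DD_right_inverse[where s = \<rho> and q = \<rho> and ?r2.0 = \<rho>])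
    fix j assume "j \<in> {(i - 1) + 1..i}"
    then have "j = i" by auto
    then show "cv v j \<notin> annulus \<rho> \<rho>" using c by simp
  qed (use q rho in \<open>auto simp: two_bounded_self\<close>)
  moreover have "DD (cv v) (i - 1) i ?q = dop (cv v i) ?q"
    using DD_Suc_left[of "i - 1" i "cv v" ?q] i by (simp add: DD_id)
  ultimately show ?thesis using conv_op_one[OF rho] by auto
qed

text \<open>A row of the initial kernel before any factor is applied, reflected so that the forward
  differences in the recursion of \<open>HH\<close> become \<open>dop\<close>.\<close>

definition refl_row :: "nat => int => complex" where
  "refl_row k x = HH (- T k) (y k) k 0 (- x)"

lemma mT_in: "k \<in> {1..N} ==> - T k \<in> TT"
  using TT_diff[OF TT_0 T_in[of k]] by simp

lemma refl_row_DD: "k \<in> {1..N} ==> DD (cv v) 0 l (refl_row k) x = HH (- T k) (y k) k l (- x)"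
proof (induction l arbitrary: x)
  case (Suc l)
  have "DD (cv v) 0 (Suc l) (refl_row k) x = dop (cv v (Suc l)) (DD (cv v) 0 l (refl_row k)) x"
    by (simp add: DD_dop)
  also have "\<dots> = HH (- T k) (y k) k (Suc l) (- x)"
    using Suc HH_Suc[OF mT_in[OF Suc.prems], of k "y k" l "- x"] by (simp add: dop_def)
  finally show ?case .
qed (simp add: refl_row_def)

text \<open>After \<open>D 1 ... D k\<close> the poles have cancelled and the contour shrinks to
  \<rho>, giving growth \<rho>. Undoing these operators adds only functions of
  \<open>V_space\<close>, that is, the residues at the points \<open>v i\<close>.\<close>

lemma refl_row_decompose:
  assumes k: "k \<in> {1..N}"
  shows "\<exists>\<alpha> q. pow_bounded \<rho> q \<and> (\<forall>x. refl_row k x = (\<Sum>i=1..N. \<alpha> i * V_basis v i x) + q x)"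
proof -
  have kN: "k \<le> N" using k by auto
  have "pow_bounded \<rho> (DD (cv v) 0 k (refl_row k))"
  proof -
    have cont: "continuous_on (sphere 0 \<rho>) (P (- T k))"
      by (rule continuous_on_sphere[OF P_an[OF mT_in[OF k]]]) (use lo_hi in auto)
    obtain B where B: "0 \<le> B" "\<And>d. norm (lcoeff \<rho> (P (- T k)) d) * \<rho> powi d \<le> B"
      by (rule lcoeff_bound[OF rho cont]) (rule that)
    have "norm (DD (cv v) 0 k (refl_row k) x) \<le> (B * \<rho> powi y k) * \<rho> powi x" for x
    proof -
      have "DD (cv v) 0 k (refl_row k) x = lcoeff \<rho> (P (- T k)) (- x - y k)"
        using HH_top[OF mT_in[OF k] le_refl kN, of "y k" "- x"] by (simp add: refl_row_DD[OF k])
      moreover have "norm (lcoeff \<rho> (P (- T k)) (- x - y k)) \<le> B / \<rho> powi (- x - y k)"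
        using B(2)[of "- x - y k"] rho by (simp add: pos_le_divide_eq)
      moreover have "B / \<rho> powi (- x - y k) = (B * \<rho> powi y k) * \<rho> powi x"
        using rho by (simp add: power_int_diff power_int_minus field_simps)
      ultimately show ?thesis by simp
    qed
    then show ?thesis by (rule pow_boundedI)
  qed
  then have "\<exists>f\<in>V_space v k. \<exists>q\<in>{q. pow_bounded \<rho> q}. refl_row k = (\<lambda>x. f x + q x)"
    using v_pos kN dop_inverse_rho by (intro DD_decompose) auto
  then obtain f q where f: "f \<in> V_space v k" and q: "pow_bounded \<rho> q" and eq: "refl_row k = (\<lambda>x. f x + q x)" by blast
  have "f \<in> V_space v N" using kN f by (induction N rule: dec_induct) (auto intro: V_space_mono)
  from V_space_basis_sum[OF this] obtain \<alpha> where "\<forall>x. f x = (\<Sum>i=1..N. \<alpha> i * V_basis v i x)" by blast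
  then show ?thesis using q eq by auto
qed

text \<open>
  The entries of the determinant in \<open>G_minus\<close> do not decay as \<open>z l \<longrightarrow> -\<infinity>\<close> below the diagonal. Expanding
  the rows in the functions \<open>V_basis v i\<close>, no \<open>i\<close> is used twice, and \<open>i\<close> is only used in columns \<open>l < i\<close>;
  as \<open>z\<close> is decreasing this suffices for the product of the entries to decay.
\<close>

lemma G_minus_summable:
  assumes n: "n \<le> N" and r: "hi \<le> r" "r < R"
  shows "(\<lambda>z. norm (Gm z) * (\<Prod>k=1..n. (r / v k) powi z k)) summable_on Omega N"
proof -
  let ?P = "\<lambda>g A i. \<Prod>c\<in>{i..N} - g ` A - {i}. \<rho> / v c"
  let ?V = "\<lambda>z. \<Prod>l=1..N. v l powi z l"
  let ?o = "\<lambda>l z. if l \<le> n then (r / v l) powi z else 1"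
  have r0: "0 < r" "0 < R" using r lo_hi by auto
  have vr: "0 < v k" "v k < r" "\<rho> < v k" "lo < v k" if "k \<in> {1..N}" for k
    using v_pos[OF that] lo_hi(4)[OF that] r v[OF that] lo_hi(3)[OF that] by auto
  \<comment> \<open>Slack for the polynomial factors: \<open>E * v c\<close> dominates the basis
    function with frequency \<open>v c\<close>. The root of order \<open>Suc N\<close> is such that
    \<open>N\<close> losses of \<open>E\<close> do not use up one gain \<open>\<rho> / lo\<close>,
    and the factor \<open>\<eta> = 1 / E\<close> remains.\<close>
  define E where "E = root (Suc N) (lo / \<rho>)"
  have lr: "1 < lo / \<rho>" using lo_hi rho by simp
  have E: "1 < E" "E ^ Suc N = lo / \<rho>"
    unfolding E_def using lr by (auto simp: real_root_gt_1_iff simp del: power_Suc intro!: real_root_pow_pos2)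
  define \<eta> where "\<eta> = 1 / E"
  have \<eta>: "0 < \<eta>" "\<eta> < 1" using E by (auto simp: \<eta>_def)
  have E\<rho>: "E ^ N * (\<rho> / lo) = \<eta>"
    using E rho lo_hi by (simp add: \<eta>_def field_simps)
  \<comment> \<open>The estimate below gives a power of \<eta> governed by the last, hence lowest,
    coordinate; the root spreads it over all \<open>N\<close> coordinates.\<close>
  define \<eta>' where "\<eta>' = root N \<eta>"
  have \<eta>': "0 < \<eta>'" "\<eta>' < 1" "\<eta>' ^ N = \<eta>"
    unfolding \<eta>'_def using \<eta> N by (auto simp: real_root_lt_1_iff intro!: real_root_pow_pos2)
  have "\<forall>k\<in>{1..N}. \<exists>\<alpha>q. pow_bounded \<rho> (snd \<alpha>q) \<and> (\<forall>x. refl_row k x = (\<Sum>i=1..N. fst \<alpha>q i * V_basis v i x) + snd \<alpha>q x)"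
    using refl_row_decompose by simp
  from bchoice[OF this] obtain \<alpha>q where
    \<alpha>q: "\<forall>k\<in>{1..N}. pow_bounded \<rho> (snd (\<alpha>q k)) \<and> (\<forall>x. refl_row k x = (\<Sum>i=1..N. fst (\<alpha>q k) i * V_basis v i x) + snd (\<alpha>q k) x)" ..
  define \<alpha> where "\<alpha> k = fst (\<alpha>q k)" for k
  define q where "q k = snd (\<alpha>q k)" for k
  have q: "pow_bounded \<rho> (q k)" if "k \<in> {1..N}" for k using \<alpha>q that by (simp add: q_def)
  have dec: "refl_row k x = (\<Sum>i=1..N. \<alpha> k i * V_basis v i x) + q k x" if "k \<in> {1..N}" for k x
    using \<alpha>q that by (simp add: q_def \<alpha>_def)
  define B where "B i l x = DD (cv v) 0 l (V_basis v i) x" for i l x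
  define H where "H k l z = HH (- T k) (y k) k l z" for k l z
  \<comment> \<open>The expansion is needed only for \<open>z \<le> 0\<close>. There
    \<open>c = 0\<close> selects the remainder and \<open>c \<ge> 1\<close> a basis function; for
    \<open>z > 0\<close> the undivided entry sits in the slot 0.\<close>
  define X where "X k c l z = (if c = 0 then (if z \<le> 0 then DD (cv v) 0 l (q k) (- z) else H k l z)
      else (if z \<le> 0 then B c l (- z) else 0))" for k c l :: nat and z :: int
  let ?D = "\<lambda>f z. det1 N (\<lambda>k l. X k (f k) l (z l))"
  define w where "w k c = (if c = 0 then 1 else \<alpha> k c)" for k c :: nat
  have HX: "H k l z = (\<Sum>c\<in>{0..N}. w k c * X k c l z)" if k: "k \<in> {1..N}" for k l z
  proof -
    have sp: "(\<Sum>c\<in>{0..N}. w k c * X k c l z) = w k 0 * X k 0 l z + (\<Sum>c=1..N. w k c * X k c l z)"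
      by (simp add: sum.atLeast_Suc_atMost)
    show ?thesis
    proof (cases "z \<le> 0")
      case True
      have "H k l z = DD (cv v) 0 l (refl_row k) (- z)" by (simp add: H_def refl_row_DD[OF k])
      also have "refl_row k = (\<lambda>x. (\<Sum>i=1..N. \<alpha> k i * V_basis v i x) + q k x)" using dec[OF k] by auto
      also have "DD (cv v) 0 l (\<lambda>x. (\<Sum>i=1..N. \<alpha> k i * V_basis v i x) + q k x) (- z) =
          (\<Sum>i=1..N. \<alpha> k i * B i l (- z)) + DD (cv v) 0 l (q k) (- z)"
        by (simp add: DD_add DD_sum DD_cmult B_def)
      finally show ?thesis unfolding sp using True by (simp add: w_def X_def)
    next
      case False
      then show ?thesis unfolding sp by (simp add: w_def X_def)
    qed
  qed
  have B0: "B i l x = 0" if "i \<in> {1..N}" "i \<le> l" for i l x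
  proof -
    have "DD (cv v) 0 l (V_basis v i) = DD (cv v) 0 i (DD (cv v) i l (V_basis v i))"
      using that by (intro DD_split) auto
    also have "\<dots> = DD (cv v) i l (DD (cv v) 0 i (V_basis v i))"
    proof -
      have "DD (cv v) 0 i (DD (cv v) i l f) = DD (cv v) i l (DD (cv v) 0 i f)" for f
        by (induction l arbitrary: f) (auto simp: DD_dop)
      then show ?thesis .
    qed
    also have "DD (cv v) 0 i (V_basis v i) = (\<lambda>x. 0)"
      using that v_pos by (intro V_space_DD V_basis_in) auto
    finally show ?thesis by (simp add: B_def)
  qed
  \<comment> \<open>Rate per unit step to the left of an entry of column \<open>l\<close> with
    choice \<open>c\<close>, the factor \<open>v l powi z\<close> of the kernel included. It may
    exceed 1 for a single column; only products over tails of columns are small.\<close>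
  define \<kappa> where "\<kappa> c l = (if c = 0 then \<rho> else E * v c) / v l" for c l
  define d where "d c l z = (r / R) ^ nat z * \<kappa> c l ^ nat (- z)" for c l and z :: int
  have colb: "\<exists>C\<ge>0. \<forall>z. v l powi z * norm (X k c l z) * (?o l z) \<le> C * d c l z"
    if k: "k \<in> {1..N}" and c: "c \<in> {0..N}" and l: "l \<in> {1..N}" for k c l
  proof -
    define f where "f = (if c = 0 then DD (cv v) 0 l (q k) else B c l)"
    define s where "s = (if c = 0 then \<rho> else E * v c)"
    have s: "0 < s" using rho E(1) vr[of c] c by (auto simp: s_def)
    have "right_bounded s f"
    proof (cases "c = 0")
      case True
      then show ?thesis unfolding f_def s_def using q[OF k] rho by (simp add: right_bounded_DD pow_bounded_right)
    next
      case False
      then have c': "c \<in> {1..N}" using c by auto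
      have "0 < v c" "v c < E * v c" using vr[OF c'] E by auto
      from pow_exp_bound_right[OF this, of "mult_upto v (c - 1) (v c)"]
      have "right_bounded (E * v c) (V_basis v c)" unfolding right_bounded_def V_basis_def by blast
      then show ?thesis using s False by (simp add: f_def s_def B_def[abs_def] right_bounded_DD)
    qed
    then obtain C1 where C1: "0 \<le> C1" "\<And>x. 0 \<le> x ==> norm (f x) \<le> C1 * s powi x" unfolding right_bounded_def by blast
    have "k \<le> N" using k by auto
    from pow_boundedE[OF HH_bounded[OF mT_in[OF k] this, of "y k" l]]
    obtain C2 where C2: "0 \<le> C2" "\<And>z. norm (H k l z) \<le> C2 * (1 / R) powi z" unfolding H_def by blast
    have vl: "0 < v l" "v l < r" using vr[OF l] by auto
    have "v l powi z * norm (X k c l z) * (?o l z) \<le> (C1 + C2) * d c l z" for z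
    proof (cases "z \<le> 0")
      case True
      have vz: "v l powi z = (1 / v l) ^ nat (- z)" using True by (cases "z = 0") (auto simp: power_int_def power_one_over inverse_eq_divide)
      have x: "norm (X k c l z) \<le> C1 * s ^ nat (- z)"
        using C1(2)[of "- z"] True by (auto simp: X_def f_def power_int_def)
      have "(v l / r) ^ nat (- z) \<le> 1" using vl r0 by (intro power_le_one) auto
      then have "(?o l z) \<le> 1"
        using True by (cases "z = 0") (auto simp: power_int_def)
      then have "v l powi z * norm (X k c l z) * (?o l z) \<le> v l powi z * norm (X k c l z) * 1"
        using vl by (intro mult_left_mono) auto
      also have "\<dots> \<le> v l powi z * (C1 * s ^ nat (- z))" using x vl by (simp add: mult_left_mono)
      also have "\<dots> = C1 * d c l z"
        unfolding vz using True by (simp add: d_def \<kappa>_def s_def power_divide)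
      also have "\<dots> \<le> (C1 + C2) * d c l z"
        using C2(1) s vl r0 by (intro mult_right_mono) (auto simp: d_def \<kappa>_def s_def)
      finally show ?thesis .
    next
      case False
      then have z: "0 < z" by simp
      have x: "norm (X k c l z) \<le> C2 * (1 / R) powi z"
        using C2 z r0 by (auto simp: X_def)
      have "v l powi z * (?o l z) \<le> r powi z"
      proof (cases "l \<le> n")
        case True
        then show ?thesis using vl by (simp add: power_int_divide_distrib)
      next
        case False
        then show ?thesis using vl z by (simp add: power_int_def power_mono)
      qed
      then have "v l powi z * (?o l z) * norm (X k c l z) \<le> r powi z * (C2 * (1 / R) powi z)"
        using x r0 by (intro mult_mono) auto
      also have "\<dots> = C2 * d c l z"
        using z by (simp add: d_def power_int_def power_divide)
      also have "\<dots> \<le> (C1 + C2) * d c l z"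
        using C1(1) s vl r0 by (intro mult_right_mono) (auto simp: d_def \<kappa>_def s_def)
      finally show ?thesis by (simp only: mult_ac)
    qed
    then show ?thesis using C1(1) C2(1) by (intro exI[of _ "C1 + C2"]) auto
  qed
  define e where "e z = (r / R) ^ nat z * \<eta>' ^ nat (- z)" for z :: int
  have esum: "e summable_on UNIV"
  proof -
    have "e summable_on {..0}"
    proof (rule summable_on_cong[THEN iffD1])
      show "(\<lambda>z. (1 / \<eta>') powi z) summable_on {..0}" using \<eta>' by (intro powi_summable_le) auto
      show "(1 / \<eta>') powi z = e z" if "z \<in> {..0}" for z
        using that by (cases "z = 0") (auto simp: e_def power_int_def power_one_over inverse_eq_divide)
    qed
    moreover have "e summable_on {0<..}"
    proof (rule summable_on_cong[THEN iffD1])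
      show "(\<lambda>z. (r / R) powi z) summable_on {0<..}" using r r0 by (intro powi_summable_gt) auto
      show "(r / R) powi z = e z" if "z \<in> {0<..}" for z using that by (auto simp: e_def power_int_def)
    qed
    ultimately have "e summable_on ({..0} \<union> {0<..})" by (rule summable_on_Un_disjoint) auto
    also have "{..0} \<union> {0<..} = (UNIV :: int set)" by auto
    finally show ?thesis .
  qed
  have e0: "0 \<le> e z" for z using r0 \<eta>' by (simp add: e_def)
  define wtn where "wtn z = (\<Prod>k=1..n. (r / v k) powi z k)" for z
  have wtn0: "0 \<le> wtn z" for z
    unfolding wtn_def using vr n r0 by (intro prod_nonneg) (auto simp: less_imp_le)
  define Gd where "Gd z = (\<Prod>l=1..N. e (z l))" for z :: "nat => int"
  have Gd_sum: "Gd summable_on Omega N"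
  proof -
    have "(\<lambda>z. \<Prod>l\<in>{1..N}. e (z l)) summable_on ({1..N} \<rightarrow>\<^sub>E UNIV)"
      by (rule summable_prod_PiE) (use esum e0 in auto)
    then show ?thesis unfolding Gd_def by (rule summable_on_subset) (auto simp: Omega_def)
  qed
  have dprod: "(\<Prod>l=1..N. d (g l) l (z l)) \<le> Gd z"
    if z: "z \<in> Omega N" and g: "\<And>l. l \<in> {1..N} ==> g l = 0 \<or> (l < g l \<and> g l \<le> N)"
      and ginj: "\<And>l l'. l \<in> {1..N} ==> l' \<in> {1..N} ==> g l = g l' ==> g l \<noteq> 0 ==> l = l'" for z g
  proof -
    define \<zeta> where "\<zeta> l = nat (- z l)" for l
    define \<kappa>' where "\<kappa>' l = \<kappa> (g l) l" for l
    have gp: "0 < v (g l)" if "l \<in> {1..N}" "g l \<noteq> 0" for l using g[OF that(1)] that vr[of "g l"] by auto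
    have kp: "0 < \<kappa>' l" if "l \<in> {1..N}" for l
      using gp[OF that] vr[OF that] rho E by (auto simp: \<kappa>'_def \<kappa>_def)
    \<comment> \<open>A nonzero choice exceeds its column, so within this tail the chosen indices
      lie in \<open>{Suc i..N}\<close>. Their frequencies cancel against denominators, the index
      \<open>i\<close> is never chosen, and its factor \<open>\<rho> / v i \<le> \<rho> / lo\<close>
      beats the at most \<open>N\<close> factors \<open>E\<close>; the other factors are at most
      1.\<close>
    have tail: "(\<Prod>l=i..N. \<kappa>' l) \<le> \<eta>" if i: "i \<in> {1..N}" for i
    proof -
      define A where "A = {l \<in> {i..N}. g l \<noteq> 0}"
      have A: "A \<subseteq> {i..N}" "finite A" "A \<subseteq> {1..N}" using i by (auto simp: A_def)
      have gA: "g ` A \<subseteq> {Suc i..N}"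
      proof
        fix x assume "x \<in> g ` A"
        then obtain l where "l \<in> {i..N}" "g l \<noteq> 0" "x = g l" by (auto simp: A_def)
        then show "x \<in> {Suc i..N}" using g[of l] i by auto
      qed
      have inj: "inj_on g A" 
      proof (rule inj_onI)
        fix l l' assume "l \<in> A" "l' \<in> A" and gg: "g l = g l'"
        then have "l \<in> {1..N}" "l' \<in> {1..N}" "g l \<noteq> 0" using A(3) by (auto simp: A_def)
        then show "l = l'" using ginj gg by blast
      qed
      have vpos: "(\<Prod>l=i..N. v l) > 0" using vr i by (intro prod_pos) auto
      have "(\<Prod>l=i..N. (if g l = 0 then \<rho> else E * v (g l))) = (\<Prod>l\<in>A. E * v (g l)) * (\<Prod>l\<in>{i..N} - A. \<rho>)"
        using A by (subst prod.subset_diff[of A]) (auto simp: A_def intro!: prod.cong arg_cong2[of _ _ _ _ "(*)"])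
      also have "(\<Prod>l\<in>A. E * v (g l)) = E ^ card A * (\<Prod>c\<in>g ` A. v c)"
        by (simp add: prod.distrib prod.reindex[OF inj])
      also have "(\<Prod>l\<in>{i..N} - A. \<rho>) = \<rho> ^ card ({i..N} - g ` A)"
        using A gA inj by (simp add: card_Diff_subset card_image finite_subset[OF gA] subset_trans[OF gA])
      finally have num: "(\<Prod>l=i..N. (if g l = 0 then \<rho> else E * v (g l))) =
          E ^ card A * (\<Prod>c\<in>g ` A. v c) * \<rho> ^ card ({i..N} - g ` A)" .
      have "(\<Prod>l=i..N. v l) = (\<Prod>c\<in>{i..N} - g ` A. v c) * (\<Prod>c\<in>g ` A. v c)"
        using gA by (intro prod.subset_diff) auto
      then have "(\<Prod>l=i..N. \<kappa>' l) = (E ^ card A * (\<Prod>c\<in>g ` A. v c) * \<rho> ^ card ({i..N} - g ` A)) /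
          ((\<Prod>c\<in>{i..N} - g ` A. v c) * (\<Prod>c\<in>g ` A. v c))"
        unfolding \<kappa>'_def \<kappa>_def prod_dividef num by simp
      also have "\<dots> = E ^ card A * (\<rho> ^ card ({i..N} - g ` A) / (\<Prod>c\<in>{i..N} - g ` A. v c))"
      proof -
        have "(\<Prod>c\<in>g ` A. v c) \<noteq> 0" using vpos \<open>(\<Prod>l=i..N. v l) = _\<close> by auto
        then show ?thesis by simp
      qed
      also have "\<rho> ^ card ({i..N} - g ` A) / (\<Prod>c\<in>{i..N} - g ` A. v c) = (\<Prod>c\<in>{i..N} - g ` A. \<rho> / v c)"
        by (simp add: prod_dividef)
      also have "\<dots> = (\<rho> / v i) * (?P g A i)"
        using i gA by (intro prod.remove) auto
      also have "(\<rho> / v i) * (?P g A i) \<le> (\<rho> / lo) * 1"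
      proof (rule mult_mono)
        show "\<rho> / v i \<le> \<rho> / lo" using vr[OF i] rho lo_hi by (intro divide_left_mono) auto
        have "0 \<le> \<rho> / v c \<and> \<rho> / v c \<le> 1" if "c \<in> {i..N} - g ` A - {i}" for c
          using vr[of c] that i rho by auto
        then have "\<forall>c\<in>{i..N} - g ` A - {i}. 0 \<le> \<rho> / v c \<and> \<rho> / v c \<le> 1" by blast
        then have c01: "0 \<le> \<rho> / v c \<and> \<rho> / v c \<le> 1" if "c \<in> {i..N} - g ` A - {i}" for c using that by (rule bspec)
        show "(?P g A i) \<le> 1" by (rule prod_le_1[OF c01])
        show "0 \<le> (?P g A i)" by (rule prod_nonneg) (rule c01[THEN conjunct1])
      qed (use rho lo_hi in auto)
      also have "E ^ card A * ((\<rho> / lo) * 1) \<le> E ^ N * (\<rho> / lo)"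
      proof -
        have "card A \<le> N" using card_mono[OF _ A(3)] by simp
        then have "E ^ card A \<le> E ^ N" using E by (intro power_increasing) auto
        then show ?thesis using rho lo_hi unfolding mult_1_right by (intro mult_right_mono) auto
      qed
      finally show ?thesis using E\<rho> E by (simp add: mult_left_mono)
    qed
    have mono: "\<zeta> i \<le> \<zeta> (Suc i)" if "1 \<le> i" "i < N" for i
    proof -
      have "z (Suc i) < z i" using z unfolding Omega_eq by (rule OmegaI_less) (use that in auto)
      then show ?thesis by (simp add: \<zeta>_def)
    qed
    have "(\<Prod>l=1..N. \<kappa>' l ^ (\<zeta> l - 0)) \<le> \<eta> ^ (\<zeta> N - 0)"
      by (rule abel_prod_le) (use N kp tail mono in auto)
    also have "\<dots> \<le> (\<Prod>l=1..N. \<eta>' ^ \<zeta> l)"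
    proof -
      have le: "\<zeta> l \<le> \<zeta> N" if "l \<in> {1..N}" for l
      proof -
        have "z N \<le> z l" using Omega_gap[OF z that] by auto
        then show ?thesis by (simp add: \<zeta>_def)
      qed
      have "(\<Sum>l=1..N. \<zeta> l) \<le> (\<Sum>l=1..N. \<zeta> N)" by (rule sum_mono[OF le])
      then have "\<eta>' ^ (N * \<zeta> N) \<le> \<eta>' ^ (\<Sum>l=1..N. \<zeta> l)" using \<eta>' by (intro power_decreasing) auto
      then show ?thesis using \<eta>'(3) by (simp add: power_sum power_mult)
    qed
    finally have *: "(\<Prod>l=1..N. \<kappa>' l ^ \<zeta> l) \<le> (\<Prod>l=1..N. \<eta>' ^ \<zeta> l)" by simp
    have "(\<Prod>l=1..N. d (g l) l (z l)) = (\<Prod>l=1..N. (r / R) ^ nat (z l)) * (\<Prod>l=1..N. \<kappa>' l ^ \<zeta> l)"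
      by (simp add: d_def prod.distrib \<kappa>'_def \<zeta>_def)
    also have "\<dots> \<le> (\<Prod>l=1..N. (r / R) ^ nat (z l)) * (\<Prod>l=1..N. \<eta>' ^ \<zeta> l)"
      using r0 by (intro mult_left_mono * prod_nonneg) auto
    also have "\<dots> = Gd z" by (simp add: Gd_def e_def prod.distrib \<zeta>_def)
    finally show ?thesis .
  qed
  have "\<exists>K\<ge>0. \<forall>f\<in>{1..N} \<rightarrow>\<^sub>E {0..N}. \<forall>z\<in>Omega N.
      (?V z) * norm (?D f z) * wtn z \<le> K * Gd z"
  proof -
    have "\<exists>C\<ge>0. \<forall>(k, c, l)\<in>{1..N} \<times> {0..N} \<times> {1..N}. \<forall>z.
        v l powi z * norm (X k c l z) * (?o l z) \<le> C * d c l z"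
      unfolding case_prod_unfold
    proof (rule uniform_bound)
      fix kcl z assume "kcl \<in> {1..N} \<times> {0..N} \<times> {1..N}"
      then show "0 \<le> d (fst (snd kcl)) (snd (snd kcl)) z"
        using vr[of "snd (snd kcl)"] vr[of "fst (snd kcl)"] rho E r0 by (auto simp: d_def \<kappa>_def)
    next
      fix kcl assume "kcl \<in> {1..N} \<times> {0..N} \<times> {1..N}"
      then obtain k c l where kcl: "kcl = (k, c, l)" "k \<in> {1..N}" "c \<in> {0..N}" "l \<in> {1..N}" by auto
      from colb[OF kcl(2-4)]
      show "\<exists>C. \<forall>z. v (snd (snd kcl)) powi z * norm (X (fst kcl) (fst (snd kcl)) (snd (snd kcl)) z) *
          (if snd (snd kcl) \<le> n then (r / v (snd (snd kcl))) powi z else 1) \<le> C * d (fst (snd kcl)) (snd (snd kcl)) z"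
        unfolding kcl(1) fst_conv snd_conv by blast
    qed auto
    then obtain C where C: "0 \<le> C" and C': "\<And>k c l z. k \<in> {1..N} ==> c \<in> {0..N} ==> l \<in> {1..N} ==>
        v l powi z * norm (X k c l z) * (?o l z) \<le> C * d c l z" by blast
    have "(?V z) * norm (?D f z) * wtn z \<le> (fact N * C ^ N) * Gd z"
      if f: "f \<in> {1..N} \<rightarrow>\<^sub>E {0..N}" and z: "z \<in> Omega N" for f z
    proof -
      have Gd0: "0 \<le> Gd z" unfolding Gd_def by (intro prod_nonneg e0 ballI)
      have wtn_eq: "wtn z = (\<Prod>l=1..N. if l \<le> n then (r / v l) powi z l else 1)"
        unfolding wtn_def using n by (intro prod.mono_neutral_cong_left) auto
      have vp0: "0 \<le> (?V z)" using vr by (intro prod_nonneg) (auto simp: less_imp_le)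
      show ?thesis
      proof (cases "\<exists>k\<in>{1..N}. \<exists>k'\<in>{1..N}. k \<noteq> k' \<and> f k = f k' \<and> f k \<noteq> 0")
        case True
        then obtain k k' where "k \<in> {1..N}" "k' \<in> {1..N}" "k \<noteq> k'" "f k = f k'" "f k \<noteq> 0" by blast
        \<comment> \<open>For \<open>c \<noteq> 0\<close> the entry \<open>X k c l z\<close> does
          not depend on the row \<open>k\<close>, so a repeated choice produces two equal
          rows.\<close>
        then have "?D f z = 0"
          by (intro det1_eq_rows[of k N k']) (auto simp: X_def)
        then show ?thesis using C Gd0 by simp
      next
        case False
        have "norm (?D f z) \<le>
            (\<Sum>p | p permutes {0..<N}. \<Prod>i=0..<N. norm (X (p i + 1) (f (p i + 1)) (i + 1) (z (i + 1))))"
          using norm_det1_le[of N "\<lambda>l k. X k (f k) l (z l)"] det1_transpose[of N "\<lambda>k l. X k (f k) l (z l)"] by simp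
        then have "(?V z) * norm (?D f z) * wtn z \<le>
            (?V z) * (\<Sum>p | p permutes {0..<N}. \<Prod>i=0..<N. norm (X (p i + 1) (f (p i + 1)) (i + 1) (z (i + 1)))) * wtn z"
          using vp0 wtn0 by (intro mult_right_mono mult_left_mono)
        also have "\<dots> = (\<Sum>p | p permutes {0..<N}. (?V z) * (\<Prod>i=0..<N. norm (X (p i + 1) (f (p i + 1)) (i + 1) (z (i + 1)))) * wtn z)"
          by (simp add: sum_distrib_left sum_distrib_right)
        also have "\<dots> \<le> (\<Sum>p | p permutes {0..<N}. C ^ N * Gd z)"
        proof (rule sum_mono)
          fix p assume "p \<in> {p. p permutes {0..<N}}"
          then have p: "p permutes {0..<N}" by simp
          define g where "g l = f (p (l - 1) + 1)" for l
          have pin: "p (l - 1) + 1 \<in> {1..N}" if "l \<in> {1..N}" for l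
            using permutes_in_image[OF p, of "l - 1"] that by auto
          have "(\<Prod>i=0..<N. norm (X (p i + 1) (f (p i + 1)) (i + 1) (z (i + 1)))) =
              (\<Prod>l=1..N. norm (X (p (l - 1) + 1) (g l) l (z l)))"
            using prod_shift[of "\<lambda>l. norm (X (p (l - 1) + 1) (g l) l (z l))" N] by (simp add: g_def)
          then have eq: "(?V z) * (\<Prod>i=0..<N. norm (X (p i + 1) (f (p i + 1)) (i + 1) (z (i + 1)))) * wtn z =
              (\<Prod>l=1..N. v l powi z l * norm (X (p (l - 1) + 1) (g l) l (z l)) * (?o l (z l)))"
            by (simp only: wtn_eq prod.distrib)
          have gN: "g l \<in> {0..N}" if "l \<in> {1..N}" for l using f pin[OF that] by (auto simp: g_def)
          show "(?V z) * (\<Prod>i=0..<N. norm (X (p i + 1) (f (p i + 1)) (i + 1) (z (i + 1)))) * wtn z \<le> C ^ N * Gd z"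
          proof (cases "\<exists>l\<in>{1..N}. g l \<noteq> 0 \<and> g l \<le> l")
            case True
            then obtain l where l: "l \<in> {1..N}" "g l \<noteq> 0" "g l \<le> l" by blast
            then have "X (p (l - 1) + 1) (g l) l (z l) = 0" using B0[of "g l" l] gN[of l] by (auto simp: X_def)
            then have "(\<Prod>l=1..N. v l powi z l * norm (X (p (l - 1) + 1) (g l) l (z l)) * (?o l (z l))) = 0"
              using l(1) by (intro prod_zero) (auto intro!: bexI[of _ l])
            then show ?thesis unfolding eq using mult_nonneg_nonneg[OF zero_le_power[OF C] Gd0] by (simp only:)
          next
            case False
            have "(\<Prod>l=1..N. v l powi z l * norm (X (p (l - 1) + 1) (g l) l (z l)) * (?o l (z l))) \<le>
                (\<Prod>l=1..N. C * d (g l) l (z l))"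
            proof (rule prod_mono, rule conjI)
              fix l assume l: "l \<in> {1..N}"
              show "0 \<le> v l powi z l * norm (X (p (l - 1) + 1) (g l) l (z l)) * (?o l (z l))"
                using vr[OF l] r0 by auto
              show "v l powi z l * norm (X (p (l - 1) + 1) (g l) l (z l)) * (?o l (z l)) \<le> C * d (g l) l (z l)"
                by (rule C'[OF pin[OF l] gN[OF l] l])
            qed
            also have "\<dots> = C ^ N * (\<Prod>l=1..N. d (g l) l (z l))" by (simp add: prod.distrib)
            also have "\<dots> \<le> C ^ N * Gd z"
            proof (intro mult_left_mono dprod[OF z])
              show "g l = 0 \<or> (l < g l \<and> g l \<le> N)" if "l \<in> {1..N}" for l using False gN[OF that] that by auto
              show "l = l'" if "l \<in> {1..N}" "l' \<in> {1..N}" "g l = g l'" "g l \<noteq> 0" for l l'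
              proof -
                have "p (l - 1) + 1 = p (l' - 1) + 1"
                  using that pin[OF that(1)] pin[OF that(2)] \<open>\<not> (\<exists>k\<in>{1..N}. \<exists>k'\<in>{1..N}. k \<noteq> k' \<and> f k = f k' \<and> f k \<noteq> 0)\<close>
                  unfolding g_def by blast
                then have "l - 1 = l' - 1" using permutes_inj[OF p] by (simp add: inj_eq)
                then show ?thesis using that by auto
              qed
            qed (use C in auto)
            finally show ?thesis unfolding eq .
          qed
        qed
        also have "\<dots> = (fact N * C ^ N) * Gd z" by (simp add: card_permutations)
        finally show ?thesis .
      qed
    qed
    then show ?thesis using C by (intro exI[of _ "fact N * C ^ N"]) auto
  qed
  then obtain K where K: "0 \<le> K" "\<And>f z. f \<in> {1..N} \<rightarrow>\<^sub>E {0..N} ==> z \<in> Omega N ==>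
      (?V z) * norm (?D f z) * wtn z \<le> K * Gd z" by blast
  define c0 where "c0 = norm (\<Prod>i=1..N. P (T i) (cv v i)) * (\<Prod>k=1..N. v k powi (- y k))"
  have c00: "0 \<le> c0" unfolding c0_def using vr by (intro mult_nonneg_nonneg prod_nonneg) (auto simp: less_imp_le)
  define W where "W = (\<Sum>f\<in>{1..N} \<rightarrow>\<^sub>E {0..N}. norm (\<Prod>k=1..N. w k (f k)))"
  have main: "norm (Gm z) * wtn z \<le> (c0 * (W * K)) * Gd z" if z: "z \<in> Omega N" for z
  proof -
    have nv: "norm (cv v k powi j) = v k powi j" if "k \<in> {1..N}" for k j using vr[OF that] by (simp add: norm_power_int)
    have "det1 N (\<lambda>k l. Ff k l (y k) (z l) (- T k)) =
        det1 N (\<lambda>k l. ((- 1) ^ k * cv v k powi (- y k)) * ((- 1) ^ l * cv v l powi z l) * H k l (z l))"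
      unfolding H_def using mT_in by (intro det1_cong F_fun_eq) auto
    also have "\<dots> = (\<Prod>k=1..N. (- 1) ^ k * cv v k powi (- y k)) * (\<Prod>l=1..N. (- 1) ^ l * cv v l powi z l) *
        det1 N (\<lambda>k l. H k l (z l))" by (rule det1_scale)
    finally have "norm (det1 N (\<lambda>k l. Ff k l (y k) (z l) (- T k))) =
        norm (\<Prod>k=1..N. (- 1) ^ k * cv v k powi (- y k)) * norm (\<Prod>l=1..N. (- 1) ^ l * cv v l powi z l) *
        norm (det1 N (\<lambda>k l. H k l (z l)))" by (simp only: norm_mult)
    also have "norm (\<Prod>k=1..N. (- 1) ^ k * cv v k powi (- y k)) = (\<Prod>k=1..N. v k powi (- y k))"
      unfolding prod_norm[symmetric]
      by (rule prod.cong[OF refl]) (simp only: norm_mult norm_power norm_minus_cancel norm_one power_one mult_1_left nv)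
    also have "norm (\<Prod>k=1..N. (- 1) ^ k * cv v k powi z k) = (\<Prod>k=1..N. v k powi z k)"
      unfolding prod_norm[symmetric]
      by (rule prod.cong[OF refl]) (simp only: norm_mult norm_power norm_minus_cancel norm_one power_one mult_1_left nv)
    finally have G: "norm (Gm z) = c0 * ((\<Prod>k=1..N. v k powi z k) * norm (det1 N (\<lambda>k l. H k l (z l))))"
      by (simp only: G_minus_def norm_mult c0_def mult_ac)
    have "det1 N (\<lambda>k l. H k l (z l)) = det1 N (\<lambda>k l. \<Sum>c\<in>{0..N}. w k c * X k c l (z l))"
      by (rule det1_cong) (rule HX)
    also have "\<dots> = (\<Sum>f\<in>{1..N} \<rightarrow>\<^sub>E {0..N}. det1 N (\<lambda>k l. w k (f k) * X k (f k) l (z l)))"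
      by (rule det1_row_sum) simp
    also have "\<dots> = (\<Sum>f\<in>{1..N} \<rightarrow>\<^sub>E {0..N}. (\<Prod>k=1..N. w k (f k)) * ?D f z)"
    proof (rule sum.cong[OF refl])
      fix f show "det1 N (\<lambda>k l. w k (f k) * X k (f k) l (z l)) = (\<Prod>k=1..N. w k (f k)) * ?D f z"
        using det1_scale[of N "\<lambda>k. w k (f k)" "\<lambda>_. 1" "\<lambda>k l. X k (f k) l (z l)"] by simp
    qed
    finally have "norm (det1 N (\<lambda>k l. H k l (z l))) \<le>
        (\<Sum>f\<in>{1..N} \<rightarrow>\<^sub>E {0..N}. norm (\<Prod>k=1..N. w k (f k)) * norm (?D f z))"
      by (simp only: norm_mult[symmetric] norm_sum)
    then have "((\<Prod>k=1..N. v k powi z k) * norm (det1 N (\<lambda>k l. H k l (z l)))) * wtn z \<le>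
        ((\<Prod>k=1..N. v k powi z k) * (\<Sum>f\<in>{1..N} \<rightarrow>\<^sub>E {0..N}. norm (\<Prod>k=1..N. w k (f k)) * norm (?D f z))) * wtn z"
      using wtn0 vr by (intro mult_right_mono mult_left_mono prod_nonneg) (auto simp: less_imp_le)
    also have "\<dots> = (\<Sum>f\<in>{1..N} \<rightarrow>\<^sub>E {0..N}. norm (\<Prod>k=1..N. w k (f k)) *
        ((?V z) * norm (?D f z) * wtn z))"
      by (simp only: sum_distrib_left sum_distrib_right mult_ac)
    also have "\<dots> \<le> (\<Sum>f\<in>{1..N} \<rightarrow>\<^sub>E {0..N}. norm (\<Prod>k=1..N. w k (f k)) * (K * Gd z))"
      using K(2)[OF _ z] by (intro sum_mono mult_left_mono) auto
    also have "\<dots> = W * (K * Gd z)" by (simp only: W_def sum_distrib_right)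
    finally have "c0 * (((\<Prod>k=1..N. v k powi z k) * norm (det1 N (\<lambda>k l. H k l (z l)))) * wtn z) \<le> c0 * (W * (K * Gd z))"
      using c00 by (rule mult_left_mono)
    then show ?thesis unfolding G by (simp only: mult.assoc)
  qed
  have "(\<lambda>z. (c0 * (W * K)) * Gd z) summable_on Omega N" by (rule summable_on_cmult_right[OF Gd_sum])
  then have "(\<lambda>z. norm (Gm z) * wtn z) summable_on Omega N"
    by (rule summable_on_comparison_test) (use main wtn0 in auto)
  then show ?thesis by (simp only: wtn_def)
qed

end

section \<open>The determinant of finite size\<close>

context contour_setting
begin

lemma P_zero: "w \<in> annulus \<rho> R ==> P 0 w = 1"
  using P_add[of 0 0 w] P_nz[of 0 w] TT_0 by auto

lemma P_minus: "t \<in> TT ==> w \<in> annulus \<rho> R ==> P t w * P (- t) w = 1"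
  using P_add[of t "- t" w] TT_diff[of 0 t] TT_0 by (simp add: P_zero)

text \<open>Since \<open>CC\<close> commutes with \<open>DD\<close>, and \<open>DD\<close> involves
  finitely many values, the limit reduces to that of a truncated convolution.\<close>

lemma DD_truncate:
  assumes "t \<in> TT" "two_bounded lo hi f"
  shows "(\<lambda>p. CC t (DD (cv v) k n (restr_gt (- int p) f)) x) \<longlonglongrightarrow> CC t (DD (cv v) k n f) x"
proof -
  interpret conv_kernel lo hi "lcoeff \<rho> (P t)" by (rule kernel_lo_hi[OF assms(1)])
  have tr: "two_bounded lo hi (restr_gt b f)" for b
    using lo_hi restr_gt_bounded[OF assms(2), of b] by (intro two_bounded_mono_right) auto
  have lim: "(\<lambda>p. DD (cv v) k n (g p) x) \<longlonglongrightarrow> DD (cv v) k n g' x" if "\<And>x. (\<lambda>p. g p x) \<longlonglongrightarrow> g' x" for g g' x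
    using that
  proof (induction n arbitrary: g g')
    case (Suc n)
    show ?case
    proof (cases "k \<le> n")
      case True
      then show ?thesis by (simp, intro Suc.IH) (auto simp: dop_def intro!: tendsto_intros Suc.prems)
    qed (use Suc.prems in auto)
  qed simp
  have "(\<lambda>p. CC t (restr_gt (- int p) f) x) \<longlonglongrightarrow> CC t f x" for x
    using conv_truncate[OF assms(2), of x] by (simp add: CC_def restr_gt_def[abs_def])
  then have "(\<lambda>p. DD (cv v) k n (CC t (restr_gt (- int p) f)) x) \<longlonglongrightarrow> DD (cv v) k n (CC t f) x" by (rule lim)
  then show ?thesis
    using conv_kernel_DD[OF kernel_lo_hi[OF assms(1)] tr] conv_kernel_DD[OF kernel_lo_hi[OF assms(1)] assms(2)]
    by (simp add: CC_def)
qed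

text \<open>\<open>DD\<close> undoes \<open>QQ\<close>, and the time \<open>t\<close> combines with
  \<open>- T k\<close>; so lifting and propagating a function leaves its pairings with the
  functionals unchanged.\<close>

lemma LL_QQ:
  assumes n: "n \<le> N" and t: "t \<in> TT" and k: "k \<in> {1..n}" and f: "pow_bounded hi f"
  shows "LL N 0 k (QQ n N (CC t f)) = LL n t k f"
proof -
  have Tk: "- T k \<in> TT" using mT_in k n by auto
  have fk: "pow_bounded hi (DD (cv v) k n f)" using lo_hi f by (intro pow_bounded_DD)
  have "LL N 0 k (QQ n N (CC t f)) = CC (- T k) (DD (cv v) k n (DD (cv v) n N (QQ n N (CC t f)))) (y k)"
    using k n DD_split[of k n N "cv v"] by (simp add: LL_def)
  also have "DD (cv v) n N (QQ n N (CC t f)) = CC t f"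
    using n by (intro DD_QQ CC_bounded t f) auto
  also have "DD (cv v) k n (CC t f) = CC t (DD (cv v) k n f)"
    unfolding CC_def by (rule conv_kernel_DD[OF kernel_hi[OF t], symmetric]) (use f in \<open>simp add: two_bounded_self\<close>)
  also have "CC (- T k) (CC t (DD (cv v) k n f)) = CC (- T k + t) (DD (cv v) k n f)"
    by (rule CC_CC[where a = hi and b = hi]) (use Tk t lo_hi fk in \<open>auto simp: two_bounded_self\<close>)
  also have "CC (- T k + t) (DD (cv v) k n f) (y k) = LL n t k f" by (simp add: LL_def)
  finally show ?thesis .
qed

end

context path_setting
begin

lemma pwr_prod:
  "1 \<le> i ==> pwr i u s X = Gt (nl i) s (tl i) u (X i) *
    (\<Prod>j\<in>{1..<i}. Gt (nl j) (tl (j + 1)) (tl j) (X (j + 1)) (X j))"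
proof (induction i arbitrary: u s)
  case (Suc i)
  show ?case
  proof (cases "i = 0")
    case False
    then show ?thesis using Suc by (simp add: prod.atLeastLessThan_Suc mult_ac)
  qed simp
qed simp

lemma G_plus_eq:
  "G_plus v R P m \<nn> z x = (\<Sum>\<^sub>\<infinity>X\<in>{X \<in> (\<Pi>\<^sub>E i\<in>{1..m}. Omega (nl i)). \<forall>i\<in>{1..m}. X i (nl i) = x i}. pwr m z 0 X)"
proof -
  have nl: "fst (\<nn> i) = nl i" if "i \<in> {1..m}" for i using that by (simp add: nl_def)
  have "(\<Pi>\<^sub>E i\<in>{1..m}. Omega (fst (\<nn> i))) = (\<Pi>\<^sub>E i\<in>{1..m}. Omega (nl i))" by (rule PiE_cong) (simp add: nl)
  then have dom: "{X. X \<in> (\<Pi>\<^sub>E i\<in>{1..m}. Omega (fst (\<nn> i))) \<and> (\<forall>i\<in>{1..m}. X i (fst (\<nn> i)) = x i)} =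
      {X \<in> (\<Pi>\<^sub>E i\<in>{1..m}. Omega (nl i)). \<forall>i\<in>{1..m}. X i (nl i) = x i}" using nl by auto
  have "Gt (fst (\<nn> m)) 0 (snd (\<nn> m)) (restrict z {1..fst (\<nn> m)}) (X m) *
      (\<Prod>i\<in>{1..<m}. Gt (fst (\<nn> i)) (snd (\<nn> (i + 1))) (snd (\<nn> i)) (restrict (X (i + 1)) {1..fst (\<nn> i)}) (X i)) =
      pwr m z 0 X" for X
    unfolding pwr_prod[OF m]
  proof (intro arg_cong2[of _ _ _ _ "(*)"] prod.cong refl)
    show "Gt (fst (\<nn> m)) 0 (snd (\<nn> m)) (restrict z {1..fst (\<nn> m)}) (X m) = Gt (nl m) 0 (tl m) z (X m)"
      unfolding nl[of m, OF atLeastAtMost_iff[THEN iffD2, OF conjI[OF m order_refl]]] tl_def by (rule G_trans_cong) simp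
    show "Gt (fst (\<nn> i)) (snd (\<nn> (i + 1))) (snd (\<nn> i)) (restrict (X (i + 1)) {1..fst (\<nn> i)}) (X i) =
        Gt (nl i) (tl (i + 1)) (tl i) (X (i + 1)) (X i)" if "i \<in> {1..<m}" for i
    proof -
      have "i \<in> {1..m}" using that by auto
      from nl[OF this] show ?thesis unfolding tl_def by (simp only:) (rule G_trans_cong, simp)
    qed
  qed
  then show ?thesis unfolding G_plus_def Let_def dom by simp
qed

definition endp :: "(nat => nat => int) => nat => int" where
  "endp X = (\<lambda>i\<in>{1..m}. X i (nl i))"

lemma minus_path_summable:
  "(\<lambda>(z, X). norm (Gm z * pwr m z 0 X)) summable_on Omega N \<times> XX m"
proof -
  obtain C where C: "0 \<le> C" "\<And>u. (\<lambda>X. norm (pwr m u 0 X)) summable_on XX m"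
    "\<And>u. (\<Sum>\<^sub>\<infinity>X\<in>XX m. norm (pwr m u 0 X)) \<le> C * wt m u" using path_abs[OF order_refl TT_0] by blast
  have Gs: "(\<lambda>z. norm (Gm z) * wt m z) summable_on Omega N"
    unfolding wt_def by (rule G_minus_summable) (use nl_le_N[of m] rad(1)[of m] in auto)
  have s: "(\<lambda>z. norm (Gm z) * (\<Sum>\<^sub>\<infinity>X\<in>XX m. norm (pwr m z 0 X))) summable_on Omega N"
  proof (rule summable_on_comparison_test[OF summable_on_cmult_right[OF Gs, of C]])
    fix z
    have "norm (Gm z) * (\<Sum>\<^sub>\<infinity>X\<in>XX m. norm (pwr m z 0 X)) \<le> norm (Gm z) * (C * wt m z)"
      by (intro mult_left_mono C(3)) simp
    then show "norm (Gm z) * (\<Sum>\<^sub>\<infinity>X\<in>XX m. norm (pwr m z 0 X)) \<le> C * (norm (Gm z) * wt m z)"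
      by (simp only: mult_ac)
  qed (auto intro!: mult_nonneg_nonneg infsum_nonneg)
  show ?thesis
  proof (rule summable_on_SigmaI[OF _ s])
    fix z
    show "((\<lambda>X. case (z, X) of (z, X) => norm (Gm z * pwr m z 0 X)) has_sum
        norm (Gm z) * (\<Sum>\<^sub>\<infinity>X\<in>XX m. norm (pwr m z 0 X))) (XX m)"
      unfolding case_prod_conv norm_mult by (intro has_sum_cmult_right has_sum_infsum C(2))
  qed auto
qed

text \<open>The constraint concerns only the last entries of the configurations, so summing over
  these entries and over the fibres amounts to summing over the constrained configurations
  \<open>XX m\<close>.\<close>

lemma M_fun_eq_infsum:
  "M_fun v R P N T m \<nn> y a = (\<Sum>\<^sub>\<infinity>z\<in>Omega N. Gm z * (\<Sum>\<^sub>\<infinity>X\<in>XX m. pwr m z 0 X))"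
proof -
  define A where "A = {x \<in> {1..m} \<rightarrow>\<^sub>E (UNIV :: int set). \<forall>i\<in>{1..m}. x i > a i}"
  have fib: "{X \<in> (\<Pi>\<^sub>E i\<in>{1..m}. Omega (nl i)). \<forall>i\<in>{1..m}. X i (nl i) = x i} = {X \<in> XX m. endp X = x}"
    if x: "x \<in> A" for x
  proof -
    have "endp X = x \<longleftrightarrow> (\<forall>i\<in>{1..m}. X i (nl i) = x i)" for X
      using x by (auto simp: endp_def A_def fun_eq_iff PiE_def extensional_def restrict_def)
    moreover have "X \<in> XX m \<longleftrightarrow> X \<in> (\<Pi>\<^sub>E i\<in>{1..m}. Omega (nl i))" if "\<forall>i\<in>{1..m}. X i (nl i) = x i" for X
      using that x by (auto simp: XX_def OmegaA_def A_def PiE_def Pi_def)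
    ultimately show ?thesis by blast
  qed
  have "M_fun v R P N T m \<nn> y a =
      (\<Sum>\<^sub>\<infinity>x\<in>A. \<Sum>\<^sub>\<infinity>z\<in>Omega N. \<Sum>\<^sub>\<infinity>X\<in>{X \<in> XX m. endp X = x}. (\<lambda>(z, X). Gm z * pwr m z 0 X) (z, X))"
    unfolding M_fun_def G_path_def A_def[symmetric]
    by (intro infsum_cong) (simp only: G_plus_eq fib infsum_cmult_right' case_prod_conv)
  also have "\<dots> = (\<Sum>\<^sub>\<infinity>z\<in>Omega N. \<Sum>\<^sub>\<infinity>X\<in>XX m. (\<lambda>(z, X). Gm z * pwr m z 0 X) (z, X))"
  proof (rule infsum_fibres)
    show "(\<lambda>w. norm ((\<lambda>(z, X). Gm z * pwr m z 0 X) w)) summable_on Omega N \<times> XX m"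
      using minus_path_summable by (simp add: case_prod_unfold)
    show "endp X \<in> A" if "X \<in> XX m" for X
      using that by (auto simp: endp_def A_def XX_def OmegaA_def PiE_def Pi_def)
  qed
  finally show ?thesis by (simp add: infsum_cmult_right')
qed

lemma minus_path_abs:
  "(\<lambda>z. norm (Gm z * (\<Sum>\<^sub>\<infinity>X\<in>XX m. pwr m z 0 X))) summable_on Omega N"
proof -
  obtain C where C: "0 \<le> C" "\<And>u. (\<lambda>X. norm (pwr m u 0 X)) summable_on XX m"
    "\<And>u. (\<Sum>\<^sub>\<infinity>X\<in>XX m. norm (pwr m u 0 X)) \<le> C * wt m u" using path_abs[OF order_refl TT_0] by blast
  have Gs: "(\<lambda>z. norm (Gm z) * wt m z) summable_on Omega N"
    unfolding wt_def by (rule G_minus_summable) (use nl_le_N[of m] rad(1)[of m] in auto)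
  show ?thesis
  proof (rule summable_on_comparison_test[OF summable_on_cmult_right[OF Gs, of C]])
    fix z
    have "norm (\<Sum>\<^sub>\<infinity>X\<in>XX m. pwr m z 0 X) \<le> C * wt m z"
      using norm_infsum_bound[OF C(2), of z] C(3)[of z] by linarith
    then have "norm (Gm z) * norm (\<Sum>\<^sub>\<infinity>X\<in>XX m. pwr m z 0 X) \<le> norm (Gm z) * (C * wt m z)"
      by (intro mult_left_mono) simp_all
    then show "norm (Gm z * (\<Sum>\<^sub>\<infinity>X\<in>XX m. pwr m z 0 X)) \<le> C * (norm (Gm z) * wt m z)"
      by (simp only: norm_mult mult_ac)
  qed auto
qed

text \<open>The sum over the configuration at time 0 is treated like one more node, at level
  \<open>N\<close>. There is no constraint at this node, so an artificial cut at
  \<open>- int p\<close> is introduced, as \<open>det_step\<close> demands, and then removed by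
  dominated convergence.\<close>

lemma M_fun_eq_det:
  "M_fun v R P N T m \<nn> y a = det1 (nl m) (\<lambda>k j. LL (nl m) (tl m) k (fs m j))"
proof -
  let ?n = "nl m" and ?t = "tl m"
  have mm: "m \<in> {1..m}" using m by simp
  have n: "1 \<le> ?n" "?n \<le> N" using nl_range[OF mm] by auto
  note t = tl_in[OF mm]
  define h where "h j = CC ?t (fs m j)" for j
  have hb: "pow_bounded hi (h j)" if "j \<in> {1..?n}" for j
    unfolding h_def by (intro CC_bounded t fs_bounded that) simp
  \<comment> \<open>An auxiliary dual family at level \<open>N\<close> and time 0, which need not be
    on the path; it fills the columns beyond \<open>nl m\<close>.\<close>
  obtain \<Phi>0 where "is_Phi v \<rho> P T y (N, 0) \<Phi>0" using is_Phi_exists[OF TT_0 order_refl] by blast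
  then have \<Phi>0: "\<forall>k<N. \<Phi>0 k \<in> VV N \<and> (\<forall>l\<in>{1..N}. LL N 0 l (\<Phi>0 k) = (if k + l = N then 1 else 0))"
    using is_Phi_iff[OF TT_0 order_refl] by blast
  define \<kappa> where "\<kappa> j = \<Phi>0 (N - j)" for j
  have \<kappa>: "\<kappa> j \<in> VV N" "\<And>l. l \<in> {1..N} ==> LL N 0 l (\<kappa> j) = (if l = j then 1 else 0)" if "j \<in> {1..N}" for j
  proof -
    have lt: "N - j < N" using that N by auto
    show "\<kappa> j \<in> VV N" using \<Phi>0 lt by (simp add: \<kappa>_def)
    fix l assume l: "l \<in> {1..N}"
    have "LL N 0 l (\<kappa> j) = (if N - j + l = N then 1 else 0)" using \<Phi>0 lt l by (simp add: \<kappa>_def)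
    also have "N - j + l = N \<longleftrightarrow> l = j" using that l by auto
    finally show "LL N 0 l (\<kappa> j) = (if l = j then 1 else 0)" .
  qed
  define q where "q j = (if j \<le> ?n then QQ ?n N (h j) else \<kappa> j)" for j
  have "\<forall>j\<in>{?n+1..N}. \<exists>\<theta>. DD (cv v) j N (q j) = (\<lambda>x. \<theta> * cv v j powi x) \<and> \<theta> * (P (- T j) (cv v j) * cv v j powi y j) = 1"
  proof
    fix j assume j: "j \<in> {?n+1..N}"
    then have j': "j \<in> {1..N}" by auto
    obtain \<theta> where "DD (cv v) j N (\<kappa> j) = (\<lambda>x. \<theta> * cv v j powi x)" "\<theta> * (P (0 - T j) (cv v j) * cv v j powi y j) = 1"
      by (rule LL_first[OF TT_0 order_refl \<kappa>(1)[OF j'], of j]) (use j' \<kappa>(2)[OF j'] in auto)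
    then show "\<exists>\<theta>. DD (cv v) j N (q j) = (\<lambda>x. \<theta> * cv v j powi x) \<and> \<theta> * (P (- T j) (cv v j) * cv v j powi y j) = 1"
      using j by (auto simp: q_def)
  qed
  from bchoice[OF this] obtain \<theta> where \<theta>: "\<And>j. j \<in> {?n+1..N} ==> DD (cv v) j N (q j) = (\<lambda>x. \<theta> j * cv v j powi x)"
    "\<And>j. j \<in> {?n+1..N} ==> \<theta> j * (P (- T j) (cv v j) * cv v j powi y j) = 1" by blast
  define \<Theta> where "\<Theta> = (\<Prod>j=?n+1..N. \<theta> j)"
  have "\<theta> j \<noteq> 0" if "j \<in> {?n+1..N}" for j using \<theta>(2)[OF that] by auto
  then have \<Theta>0: "\<Theta> \<noteq> 0" unfolding \<Theta>_def prod_zero_iff[OF finite_atLeastAtMost] by blast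
  have q_bd: "two_bounded lo hi (q j)" if "j \<in> {1..N}" for j
  proof (cases "j \<le> ?n")
    case True
    then have "pow_bounded hi (q j)" unfolding q_def using that by (auto intro!: QQ_bounded hb)
    then show ?thesis using lo_hi by (intro two_bounded_mono_right) auto
  next
    case False
    then show ?thesis using VV_bounded[OF order_refl \<kappa>(1)[OF that]] by (simp add: q_def)
  qed
  have raise: "cost N (\<lambda>j. restr_gt b (q j)) z = (if b < z N then cost ?n h z * \<Theta> else 0)" if z: "z \<in> Omega N" for b z
    unfolding \<Theta>_def
  proof (rule cost_raise[OF N n(2) order_refl z])
    show "DD (cv v) ?n N (q j) = h j" if "j \<in> {1..?n}" for j
      using that DD_QQ[OF n(2) order_refl hb[OF that]] by (simp add: q_def)
    show "DD (cv v) j N (q j) = (\<lambda>x. \<theta> j * cv v j powi x)" if "j \<in> {?n+1..N}" for j by (rule \<theta>(1)[OF that])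
    show "DD (cv v) k N (q j) = (\<lambda>x. 0)" if j: "j \<in> {?n+1..N}" and k: "k < j" for j k
    proof -
      have j': "j \<in> {1..N}" using j by auto
      have "DD (cv v) k N (\<kappa> j) = (\<lambda>x. 0)"
        by (rule LL_zero_DD[OF TT_0 order_refl \<kappa>(1)[OF j'] _ _ k]) (use j \<kappa>(2)[OF j'] in auto)
      then show ?thesis using j by (simp add: q_def)
    qed
  qed
  define K where "K = con m * (\<Prod>j=1..?n. P (0 - ?t) (cv v j))"
  define g where "g z = Gm z * (\<Sum>\<^sub>\<infinity>X\<in>XX m. pwr m z 0 X)" for z
  have g: "g z = Gm z * (K * cost ?n h z)" for z
    using path_sum[OF order_refl TT_0, of z] by (simp add: g_def K_def h_def[abs_def])
  define PT where "PT = (\<Prod>i=1..N. P (T i) (cv v i))"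
  define Dp where "Dp p = det1 N (\<lambda>k j. cv v k powi (- y k) * CC (- T k) (DD (cv v) k N (restr_gt (- int p) (q j))) (y k))" for p
  let ?D = "\<lambda>p z. if - int p < z N then g z else 0"
  have eqp: "\<Theta> * (\<Sum>\<^sub>\<infinity>z\<in>Omega N. if - int p < z N then g z else 0) = K * (PT * Dp p)" for p
  proof -
    have "((\<lambda>z. det1 N (\<lambda>k l. Ff k l (y k) (z l) (- T k)) * cost N (\<lambda>j. restr_gt (- int p) (q j)) z) has_sum Dp p) (Omega N)"
      unfolding Dp_def
    proof (rule det_step[where a = "- int p", OF order_refl])
      show "pow_bounded hi (restr_gt (- int p) (q j))" if "j \<in> {1..N}" for j
        using q_bd[OF that] lo_hi by (intro restr_gt_bounded) auto
    qed (auto simp: restr_gt_def intro!: mT_in)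
    from has_sum_cmult_right[OF this, of "K * PT"]
    have "((\<lambda>z. K * PT * (det1 N (\<lambda>k l. Ff k l (y k) (z l) (- T k)) * cost N (\<lambda>j. restr_gt (- int p) (q j)) z)) has_sum K * PT * Dp p) (Omega N)" .
    then have "((\<lambda>z. \<Theta> * (?D p z)) has_sum K * PT * Dp p) (Omega N)"
    proof (rule has_sum_cong[THEN iffD1, rotated])
      fix z assume "z \<in> Omega N"
      then show "K * PT * (det1 N (\<lambda>k l. Ff k l (y k) (z l) (- T k)) * cost N (\<lambda>j. restr_gt (- int p) (q j)) z) =
          \<Theta> * (?D p z)"
        by (simp add: raise g G_minus_def PT_def)
    qed
    from infsumI[OF this] show ?thesis by (simp add: infsum_cmult_right' mult.assoc)
  qed
  have lim1: "(\<lambda>p. \<Sum>\<^sub>\<infinity>z\<in>Omega N. if - int p < z N then g z else 0) \<longlonglongrightarrow> infsum g (Omega N)"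
  proof (rule infsum_dominated)
    show "(\<lambda>z. norm (g z)) summable_on Omega N" unfolding g_def by (rule minus_path_abs)
    show "norm (?D p z) \<le> norm (g z)" for p z by simp
    show "(\<lambda>p. if - int p < z N then g z else 0) \<longlonglongrightarrow> g z" for z
    proof (rule tendsto_eventually)
      show "\<forall>\<^sub>F p in sequentially. (?D p z) = g z"
        using eventually_gt_at_top[of "nat (- z N)"] by eventually_elim auto
    qed
  qed
  let ?L = "\<lambda>k j. cv v k powi (- y k) * LL N 0 k (q j)"
  have lim2: "Dp \<longlonglongrightarrow> det1 N ?L"
    unfolding Dp_def
  proof (rule tendsto_det1)
    fix k j assume k: "k \<in> {1..N}" and j: "j \<in> {1..N}"
    have "(\<lambda>p. CC (- T k) (DD (cv v) k N (restr_gt (- int p) (q j))) (y k)) \<longlonglongrightarrow> LL N 0 k (q j)"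
      using DD_truncate[OF mT_in[OF k] q_bd[OF j]] by (simp add: LL_def)
    then show "(\<lambda>p. cv v k powi (- y k) * CC (- T k) (DD (cv v) k N (restr_gt (- int p) (q j))) (y k)) \<longlonglongrightarrow> cv v k powi (- y k) * LL N 0 k (q j)"
      by (rule tendsto_mult_left)
  qed
  have "(\<lambda>p. \<Theta> * (\<Sum>\<^sub>\<infinity>z\<in>Omega N. if - int p < z N then g z else 0)) \<longlonglongrightarrow> \<Theta> * infsum g (Omega N)"
    by (rule tendsto_mult_left[OF lim1])
  moreover have "(\<lambda>p. \<Theta> * (\<Sum>\<^sub>\<infinity>z\<in>Omega N. if - int p < z N then g z else 0)) \<longlonglongrightarrow>
      K * (PT * det1 N ?L)"
    unfolding eqp by (intro tendsto_mult_left lim2)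
  ultimately have lim: "\<Theta> * infsum g (Omega N) = K * (PT * det1 N ?L)"
    by (rule LIMSEQ_unique)
  define Y where "Y = (\<Prod>k=1..N. cv v k powi (- y k))"
  have "det1 N ?L = Y * det1 N (\<lambda>k j. LL N 0 k (q j))"
    using det1_scale[of N "\<lambda>k. cv v k powi (- y k)" "\<lambda>_. 1" "\<lambda>k j. LL N 0 k (q j)"] by (simp add: Y_def)
  also have "det1 N (\<lambda>k j. LL N 0 k (q j)) = det1 ?n (\<lambda>k j. LL N 0 k (q j)) * (\<Prod>l=?n+1..N. LL N 0 l (q l))"
    using \<kappa>(2) by (intro det1_lower_block n) (auto simp: q_def)
  also have "(\<Prod>l=?n+1..N. LL N 0 l (q l)) = 1"
    using \<kappa>(2) by (intro prod.neutral) (auto simp: q_def)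
  also have "det1 ?n (\<lambda>k j. LL N 0 k (q j)) = det1 ?n (\<lambda>k j. LL ?n ?t k (fs m j))"
  proof (rule det1_cong)
    fix k j assume k: "k \<in> {1..?n}" and j: "j \<in> {1..?n}"
    have "pow_bounded hi (fs m j)" by (rule fs_bounded[OF order_refl j])
    from LL_QQ[OF n(2) t k this] show "LL N 0 k (q j) = LL ?n ?t k (fs m j)" using j by (simp add: q_def h_def)
  qed
  finally have det: "det1 N ?L = Y * det1 ?n (\<lambda>k j. LL ?n ?t k (fs m j))" by simp
  \<comment> \<open>Up to \<open>nl m\<close> all powers of \<phi> and of \<open>v\<close> cancel;
    beyond, the factors are the normalisations \<theta> of the auxiliary columns, which drop out on
    division by \<Theta>.\<close>
  have const: "K * (PT * Y) = \<Theta>"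
  proof -
    have vn: "cv v j \<noteq> 0" if "j \<in> {1..N}" for j using v_pos[OF that] by simp
    have split: "(\<Prod>j=1..N. f j) = (\<Prod>j=1..?n. f j) * (\<Prod>j=?n+1..N. f j)" for f :: "nat => complex"
      using prod.ub_add_nat[of 1 ?n f "N - ?n"] n by simp
    have "K * (PT * Y) = (\<Prod>j=1..?n. (cv v j powi y j * P (?t - T j) (cv v j) * P (0 - ?t) (cv v j)) * (P (T j) (cv v j) * cv v j powi (- y j))) *
        (\<Prod>j=?n+1..N. P (T j) (cv v j) * cv v j powi (- y j))"
      unfolding K_def con_def PT_def Y_def split by (simp only: prod.distrib mult_ac)
    also have "(\<Prod>j=1..?n. (cv v j powi y j * P (?t - T j) (cv v j) * P (0 - ?t) (cv v j)) * (P (T j) (cv v j) * cv v j powi (- y j))) = 1"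
    proof (rule prod.neutral, rule ballI)
      fix j assume "j \<in> {1..?n}"
      then have j: "j \<in> {1..N}" using n by auto
      have 1: "P (?t - T j) (cv v j) * P (0 - ?t) (cv v j) = P (- T j) (cv v j)"
        using P_add[OF TT_diff[OF t T_in[OF j]] TT_diff[OF TT_0 t] v_annulus[OF j]] by simp
      have "(cv v j powi y j * P (?t - T j) (cv v j) * P (0 - ?t) (cv v j)) * (P (T j) (cv v j) * cv v j powi (- y j)) =
          (cv v j powi y j * cv v j powi (- y j)) * (P (T j) (cv v j) * (P (?t - T j) (cv v j) * P (0 - ?t) (cv v j)))"
        by (simp only: mult_ac)
      also have "\<dots> = 1"
        unfolding 1 P_minus[OF T_in[OF j] v_annulus[OF j]] using vn[OF j] by (simp add: power_int_minus)
      finally show "(cv v j powi y j * P (?t - T j) (cv v j) * P (0 - ?t) (cv v j)) * (P (T j) (cv v j) * cv v j powi (- y j)) = 1" .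
    qed
    also have "(\<Prod>j=?n+1..N. P (T j) (cv v j) * cv v j powi (- y j)) = \<Theta>"
      unfolding \<Theta>_def
    proof (rule prod.cong[OF refl])
      fix j assume j': "j \<in> {?n+1..N}"
      then have j: "j \<in> {1..N}" by auto
      have "P (T j) (cv v j) * cv v j powi (- y j) =
          (P (T j) (cv v j) * cv v j powi (- y j)) * (\<theta> j * (P (- T j) (cv v j) * cv v j powi y j))"
        by (simp only: \<theta>(2)[OF j'] mult_1_right)
      also have "\<dots> = \<theta> j * (P (T j) (cv v j) * P (- T j) (cv v j)) * (cv v j powi y j * cv v j powi (- y j))"
        by (simp only: mult_ac)
      also have "\<dots> = \<theta> j"
        unfolding P_minus[OF T_in[OF j] v_annulus[OF j]] using vn[OF j] by (simp add: power_int_minus)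
      finally show "P (T j) (cv v j) * cv v j powi (- y j) = \<theta> j" .
    qed
    finally show ?thesis by simp
  qed
  have "\<Theta> * infsum g (Omega N) = (K * (PT * Y)) * det1 ?n (\<lambda>k j. LL ?n ?t k (fs m j))"
    unfolding lim det by (simp only: mult_ac)
  then have "infsum g (Omega N) = det1 ?n (\<lambda>k j. LL ?n ?t k (fs m j))" using const \<Theta>0 by simp
  then show ?thesis by (simp add: M_fun_eq_infsum g_def[abs_def])
qed

end

section \<open>Fredholm determinants\<close>

text \<open>Indexed by a finite set without an order, so that principal minors belong to subsets
  rather than to tuples.\<close>

definition detset :: "'a set => ('a => 'a => complex) => complex" where
  "detset B A = (\<Sum>p | p permutes B. of_int (sign p) * (\<Prod>i\<in>B. A i (p i)))"

lemma det1_detset: "det1 n (\<lambda>k l. A (k - 1) (l - 1)) = detset {0..<n} A"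
  by (simp add: det1_perm detset_def)

lemma detset_reindex:
  assumes f: "bij_betw f B C" and B: "finite B"
  shows "detset C A = detset B (\<lambda>i j. A (f i) (f j))"
proof -
  have bij: "bij_betw (map_permutation B f) {p. p permutes B} {p. p permutes C}"
  proof (rule bij_betw_cong[THEN iffD1, OF _ bij_betw_permutations[OF f]])
    fix p assume "p \<in> {p. p permutes B}"
    show "(\<lambda>x. if x \<in> C then f (p (inv_into B f x)) else x) = map_permutation B f p"
      using f by (auto simp: map_permutation_def restrict_id_def bij_betw_def fun_eq_iff)
  qed
  have inj: "inj_on f B" using f by (simp add: bij_betw_def)
  have "detset C A = (\<Sum>p | p permutes B. of_int (sign (map_permutation B f p)) * (\<Prod>i\<in>C. A i (map_permutation B f p i)))"
    unfolding detset_def by (rule sum.reindex_bij_betw[OF bij, symmetric])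
  also have "\<dots> = detset B (\<lambda>i j. A (f i) (f j))"
    unfolding detset_def
  proof (rule sum.cong[OF refl])
    fix p assume "p \<in> {p. p permutes B}"
    then have p: "p permutes B" by simp
    have "(\<Prod>i\<in>C. A i (map_permutation B f p i)) = (\<Prod>i\<in>B. A (f i) (map_permutation B f p (f i)))"
      by (rule prod.reindex_bij_betw[OF f, symmetric])
    also have "\<dots> = (\<Prod>i\<in>B. A (f i) (f (p i)))"
      by (rule prod.cong[OF refl]) (simp add: map_permutation_apply[OF inj])
    finally show "of_int (sign (map_permutation B f p)) * (\<Prod>i\<in>C. A i (map_permutation B f p i)) =
        of_int (sign p) * (\<Prod>i\<in>B. A (f i) (f (p i)))"
      by (simp add: sign_map_permutation[OF inj p B])
  qed
  finally show ?thesis .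
qed

text \<open>Expanding the product over the indices, a subset \<open>J\<close> collects those that
  take the entry of \<open>A\<close>; the remaining indices force fixed points, so only permutations
  of \<open>J\<close> contribute.\<close>

lemma detset_I_minus:
  assumes B: "finite B"
  shows "detset B (\<lambda>i j. (if i = j then 1 else 0) - A i j) = (\<Sum>J\<in>Pow B. (- 1) ^ card J * detset J A)"
proof -
  let ?q = "\<lambda>J p. (\<Prod>i\<in>J. - A i (p i)) * (\<Prod>i\<in>B - J. if i = p i then 1 else 0)"
  have "detset B (\<lambda>i j. (if i = j then 1 else 0) - A i j) =
      (\<Sum>p | p permutes B. \<Sum>J\<in>Pow B. of_int (sign p) * (?q J p))"
    unfolding detset_def
  proof (rule sum.cong[OF refl])
    fix p
    have "(\<Prod>i\<in>B. (if i = p i then 1 else 0) - A i (p i)) = (\<Prod>i\<in>B. - A i (p i) + (if i = p i then 1 else 0))"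
      by (rule prod.cong) auto
    also have "\<dots> = (\<Sum>J\<in>Pow B. (\<Prod>i\<in>J. - A i (p i)) * (\<Prod>i\<in>B - J. if i = p i then 1 else 0))"
      by (rule prod_add[OF B])
    finally show "of_int (sign p) * (\<Prod>i\<in>B. (if i = p i then 1 else 0) - A i (p i)) =
        (\<Sum>J\<in>Pow B. of_int (sign p) * (?q J p))"
      by (simp only: sum_distrib_left)
  qed
  also have "\<dots> = (\<Sum>J\<in>Pow B. \<Sum>p | p permutes B. of_int (sign p) * (?q J p))"
    by (rule sum.swap)
  also have "\<dots> = (\<Sum>J\<in>Pow B. (- 1) ^ card J * detset J A)"
  proof (rule sum.cong[OF refl])
    fix J assume "J \<in> Pow B"
    then have J: "J \<subseteq> B" "finite J" using B finite_subset by auto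
    have "(\<Sum>p | p permutes B. of_int (sign p) * (?q J p)) =
        (\<Sum>p | p permutes J. of_int (sign p) * (\<Prod>i\<in>J. - A i (p i)))"
    proof (rule sum.mono_neutral_cong_right)
      show "finite {p. p permutes B}" by (rule finite_permutations[OF B])
      show "{p. p permutes J} \<subseteq> {p. p permutes B}" using permutes_subset J by blast
      show "\<forall>p\<in>{p. p permutes B} - {p. p permutes J}. of_int (sign p) * (?q J p) = 0"
      proof
        fix p assume p: "p \<in> {p. p permutes B} - {p. p permutes J}"
        have "\<exists>i\<in>B - J. p i \<noteq> i"
        proof (rule ccontr)
          assume "\<not> ?thesis"
          then have "p permutes J" using p permutes_superset[of p B J] by auto
          then show False using p by simp
        qed
        then have "(\<Prod>i\<in>B - J. if i = p i then 1 else 0 :: complex) = 0" using B by (subst prod_zero_iff) force+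
        then show "of_int (sign p) * (?q J p) = 0" by simp
      qed
      fix p assume "p \<in> {p. p permutes J}"
      then have "(\<Prod>i\<in>B - J. if i = p i then 1 else 0 :: complex) = 1"
        by (intro prod.neutral) (auto simp: permutes_not_in)
      then show "of_int (sign p) * (?q J p) =
          of_int (sign p) * (\<Prod>i\<in>J. - A i (p i))" by simp
    qed
    also have "\<dots> = (- 1) ^ card J * detset J A"
      unfolding detset_def sum_distrib_left
    proof (rule sum.cong[OF refl])
      fix p
      have "(\<Prod>i\<in>J. - A i (p i)) = (\<Prod>i\<in>J. (- 1) * A i (p i))" by simp
      also have "\<dots> = (- 1) ^ card J * (\<Prod>i\<in>J. A i (p i))" by (simp only: prod.distrib prod_constant)
      finally show "of_int (sign p) * (\<Prod>i\<in>J. - A i (p i)) = (- 1) ^ card J * (of_int (sign p) * (\<Prod>i\<in>J. A i (p i)))"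
        by (simp only: mult_ac)
    qed
    finally show "(\<Sum>p | p permutes B. of_int (sign p) * (?q J p)) =
        (- 1) ^ card J * detset J A" .
  qed
  finally show ?thesis .
qed

lemma fredholm_minor_det1: "fredholm_minor A us = det1 (length us) (\<lambda>k l. A (us ! (k - 1)) (us ! (l - 1)))"
  by (simp add: fredholm_minor_def det1_def)

lemma fredholm_minor_distinct:
  assumes "distinct us"
  shows "fredholm_minor A us = detset (set us) A"
proof -
  have "bij_betw (\<lambda>i. us ! i) {0..<length us} (set us)"
    using bij_betw_nth[OF assms refl refl] by (simp add: atLeast0LessThan)
  from detset_reindex[OF this] show ?thesis
    unfolding fredholm_minor_det1 det1_detset[of _ "\<lambda>i j. A (us ! i) (us ! j)"] by simp
qed

lemma fredholm_minor_not_distinct: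
  assumes "\<not> distinct us"
  shows "fredholm_minor A us = 0"
proof -
  obtain i j where ij: "i < length us" "j < length us" "i \<noteq> j" "us ! i = us ! j"
    using assms by (auto simp: distinct_conv_nth)
  then show ?thesis unfolding fredholm_minor_det1
    by (intro det1_eq_rows[of "Suc i" _ "Suc j"]) auto
qed

lemma finite_tuples: "finite B ==> finite (tuples B n)"
  using finite_lists_length_eq[of B n] by (simp add: tuples_def conj_commute)

text \<open>Each subset of size \<open>n\<close> is listed by \<open>fact n\<close> distinct tuples,
  which cancels the factorial in the series; tuples with a repetition have zero minor.\<close>

lemma fredholm_det_finite:
  assumes B: "finite B"
  shows "fredholm_det_I_minus B A = detset B (\<lambda>i j. (if i = j then 1 else 0) - A i j)"
proof -
  let ?J = "\<lambda>n. \<Sum>J | J \<in> Pow B \<and> card J = n. detset J A"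
  let ?M = "\<lambda>n. \<Sum>\<^sub>\<infinity>us\<in>tuples B n. fredholm_minor A us"
  have sum: "(?M n) = fact n * (?J n)" for n
  proof -
    have "(?M n) = (\<Sum>us\<in>tuples B n. fredholm_minor A us)"
      by (simp add: finite_tuples B)
    also have "\<dots> = (\<Sum>us | us \<in> tuples B n \<and> distinct us. detset (set us) A)"
      by (rule sum.mono_neutral_cong_right)
        (auto simp: finite_tuples B fredholm_minor_not_distinct fredholm_minor_distinct)
    also have "\<dots> = (\<Sum>J | J \<in> Pow B \<and> card J = n. \<Sum>us | us \<in> {us \<in> tuples B n. distinct us} \<and> set us = J. detset (set us) A)"
      by (rule sum.group[symmetric])
        (use finite_subset[OF _ finite_tuples[OF B, of n], of "{us \<in> tuples B n. distinct us}"] B in \<open>auto simp: tuples_def distinct_card\<close>)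
    also have "\<dots> = (\<Sum>J | J \<in> Pow B \<and> card J = n. fact n * detset J A)"
    proof (rule sum.cong[OF refl])
      fix J assume J: "J \<in> {J. J \<in> Pow B \<and> card J = n}"
      then have "finite J" using B finite_subset by auto
      have "{us \<in> {us \<in> tuples B n. distinct us}. set us = J} = permutations_of_set J"
        using J by (auto simp: tuples_def permutations_of_set_def distinct_card)
      then show "(\<Sum>us | us \<in> {us \<in> tuples B n. distinct us} \<and> set us = J. detset (set us) A) = fact n * detset J A"
        using J \<open>finite J\<close> by (simp add: permutations_of_set_def[symmetric] permutations_of_setD)
    qed
    finally show ?thesis by (simp add: sum_distrib_left)
  qed
  have "fredholm_det_I_minus B A = (\<Sum>n. (- 1) ^ n * (?J n))"
    unfolding fredholm_det_I_minus_def sum by simp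
  also have "\<dots> = (\<Sum>n\<le>card B. (- 1) ^ n * (?J n))"
  proof (rule suminf_finite)
    fix n assume "n \<notin> {..card B}"
    then have "{J. J \<in> Pow B \<and> card J = n} = {}" using card_mono[OF B] by force
    then show "(- 1) ^ n * (?J n) = 0" by (simp only: sum.empty mult_zero_right)
  qed simp
  also have "\<dots> = (\<Sum>n\<le>card B. \<Sum>J | J \<in> Pow B \<and> card J = n. (- 1) ^ card J * detset J A)"
    by (simp add: sum_distrib_left)
  also have "\<dots> = (\<Sum>J\<in>Pow B. (- 1) ^ card J * detset J A)"
    by (rule sum.group) (use B card_mono in auto)
  finally show ?thesis by (simp add: detset_I_minus[OF B])
qed

lemma tuples_Suc: "tuples X (Suc n) = (\<lambda>(u, us). u # us) ` (X \<times> tuples X n)"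
  by (force simp: tuples_def length_Suc_conv image_iff)

lemma tuples_weight:
  fixes w :: "'a => real"
  assumes w: "(w has_sum W) X" and w0: "\<And>u. u \<in> X ==> 0 \<le> w u"
  shows "((\<lambda>us. \<Prod>i<length us. w (us ! i)) has_sum W ^ n) (tuples X n)"
proof (induction n)
  case 0
  have "tuples X 0 = {[]}" by (auto simp: tuples_def)
  then show ?case by (simp add: has_sum_finiteI)
next
  case (Suc n)
  have inj: "inj_on (\<lambda>(u, us). u # us) (X \<times> tuples X n)" by (auto simp: inj_on_def)
  let ?f = "\<lambda>(u, us). w u * (\<Prod>i<length us. w (us ! i))"
  have in_sum: "((\<lambda>us. ?f (u, us)) has_sum w u * W ^ n) (tuples X n)" for u
    unfolding case_prod_conv by (rule has_sum_cmult_right[OF Suc])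
  have out: "((\<lambda>u. w u * W ^ n) has_sum W * W ^ n) X" by (rule has_sum_cmult_left[OF w])
  have "?f summable_on (X \<times> tuples X n)"
    by (rule summable_on_SigmaI[OF in_sum])
      (use out in \<open>auto simp: summable_on_def tuples_def intro!: mult_nonneg_nonneg prod_nonneg w0\<close>)
  then have "(?f has_sum W * W ^ n) (X \<times> tuples X n)" by (intro has_sum_SigmaI[OF in_sum out])
  moreover have "?f = (\<lambda>us. \<Prod>i<length us. w (us ! i)) \<circ> (\<lambda>(u, us). u # us)"
    by (auto simp: fun_eq_iff prod.lessThan_Suc_shift simp del: prod.lessThan_Suc)
  ultimately show ?case unfolding tuples_Suc has_sum_reindex[OF inj] by (simp only: power_Suc)
qed

lemma fredholm_minor_bound:
  assumes A: "\<And>u u'. u \<in> X ==> u' \<in> X ==> norm (A u u') \<le> g u * h u'" and us: "set us \<subseteq> X"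
  shows "norm (fredholm_minor A us) \<le> fact (length us) * (\<Prod>i<length us. g (us ! i) * h (us ! i))"
proof -
  have "us ! (k - 1) \<in> X" if "k \<in> {1..length us}" for k using that by (intro subsetD[OF us] nth_mem) auto
  then have "norm (fredholm_minor A us) \<le>
      fact (length us) * ((\<Prod>k=1..length us. g (us ! (k - 1))) * (\<Prod>k=1..length us. h (us ! (k - 1))))"
    unfolding fredholm_minor_det1 by (intro norm_det1_le_rank1 A)
  then show ?thesis
    unfolding prod_shift[of _ "length us", symmetric] by (simp add: prod.distrib atLeast0LessThan)
qed

text \<open>
  A nonzero minor has distinct points, so at most \<open>card F\<close> of them lie in a finite set \<open>F\<close> outside of
  which the total weight is small; scaling the weight down on \<open>F\<close> therefore only costs a constant.
\<close>

lemma fredholm_bound: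
  fixes g h :: "'a => real"
  assumes A: "\<And>u u'. u \<in> X ==> u' \<in> X ==> norm (A u u') \<le> g u * h u'"
    and gh0: "\<And>u. u \<in> X ==> 0 \<le> g u * h u" and gh: "(\<lambda>u. g u * h u) summable_on X"
  shows "(\<lambda>us. norm (fredholm_minor A us)) summable_on tuples X n"
    and "\<exists>D. \<forall>n. (\<Sum>\<^sub>\<infinity>us\<in>tuples X n. norm (fredholm_minor A us)) \<le> fact n * (D * (1 / 2) ^ n)"
proof -
  let ?N = "\<lambda>n. \<Sum>\<^sub>\<infinity>us\<in>tuples X n. norm (fredholm_minor A us)"
  define w where "w u = g u * h u" for u
  have w0: "0 \<le> w u" if "u \<in> X" for u using gh0 that by (simp add: w_def)
  have ws: "w summable_on X" using gh by (simp add: w_def[abs_def])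
  obtain F where F: "finite F" "F \<subseteq> X" "dist (sum w F) (infsum w X) \<le> 1 / 4"
    using infsum_finite_approximation[OF ws, of "1 / 4"] by auto
  have wF: "0 \<le> sum w F" using F w0 by (intro sum_nonneg) auto
  \<comment> \<open>Dividing by \<open>K\<close> leaves at most 1/4 of total weight on
    \<open>F\<close>; with at most 1/4 outside, the modified weight has total at most 1/2.\<close>
  define K where "K = 1 + 4 * sum w F"
  have K: "1 \<le> K" using wF by (simp add: K_def)
  define w' where "w' u = (if u \<in> F then w u / K else w u)" for u
  have tail: "(w has_sum (infsum w X - sum w F)) (X - F)"
    by (rule has_sum_Diff[OF has_sum_infsum[OF ws] has_sum_finite[OF F(1)] F(2)])
  have w'1: "(w' has_sum (infsum w X - sum w F)) (X - F)"
    by (rule has_sum_cong[THEN iffD1, OF _ tail]) (simp add: w'_def)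
  have w'2: "(w' has_sum sum w F / K) F"
    using has_sum_finite[OF F(1), of w'] by (simp add: w'_def sum_divide_distrib)
  have "(w' has_sum (infsum w X - sum w F + sum w F / K)) (X - F \<union> F)"
    by (rule has_sum_Un_disjoint[OF w'1 w'2]) auto
  then have w': "(w' has_sum (infsum w X - sum w F + sum w F / K)) X" using F(2) by (simp add: Un_absorb2)
  define W where "W = infsum w X - sum w F + sum w F / K"
  have w'0: "0 \<le> w' u" if "u \<in> X" for u using w0[OF that] K by (simp add: w'_def)
  have W0: "0 \<le> W" using has_sum_nonneg[OF w' w'0] by (simp add: W_def)
  have "sum w F / K \<le> 1 / 4" using K wF by (simp add: K_def field_simps)
  moreover have "infsum w X - sum w F \<le> 1 / 4" using F(3) unfolding dist_real_def by linarith
  ultimately have W: "W \<le> 1 / 2" unfolding W_def by linarith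
  define D where "D = K ^ card F"
  define b where "b us = fact (length us) * (D * (\<Prod>i<length us. w' (us ! i)))" for us
  have b: "(b has_sum fact n * (D * W ^ n)) (tuples X n)" for n
  proof (rule has_sum_cong[THEN iffD1])
    show "((\<lambda>us. fact n * (D * (\<Prod>i<length us. w' (us ! i)))) has_sum fact n * (D * W ^ n)) (tuples X n)"
      unfolding W_def by (intro has_sum_cmult_right tuples_weight w' w'0)
  qed (simp add: b_def tuples_def)
  have le: "norm (fredholm_minor A us) \<le> b us" if us: "us \<in> tuples X n" for us n
  proof (cases "distinct us")
    case False
    have "0 \<le> b us" unfolding b_def D_def using us K by (auto intro!: mult_nonneg_nonneg prod_nonneg w'0 simp: tuples_def)
    then show ?thesis using False by (simp add: fredholm_minor_not_distinct)
  next
    case True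
    have sX: "set us \<subseteq> X" using us by (simp add: tuples_def)
    define I where "I = {i. i < length us \<and> us ! i \<in> F}"
    have "card I \<le> card F"
      by (rule card_inj_on_le[of "\<lambda>i. us ! i"]) (use True F in \<open>auto simp: I_def inj_on_def nth_eq_iff_index_eq\<close>)
    have "(\<Prod>i<length us. w (us ! i)) = (\<Prod>i<length us. (if us ! i \<in> F then K else 1) * w' (us ! i))"
      using K by (intro prod.cong) (auto simp: w'_def)
    also have "\<dots> = (\<Prod>i<length us. if us ! i \<in> F then K else 1) * (\<Prod>i<length us. w' (us ! i))"
      by (rule prod.distrib)
    also have "(\<Prod>i<length us. if us ! i \<in> F then K else 1) = (\<Prod>i\<in>I. K)"
      by (rule prod.mono_neutral_cong_right) (auto simp: I_def)
    also have "(\<Prod>i\<in>I. K) * (\<Prod>i<length us. w' (us ! i)) \<le> D * (\<Prod>i<length us. w' (us ! i))"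
      using K \<open>card I \<le> card F\<close> sX unfolding D_def prod_constant
      by (intro mult_right_mono power_increasing prod_nonneg) (auto intro!: w'0)
    finally have "(\<Prod>i<length us. w (us ! i)) \<le> D * (\<Prod>i<length us. w' (us ! i))" .
    then have "fact (length us) * (\<Prod>i<length us. w (us ! i)) \<le> b us"
      unfolding b_def by (intro mult_left_mono) auto
    moreover have "norm (fredholm_minor A us) \<le> fact (length us) * (\<Prod>i<length us. g (us ! i) * h (us ! i))"
      using A sX by (rule fredholm_minor_bound)
    ultimately show ?thesis by (simp add: w_def)
  qed
  have sm: "(\<lambda>us. norm (fredholm_minor A us)) summable_on tuples X n" for n
    by (rule summable_on_comparison_test[OF has_sum_imp_summable[OF b]]) (use le in auto)
  then show "(\<lambda>us. norm (fredholm_minor A us)) summable_on tuples X n" .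
  show "\<exists>D. \<forall>n. (?N n) \<le> fact n * (D * (1 / 2) ^ n)"
  proof (intro exI allI)
    fix n
    have "(?N n) \<le> fact n * (D * W ^ n)"
      by (rule has_sum_mono[OF has_sum_infsum[OF sm] b le])
    also have "\<dots> \<le> fact n * (D * (1 / 2) ^ n)"
      using W W0 K by (intro mult_left_mono power_mono) (auto simp: D_def)
    finally show "(?N n) \<le> fact n * (D * (1 / 2) ^ n)" .
  qed
qed

lemma fredholm_convergentI:
  fixes g h :: "'a => real"
  assumes "\<And>u u'. u \<in> X ==> u' \<in> X ==> norm (A u u') \<le> g u * h u'"
    and "\<And>u. u \<in> X ==> 0 \<le> g u * h u" and "(\<lambda>u. g u * h u) summable_on X"
  shows "fredholm_convergent X A"
  unfolding fredholm_convergent_def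
proof (intro conjI allI)
  note fb = fredholm_bound[OF assms]
  show "(\<lambda>us. norm (fredholm_minor A us)) summable_on tuples X n" for n by (rule fb(1))
  obtain D where D: "\<And>n. (\<Sum>\<^sub>\<infinity>us\<in>tuples X n. norm (fredholm_minor A us)) \<le> fact n * (D * (1 / 2) ^ n)"
    using fb(2) by blast
  show "summable (\<lambda>n. (\<Sum>\<^sub>\<infinity>us\<in>tuples X n. norm (fredholm_minor A us)) / fact n)"
  proof (rule summable_comparison_test)
    show "\<exists>N. \<forall>n\<ge>N. norm ((\<Sum>\<^sub>\<infinity>us\<in>tuples X n. norm (fredholm_minor A us)) / fact n) \<le> D * (1 / 2) ^ n"
      using D by (auto simp: pos_divide_le_eq mult.commute infsum_nonneg)
    show "summable (\<lambda>n. D * (1 / 2) ^ n :: real)" by (intro summable_mult summable_geometric) simp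
  qed
qed

text \<open>Dominated convergence twice, over tuples and over the order of the minor. Points that
  never enter the windows are harmless if their row vanishes, which is the case beyond the
  cut.\<close>

lemma fredholm_det_limit:
  assumes conv: "fredholm_convergent X A"
    and sub: "\<And>L. B L \<subseteq> X"
    and ev: "\<And>u. u \<in> X ==> (\<forall>u'\<in>X. A u u' = 0) \<or> (\<forall>\<^sub>F L in sequentially. u \<in> B L)"
  shows "(\<lambda>L. fredholm_det_I_minus (B L) A) \<longlonglongrightarrow> fredholm_det_I_minus X A"
proof -
  let ?M = "\<lambda>Y n. \<Sum>\<^sub>\<infinity>us\<in>tuples Y n. fredholm_minor A us"
  define S where "S n = (\<Sum>\<^sub>\<infinity>us\<in>tuples X n. norm (fredholm_minor A us))" for n
  define c where "c n = (- 1) ^ n / (fact n :: complex)" for n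
  have sm: "(\<lambda>us. norm (fredholm_minor A us)) summable_on tuples X n" for n
    using conv by (simp add: fredholm_convergent_def)
  have sS: "summable (\<lambda>n. S n / fact n)" using conv by (simp add: fredholm_convergent_def S_def)
  have S0: "0 \<le> S n" for n unfolding S_def by (rule infsum_nonneg) simp
  have S: "(\<lambda>n. S n / fact n) summable_on UNIV"
    using sS S0 by (subst summable_on_UNIV_nonneg_real_iff) auto
  have bd: "norm (c n * (?M Y n)) \<le> S n / fact n" if "Y \<subseteq> X" for Y n
  proof -
    have tY: "tuples Y n \<subseteq> tuples X n" using that by (auto simp: tuples_def)
    have smY: "(\<lambda>us. norm (fredholm_minor A us)) summable_on tuples Y n"
      by (rule summable_on_subset[OF sm tY])
    have "norm (?M Y n) \<le> (\<Sum>\<^sub>\<infinity>us\<in>tuples Y n. norm (fredholm_minor A us))"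
      by (rule norm_infsum_bound[OF smY])
    also have "\<dots> \<le> S n"
      unfolding S_def by (rule infsum_mono2[OF smY sm tY]) simp
    finally show ?thesis by (simp add: c_def norm_mult norm_divide norm_power divide_right_mono)
  qed
  have eq: "fredholm_det_I_minus Y A = (\<Sum>\<^sub>\<infinity>n. c n * (?M Y n))" if "Y \<subseteq> X" for Y
  proof -
    have "(\<lambda>n. norm (c n * (?M Y n))) summable_on UNIV"
      by (rule summable_on_comparison_test[OF S]) (use bd[OF that] in auto)
    then have "(\<lambda>n. c n * (?M Y n)) summable_on UNIV" by (rule abs_summable_summable)
    from has_sum_imp_sums[OF has_sum_infsum[OF this]] show ?thesis
      by (simp add: fredholm_det_I_minus_def c_def sums_iff)
  qed
  have zero: "fredholm_minor A us = 0" if us: "set us \<subseteq> X" and u: "u \<in> set us" "\<forall>u'\<in>X. A u u' = 0" for us u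
  proof -
    obtain i where "i < length us" "us ! i = u" using u by (auto simp: in_set_conv_nth)
    then show ?thesis unfolding fredholm_minor_det1
      using u us by (intro det1_zero_row[of "Suc i"]) (auto intro!: bspec[OF u(2)] subsetD[OF us])
  qed
  have inner: "(\<lambda>L. \<Sum>\<^sub>\<infinity>us\<in>tuples (B L) n. fredholm_minor A us) \<longlonglongrightarrow> (?M X n)" for n
  proof -
    have "(?M (B L) n) =
        (\<Sum>\<^sub>\<infinity>us\<in>tuples X n. if set us \<subseteq> B L then fredholm_minor A us else 0)" for L
      by (rule infsum_cong_neutral) (use sub[of L] in \<open>auto simp: tuples_def\<close>)
    moreover have "(\<lambda>L. \<Sum>\<^sub>\<infinity>us\<in>tuples X n. if set us \<subseteq> B L then fredholm_minor A us else 0) \<longlonglongrightarrow>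
        (?M X n)"
    proof (rule infsum_dominated[OF _ sm])
      show "norm (if set us \<subseteq> B L then fredholm_minor A us else 0) \<le> norm (fredholm_minor A us)" for us L by simp
      fix us assume "us \<in> tuples X n"
      then have us: "set us \<subseteq> X" by (simp add: tuples_def)
      show "(\<lambda>L. if set us \<subseteq> B L then fredholm_minor A us else 0) \<longlonglongrightarrow> fredholm_minor A us"
      proof (cases "\<exists>u\<in>set us. \<forall>u'\<in>X. A u u' = 0")
        case True
        then have "fredholm_minor A us = 0" using zero[OF us] by blast
        then show ?thesis by (simp cong: if_cong)
      next
        case False
        then have "\<forall>u\<in>set us. \<forall>\<^sub>F L in sequentially. u \<in> B L" using ev us by blast
        then have "\<forall>\<^sub>F L in sequentially. \<forall>u\<in>set us. u \<in> B L" by (rule eventually_ball_finite[OF finite_set])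
        then have "\<forall>\<^sub>F L in sequentially. (if set us \<subseteq> B L then fredholm_minor A us else 0) = fredholm_minor A us"
          by eventually_elim auto
        then show ?thesis by (rule tendsto_eventually)
      qed
    qed
    ultimately show ?thesis by simp
  qed
  show ?thesis
    unfolding eq[OF sub] eq[OF order_refl]
    by (rule infsum_dominated[OF bd[OF sub] S]) (intro tendsto_mult_left inner)
qed

text \<open>The block matrix with identities on the diagonal and \<Lambda>, \<Psi> off it is
  factored into triangular blocks in two ways.\<close>

lemma det1_sylvester:
  "det1 M (\<lambda>p q. (if p = q then 1 else 0) - (\<Sum>k=1..n. a p k * b k q)) =
   det1 n (\<lambda>k l. (if k = l then 1 else 0) - (\<Sum>p=1..M. b k p * a p l))"
proof -
  define \<Psi> where "\<Psi> = Matrix.mat M n (\<lambda>(p, k). a (p + 1) (k + 1))"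
  define \<Lambda> where "\<Lambda> = Matrix.mat n M (\<lambda>(k, p). b (k + 1) (p + 1))"
  have c: "\<Psi> \<in> carrier_mat M n" "\<Lambda> \<in> carrier_mat n M" by (simp_all add: \<Psi>_def \<Lambda>_def)
  have cc: "\<Psi> * \<Lambda> \<in> carrier_mat M M" "\<Lambda> * \<Psi> \<in> carrier_mat n n" using c by auto
  then have c3: "1\<^sub>m M - \<Psi> * \<Lambda> \<in> carrier_mat M M" "1\<^sub>m n - \<Lambda> * \<Psi> \<in> carrier_mat n n"
    by (auto intro: minus_carrier_mat)
  have 1: "Matrix.mat M M (\<lambda>(p, q). (if p + 1 = q + 1 then 1 else 0) - (\<Sum>k=1..n. a (p + 1) k * b k (q + 1))) = 1\<^sub>m M - \<Psi> * \<Lambda>"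
    by (rule eq_matI) (auto simp: \<Psi>_def \<Lambda>_def scalar_prod_def sum.atLeast_Suc_atMost_Suc_shift sum.shift_bounds_Suc_ivl[symmetric] atLeastLessThanSuc_atLeastAtMost
        simp del: sum.op_ivl_Suc intro!: sum.reindex_bij_witness[of _ Suc "\<lambda>k. k - 1"])
  have 2: "Matrix.mat n n (\<lambda>(k, l). (if k + 1 = l + 1 then 1 else 0) - (\<Sum>p=1..M. b (k + 1) p * a p (l + 1))) = 1\<^sub>m n - \<Lambda> * \<Psi>"
    by (rule eq_matI) (auto simp: \<Psi>_def \<Lambda>_def scalar_prod_def simp del: sum.op_ivl_Suc intro!: sum.reindex_bij_witness[of _ Suc "\<lambda>k. k - 1"])
  let ?T = "four_block_mat (1\<^sub>m n) \<Lambda> \<Psi> (1\<^sub>m M)"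
  have "four_block_mat (1\<^sub>m n) (0\<^sub>m n M) \<Psi> (1\<^sub>m M) * four_block_mat (1\<^sub>m n) \<Lambda> (0\<^sub>m M n) (1\<^sub>m M - \<Psi> * \<Lambda>) =
      four_block_mat (1\<^sub>m n * 1\<^sub>m n + 0\<^sub>m n M * 0\<^sub>m M n) (1\<^sub>m n * \<Lambda> + 0\<^sub>m n M * (1\<^sub>m M - \<Psi> * \<Lambda>))
        (\<Psi> * 1\<^sub>m n + 1\<^sub>m M * 0\<^sub>m M n) (\<Psi> * \<Lambda> + 1\<^sub>m M * (1\<^sub>m M - \<Psi> * \<Lambda>))"
    by (rule mult_four_block_mat) (use c cc in auto)
  also have "\<dots> = ?T"
    by (rule cong_four_block_mat) (use c cc in \<open>auto intro!: eq_matI simp: left_mult_zero_mat[of _ M M] left_mult_one_mat[of _ M M]\<close>)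
  finally have T1: "Determinant.det ?T = Determinant.det (1\<^sub>m M - \<Psi> * \<Lambda>)"
    using c cc c3 det_mult[of "four_block_mat (1\<^sub>m n) (0\<^sub>m n M) \<Psi> (1\<^sub>m M)" "n + M" "four_block_mat (1\<^sub>m n) \<Lambda> (0\<^sub>m M n) (1\<^sub>m M - \<Psi> * \<Lambda>)"]
      det_four_block_mat_upper_right_zero[of "1\<^sub>m n" n "0\<^sub>m n M" M \<Psi> "1\<^sub>m M"]
      det_four_block_mat_lower_left_zero[of "1\<^sub>m n" n \<Lambda> M "0\<^sub>m M n" "1\<^sub>m M - \<Psi> * \<Lambda>"] by simp
  have "four_block_mat (1\<^sub>m n - \<Lambda> * \<Psi>) \<Lambda> (0\<^sub>m M n) (1\<^sub>m M) * four_block_mat (1\<^sub>m n) (0\<^sub>m n M) \<Psi> (1\<^sub>m M) =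
      four_block_mat ((1\<^sub>m n - \<Lambda> * \<Psi>) * 1\<^sub>m n + \<Lambda> * \<Psi>) ((1\<^sub>m n - \<Lambda> * \<Psi>) * 0\<^sub>m n M + \<Lambda> * 1\<^sub>m M)
        (0\<^sub>m M n * 1\<^sub>m n + 1\<^sub>m M * \<Psi>) (0\<^sub>m M n * 0\<^sub>m n M + 1\<^sub>m M * 1\<^sub>m M)"
    by (rule mult_four_block_mat) (use c cc in auto)
  also have "\<dots> = ?T"
    by (rule cong_four_block_mat) (use c cc in \<open>auto intro!: eq_matI simp: right_mult_zero_mat[of _ n n] right_mult_one_mat[of _ n n]\<close>)
  finally have T2: "Determinant.det ?T = Determinant.det (1\<^sub>m n - \<Lambda> * \<Psi>)"
    using c cc c3 det_mult[of "four_block_mat (1\<^sub>m n - \<Lambda> * \<Psi>) \<Lambda> (0\<^sub>m M n) (1\<^sub>m M)" "n + M" "four_block_mat (1\<^sub>m n) (0\<^sub>m n M) \<Psi> (1\<^sub>m M)"]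
      det_four_block_mat_upper_right_zero[of "1\<^sub>m n" n "0\<^sub>m n M" M \<Psi> "1\<^sub>m M"]
      det_four_block_mat_lower_left_zero[of "1\<^sub>m n - \<Lambda> * \<Psi>" n \<Lambda> M "0\<^sub>m M n" "1\<^sub>m M"] by simp
  show ?thesis unfolding det1_def 1 2 using T1 T2 by simp
qed

text \<open>The recursion for the \<lambda> of the overview, that is, forward substitution in
  \<open>\<lambda> (1 + U) = \<Phi>\<close>. The sets \<open>Y\<close> are a parameter so that
  finite windows and half lines share one definition.\<close>

function blam :: "(nat => nat => int => int => complex) => (nat => nat => int => complex) =>
    (nat => int set) => nat => nat => int => complex" where
  "blam \<phi> \<Phi> Y j = (\<lambda>k x'. \<Phi> j k x' - (\<Sum>i\<in>{1..<j}. \<Sum>\<^sub>\<infinity>x\<in>Y i. blam \<phi> \<Phi> Y i k x * \<phi> i j x x'))"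
  by pat_completeness auto
termination by (relation "Wellfounded.measure (\<lambda>(\<phi>, \<Phi>, Y, j). j)") auto

declare blam.simps [simp del]

text \<open>A nonzero term on a nonempty subset would be a permutation increasing the level
  \<open>I\<close> at every point, although the sum of the levels is invariant.\<close>

lemma det1_unipotent:
  fixes I :: "nat => nat"
  assumes U: "\<And>r q. r \<in> {1..M} ==> q \<in> {1..M} ==> U r q \<noteq> 0 ==> I r < I q"
  shows "det1 M (\<lambda>r q. (if r = q then 1 else 0) + U r q) = 1"
proof -
  define A where "A r q = - U (Suc r) (Suc q)" for r q
  have "det1 M (\<lambda>r q. (if r = q then 1 else 0) + U r q) = detset {0..<M} (\<lambda>r q. (if r = q then 1 else 0) - A r q)"
    unfolding det1_detset[symmetric] by (rule det1_cong) (auto simp: A_def)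
  also have "\<dots> = (\<Sum>J\<in>Pow {0..<M}. if J = {} then 1 else 0)"
    unfolding detset_I_minus[OF finite_atLeastLessThan]
  proof (rule sum.cong[OF refl])
    fix J assume J: "J \<in> Pow {0..<M}"
    have "detset J A = 0" if "J \<noteq> {}"
      unfolding detset_def
    proof (rule sum.neutral, rule ballI)
      fix p assume "p \<in> {p. p permutes J}"
      then have p: "p permutes J" by simp
      have fin: "finite J" using J finite_subset by auto
      have "(\<Prod>i\<in>J. A i (p i)) = 0"
      proof (rule ccontr)
        assume "(\<Prod>i\<in>J. A i (p i)) \<noteq> 0"
        then have nz: "A i (p i) \<noteq> 0" if "i \<in> J" for i using that fin by auto
        have "I (Suc i) < I (Suc (p i))" if i: "i \<in> J" for i
        proof (rule U)
          have "p i \<in> J" using permutes_in_image[OF p] i by simp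
          then show "Suc i \<in> {1..M}" "Suc (p i) \<in> {1..M}" using J i by auto
        qed (use nz[OF i] in \<open>simp add: A_def\<close>)
        then have "(\<Sum>i\<in>J. I (Suc i)) < (\<Sum>i\<in>J. I (Suc (p i)))" by (rule sum_strict_mono[OF fin that])
        also have "\<dots> = (\<Sum>i\<in>J. I (Suc i))" using sum.permute[OF p, of "\<lambda>i. I (Suc i)"] by (simp add: o_def)
        finally show False by simp
      qed
      then show "of_int (sign p) * (\<Prod>i\<in>J. A i (p i)) = 0" by simp
    qed
    then show "(- 1) ^ card J * detset J A = (if J = {} then 1 else 0)" by (auto simp: detset_def)
  qed
  also have "\<dots> = 1" by (simp add: sum.delta)
  finally show ?thesis .
qed

text \<open>The hypothesis says \<open>l (1 + U) = f\<close>, hence the matrix is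
  \<open>(1 - b l) (1 + U)\<close>; the second factor has determinant 1 and the first is turned
  around by Sylvester's identity.\<close>

lemma det1_rank_update:
  fixes I :: "nat => nat"
  assumes U: "\<And>r q. r \<in> {1..M} ==> q \<in> {1..M} ==> U r q \<noteq> 0 ==> I r < I q"
    and f: "\<And>k q. k \<in> {1..n} ==> q \<in> {1..M} ==> l k q + (\<Sum>r=1..M. l k r * U r q) = f k q"
  shows "det1 M (\<lambda>p q. (if p = q then 1 else 0) + U p q - (\<Sum>k=1..n. b p k * f k q)) =
    det1 n (\<lambda>k k'. (if k = k' then 1 else 0) - (\<Sum>p=1..M. l k p * b p k'))"
proof -
  let ?X = "\<lambda>p r. (if p = r then 1 else 0) - (\<Sum>k=1..n. b p k * l k r)"
  let ?Y = "\<lambda>r q. (if r = q then 1 else 0) + U r q"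
  have "det1 M (\<lambda>p q. (if p = q then 1 else 0) + U p q - (\<Sum>k=1..n. b p k * f k q)) = det1 M (\<lambda>p q. \<Sum>r=1..M. ?X p r * ?Y r q)"
  proof (rule det1_cong)
    fix p q assume p: "p \<in> {1..M}" and q: "q \<in> {1..M}"
    have "(\<Sum>r=1..M. ?X p r * ?Y r q) = (\<Sum>r=1..M. (if p = r then ?Y r q else 0)) - (\<Sum>r=1..M. (\<Sum>k=1..n. b p k * l k r) * ?Y r q)"
      unfolding sum_subtractf[symmetric] by (rule sum.cong) (auto simp: algebra_simps)
    also have "(\<Sum>r=1..M. (if p = r then ?Y r q else 0)) = ?Y p q" using p by simp
    also have "(\<Sum>r=1..M. (\<Sum>k=1..n. b p k * l k r) * ?Y r q) = (\<Sum>k=1..n. b p k * (\<Sum>r=1..M. l k r * ?Y r q))"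
      unfolding sum_distrib_right sum_distrib_left mult.assoc by (rule sum.swap)
    also have "\<dots> = (\<Sum>k=1..n. b p k * f k q)"
    proof (rule sum.cong[OF refl])
      fix k assume k: "k \<in> {1..n}"
      have "(\<Sum>r=1..M. l k r * ?Y r q) = (\<Sum>r=1..M. (if r = q then l k r else 0)) + (\<Sum>r=1..M. l k r * U r q)"
        unfolding sum.distrib[symmetric] by (rule sum.cong) (auto simp: algebra_simps)
      also have "(\<Sum>r=1..M. (if r = q then l k r else 0)) = l k q" using q by simp
      finally show "b p k * (\<Sum>r=1..M. l k r * ?Y r q) = b p k * f k q" by (simp only: f[OF k q])
    qed
    finally show "(if p = q then 1 else 0) + U p q - (\<Sum>k=1..n. b p k * f k q) = (\<Sum>r=1..M. ?X p r * ?Y r q)" by (rule sym)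
  qed
  also have "\<dots> = det1 M ?X * det1 M ?Y" by (rule det1_mult)
  also have "det1 M ?Y = 1" by (rule det1_unipotent) (rule U)
  also have "det1 M ?X = det1 n (\<lambda>k k'. (if k = k' then 1 else 0) - (\<Sum>p=1..M. l k p * b p k'))"
    by (rule det1_sylvester)
  finally show ?thesis by simp
qed

lemma infsum_window_tendsto:
  fixes f :: "nat => int => complex"
  assumes le: "\<And>L x. x \<le> a ==> norm (f L x) \<le> b x" and b: "b summable_on {..a}"
    and lim: "\<And>x. x \<le> a ==> (\<lambda>L. f L x) \<longlonglongrightarrow> F x"
  shows "(\<lambda>L. \<Sum>\<^sub>\<infinity>x\<in>{a - int L<..a}. f L x) \<longlonglongrightarrow> (\<Sum>\<^sub>\<infinity>x\<in>{..a}. F x)"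
proof -
  have "(\<Sum>\<^sub>\<infinity>x\<in>{a - int L<..a}. f L x) = (\<Sum>\<^sub>\<infinity>x\<in>{..a}. if a - int L < x then f L x else 0)" for L
    by (rule infsum_cong_neutral) auto
  moreover have "(\<lambda>L. \<Sum>\<^sub>\<infinity>x\<in>{..a}. if a - int L < x then f L x else 0) \<longlonglongrightarrow> (\<Sum>\<^sub>\<infinity>x\<in>{..a}. F x)"
  proof (rule infsum_dominated[OF _ b])
    fix x assume "x \<in> {..a}"
    then have x: "x \<le> a" by simp
    have "0 \<le> b x" using le[OF x, of 0] norm_ge_zero[of "f 0 x"] by linarith
    then show "norm (if a - int L < x then f L x else 0) \<le> b x" for L using le[OF x] by auto
    have "\<forall>\<^sub>F L in sequentially. f L x = (if a - int L < x then f L x else 0)"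
      using eventually_gt_at_top[of "nat (a - x)"] by eventually_elim auto
    then show "(\<lambda>L. if a - int L < x then f L x else 0) \<longlonglongrightarrow> F x"
      by (rule Lim_transform_eventually[OF lim[OF x]])
  qed
  ultimately show ?thesis by simp
qed

text \<open>The bounds split into a row weight \<open>g\<close> and a column weight
  \<open>h\<close>, and only \<open>g i\<close> times \<open>h i\<close> at the same node has to be
  summable: in a minor every point occurs once as row and once as column. The conjugation of the
  kernel is hidden in these weights.\<close>

locale block_kernel =
  fixes m n :: nat and a :: "nat => int" and \<phi> :: "nat => nat => int => int => complex"
    and \<Psi> \<Phi> :: "nat => nat => int => complex" and g h :: "nat => int => real"
  assumes phi: "\<And>i j x x'. i \<in> {1..m} ==> j \<in> {1..m} ==> i < j ==> x \<le> a i ==> x' \<le> a j ==> norm (\<phi> i j x x') \<le> g i x * h j x'"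
    and Psi: "\<And>i k x. i \<in> {1..m} ==> k \<in> {1..n} ==> x \<le> a i ==> norm (\<Psi> i k x) \<le> g i x"
    and Phi: "\<And>i k x. i \<in> {1..m} ==> k \<in> {1..n} ==> x \<le> a i ==> norm (\<Phi> i k x) \<le> h i x"
    and g0: "\<And>i x. i \<in> {1..m} ==> x \<le> a i ==> 0 \<le> g i x"
    and h0: "\<And>i x. i \<in> {1..m} ==> x \<le> a i ==> 0 \<le> h i x"
    and gh: "\<And>i. i \<in> {1..m} ==> (\<lambda>x. g i x * h i x) summable_on {..a i}"
begin

text \<open>The constant does not depend on the sets \<open>Y\<close>, so the bound dominates all
  windows at once.\<close>

lemma blam_bound:
  assumes "j \<in> {1..m}"
  shows "\<exists>c\<ge>0. \<forall>Y k x. (\<forall>i. Y i \<subseteq> {..a i}) \<longrightarrow> k \<in> {1..n} \<longrightarrow> x \<le> a j \<longrightarrow> norm (blam \<phi> \<Phi> Y j k x) \<le> c * h j x"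
  using assms
proof (induction j rule: less_induct)
  case (less j)
  have "\<forall>i\<in>{1..<j}. \<exists>c\<ge>0. \<forall>Y k x. (\<forall>i. Y i \<subseteq> {..a i}) \<longrightarrow> k \<in> {1..n} \<longrightarrow> x \<le> a i \<longrightarrow> norm (blam \<phi> \<Phi> Y i k x) \<le> c * h i x"
    using less by auto
  from bchoice[OF this] obtain c where c: "\<And>i. i \<in> {1..<j} ==> 0 \<le> c i"
    "\<And>i Y k x. i \<in> {1..<j} ==> (\<And>i. Y i \<subseteq> {..a i}) ==> k \<in> {1..n} ==> x \<le> a i ==> norm (blam \<phi> \<Phi> Y i k x) \<le> c i * h i x"
    by blast
  define W where "W i = (\<Sum>\<^sub>\<infinity>x\<in>{..a i}. g i x * h i x)" for i
  have im: "i \<in> {1..m}" if "i \<in> {1..<j}" for i using that less.prems by auto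
  have "norm (blam \<phi> \<Phi> Y j k x) \<le> (1 + (\<Sum>i\<in>{1..<j}. c i * W i)) * h j x"
    if Y: "\<And>i. Y i \<subseteq> {..a i}" and k: "k \<in> {1..n}" and x: "x \<le> a j" for Y k x
  proof -
    have "norm (\<Sum>\<^sub>\<infinity>z\<in>Y i. blam \<phi> \<Phi> Y i k z * \<phi> i j z x) \<le> c i * W i * h j x" if i: "i \<in> {1..<j}" for i
    proof -
      have le: "norm (blam \<phi> \<Phi> Y i k z * \<phi> i j z x) \<le> (c i * h j x) * (g i z * h i z)" if "z \<in> Y i" for z
      proof -
        have z: "z \<le> a i" using Y that by auto
        have "norm (blam \<phi> \<Phi> Y i k z * \<phi> i j z x) \<le> (c i * h i z) * (g i z * h j x)"
          unfolding norm_mult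
          by (intro mult_mono c(2)[OF i Y k z] phi[OF im[OF i] less.prems _ z x] mult_nonneg_nonneg c(1)[OF i] h0[OF im[OF i] z])
            (use i in auto)
        then show ?thesis by (simp only: mult_ac)
      qed
      have sm: "(\<lambda>z. (c i * h j x) * (g i z * h i z)) summable_on Y i"
        by (intro summable_on_cmult_right summable_on_subset_banach[OF gh[OF im[OF i]] Y])
      then have sm': "(\<lambda>z. norm (blam \<phi> \<Phi> Y i k z * \<phi> i j z x)) summable_on Y i"
        by (rule summable_on_comparison_test) (use le in auto)
      have "norm (\<Sum>\<^sub>\<infinity>z\<in>Y i. blam \<phi> \<Phi> Y i k z * \<phi> i j z x) \<le> (\<Sum>\<^sub>\<infinity>z\<in>Y i. norm (blam \<phi> \<Phi> Y i k z * \<phi> i j z x))"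
        by (rule norm_infsum_bound[OF sm'])
      also have "\<dots> \<le> (\<Sum>\<^sub>\<infinity>z\<in>Y i. (c i * h j x) * (g i z * h i z))" by (rule infsum_mono[OF sm' sm le])
      also have "\<dots> \<le> (\<Sum>\<^sub>\<infinity>z\<in>{..a i}. (c i * h j x) * (g i z * h i z))"
        by (rule infsum_mono2[OF sm summable_on_cmult_right[OF gh[OF im[OF i]]] Y])
          (use c(1)[OF i] h0 g0 im[OF i] less.prems x in auto)
      also have "\<dots> = c i * W i * h j x" by (simp add: W_def infsum_cmult_right')
      finally show ?thesis .
    qed
    then have "norm (\<Sum>i\<in>{1..<j}. \<Sum>\<^sub>\<infinity>z\<in>Y i. blam \<phi> \<Phi> Y i k z * \<phi> i j z x) \<le> (\<Sum>i\<in>{1..<j}. c i * W i * h j x)"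
      by (rule sum_norm_le)
    then have "norm (blam \<phi> \<Phi> Y j k x) \<le> h j x + (\<Sum>i\<in>{1..<j}. c i * W i * h j x)"
      using Phi[OF less.prems k x] unfolding blam.simps[of \<phi> \<Phi> Y j] by norm
    then show ?thesis by (simp add: sum_distrib_right distrib_right)
  qed
  moreover have "0 \<le> 1 + (\<Sum>i\<in>{1..<j}. c i * W i)"
    using g0 h0 im c(1) by (intro add_nonneg_nonneg sum_nonneg mult_nonneg_nonneg) (auto simp: W_def intro!: infsum_nonneg mult_nonneg_nonneg)
  ultimately show ?case by blast
qed

definition win :: "nat => nat => int set" where "win L i = {a i - int L<..a i}"

lemma blam_tendsto:
  assumes "j \<in> {1..m}" "k \<in> {1..n}" "x \<le> a j"
  shows "(\<lambda>L. blam \<phi> \<Phi> (win L) j k x) \<longlonglongrightarrow> blam \<phi> \<Phi> (\<lambda>i. {..a i}) j k x"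
  using assms(1,3)
proof (induction j arbitrary: x rule: less_induct)
  case (less j)
  have "(\<lambda>L. \<Sum>\<^sub>\<infinity>z\<in>win L i. blam \<phi> \<Phi> (win L) i k z * \<phi> i j z x) \<longlonglongrightarrow>
      (\<Sum>\<^sub>\<infinity>z\<in>{..a i}. blam \<phi> \<Phi> (\<lambda>i. {..a i}) i k z * \<phi> i j z x)" if i: "i \<in> {1..<j}" for i
  proof -
    have im: "i \<in> {1..m}" using i less.prems by auto
    obtain c where c: "0 \<le> c" "\<And>Y z. (\<And>i. Y i \<subseteq> {..a i}) ==> z \<le> a i ==> norm (blam \<phi> \<Phi> Y i k z) \<le> c * h i z"
      using blam_bound[OF im] assms(2) by blast
    show ?thesis unfolding win_def[of _ i]
    proof (rule infsum_window_tendsto[where b = "\<lambda>z. (c * h j x) * (g i z * h i z)"])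
      show "(\<lambda>z. c * h j x * (g i z * h i z)) summable_on {..a i}" by (intro summable_on_cmult_right gh im)
      fix z assume z: "z \<le> a i"
      show "norm (blam \<phi> \<Phi> (win L) i k z * \<phi> i j z x) \<le> (c * h j x) * (g i z * h i z)" for L
      proof -
        have "norm (blam \<phi> \<Phi> (win L) i k z * \<phi> i j z x) \<le> (c * h i z) * (g i z * h j x)"
          unfolding norm_mult
          by (intro mult_mono c(2)[OF _ z] phi[OF im less.prems(1) _ z less.prems(2)] mult_nonneg_nonneg c(1) h0[OF im z])
            (use i in \<open>auto simp: win_def\<close>)
        then show ?thesis by (simp only: mult_ac)
      qed
      show "(\<lambda>L. blam \<phi> \<Phi> (win L) i k z * \<phi> i j z x) \<longlonglongrightarrow> blam \<phi> \<Phi> (\<lambda>i. {..a i}) i k z * \<phi> i j z x"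
        using i im z by (intro tendsto_mult_right less.IH) auto
    qed
  qed
  then show ?case unfolding blam.simps[of \<phi> \<Phi> _ j] by (intro tendsto_diff tendsto_const tendsto_sum)
qed

abbreviation entry :: "(nat => int set) => nat => nat => complex" where
  "entry Y k k' \<equiv> (if k = k' then 1 else 0) - (\<Sum>i=1..m. \<Sum>\<^sub>\<infinity>x\<in>Y i. blam \<phi> \<Phi> Y i k x * \<Psi> i k' x)"

text \<open>On a finite window the points are enumerated and the Fredholm determinant is that of a
  matrix. The node \<open>I p\<close> of a point serves as its level, with respect to which the
  \<phi> part is strictly triangular.\<close>

lemma window_det:
  fixes A :: "'p \<times> int => 'p \<times> int => complex"
  assumes inj: "inj_on \<nu> {1..m}"
    and A: "\<And>i j x x'. i \<in> {1..m} ==> j \<in> {1..m} ==> x \<le> a i ==> x' \<le> a j ==>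
      A (\<nu> i, x) (\<nu> j, x') = - (if i < j then \<phi> i j x x' else 0) + (\<Sum>k=1..n. \<Psi> i k x * \<Phi> j k x')"
  shows "fredholm_det_I_minus ((\<lambda>(i, x). (\<nu> i, x)) ` Sigma {1..m} (win L)) A =
    det1 n (entry (win L))"
proof -
  let ?q = "\<lambda>i x. (i - 1) * L + nat (a i - x) + 1"
  define S where "S = Sigma {1..m} (win L)"
  have fS: "finite S" by (auto simp: S_def win_def)
  define M where "M = card S"
  obtain e where e: "bij_betw e {1..M} S" using ex_bij_betw_nat_finite_1[OF fS] unfolding M_def by blast
  define I where "I p = fst (e p)" for p
  define Z where "Z p = snd (e p)" for p
  have eS: "I p \<in> {1..m}" "Z p \<le> a (I p)" if "p \<in> {1..M}" for p
    using bij_betw_apply[OF e that] by (auto simp: S_def win_def I_def Z_def mem_Sigma_iff case_prod_unfold)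
  have sumS: "(\<Sum>p=1..M. F (I p) (Z p)) = (\<Sum>i=1..m. \<Sum>x\<in>win L i. F i x)" for F :: "nat => int => complex"
  proof -
    have "(\<Sum>p=1..M. F (I p) (Z p)) = (\<Sum>(i, x)\<in>S. F i x)"
      using sum.reindex_bij_betw[OF e, of "\<lambda>(i, x). F i x"] by (simp add: I_def Z_def case_prod_unfold)
    also have "\<dots> = (\<Sum>i=1..m. \<Sum>x\<in>win L i. F i x)"
      unfolding S_def by (rule sum.Sigma[symmetric]) (auto simp: win_def)
    finally show ?thesis .
  qed
  define \<sigma> where "\<sigma> = (\<lambda>(i, x :: int). (\<nu> i, x))"
  have inv: "the_inv_into {1..m} \<nu> (\<nu> i) = i" if "i \<in> {1..m}" for i by (rule the_inv_into_f_f[OF inj that])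
  have \<sigma>: "inj_on \<sigma> S"
    by (rule inj_on_inverseI[where g = "\<lambda>(p, x). (the_inv_into {1..m} \<nu> p, x)"])
      (use inv in \<open>auto simp: \<sigma>_def S_def\<close>)
  define f where "f q = \<sigma> (I (q + 1), Z (q + 1))" for q
  have sh: "bij_betw Suc {0..<M} {1..M}" by (rule bij_betw_byWitness[where f' = "\<lambda>p. p - 1"]) auto
  have "bij_betw (\<sigma> \<circ> (e \<circ> Suc)) {0..<M} (\<sigma> ` S)"
    by (rule bij_betw_trans[OF bij_betw_trans[OF sh e]]) (simp add: \<sigma> bij_betw_def)
  moreover have "\<sigma> \<circ> (e \<circ> Suc) = f" by (auto simp: f_def I_def Z_def fun_eq_iff)
  ultimately have fb: "bij_betw f {0..<M} (\<sigma> ` S)" by simp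
  then have fe: "f p = f q \<longleftrightarrow> p = q" if "p < M" "q < M" for p q
    using that by (auto simp: bij_betw_def inj_on_def)
  have finS: "finite (\<sigma> ` S)" using bij_betw_finite[OF fb] by simp
  define U where "U r q = (if I r < I q then \<phi> (I r) (I q) (Z r) (Z q) else 0)" for r q
  define l where "l k r = blam \<phi> \<Phi> (win L) (I r) k (Z r)" for k r
  have "fredholm_det_I_minus (\<sigma> ` S) A = detset {0..<M} (\<lambda>p q. (if f p = f q then 1 else 0) - A (f p) (f q))"
    by (simp only: fredholm_det_finite[OF finS] detset_reindex[OF fb finite_atLeastLessThan])
  also have "\<dots> = det1 M (\<lambda>p q. (if f (p - 1) = f (q - 1) then 1 else 0) - A (f (p - 1)) (f (q - 1)))"
    by (rule det1_detset[symmetric])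
  also have "\<dots> = det1 M (\<lambda>p q. (if p = q then 1 else 0) + U p q - (\<Sum>k=1..n. \<Psi> (I p) k (Z p) * \<Phi> (I q) k (Z q)))"
  proof (rule det1_cong)
    fix p q assume p: "p \<in> {1..M}" and q: "q \<in> {1..M}"
    have "f (p - 1) = (\<nu> (I p), Z p)" "f (q - 1) = (\<nu> (I q), Z q)" using p q by (auto simp: f_def \<sigma>_def)
    moreover have "f (p - 1) = f (q - 1) \<longleftrightarrow> p = q"
    proof -
      have "p - 1 < M" "q - 1 < M" using p q by auto
      from fe[OF this] show ?thesis using p q by auto
    qed
    ultimately show "(if f (p - 1) = f (q - 1) then 1 else 0) - A (f (p - 1)) (f (q - 1)) =
        (if p = q then 1 else 0) + U p q - (\<Sum>k=1..n. \<Psi> (I p) k (Z p) * \<Phi> (I q) k (Z q))"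
      using A[OF eS(1)[OF p] eS(1)[OF q] eS(2)[OF p] eS(2)[OF q]] by (simp add: U_def)
  qed
  also have "\<dots> = det1 n (\<lambda>k k'. (if k = k' then 1 else 0) - (\<Sum>p=1..M. l k p * \<Psi> (I p) k' (Z p)))"
  proof (rule det1_rank_update)
    show "I r < I q" if "U r q \<noteq> 0" for r q using that by (simp add: U_def split: if_splits)
    fix k q assume q: "q \<in> {1..M}"
    have "(\<Sum>r=1..M. l k r * U r q) =
        (\<Sum>i=1..m. \<Sum>x\<in>win L i. blam \<phi> \<Phi> (win L) i k x * (if i < I q then \<phi> i (I q) x (Z q) else 0))"
      unfolding l_def U_def by (rule sumS)
    also have "\<dots> = (\<Sum>i\<in>{1..<I q}. \<Sum>x\<in>win L i. blam \<phi> \<Phi> (win L) i k x * \<phi> i (I q) x (Z q))"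
      by (rule sum.mono_neutral_cong_right) (use eS(1)[OF q] in auto)
    also have "\<dots> = (\<Sum>i\<in>{1..<I q}. \<Sum>\<^sub>\<infinity>x\<in>win L i. blam \<phi> \<Phi> (win L) i k x * \<phi> i (I q) x (Z q))"
      by (simp add: win_def)
    finally show "l k q + (\<Sum>r=1..M. l k r * U r q) = \<Phi> (I q) k (Z q)"
      unfolding l_def by (subst blam.simps) simp
  qed
  also have "\<dots> = det1 n (entry (win L))"
  proof -
    have "(\<Sum>p=1..M. l k p * \<Psi> (I p) k' (Z p)) = (\<Sum>i=1..m. \<Sum>\<^sub>\<infinity>x\<in>win L i. blam \<phi> \<Phi> (win L) i k x * \<Psi> i k' x)" for k k'
      using sumS[of "\<lambda>i x. blam \<phi> \<Phi> (win L) i k x * \<Psi> i k' x"] by (simp add: l_def win_def)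
    then show ?thesis by simp
  qed
  finally show ?thesis unfolding \<sigma>_def S_def .
qed

lemma fredholm_eq_det:
  fixes A :: "'p \<times> int => 'p \<times> int => complex"
  assumes inj: "inj_on \<nu> {1..m}"
    and A: "\<And>i j x x'. i \<in> {1..m} ==> j \<in> {1..m} ==> x \<le> a i ==> x' \<le> a j ==>
      A (\<nu> i, x) (\<nu> j, x') = - (if i < j then \<phi> i j x x' else 0) + (\<Sum>k=1..n. \<Psi> i k x * \<Phi> j k x')"
    and A0: "\<And>i j x x'. i \<in> {1..m} ==> j \<in> {1..m} ==> \<not> (x \<le> a i \<and> x' \<le> a j) ==> A (\<nu> i, x) (\<nu> j, x') = 0"
  shows "fredholm_convergent (\<nu> ` {1..m} \<times> UNIV) A"
    and "fredholm_det_I_minus (\<nu> ` {1..m} \<times> UNIV) A =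
      det1 n (entry (\<lambda>i. {..a i}))"
proof -
  let ?X = "\<nu> ` {1..m} \<times> (UNIV :: int set)"
  define idx where "idx = the_inv_into {1..m} \<nu>"
  have idx: "idx (\<nu> i) = i" if "i \<in> {1..m}" for i unfolding idx_def by (rule the_inv_into_f_f[OF inj that])
  \<comment> \<open>The factor \<open>1 + real n\<close> counts the \<phi> term and the
    \<open>n\<close> products of \<Psi> and \<Phi>.\<close>
  define G where "G = (\<lambda>(p, x). if x \<le> a (idx p) then (1 + real n) * g (idx p) x else 0)"
  define H where "H = (\<lambda>(p, x). if x \<le> a (idx p) then h (idx p) x else 0)"
  have GH: "norm (A u u') \<le> G u * H u'" if u: "u \<in> ?X" "u' \<in> ?X" for u u'
  proof -
    obtain i x j x' where ij: "i \<in> {1..m}" "j \<in> {1..m}" "u = (\<nu> i, x)" "u' = (\<nu> j, x')" using u by auto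
    show ?thesis
    proof (cases "x \<le> a i \<and> x' \<le> a j")
      case False
      then have "G u * H u' = 0" using ij by (auto simp: G_def H_def idx)
      moreover have "A u u' = 0" using A0[OF ij(1,2) False] ij(3,4) by simp
      ultimately show ?thesis by (simp only: norm_zero order_refl)
    next
      case True
      then have x: "x \<le> a i" "x' \<le> a j" by auto
      have "norm (\<Sum>k=1..n. \<Psi> i k x * \<Phi> j k x') \<le> (\<Sum>k=1..n. g i x * h j x')"
        by (rule sum_norm_le) (use ij x in \<open>auto simp: norm_mult intro!: mult_mono Psi Phi g0\<close>)
      moreover have "norm (if i < j then \<phi> i j x x' else 0) \<le> g i x * h j x'"
        using phi[OF ij(1,2) _ x] g0[OF ij(1) x(1)] h0[OF ij(2) x(2)] by auto
      ultimately have "norm (A u u') \<le> g i x * h j x' + real n * (g i x * h j x')"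
        unfolding ij A[OF ij(1,2) x]
        using norm_triangle_ineq[of "- (if i < j then \<phi> i j x x' else 0)" "\<Sum>k=1..n. \<Psi> i k x * \<Phi> j k x'"]
        by (simp only: norm_minus_cancel sum_constant card_atLeastAtMost) simp
      then show ?thesis using ij x by (simp add: G_def H_def idx algebra_simps)
    qed
  qed
  have GH0: "0 \<le> G u * H u" if "u \<in> ?X" for u
    using that g0 h0 by (auto simp: G_def H_def idx intro!: mult_nonneg_nonneg)
  have GHs: "(\<lambda>u. G u * H u) summable_on ?X"
  proof -
    define \<sigma> where "\<sigma> = (\<lambda>(i, x :: int). (\<nu> i, x))"
    have \<sigma>: "inj_on \<sigma> ({1..m} \<times> UNIV)"
      by (rule inj_on_inverseI[where g = "\<lambda>(p, x). (idx p, x)"]) (auto simp: \<sigma>_def idx)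
    have X: "?X = \<sigma> ` ({1..m} \<times> UNIV)" by (auto simp: \<sigma>_def)
    have s: "(\<lambda>x. if x \<le> a i then (1 + real n) * g i x * h i x else 0) summable_on UNIV" if "i \<in> {1..m}" for i
    proof (rule summable_on_cong_neutral[THEN iffD1, OF _ _ _ summable_on_cmult_right[OF gh[OF that], of "1 + real n"]])
    qed auto
    have "(\<lambda>(i, x). if x \<le> a i then (1 + real n) * g i x * h i x else 0) summable_on ({1..m} \<times> UNIV)"
    proof (rule summable_on_SigmaI)
      fix i assume "i \<in> {1..m}"
      from has_sum_infsum[OF s[OF this]]
      show "((\<lambda>x. case (i, x) of (i, x) => if x \<le> a i then (1 + real n) * g i x * h i x else 0) has_sum
          (\<Sum>\<^sub>\<infinity>x. if x \<le> a i then (1 + real n) * g i x * h i x else 0)) UNIV" by simp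
    qed (use g0 h0 in \<open>auto\<close>)
    then have "((\<lambda>u. G u * H u) \<circ> \<sigma>) summable_on ({1..m} \<times> UNIV)"
      by (rule summable_on_cong[THEN iffD1, rotated]) (auto simp: \<sigma>_def G_def H_def idx)
    then show ?thesis unfolding X summable_on_reindex[OF \<sigma>] .
  qed
  show conv: "fredholm_convergent ?X A" by (rule fredholm_convergentI[OF GH GH0 GHs])
  let ?B = "\<lambda>L. (\<lambda>(i, x). (\<nu> i, x)) ` Sigma {1..m} (win L)"
  have "(\<lambda>L. fredholm_det_I_minus (?B L) A) \<longlonglongrightarrow> fredholm_det_I_minus ?X A"
  proof (rule fredholm_det_limit[OF conv])
    fix u assume "u \<in> ?X"
    then obtain i x where ix: "i \<in> {1..m}" "u = (\<nu> i, x)" by auto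
    show "(\<forall>u'\<in>?X. A u u' = 0) \<or> (\<forall>\<^sub>F L in sequentially. u \<in> ?B L)"
    proof (cases "x \<le> a i")
      case False
      then show ?thesis using A0 ix by auto
    next
      case True
      have "\<forall>\<^sub>F L in sequentially. u \<in> ?B L"
        using eventually_gt_at_top[of "nat (a i - x)"]
      proof eventually_elim
        case (elim L)
        then have "(i, x) \<in> Sigma {1..m} (win L)" using ix True by (auto simp: win_def)
        then show ?case using ix by force
      qed
      then show ?thesis ..
    qed
  qed auto
  moreover have "fredholm_det_I_minus (?B L) A =
      det1 n (entry (win L))"
    for L by (rule window_det[OF inj A])
  ultimately have "(\<lambda>L. det1 n (entry (win L)))
      \<longlonglongrightarrow> fredholm_det_I_minus ?X A" by simp
  moreover have "(\<lambda>L. det1 n (entry (win L)))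
      \<longlonglongrightarrow> det1 n (entry (\<lambda>i. {..a i}))"
  proof (intro tendsto_det1 tendsto_diff tendsto_const tendsto_sum)
    fix k k' i assume k: "k \<in> {1..n}" "k' \<in> {1..n}" and i: "i \<in> {1..m}"
    obtain c where c: "0 \<le> c" "\<And>Y z. (\<And>i. Y i \<subseteq> {..a i}) ==> z \<le> a i ==> norm (blam \<phi> \<Phi> Y i k z) \<le> c * h i z"
      using blam_bound[OF i] k by blast
    show "(\<lambda>L. \<Sum>\<^sub>\<infinity>x\<in>win L i. blam \<phi> \<Phi> (win L) i k x * \<Psi> i k' x) \<longlonglongrightarrow>
        (\<Sum>\<^sub>\<infinity>x\<in>{..a i}. blam \<phi> \<Phi> (\<lambda>i. {..a i}) i k x * \<Psi> i k' x)"
      unfolding win_def[of _ i]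
    proof (rule infsum_window_tendsto[where b = "\<lambda>x. c * (g i x * h i x)"])
      show "(\<lambda>x. c * (g i x * h i x)) summable_on {..a i}" by (intro summable_on_cmult_right gh i)
      fix x assume x: "x \<le> a i"
      show "norm (blam \<phi> \<Phi> (win L) i k x * \<Psi> i k' x) \<le> c * (g i x * h i x)" for L
      proof -
        have "norm (blam \<phi> \<Phi> (win L) i k x * \<Psi> i k' x) \<le> (c * h i x) * g i x"
          unfolding norm_mult
          by (intro mult_mono c(2)[OF _ x] Psi[OF i k(2) x] mult_nonneg_nonneg c(1) h0[OF i x]) (auto simp: win_def)
        then show ?thesis by (simp only: mult_ac)
      qed
      show "(\<lambda>L. blam \<phi> \<Phi> (win L) i k x * \<Psi> i k' x) \<longlonglongrightarrow> blam \<phi> \<Phi> (\<lambda>i. {..a i}) i k x * \<Psi> i k' x"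
        by (intro tendsto_mult_right blam_tendsto i k x)
    qed
  qed
  ultimately show "fredholm_det_I_minus ?X A =
      det1 n (entry (\<lambda>i. {..a i}))"
    by (rule LIMSEQ_unique)
qed

end

section \<open>Left half lines and symbols on the inner annulus\<close>

lemma power_int_mono_base:
  fixes p q :: real
  assumes "0 < p" "p \<le> q" "x \<le> a"
  shows "q powi x \<le> (q / p) powi a * p powi x"
proof -
  have "(q / p) powi x \<le> (q / p) powi a" using assms by (intro power_int_increasing) auto
  then have "(q / p) powi x * p powi x \<le> (q / p) powi a * p powi x" using assms by (intro mult_right_mono) auto
  then show ?thesis using assms by (simp add: power_int_divide_distrib)
qed

definition restr_le :: "int => (int => complex) => int => complex" where
  "restr_le a f x = (if x \<le> a then f x else 0)"

lemma restr_le_bounded: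
  assumes f: "two_bounded s r f" and s: "0 < s" "s \<le> r"
  shows "pow_bounded s (restr_le a f)"
proof -
  obtain C where C: "0 \<le> C" "\<And>x. norm (f x) \<le> C * (s powi x + r powi x)" using two_boundedE[OF f] by blast
  have "norm (restr_le a f x) \<le> (C * (1 + (r / s) powi a)) * s powi x" for x
  proof (cases "x \<le> a")
    case True
    have "C * (s powi x + r powi x) \<le> C * (s powi x + (r / s) powi a * s powi x)"
      using power_int_mono_base[OF s True] C(1) by (intro mult_left_mono add_left_mono) auto
    then show ?thesis using C(2)[of x] True by (simp add: restr_le_def algebra_simps)
  next
    case False
    then show ?thesis using C(1) s by (simp add: restr_le_def)
  qed
  then show ?thesis by (rule pow_boundedI)
qed

lemma restr_gt_eq: "restr_gt a f = (\<lambda>x. f x - restr_le a f x)"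
  by (auto simp: restr_gt_def restr_le_def fun_eq_iff)

lemma conv_op_zero [simp]: "conv_op a (\<lambda>x. 0) = (\<lambda>x. 0)"
  by (rule ext) (simp add: conv_op_def)

context contour_setting
begin

lemma not_v: "w \<in> annulus \<rho> lo ==> i \<in> {1..N} ==> cv v i \<noteq> w"
  using lo_hi(3)[of i] v_pos[of i] by (auto simp: in_annulus)

lemma rho_annulus: "norm w = \<rho> ==> w \<in> annulus \<rho> lo" "norm w = \<rho> ==> w \<in> annulus \<rho> R"
  using lo_hi by (auto simp: in_annulus)

lemma factor_nz: "w \<in> annulus \<rho> lo ==> k \<le> N ==> (fac n k w) \<noteq> 0"
  using not_v rho by (auto simp: prod_zero_iff in_annulus)

lemma P_an_lo: "t \<in> TT ==> P t analytic_on annulus \<rho> lo"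
  by (rule analytic_on_subset[OF P_an annulus_mono]) (use lo_hi in auto)

definition phisym :: "nat => real => nat => real => complex => complex" where
  "phisym n s n' s' w = P (s - s') w / (fac n n' w)"

text \<open>The second case is the convention for indices \<open>k > n\<close>: the quotient of
  products leaves only the factors from \<open>n + 1\<close> to \<open>k\<close>, in the
  denominator.\<close>

definition psisym :: "nat => real => nat => complex => complex" where
  "psisym n t k w = P (t - T k) w * (if k \<le> n then \<Prod>i=k + 1..n. (cv v i - w) / w else 1 / (fac n k w))"

lemma inverse_prod_analytic:
  assumes "k \<le> N"
  shows "(\<lambda>w. 1 / (fac n k w)) analytic_on annulus \<rho> lo"
  using factor_nz[OF _ assms] rho
  by (intro analytic_on_divide analytic_on_const analytic_on_prod analytic_on_diff analytic_on_ident) (auto simp: in_annulus)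

lemma phisym_analytic:
  assumes "s \<in> TT" "s' \<in> TT" "n' \<le> N"
  shows "phisym n s n' s' analytic_on annulus \<rho> lo"
  using analytic_on_mult[OF P_an_lo[OF TT_diff[OF assms(1,2)]] inverse_prod_analytic[OF assms(3), of n]]
  by (simp add: phisym_def[abs_def])

lemma psisym_analytic:
  assumes "t \<in> TT" "k \<in> {1..N}"
  shows "psisym n t k analytic_on annulus \<rho> lo"
proof (cases "k \<le> n")
  case True
  then show ?thesis
    using prod_symbol_analytic[OF rho P_an_lo[OF TT_diff[OF assms(1) T_in[OF assms(2)]]], of "cv v" k n]
    by (simp add: psisym_def[abs_def])
next
  case False
  have "k \<le> N" using assms by simp
  then show ?thesis
    using False analytic_on_mult[OF P_an_lo[OF TT_diff[OF assms(1) T_in[OF assms(2)]]] inverse_prod_analytic[of k n]]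
    by (simp add: psisym_def[abs_def])
qed

lemma circ_avg_symbol:
  assumes "n \<le> n'" "n' \<le> N"
  shows "circ_avg \<rho> (\<lambda>w. f w / w powi (d - int n' + int n + 1) * (\<Prod>k=n + 1..n'. inverse (cv v k - w))) =
    lcoeff \<rho> (\<lambda>w. f w / (fac n n' w)) d"
  unfolding lcoeff_def
proof (rule circ_avg_cong[OF rho])
  fix w :: complex assume "norm w = \<rho>"
  then have w: "w \<noteq> 0" using rho by auto
  have e: "d - int n' + int n + 1 = (d + 1) - int (n' - n)" using assms by auto
  have 1: "w powi (d - int n' + int n + 1) = w powi (d + 1) / w ^ (n' - n)"
    unfolding e using w by (subst power_int_diff) auto
  have 2: "(fac n n' w) = (\<Prod>i=n + 1..n'. cv v i - w) / w ^ (n' - n)"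
    by (simp add: prod_dividef)
  have 3: "(\<Prod>k=n + 1..n'. inverse (cv v k - w)) = inverse (\<Prod>k=n + 1..n'. cv v k - w)"
    using prod_inversef[of "\<lambda>k. cv v k - w" "{n + 1..n'}"] by (simp add: o_def)
  show "f w / w powi (d - int n' + int n + 1) * (\<Prod>k=n + 1..n'. inverse (cv v k - w)) =
      f w / (fac n n' w) / w powi (d + 1)"
    unfolding 1 2 3 by (simp add: divide_inverse mult_ac)
qed

lemma phi_lcoeff:
  assumes "n \<le> n'" "n' \<le> N"
  shows "phi_kernel v \<rho> P (n, s) (n', s') x x' = lcoeff \<rho> (phisym n s n' s') (x - x')"
  using circ_avg_symbol[OF assms, of "P (s - s')" "x - x'"] by (simp add: phi_kernel_def phisym_def[abs_def])

lemma Psi_lcoeff: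
  assumes "k \<in> {1..N}" "n \<le> N"
  shows "PsiN n t k x = lcoeff \<rho> (psisym n t k) (x - y k)"
proof (cases "k \<le> n")
  case True
  then show ?thesis using Psi_eq[of k n t x] assms by (simp add: psisym_def[abs_def])
next
  case False
  have "PsiN n t k x = circ_avg \<rho> (\<lambda>w. P (t - T k) w / w powi (x - y k - int k + int n + 1) * (\<Prod>i=n + 1..k. inverse (cv v i - w)))"
    unfolding Psi_def Let_def fst_conv snd_conv
  proof (rule circ_avg_cong[OF rho])
    fix w :: complex assume "norm w = \<rho>"
    then have nz: "cv v i - w \<noteq> 0" if "i \<in> {1..N}" for i using not_v[OF rho_annulus(1) that] by auto
    have "(\<Prod>i=1..k. cv v i - w) = (\<Prod>i=1..n. cv v i - w) * (\<Prod>i=n + 1..k. cv v i - w)"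
      using prod.ub_add_nat[of 1 n "\<lambda>i. cv v i - w" "k - n"] False by simp
    moreover have "(\<Prod>i=1..n. cv v i - w) \<noteq> 0" using nz assms by (auto simp: prod_zero_iff)
    ultimately have "(\<Prod>i=1..n. cv v i - w) / (\<Prod>i=1..k. cv v i - w) = inverse (\<Prod>i=n + 1..k. cv v i - w)"
      by (simp add: divide_inverse)
    also have "\<dots> = (\<Prod>i=n + 1..k. inverse (cv v i - w))"
      using prod_inversef[of "\<lambda>i. cv v i - w" "{n + 1..k}"] by (simp add: o_def)
    moreover have "x - y k + int n - int k + 1 = x - y k - int k + int n + 1" by simp
    ultimately show "P (t - T k) w / w powi (x - y k + int n - int k + 1) *
        (if k \<le> n then \<Prod>i=k + 1..n. cv v i - w else (\<Prod>i=1..n. cv v i - w) / (\<Prod>i=1..k. cv v i - w)) =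
        P (t - T k) w / w powi (x - y k - int k + int n + 1) * (\<Prod>i=n + 1..k. inverse (cv v i - w))"
      using False by (simp only: if_False)
  qed
  also have "\<dots> = lcoeff \<rho> (psisym n t k) (x - y k)"
    using circ_avg_symbol[of n k "P (t - T k)" "x - y k"] False assms by (simp add: psisym_def[abs_def])
  finally show ?thesis .
qed

lemma symbol_bound:
  assumes "g analytic_on annulus \<rho> lo" "\<rho> \<le> s" "s \<le> lo"
  shows "\<exists>B\<ge>0. \<forall>d. norm (lcoeff \<rho> g d) \<le> B * s powi (- d)"
proof -
  have s: "0 < s" using assms rho by auto
  obtain B where B: "0 \<le> B" "\<And>d. norm (lcoeff s g d) * s powi d \<le> B"
    by (rule lcoeff_bound[OF s continuous_on_sphere[OF assms]]) (rule that)
  have "norm (lcoeff \<rho> g d) \<le> B * s powi (- d)" for d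
  proof -
    have "norm (lcoeff s g d) \<le> B / s powi d" using B(2)[of d] s by (simp add: pos_le_divide_eq)
    then show ?thesis using lcoeff_indep[OF assms(1) rho assms(2,3), of d] s by (simp add: power_int_minus divide_inverse)
  qed
  then show ?thesis using B(1) by blast
qed

text \<open>The operator with kernel \<phi>: the time shift combined with the right inverse of the
  difference operators taken below all \<open>v i\<close>. It acts on functions of growth
  \<open>lo powi x\<close>, such as those cut to \<open>x \<le> a\<close>.\<close>

definition Cop :: "nat => real => nat => real => (int => complex) => int => complex" where
  "Cop n s n' s' = conv_op (lcoeff \<rho> (phisym n s n' s'))"

lemma kernel_lo:
  assumes "g analytic_on annulus \<rho> lo"
  shows "conv_kernel lo lo (lcoeff \<rho> g)"
  by (rule conv_kernel_lcoeff[OF assms]) (use rho lo_hi in auto)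

lemma Cop_bounded:
  assumes "s \<in> TT" "s' \<in> TT" "n' \<le> N" "pow_bounded lo f"
  shows "pow_bounded lo (Cop n s n' s' f)"
  using conv_kernel.two_bounded_conv[OF kernel_lo[OF phisym_analytic[OF assms(1-3), of n]], of f] assms(4)
  by (simp add: two_bounded_self Cop_def)

lemma Cop_refl:
  assumes "t \<in> TT"
  shows "Cop n t n t f = f"
proof -
  have "lcoeff \<rho> (phisym n t n t) = lcoeff \<rho> (\<lambda>_. 1)"
    by (rule lcoeff_cong[OF rho]) (simp add: phisym_def P_zero rho_annulus)
  then show ?thesis using conv_op_one[OF rho] by (simp add: Cop_def)
qed

lemma factor_split:
  fixes f :: "nat => complex"
  shows "n \<le> n' ==> n' \<le> n'' ==> (\<Prod>i=n + 1..n''. f i) = (\<Prod>i=n + 1..n'. f i) * (\<Prod>i=n' + 1..n''. f i)"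
  using prod.ub_add_nat[of "n + 1" n' f "n'' - n'"] by simp

text \<open>The factors above the intermediate level \<open>n'\<close> cancel in the symbol, and the
  time shift splits at \<open>s'\<close>.\<close>

lemma DD_Cop:
  assumes n: "n \<le> n'" "n' \<le> n''" "n'' \<le> N" and t: "s \<in> TT" "s' \<in> TT" "s'' \<in> TT" and f: "pow_bounded lo f"
  shows "DD (cv v) n' n'' (Cop n s n'' s'' f) = CC (s' - s'') (Cop n s n' s' f)"
proof -
  have f2: "two_bounded lo lo f" using f by (simp add: two_bounded_self)
  let ?h = "phisym n s n' s''"
  have an: "?h analytic_on annulus \<rho> lo" using n t by (intro phisym_analytic) auto
  have c: "cv v i \<notin> annulus \<rho> lo" if "i \<in> {n' + 1..n''}" for i using not_v[of "cv v i" i] that n by auto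
  have "lcoeff \<rho> (phisym n s n'' s'') = lcoeff \<rho> (\<lambda>w. ?h w / (fac n' n'' w))"
    by (rule lcoeff_cong[OF rho]) (simp only: phisym_def factor_split[OF n(1,2)] divide_divide_eq_left)
  then have "DD (cv v) n' n'' (Cop n s n'' s'' f) =
      DD (cv v) n' n'' (conv_op (lcoeff \<rho> (\<lambda>w. ?h w / (fac n' n'' w))) f)"
    by (simp only: Cop_def)
  also have "\<dots> = conv_op (lcoeff \<rho> ?h) f"
    by (rule DD_right_inverse[OF an rho _ _ _ _ _ c n(2) f2]) (use lo_hi in auto)
  also have "lcoeff \<rho> ?h = lcoeff \<rho> (\<lambda>w. P (s' - s'') w * phisym n s n' s' w)"
  proof (rule lcoeff_cong[OF rho])
    fix w :: complex assume "norm w = \<rho>"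
    from P_add[OF TT_diff[OF t(2,3)] TT_diff[OF t(1,2)] rho_annulus(2)[OF this]]
    have "P (s - s'') w = P (s' - s'') w * P (s - s') w" by simp
    then show "?h w = P (s' - s'') w * phisym n s n' s' w" by (simp add: phisym_def)
  qed
  also have "conv_op \<dots> f = CC (s' - s'') (Cop n s n' s' f)"
    unfolding CC_def Cop_def
    by (rule conv_op_lcoeff_mult[symmetric, where ?r2.0 = lo and s = lo and q = lo])
      (use t n f2 lo_hi rho in \<open>auto intro!: P_an_lo TT_diff phisym_analytic\<close>)
  finally show ?thesis .
qed

text \<open>The symbols of the functional and of \<open>Cop\<close> multiply to that of \<Psi> at
  the earlier node. For \<open>l > n\<close> the product leaves a denominator, which is why the
  convention for negative indices of \<Psi> is the right one.\<close>

lemma LL_Cop: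
  assumes n: "n \<le> n'" "n' \<le> N" and t: "t \<in> TT" "t' \<in> TT" and l: "l \<in> {1..n'}" and f: "pow_bounded lo f"
  shows "LL n' t' l (Cop n t n' t' f) = (\<Sum>\<^sub>\<infinity>x. PsiN n t l x * f x)"
proof -
  have lN: "l \<in> {1..N}" "n \<le> N" using l n by auto
  have f2: "two_bounded lo lo f" using f by (simp add: two_bounded_self)
  let ?g = "\<lambda>w. P (t' - T l) w * (fac l n' w)"
  have Pan: "P (t' - T l) analytic_on annulus \<rho> lo" by (intro P_an_lo TT_diff t T_in lN)
  have Cf: "two_bounded lo lo (Cop n t n' t' f)" using Cop_bounded[OF t n(2) f] by (simp add: two_bounded_self)
  have "CC (t' - T l) (DD (cv v) l n' (Cop n t n' t' f)) = conv_op (lcoeff \<rho> ?g) (Cop n t n' t' f)"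
    unfolding CC_def by (rule conv_op_DD[OF Pan rho, symmetric, where s = lo and q = lo]) (use lo_hi Cf l in auto)
  also have "\<dots> = conv_op (lcoeff \<rho> (\<lambda>w. ?g w * phisym n t n' t' w)) f"
    unfolding Cop_def
    by (rule conv_op_lcoeff_mult[OF prod_symbol_analytic[OF rho Pan] phisym_analytic[OF t n(2)] rho, where s = lo and q = lo])
      (use f2 lo_hi in auto)
  also have "lcoeff \<rho> (\<lambda>w. ?g w * phisym n t n' t' w) = lcoeff \<rho> (psisym n t l)"
  proof (rule lcoeff_cong[OF rho])
    fix w :: complex assume w: "norm w = \<rho>"
    note an = rho_annulus(1)[OF w]
    have PP: "P (t' - T l) w * P (t - t') w = P (t - T l) w"
      using P_add[OF TT_diff[OF t(2) T_in[OF lN(1)]] TT_diff[OF t] rho_annulus(2)[OF w]] by simp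
    have "(fac l n' w) / (fac n n' w) =
        (if l \<le> n then \<Prod>i=l + 1..n. (cv v i - w) / w else 1 / (fac n l w))"
    proof (cases "l \<le> n")
      case True
      then show ?thesis using factor_split[OF True n(1), of "\<lambda>i. (cv v i - w) / w"] factor_nz[OF an n(2), of n] by simp
    next
      case False
      then show ?thesis using factor_split[of n l n' "\<lambda>i. (cv v i - w) / w"] factor_nz[OF an n(2), of l] l by simp
    qed
    moreover have "?g w * phisym n t n' t' w = (P (t' - T l) w * P (t - t') w) *
        ((fac l n' w) / (fac n n' w))"
      by (simp only: phisym_def times_divide_eq_left times_divide_eq_right mult_ac)
    ultimately show "?g w * phisym n t n' t' w = psisym n t l w" by (simp only: psisym_def PP)
  qed
  finally have "LL n' t' l (Cop n t n' t' f) = conv_op (lcoeff \<rho> (psisym n t l)) f (y l)" by (simp add: LL_def)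
  then show ?thesis by (simp add: conv_op_def Psi_lcoeff[OF lN])
qed

lemma CC_diff:
  assumes "t \<in> TT" "two_bounded lo hi f" "two_bounded lo hi g"
  shows "CC t (\<lambda>x. f x - g x) = (\<lambda>x. CC t f x - CC t g x)"
  using conv_kernel.conv_diff[OF kernel_lo_hi[OF assms(1)] assms(2,3)] by (auto simp: CC_def)

lemma two_bounded_sum:
  assumes "finite I" "\<And>i. i \<in> I ==> two_bounded lo hi (f i)"
  shows "two_bounded lo hi (\<lambda>x. \<Sum>i\<in>I. f i x)"
  using assms
proof (induction I rule: finite_induct)
  case empty
  show ?case using two_boundedI[of "\<lambda>x. 0" 0] by simp
qed (auto intro: two_bounded_add)

lemma CC_sum:
  assumes "t \<in> TT" "finite I" "\<And>i. i \<in> I ==> two_bounded lo hi (f i)"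
  shows "CC t (\<lambda>x. \<Sum>i\<in>I. c i * f i x) = (\<lambda>x. \<Sum>i\<in>I. c i * CC t (f i) x)"
  using assms(2,3)
proof (induction I rule: finite_induct)
  case empty
  show ?case by (simp add: CC_def)
next
  case (insert j I)
  have "CC t (\<lambda>x. c j * f j x + (\<Sum>i\<in>I. c i * f i x)) x = CC t (\<lambda>x. c j * f j x) x + CC t (\<lambda>x. \<Sum>i\<in>I. c i * f i x) x" for x
    unfolding CC_def
    by (rule conv_kernel.conv_add[OF kernel_lo_hi[OF assms(1)]])
      (use insert in \<open>auto intro!: two_bounded_cmult two_bounded_sum\<close>)
  then show ?case
    using insert conv_kernel.conv_cmult[OF kernel_lo_hi[OF assms(1)], of "f j" "c j"] by (auto simp: CC_def)
qed

lemma LL_DD: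
  assumes "k \<le> n" "n \<le> n'"
  shows "LL n t k (DD (cv v) n n' f) = LL n' t k f"
  using DD_split[OF assms, of "cv v" f] by (simp add: LL_def)

lemma LL_CC:
  assumes n: "n \<le> N" and t: "s \<in> TT" "t \<in> TT" and k: "k \<in> {1..n}" and f: "two_bounded lo hi f"
  shows "LL n t k (CC s f) = LL n (t + s) k f"
proof -
  have Tk: "t - T k \<in> TT" using t T_in k n by (intro TT_diff) auto
  have "LL n t k (CC s f) = CC (t - T k) (CC s (DD (cv v) k n f)) (y k)"
    using conv_kernel_DD[OF kernel_lo_hi[OF t(1)] f] by (simp add: LL_def CC_def)
  also have "\<dots> = CC (t - T k + s) (DD (cv v) k n f) (y k)"
    by (subst CC_CC[where a = lo and b = hi]) (use Tk t lo_hi f in \<open>auto intro: two_bounded_DD\<close>)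
  finally show ?thesis by (simp add: LL_def algebra_simps)
qed

end

section \<open>The triangular recursion\<close>

context path_setting
begin

text \<open>Extension by zero beyond the level of the node, so that the finite-rank part of the
  kernel has the same index range \<open>1..nl m\<close> at all nodes.\<close>

definition kap0 :: "nat => nat => int => complex" where
  "kap0 j k = (if k \<le> nl j then kap j k else (\<lambda>x. 0))"

definition lam :: "nat => nat => int => complex" where
  "lam = blam phiP kap0 (\<lambda>i. {..a i})"

definition CP :: "nat => nat => (int => complex) => int => complex" where
  "CP i j = Cop (nl i) (tl i) (nl j) (tl j)"

lemma phi_path:
  assumes "i \<in> {1..m}" "j \<in> {1..m}" "i \<le> j"
  shows "phiP i j x x' = lcoeff \<rho> (phisym (nl i) (tl i) (nl j) (tl j)) (x - x')"
  using phi_lcoeff[OF nl_mono[OF assms(3)] nl_le_N] assms by (simp add: nn_eq)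

lemma lam_eq:
  assumes "j \<in> {1..m}"
  shows "lam j k = (\<lambda>x'. kap0 j k x' - (\<Sum>i\<in>{1..<j}. CP i j (restr_le (a i) (lam i k)) x'))"
proof -
  have "(\<Sum>\<^sub>\<infinity>x\<in>{..a i}. lam i k x * phiP i j x x') = CP i j (restr_le (a i) (lam i k)) x'"
    if "i \<in> {1..<j}" for i x'
    unfolding CP_def Cop_def conv_op_def
    by (rule infsum_cong_neutral) (use that assms in \<open>auto simp: restr_le_def phi_path mult.commute\<close>)
  then show ?thesis
    unfolding lam_def by (subst blam.simps) (simp add: lam_def[symmetric])
qed

lemma kap0_bounded:
  assumes "j \<in> {1..m}" "1 \<le> k"
  shows "two_bounded lo hi (kap0 j k)"
proof (cases "k \<le> nl j")
  case True
  then show ?thesis using VV_bounded[OF nl_le_N kap_props(1)[OF assms(1)]] assms by (simp add: kap0_def)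
next
  case False
  then show ?thesis using two_boundedI[of "\<lambda>x. 0" 0] by (simp add: kap0_def)
qed

lemma lam_bounded:
  assumes "j \<in> {1..m}" "1 \<le> k"
  shows "two_bounded lo hi (lam j k)" "pow_bounded lo (restr_le (a j) (lam j k))"
proof -
  have "two_bounded lo hi (lam j k)"
    using assms
  proof (induction j rule: less_induct)
    case (less j)
    show ?case unfolding lam_eq[OF less.prems(1)]
    proof (intro two_bounded_diff kap0_bounded less.prems two_bounded_sum finite_atLeastLessThan)
      fix i assume i: "i \<in> {1..<j}"
      then have im: "i \<in> {1..m}" "j \<in> {1..m}" using less.prems by auto
      have "pow_bounded lo (restr_le (a i) (lam i k))"
        using less i im lo_hi by (intro restr_le_bounded[of lo hi]) auto
      then have "pow_bounded lo (CP i j (restr_le (a i) (lam i k)))"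
        unfolding CP_def by (intro Cop_bounded tl_in nl_le_N im) (use im in auto)
      then show "two_bounded lo hi (CP i j (restr_le (a i) (lam i k)))"
        using lo_hi by (intro two_bounded_mono_left) auto
    qed
  qed
  then show "two_bounded lo hi (lam j k)" .
  then show "pow_bounded lo (restr_le (a j) (lam j k))" using lo_hi by (intro restr_le_bounded[of lo hi]) auto
qed

lemma CP_bounded:
  assumes "i \<in> {1..m}" "j \<in> {1..m}" "1 \<le> k"
  shows "two_bounded lo hi (CP i j (restr_le (a i) (lam i k)))"
proof -
  have "pow_bounded lo (CP i j (restr_le (a i) (lam i k)))"
    unfolding CP_def by (intro Cop_bounded tl_in nl_le_N lam_bounded assms) (use assms in auto)
  then show ?thesis using lo_hi by (intro two_bounded_mono_left) auto
qed

lemma lam_zero: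
  assumes "j \<in> {1..m}" "nl j < k"
  shows "lam j k = (\<lambda>x. 0)"
  using assms
proof (induction j rule: less_induct)
  case (less j)
  have "CP i j (restr_le (a i) (lam i k)) = (\<lambda>x. 0)" if i: "i \<in> {1..<j}" for i
  proof -
    have "nl i \<le> nl j" using i less.prems by (intro nl_mono) auto
    then have "lam i k = (\<lambda>x. 0)" using less i by auto
    then have "restr_le (a i) (lam i k) = (\<lambda>x. 0)" by (simp add: restr_le_def[abs_def])
    then show ?thesis by (simp add: CP_def Cop_def)
  qed
  then show ?case unfolding lam_eq[OF less.prems(1)] using less.prems by (simp add: kap0_def)
qed

lemma kap_expand:
  assumes i: "i \<in> {1..m}" and f: "f \<in> VV (nl i)"
  shows "f = (\<lambda>x. \<Sum>k=1..nl i. LL (nl i) (tl i) k f * kap i k x)"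
proof -
  let ?n = "nl i" and ?t = "tl i"
  note t = tl_in[OF i]
  have n: "?n \<le> N" using i by (intro nl_le_N) auto
  let ?s = "\<lambda>x. \<Sum>k=1..?n. LL ?n ?t k f * kap i k x"
  have kb: "two_bounded lo hi (kap i k)" if "k \<in> {1..?n}" for k by (rule VV_bounded[OF n kap_props(1)[OF i that]])
  have sV: "?s \<in> VV ?n"
    unfolding VV_def by (intro V_space_sum V_space_cmult kap_props(1)[OF i, unfolded VV_def]) auto
  have dV: "(\<lambda>x. f x - ?s x) \<in> VV ?n" using f sV unfolding VV_def by (rule V_space_diff)
  have "(\<lambda>x. f x - ?s x) = (\<lambda>x. 0)"
  proof (rule LL_inj[OF t n dV])
    fix l assume l: "l \<in> {1..?n}"
    have "LL ?n ?t l (\<lambda>x. f x - ?s x) = LL ?n ?t l f - LL ?n ?t l ?s"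
      by (rule LL_diff[OF t l n VV_bounded[OF n f] VV_bounded[OF n sV]])
    also have "LL ?n ?t l ?s = (\<Sum>k=1..?n. LL ?n ?t l (\<lambda>x. LL ?n ?t k f * kap i k x))"
      by (rule LL_sum[OF t l n]) (auto intro!: two_bounded_cmult kb)
    also have "\<dots> = (\<Sum>k=1..?n. LL ?n ?t k f * (if l = k then 1 else 0))"
      by (rule sum.cong[OF refl]) (use l in \<open>simp only: LL_cmult[OF t l n kb] kap_props(2)[OF i _ l]\<close>)
    also have "\<dots> = LL ?n ?t l f" using l by (simp add: if_distrib[of "(*) _"] cong: if_cong)
    finally show "LL ?n ?t l (\<lambda>x. f x - ?s x) = 0" by simp
  qed
  then show ?thesis by (auto simp: fun_eq_iff)
qed

text \<open>For \<open>k \<le> nl j\<close> both sides lie in \<open>VV (nl j)\<close> and have the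
  same functionals there; for larger \<open>k\<close> both sides vanish, by elimination or by
  definition.\<close>

lemma DD_kap0:
  assumes j: "1 \<le> j" "Suc j \<le> m" and k: "1 \<le> k"
  shows "DD (cv v) (nl j) (nl (Suc j)) (kap0 (Suc j) k) = CC (tl j - tl (Suc j)) (kap0 j k)"
proof -
  let ?n = "nl j" and ?n' = "nl (Suc j)" and ?t = "tl j" and ?t' = "tl (Suc j)"
  have jm: "j \<in> {1..m}" "Suc j \<in> {1..m}" using j by auto
  have n: "?n \<le> ?n'" "?n' \<le> N" "?n \<le> N" using nl_Suc[of j] nl_le_N[of j] nl_le_N[of "Suc j"] j by auto
  note t = tl_in[OF jm(1)] and t' = tl_in[OF jm(2)]
  have tt: "?t - ?t' \<in> TT" by (rule TT_diff[OF t t'])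
  consider (a) "k \<le> ?n" | (b) "?n < k" "k \<le> ?n'" | (c) "?n' < k" by linarith
  then show ?thesis
  proof cases
    case a
    then have kk: "k \<in> {1..?n}" "k \<in> {1..?n'}" using k n by auto
    have kV: "kap j k \<in> VV ?n" "kap (Suc j) k \<in> VV ?n'" by (rule kap_props(1)[OF jm(1) kk(1)], rule kap_props(1)[OF jm(2) kk(2)])
    have kb: "two_bounded lo hi (kap j k)" by (rule VV_bounded[OF n(3) kV(1)])
    have 1: "DD (cv v) ?n ?n' (kap (Suc j) k) \<in> VV ?n"
      using kV(2) n DD_split[of 0 ?n ?n' "cv v" "kap (Suc j) k"] by (simp add: VV_iff)
    have "DD (cv v) 0 ?n (CC (?t - ?t') (kap j k)) = CC (?t - ?t') (DD (cv v) 0 ?n (kap j k))"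
      unfolding CC_def by (rule conv_kernel_DD[OF kernel_lo_hi[OF tt] kb, symmetric])
    then have 2: "CC (?t - ?t') (kap j k) \<in> VV ?n"
      using kV(1) n by (simp add: VV_iff CC_def)
    have "(\<lambda>x. DD (cv v) ?n ?n' (kap (Suc j) k) x - CC (?t - ?t') (kap j k) x) = (\<lambda>x. 0)"
    proof (rule LL_inj[OF t' n(3)])
      show "(\<lambda>x. DD (cv v) ?n ?n' (kap (Suc j) k) x - CC (?t - ?t') (kap j k) x) \<in> VV ?n"
        using 1 2 unfolding VV_def by (rule V_space_diff)
      fix l assume l: "l \<in> {1..?n}"
      then have l': "l \<in> {1..?n'}" using n by auto
      have "LL ?n ?t' l (DD (cv v) ?n ?n' (kap (Suc j) k)) = (if l = k then 1 else 0)"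
        using LL_DD[of l ?n ?n' ?t' "kap (Suc j) k"] l n kap_props(2)[OF jm(2) kk(2) l'] by simp
      moreover have "LL ?n ?t' l (CC (?t - ?t') (kap j k)) = (if l = k then 1 else 0)"
        using LL_CC[OF n(3) tt t' l kb] kap_props(2)[OF jm(1) kk(1) l] by simp
      ultimately show "LL ?n ?t' l (\<lambda>x. DD (cv v) ?n ?n' (kap (Suc j) k) x - CC (?t - ?t') (kap j k) x) = 0"
        using LL_diff[OF t' l n(3) VV_bounded[OF n(3) 1] VV_bounded[OF n(3) 2]] by simp
    qed
    then show ?thesis using a n by (auto simp: kap0_def fun_eq_iff)
  next
    case b
    then have kk: "k \<in> {1..?n'}" using k by auto
    have "DD (cv v) ?n ?n' (kap (Suc j) k) = (\<lambda>x. 0)"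
      by (rule LL_zero_DD[OF t' n(2) kap_props(1)[OF jm(2) kk] _ _ b(1)])
        (use b kap_props(2)[OF jm(2) kk] in auto)
    then show ?thesis using b by (simp add: kap0_def CC_def)
  next
    case c
    then show ?thesis using n by (simp add: kap0_def CC_def)
  qed
qed

text \<open>Passing to level \<open>nl j\<close>, every term of the recursion for
  \<open>lam (Suc j)\<close> becomes its counterpart for \<open>lam j\<close>, moved in time. There
  is one additional term, \<open>i = j\<close>, for which \<open>CP\<close> is the identity; it
  subtracts the part on \<open>x \<le> a j\<close> and so produces the cut.\<close>

lemma DD_lam:
  assumes j: "1 \<le> j" "Suc j \<le> m" and k: "1 \<le> k"
  shows "DD (cv v) (nl j) (nl (Suc j)) (lam (Suc j) k) = CC (tl j - tl (Suc j)) (restr_gt (a j) (lam j k))"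
proof -
  let ?n = "nl j" and ?n' = "nl (Suc j)" and ?t = "tl j" and ?t' = "tl (Suc j)"
  have jm: "j \<in> {1..m}" "Suc j \<in> {1..m}" using j by auto
  have n: "?n \<le> ?n'" "?n' \<le> N" using nl_Suc[of j] nl_le_N[of "Suc j"] j by auto
  have tt: "?t - ?t' \<in> TT" by (intro TT_diff tl_in jm)
  define \<mu> where "\<mu> i = restr_le (a i) (lam i k)" for i
  have CPb: "two_bounded lo hi (CP i j (\<mu> i))" if "i \<in> {1..<Suc j}" for i
    unfolding \<mu>_def using that j by (intro CP_bounded jm k) auto
  have st: "DD (cv v) ?n ?n' (CP i (Suc j) (\<mu> i)) = CC (?t - ?t') (CP i j (\<mu> i))" if i: "i \<in> {1..<Suc j}" for i
  proof -
    have im: "i \<in> {1..m}" using i j by auto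
    have "nl i \<le> nl j" using i j by (intro nl_mono) auto
    then show ?thesis unfolding CP_def \<mu>_def
      by (intro DD_Cop n tl_in im jm lam_bounded k)
  qed
  have "DD (cv v) ?n ?n' (lam (Suc j) k) =
      (\<lambda>x. CC (?t - ?t') (kap0 j k) x - (\<Sum>i\<in>{1..<Suc j}. 1 * CC (?t - ?t') (CP i j (\<mu> i)) x))"
    unfolding lam_eq[OF jm(2)] \<mu>_def[symmetric]
    by (simp only: DD_diff DD_sum[OF finite_atLeastLessThan] DD_kap0[OF j k] st mult_1_left cong: sum.cong)
  also have "\<dots> = (\<lambda>x. CC (?t - ?t') (kap0 j k) x - CC (?t - ?t') (\<lambda>x. \<Sum>i\<in>{1..<Suc j}. 1 * CP i j (\<mu> i) x) x)"
    by (simp only: CC_sum[OF tt finite_atLeastLessThan CPb, where c = "\<lambda>_. 1"])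
  also have "\<dots> = CC (?t - ?t') (\<lambda>x. kap0 j k x - (\<Sum>i\<in>{1..<Suc j}. 1 * CP i j (\<mu> i) x))"
    by (rule CC_diff[OF tt kap0_bounded[OF jm(1) k], symmetric]) (simp only: mult_1_left two_bounded_sum[OF finite_atLeastLessThan CPb])
  also have "(\<lambda>x. kap0 j k x - (\<Sum>i\<in>{1..<Suc j}. 1 * CP i j (\<mu> i) x)) = restr_gt (a j) (lam j k)"
  proof
    fix x
    have "CP j j (\<mu> j) = \<mu> j" unfolding CP_def by (rule Cop_refl[OF tl_in[OF jm(1)]])
    then have "kap0 j k x - (\<Sum>i\<in>{1..<Suc j}. 1 * CP i j (\<mu> i) x) = (kap0 j k x - (\<Sum>i\<in>{1..<j}. CP i j (\<mu> i) x)) - \<mu> j x"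
      using j by simp
    also have "kap0 j k x - (\<Sum>i\<in>{1..<j}. CP i j (\<mu> i) x) = lam j k x"
      unfolding \<mu>_def by (rule fun_cong[OF lam_eq[OF jm(1)], symmetric])
    finally show "kap0 j k x - (\<Sum>i\<in>{1..<Suc j}. 1 * CP i j (\<mu> i) x) = restr_gt (a j) (lam j k) x"
      by (simp only: restr_gt_eq \<mu>_def)
  qed
  finally show ?thesis .
qed

lemma fs_two_bounded: "i \<le> m ==> j \<in> {1..nl i} ==> two_bounded lo hi (fs i j)"
  using fs_bounded lo_hi by (intro two_bounded_mono_right) auto

text \<open>\<open>lam\<close> is built with the inverse below the \<open>v i\<close> and
  \<open>fs\<close> with the one above. By \<open>DD_lam\<close> both obey the same recursion after
  \<open>DD\<close>, so the discrepancy at each node is a combination of new dual functions, which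
  on the cut are themselves \<open>fs\<close> with larger index.\<close>

lemma lam_fs:
  "j \<le> m ==> k \<in> {1..nl j} ==>
    \<exists>c. restr_gt (a j) (lam j k) = (\<lambda>x. fs j k x + (\<Sum>k'=k + 1..nl j. c k' * fs j k' x))"
proof (induction j arbitrary: k)
  case 0
  then show ?case by (simp add: nl_def)
next
  case (Suc j)
  let ?n = "nl j" and ?n' = "nl (Suc j)" and ?t = "tl j" and ?t' = "tl (Suc j)"
  have jm: "Suc j \<in> {1..m}" using Suc.prems by auto
  have n: "?n \<le> ?n'" "?n' \<le> N" "?n \<le> N" using nl_Suc[of j] nl_le_N[of j] nl_le_N[of "Suc j"] Suc.prems by auto
  have k1: "1 \<le> k" using Suc.prems by auto
  show ?case
  proof (cases "k \<le> ?n")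
    case False
    have "CP i (Suc j) (restr_le (a i) (lam i k)) = (\<lambda>x. 0)" if i: "i \<in> {1..<Suc j}" for i
    proof -
      have "nl i \<le> nl j" using i Suc.prems by (intro nl_mono) auto
      then have "lam i k = (\<lambda>x. 0)" using False i Suc.prems by (intro lam_zero) auto
      then have "restr_le (a i) (lam i k) = (\<lambda>x. 0)" by (simp add: restr_le_def[abs_def])
      then show ?thesis by (simp add: CP_def Cop_def)
    qed
    then have "lam (Suc j) k = kap0 (Suc j) k" unfolding lam_eq[OF jm] by simp
    then have "restr_gt (a (Suc j)) (lam (Suc j) k) = (\<lambda>x. fs (Suc j) k x + (\<Sum>k'=k + 1..?n'. 0 * fs (Suc j) k' x))"
      using False Suc.prems by (simp add: kap0_def)
    then show ?thesis by (rule exI[of _ "\<lambda>_. 0"])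
  next
    case True
    then have kn: "k \<in> {1..?n}" using Suc.prems by auto
    then have j1: "1 \<le> j" "j \<in> {1..m}" using Suc.prems by (auto simp: nl_def split: if_splits)
    have tt: "?t - ?t' \<in> TT" by (intro TT_diff tl_in jm j1)
    obtain c where c: "restr_gt (a j) (lam j k) = (\<lambda>x. fs j k x + (\<Sum>k'=k + 1..?n. c k' * fs j k' x))"
      using Suc.IH[OF _ kn] Suc.prems by auto
    define F where "F k = CC (?t - ?t') (fs j k)" for k
    define Q where "Q k = QQ ?n ?n' (F k)" for k
    have Fb: "pow_bounded hi (F k)" if "k \<in> {1..?n}" for k
      unfolding F_def using that j1 by (intro CC_bounded tt fs_bounded) auto
    have DQ: "DD (cv v) ?n ?n' (Q k) = F k" if "k \<in> {1..?n}" for k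
      unfolding Q_def by (rule DD_QQ[OF n(1,2) Fb[OF that]])
    have fsQ: "fs (Suc j) k = restr_gt (a (Suc j)) (Q k)" if "k \<in> {1..?n}" for k using that by (simp add: Q_def F_def)
    have fsK: "fs (Suc j) k = restr_gt (a (Suc j)) (kap (Suc j) k)" if "k \<in> {?n + 1..?n'}" for k using that by simp
    define c1 where "c1 k' = (if k' = k then 1 else c k')" for k'
    have sumk: "(\<Sum>k'=k..?n. c1 k' * f k') = f k + (\<Sum>k'=k + 1..?n. c k' * f k')" for f :: "nat => complex"
    proof -
      have "(\<Sum>k'=k + 1..?n. c1 k' * f k') = (\<Sum>k'=k + 1..?n. c k' * f k')" by (rule sum.cong) (auto simp: c1_def)
      then show ?thesis using True by (simp add: sum.atLeast_Suc_atMost[of k] c1_def)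
    qed
    \<comment> \<open>The discrepancy of the two inverses: \<open>DD\<close> kills it, hence it
      belongs to \<open>VV ?n'\<close> and has an expansion in the dual functions.\<close>
    define E where "E x = lam (Suc j) k x - (\<Sum>k'=k..?n. c1 k' * Q k' x)" for x
    have kk': "k' \<in> {1..?n}" if "k' \<in> {k..?n}" for k' using that k1 by auto
    have "DD (cv v) ?n ?n' E = (\<lambda>x. CC (?t - ?t') (restr_gt (a j) (lam j k)) x - (\<Sum>k'=k..?n. c1 k' * DD (cv v) ?n ?n' (Q k') x))"
      unfolding E_def
      by (simp only: DD_diff DD_sum[OF finite_atLeastAtMost] DD_cmult DD_lam[OF j1(1) Suc.prems(1) k1])
    also have "\<dots> = (\<lambda>x. CC (?t - ?t') (restr_gt (a j) (lam j k)) x - (\<Sum>k'=k..?n. c1 k' * F k' x))"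
      by (intro ext arg_cong2[of _ _ _ _ "(-)"] refl sum.cong) (simp only: DQ[OF kk'])
    also have "CC (?t - ?t') (restr_gt (a j) (lam j k)) = CC (?t - ?t') (\<lambda>x. \<Sum>k'=k..?n. c1 k' * fs j k' x)"
      by (simp only: c sumk)
    also have "\<dots> = (\<lambda>x. \<Sum>k'=k..?n. c1 k' * F k' x)"
      unfolding F_def using j1 kk' by (intro CC_sum tt fs_two_bounded) auto
    finally have DE: "DD (cv v) ?n ?n' E = (\<lambda>x. 0)" by simp
    then have EV: "E \<in> VV ?n'" using n DD_split[of 0 ?n ?n' "cv v" E] by (simp add: VV_iff)
    define d where "d k' = LL ?n' ?t' k' E" for k'
    \<comment> \<open>The functionals up to \<open>?n\<close> factor through \<open>DD\<close> and
      vanish on \<open>E\<close>; so only indices beyond \<open>?n\<close> occur, and these exceed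
      \<open>k\<close>.\<close>
    have d0: "d k' = 0" if "k' \<in> {1..?n}" for k'
      using LL_DD[of k' ?n ?n' ?t' E] that n LL_zero[OF tl_in[OF jm] that n(3)] by (simp add: d_def DE)
    have "E x = (\<Sum>k'=1..?n'. d k' * kap (Suc j) k' x)" for x
      unfolding d_def using kap_expand[OF jm EV] by (rule fun_cong)
    also have "(\<Sum>k'=1..?n'. d k' * kap (Suc j) k' x) = (\<Sum>k'=?n + 1..?n'. d k' * kap (Suc j) k' x)" for x
      by (rule sum.mono_neutral_right) (use d0 in auto)
    finally have E: "lam (Suc j) k x = (\<Sum>k'=k..?n. c1 k' * Q k' x) + (\<Sum>k'=?n + 1..?n'. d k' * kap (Suc j) k' x)" for x
      by (simp add: E_def algebra_simps)
    let ?c = "\<lambda>k'. if k' \<le> ?n then c k' else d k'"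
    have "restr_gt (a (Suc j)) (lam (Suc j) k) =
        (\<lambda>x. fs (Suc j) k x + (\<Sum>k'=k + 1..?n'. (?c k') * fs (Suc j) k' x))"
    proof
      fix x
      have "restr_gt (a (Suc j)) (lam (Suc j) k) x =
          (\<Sum>k'=k..?n. c1 k' * restr_gt (a (Suc j)) (Q k') x) + (\<Sum>k'=?n + 1..?n'. d k' * restr_gt (a (Suc j)) (kap (Suc j) k') x)"
        by (simp add: restr_gt_def E)
      also have "(\<Sum>k'=k..?n. c1 k' * restr_gt (a (Suc j)) (Q k') x) = (\<Sum>k'=k..?n. c1 k' * fs (Suc j) k' x)"
        by (rule sum.cong[OF refl]) (simp only: fsQ[OF kk'])
      also have "\<dots> = fs (Suc j) k x + (\<Sum>k'=k + 1..?n. c k' * fs (Suc j) k' x)" by (rule sumk)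
      also have "(\<Sum>k'=?n + 1..?n'. d k' * restr_gt (a (Suc j)) (kap (Suc j) k') x) = (\<Sum>k'=?n + 1..?n'. d k' * fs (Suc j) k' x)"
        by (rule sum.cong[OF refl]) (simp only: fsK)
      also have "fs (Suc j) k x + (\<Sum>k'=k + 1..?n. c k' * fs (Suc j) k' x) + (\<Sum>k'=?n + 1..?n'. d k' * fs (Suc j) k' x) =
          fs (Suc j) k x + (\<Sum>k'=k + 1..?n'. (?c k') * fs (Suc j) k' x)"
      proof -
        have "{k + 1..?n'} = {k + 1..?n} \<union> {?n + 1..?n'}" using n True by auto
        then have "(\<Sum>k'=k + 1..?n'. (?c k') * fs (Suc j) k' x) =
            (\<Sum>k'=k + 1..?n. (?c k') * fs (Suc j) k' x) +
            (\<Sum>k'=?n + 1..?n'. (?c k') * fs (Suc j) k' x)"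
          by (simp only:) (rule sum.union_disjoint, auto)
        also have "(\<Sum>k'=k + 1..?n. (?c k') * fs (Suc j) k' x) = (\<Sum>k'=k + 1..?n. c k' * fs (Suc j) k' x)"
          by (rule sum.cong) (auto simp del: fs.simps)
        also have "(\<Sum>k'=?n + 1..?n'. (?c k') * fs (Suc j) k' x) = (\<Sum>k'=?n + 1..?n'. d k' * fs (Suc j) k' x)"
          by (rule sum.cong) (auto simp del: fs.simps)
        finally show ?thesis by (simp only: add.assoc)
      qed
      finally show "restr_gt (a (Suc j)) (lam (Suc j) k) x =
          fs (Suc j) k x + (\<Sum>k'=k + 1..?n'. (?c k') * fs (Suc j) k' x)" .
    qed
    then show ?thesis by (rule exI[of _ "\<lambda>k'. if k' \<le> ?n then c k' else d k'"])
  qed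
qed

text \<open>By \<open>LL_Cop\<close> each pairing with \<Psi> at an intermediate node becomes a
  functional at the last node, and the Kronecker delta is the functional of \<open>kap m k\<close>.
  Their difference is the recursion for \<open>lam m k\<close> including the term
  \<open>i = m\<close>, that is, its cut.\<close>

lemma lam_entry:
  assumes k: "k \<in> {1..nl m}" and l: "l \<in> {1..nl m}"
  shows "(if k = l then 1 else 0) - (\<Sum>i=1..m. \<Sum>\<^sub>\<infinity>x\<in>{..a i}. lam i k x * PsiP i l x) =
    LL (nl m) (tl m) l (restr_gt (a m) (lam m k))"
proof -
  let ?s = "\<lambda>i. \<Sum>\<^sub>\<infinity>x\<in>{..a i}. lam i k x * PsiP i l x"
  let ?n = "nl m" and ?t = "tl m"
  have mm: "m \<in> {1..m}" using m by simp
  note t = tl_in[OF mm]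
  have n: "?n \<le> N" by (rule nl_le_N) simp
  have k1: "1 \<le> k" using k by simp
  define \<mu> where "\<mu> i = restr_le (a i) (lam i k)" for i
  have \<mu>b: "two_bounded lo hi (CP i m (\<mu> i))" if "i \<in> {1..m}" for i
    unfolding \<mu>_def using that by (intro CP_bounded mm k1)
  have pair: "(?s i) = LL ?n ?t l (CP i m (\<mu> i))" if i: "i \<in> {1..m}" for i
  proof -
    have "(?s i) = (\<Sum>\<^sub>\<infinity>x. PsiN (nl i) (tl i) l x * \<mu> i x)"
      by (rule infsum_cong_neutral) (use i in \<open>auto simp: \<mu>_def restr_le_def nn_eq mult.commute\<close>)
    also have "\<dots> = LL ?n ?t l (CP i m (\<mu> i))"
      unfolding CP_def \<mu>_def
      by (rule LL_Cop[symmetric]) (use i l t n nl_mono[of i m] tl_in[OF i] lam_bounded(2)[OF i k1] in auto)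
    finally show ?thesis .
  qed
  have "CP m m (\<mu> m) = \<mu> m" unfolding CP_def by (rule Cop_refl[OF t])
  then have rg: "restr_gt (a m) (lam m k) = (\<lambda>x. kap m k x - (\<Sum>i\<in>{1..m}. CP i m (\<mu> i) x))"
  proof -
    assume Cm: "CP m m (\<mu> m) = \<mu> m"
    have "{1..m} = insert m {1..<m}" using m by auto
    then have "(\<Sum>i\<in>{1..m}. CP i m (\<mu> i) x) = \<mu> m x + (\<Sum>i\<in>{1..<m}. CP i m (\<mu> i) x)" for x by (simp add: Cm)
    moreover have "lam m k x = kap m k x - (\<Sum>i\<in>{1..<m}. CP i m (\<mu> i) x)" for x
      using k fun_cong[OF lam_eq[OF mm, of k]] by (simp only: \<mu>_def kap0_def) simp
    moreover have "restr_gt (a m) (lam m k) x = lam m k x - \<mu> m x" for x by (simp only: restr_gt_eq \<mu>_def)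
    ultimately show ?thesis by (simp only: fun_eq_iff) simp
  qed
  have kb: "two_bounded lo hi (kap m k)" by (rule VV_bounded[OF n kap_props(1)[OF mm k]])
  have "LL ?n ?t l (restr_gt (a m) (lam m k)) = LL ?n ?t l (kap m k) - LL ?n ?t l (\<lambda>x. \<Sum>i\<in>{1..m}. CP i m (\<mu> i) x)"
    unfolding rg by (rule LL_diff[OF t l n kb two_bounded_sum[OF finite_atLeastAtMost \<mu>b]])
  also have "LL ?n ?t l (\<lambda>x. \<Sum>i\<in>{1..m}. CP i m (\<mu> i) x) = (\<Sum>i=1..m. LL ?n ?t l (CP i m (\<mu> i)))"
    by (rule LL_sum[OF t l n finite_atLeastAtMost \<mu>b])
  also have "LL ?n ?t l (kap m k) = (if k = l then 1 else 0)" using kap_props(2)[OF mm k l] by (simp add: eq_commute)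
  finally show ?thesis using pair by simp
qed

lemma det_lam_eq:
  "det1 (nl m) (\<lambda>k l. (if k = l then 1 else 0) - (\<Sum>i=1..m. \<Sum>\<^sub>\<infinity>x\<in>{..a i}. lam i k x * PsiP i l x)) =
    M_fun v R P N T m \<nn> y a"
proof -
  let ?S = "\<lambda>k l. \<Sum>i=1..m. \<Sum>\<^sub>\<infinity>x\<in>{..a i}. lam i k x * PsiP i l x"
  let ?n = "nl m" and ?t = "tl m"
  have mm: "m \<in> {1..m}" using m by simp
  note t = tl_in[OF mm]
  have n: "?n \<le> N" by (rule nl_le_N) simp
  have "\<forall>k\<in>{1..?n}. \<exists>c. restr_gt (a m) (lam m k) = (\<lambda>x. fs m k x + (\<Sum>k'=k + 1..?n. c k' * fs m k' x))"
    using lam_fs[OF order_refl] by blast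
  from bchoice[OF this] obtain c where
    c: "\<And>k. k \<in> {1..?n} ==> restr_gt (a m) (lam m k) = (\<lambda>x. fs m k x + (\<Sum>k'=k + 1..?n. c k k' * fs m k' x))" by blast
  define C where "C k k' = (if k' = k then 1 else if k < k' then c k k' else 0)" for k k'
  have fb: "two_bounded lo hi (fs m k)" if "k \<in> {1..?n}" for k by (rule fs_two_bounded[OF order_refl that])
  have entry: "(if k = l then 1 else 0) - (?S k l) =
      (\<Sum>k'=1..?n. C k k' * LL ?n ?t l (fs m k'))" if k: "k \<in> {1..?n}" and l: "l \<in> {1..?n}" for k l
  proof -
    have "restr_gt (a m) (lam m k) = (\<lambda>x. \<Sum>k'=1..?n. C k k' * fs m k' x)"
    proof
      fix x
      have "(\<Sum>k'=1..?n. C k k' * fs m k' x) = (\<Sum>k'=k..?n. C k k' * fs m k' x)"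
        by (rule sum.mono_neutral_right) (use k in \<open>auto simp: C_def\<close>)
      also have "\<dots> = fs m k x + (\<Sum>k'=k + 1..?n. C k k' * fs m k' x)"
        using k by (simp add: sum.atLeast_Suc_atMost[of k] C_def)
      also have "(\<Sum>k'=k + 1..?n. C k k' * fs m k' x) = (\<Sum>k'=k + 1..?n. c k k' * fs m k' x)"
        by (rule sum.cong) (auto simp: C_def)
      finally show "restr_gt (a m) (lam m k) x = (\<Sum>k'=1..?n. C k k' * fs m k' x)" using c[OF k] by simp
    qed
    then have "LL ?n ?t l (restr_gt (a m) (lam m k)) = (\<Sum>k'=1..?n. LL ?n ?t l (\<lambda>x. C k k' * fs m k' x))"
      by (simp only:) (rule LL_sum[OF t l n], auto intro!: two_bounded_cmult fb)
    also have "\<dots> = (\<Sum>k'=1..?n. C k k' * LL ?n ?t l (fs m k'))"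
      by (rule sum.cong[OF refl]) (simp only: LL_cmult[OF t l n fb])
    finally show ?thesis unfolding lam_entry[OF k l] .
  qed
  have "det1 ?n (\<lambda>k l. (if k = l then 1 else 0) - (?S k l)) =
      det1 ?n (\<lambda>k l. \<Sum>k'=1..?n. C k k' * LL ?n ?t l (fs m k'))"
    by (rule det1_cong) (rule entry)
  also have "\<dots> = det1 ?n C * det1 ?n (\<lambda>k' l. LL ?n ?t l (fs m k'))" by (rule det1_mult)
  also have "det1 ?n C = (\<Prod>k=1..?n. C k k)" by (rule det1_upper_triangular) (simp add: C_def)
  also have "\<dots> = 1" by (simp add: C_def)
  also have "det1 ?n (\<lambda>k' l. LL ?n ?t l (fs m k')) = det1 ?n (\<lambda>k j. LL ?n ?t k (fs m j))" by (rule det1_transpose)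
  finally show ?thesis by (simp add: M_fun_eq_det)
qed

end

section \<open>Convergence of the Fredholm series and the determinant formula\<close>

context path_setting
begin

text \<open>Radii decreasing strictly from \<open>lo\<close> at 0 to \<rho> at \<open>Suc m\<close>.
  At node \<open>i\<close> rows carry the radius \<open>slo (Suc i)\<close> and columns
  \<open>slo i\<close>; the ratio above 1 makes the diagonal weight summable towards minus infinity,
  and \<open>slo j \<le> slo (Suc i)\<close> for \<open>i < j\<close> fits the \<phi> part
  in.\<close>

definition slo :: "nat => real" where "slo i = lo - (lo - \<rho>) * (real i / real (Suc m))"

lemma slo: "i \<le> Suc m ==> \<rho> \<le> slo i" "slo i \<le> lo" "i < j ==> slo j < slo i" "i \<le> Suc m ==> 0 < slo i"
proof -
  have d: "0 < lo - \<rho>" using lo_hi by simp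
  show 1: "\<rho> \<le> slo i" if "i \<le> Suc m" for i
  proof -
    have "real i / real (Suc m) \<le> 1" using that by simp
    then have "(lo - \<rho>) * (real i / real (Suc m)) \<le> (lo - \<rho>) * 1" using d by (intro mult_left_mono) auto
    then show ?thesis by (simp add: slo_def)
  qed
  show "slo i \<le> lo" using d by (simp add: slo_def)
  show "i < j ==> slo j < slo i" unfolding slo_def using d
    by (intro diff_strict_left_mono mult_strict_left_mono divide_strict_right_mono) auto
  show "0 < slo i" if "i \<le> Suc m" using 1[OF that] rho by simp
qed

text \<open>A Cauchy estimate at radius \<open>s\<close> fixes the column weight; for
  \<open>x\<close> bounded above, the row weight can be relaxed to a larger radius \<open>q\<close>
  at the cost of a constant.\<close>

lemma symbol_path_bound:
  assumes g: "g analytic_on annulus \<rho> lo" and s: "\<rho> \<le> s" "s \<le> q" "s \<le> lo"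
  shows "\<exists>B\<ge>0. \<forall>x x'. x \<le> b \<longrightarrow> norm (lcoeff \<rho> g (x - x')) \<le> B * (q powi (- x) * s powi x')"
proof -
  obtain B where B: "0 \<le> B" "\<And>d. norm (lcoeff \<rho> g d) \<le> B * s powi (- d)"
    using symbol_bound[OF g s(1,3)] by blast
  have s0: "0 < s" using s rho by auto
  have "norm (lcoeff \<rho> g (x - x')) \<le> (B * (q / s) powi b) * (q powi (- x) * s powi x')" if "x \<le> b" for x x'
  proof -
    have "q powi x * (s powi (- x) * q powi (- x)) \<le> ((q / s) powi b * s powi x) * (s powi (- x) * q powi (- x))"
      using s0 s by (intro mult_right_mono power_int_mono_base[OF s0 s(2) that]) auto
    moreover have "q powi x * (s powi (- x) * q powi (- x)) = s powi (- x)" using s0 s by (simp add: power_int_minus)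
    moreover have "((q / s) powi b * s powi x) * (s powi (- x) * q powi (- x)) = (q / s) powi b * q powi (- x)"
      using s0 s by (simp add: power_int_minus)
    ultimately have "s powi (- x) \<le> (q / s) powi b * q powi (- x)" by simp
    then have "(B * s powi x') * s powi (- x) \<le> (B * s powi x') * ((q / s) powi b * q powi (- x))"
      using B s0 by (intro mult_left_mono) auto
    moreover have "norm (lcoeff \<rho> g (x - x')) \<le> (B * s powi x') * s powi (- x)"
      using B(2)[of "x - x'"] s0 by (simp add: power_int_diff power_int_minus field_simps)
    ultimately show ?thesis by (simp only: mult_ac)
  qed
  moreover have "0 \<le> B * (q / s) powi b" using B s0 s by auto
  ultimately show ?thesis by blast
qed

lemma phi_bound:
  "\<exists>C\<ge>0. \<forall>(i, j)\<in>{(i, j). i \<in> {1..m} \<and> j \<in> {1..m} \<and> i < j}. \<forall>z. fst z \<le> a i \<longrightarrow>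
    norm (phiP i j (fst z) (snd z)) \<le> C * (slo (Suc i) powi (- fst z) * slo j powi snd z)"
  unfolding case_prod_unfold
proof (rule uniform_bound_on)
  show "finite {p. fst p \<in> {1..m} \<and> snd p \<in> {1..m} \<and> fst p < snd p}"
    by (rule finite_subset[of _ "{1..m} \<times> {1..m}"]) auto
  fix p assume p: "p \<in> {p. fst p \<in> {1..m} \<and> snd p \<in> {1..m} \<and> fst p < snd p}"
  then obtain i j where ij: "p = (i, j)" "i \<in> {1..m}" "j \<in> {1..m}" "i < j" by (cases p) auto
  show "0 \<le> slo (Suc (fst p)) powi (- fst z) * slo (snd p) powi snd z" for z
    using slo(4)[of "Suc i"] slo(4)[of j] ij by simp
  have "slo j \<le> slo (Suc i)" using ij slo(3)[of "Suc i" j] by (cases "j = Suc i") auto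
  from symbol_path_bound[OF phisym_analytic[OF tl_in[OF ij(2)] tl_in[OF ij(3)] nl_le_N] slo(1) this slo(2), of j "a i" "nl i"]
  show "\<exists>C. \<forall>z. fst z \<le> a (fst p) \<longrightarrow> norm (phiP (fst p) (snd p) (fst z) (snd z)) \<le>
      C * (slo (Suc (fst p)) powi (- fst z) * slo (snd p) powi snd z)"
    using ij by (auto simp: phi_path)
qed

lemma Psi_bound:
  "\<exists>C\<ge>0. \<forall>(i, k)\<in>{1..m} \<times> {1..nl m}. \<forall>x. x \<le> a i \<longrightarrow> norm (PsiP i k x) \<le> C * slo (Suc i) powi (- x)"
  unfolding case_prod_unfold
proof (rule uniform_bound_on)
  fix p assume "p \<in> {1..m} \<times> {1..nl m}"
  then obtain i k where ik: "p = (i, k)" "i \<in> {1..m}" "k \<in> {1..nl m}" by auto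
  then have kN: "k \<in> {1..N}" "nl i \<le> N" using nl_le_N[of m] nl_le_N[of i] by auto
  show "0 \<le> slo (Suc (fst p)) powi (- x)" for x using slo(4)[of "Suc i"] ik by simp
  have "\<rho> \<le> slo (Suc i)" "\<rho> \<le> lo" using ik lo_hi by (auto intro: slo)
  from symbol_path_bound[OF psisym_analytic[OF tl_in[OF ik(2)] kN(1)] order_refl this, of "a i" "nl i"]
  obtain B where "\<And>x x'. x \<le> a i ==> norm (lcoeff \<rho> (psisym (nl i) (tl i) k) (x - x')) \<le> B * (slo (Suc i) powi (- x) * \<rho> powi x')" by blast
  from this[of _ "y k"]
  show "\<exists>C. \<forall>x. x \<le> a (fst p) \<longrightarrow> norm (PsiP (fst p) (snd p) x) \<le> C * slo (Suc (fst p)) powi (- x)"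
    using ik(2,3) by (intro exI[of _ "B * \<rho> powi y k"]) (auto simp: ik(1) nn_eq Psi_lcoeff[OF kN] mult_ac)
qed auto

lemma kap0_bound:
  "\<exists>C\<ge>0. \<forall>(i, k)\<in>{1..m} \<times> {1..nl m}. \<forall>x. x \<le> a i \<longrightarrow> norm (kap0 i k x) \<le> C * slo i powi x"
  unfolding case_prod_unfold
proof (rule uniform_bound_on)
  fix p assume "p \<in> {1..m} \<times> {1..nl m}"
  then obtain i k where ik: "p = (i, k)" "i \<in> {1..m}" "k \<in> {1..nl m}" by auto
  have s: "0 < slo i" "slo i \<le> lo" using slo(2,4) ik by auto
  then show "0 \<le> slo (fst p) powi x" for x using ik by simp
  have "two_bounded lo hi (kap0 i k)" using ik by (intro kap0_bounded) auto
  then have "pow_bounded lo (restr_le (a i) (kap0 i k))" using lo_hi by (intro restr_le_bounded[of lo hi]) auto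
  then obtain B where B: "0 \<le> B" "\<And>x. norm (restr_le (a i) (kap0 i k) x) \<le> B * lo powi x" by (rule pow_boundedE) (rule that)
  have "norm (kap0 i k x) \<le> (B * (lo / slo i) powi a i) * slo i powi x" if "x \<le> a i" for x
    using B(2)[of x] mult_left_mono[OF power_int_mono_base[OF s that] B(1)] that by (simp add: restr_le_def)
  then show "\<exists>C. \<forall>x. x \<le> a (fst p) \<longrightarrow> norm (kap0 (fst p) (snd p) x) \<le> C * slo (fst p) powi x"
    by (auto simp: ik(1))
qed auto

lemma block_kernel_path:
  "\<exists>g h. block_kernel m (nl m) a phiP PsiP kap0 g h"
proof -
  obtain C1 where C1: "0 \<le> C1" "\<And>i j z. i \<in> {1..m} ==> j \<in> {1..m} ==> i < j ==> fst z \<le> a i ==>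
    norm (phiP i j (fst z) (snd z)) \<le> C1 * (slo (Suc i) powi (- fst z) * slo j powi snd z)" using phi_bound by auto
  obtain C2 where C2: "0 \<le> C2" "\<And>i k x. i \<in> {1..m} ==> k \<in> {1..nl m} ==> x \<le> a i ==>
    norm (PsiP i k x) \<le> C2 * slo (Suc i) powi (- x)" using Psi_bound by auto
  obtain C3 where C3: "0 \<le> C3" "\<And>i k x. i \<in> {1..m} ==> k \<in> {1..nl m} ==> x \<le> a i ==>
    norm (kap0 i k x) \<le> C3 * slo i powi x" using kap0_bound by auto
  define g where "g i x = (C1 + C2) * slo (Suc i) powi (- x)" for i x
  define h where "h i x = (C3 + 1) * slo i powi x" for i x
  have s: "0 < slo i" "0 < slo (Suc i)" "slo (Suc i) < slo i" if "i \<in> {1..m}" for i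
    using slo(4)[of i] slo(4)[of "Suc i"] slo(3)[of i "Suc i"] that by auto
  have "block_kernel m (nl m) a phiP PsiP kap0 g h"
  proof
    fix i j x x' assume ij: "i \<in> {1..m}" "j \<in> {1..m}" "i < j" "x \<le> a i"
    have "C1 * (slo (Suc i) powi (- x) * slo j powi x') \<le> ((C1 + C2) * (C3 + 1)) * (slo (Suc i) powi (- x) * slo j powi x')"
    proof (rule mult_right_mono)
      have "C1 * 1 \<le> (C1 + C2) * (C3 + 1)" using C1 C2 C3 by (intro mult_mono) auto
      then show "C1 \<le> (C1 + C2) * (C3 + 1)" by simp
    qed (use s[OF ij(1)] s[OF ij(2)] in auto)
    then show "norm (phiP i j x x') \<le> g i x * h j x'"
      using C1(2)[of i j "(x, x')"] ij by (simp add: g_def h_def mult_ac)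
  next
    fix i k x assume ik: "i \<in> {1..m}" "k \<in> {1..nl m}" "x \<le> a i"
    have "C2 * slo (Suc i) powi (- x) \<le> g i x" unfolding g_def using C1 s[OF ik(1)] by (intro mult_right_mono) auto
    then show "norm (PsiP i k x) \<le> g i x" using C2(2)[OF ik] by simp
    have "C3 * slo i powi x \<le> h i x" unfolding h_def using s[OF ik(1)] by (intro mult_right_mono) auto
    then show "norm (kap0 i k x) \<le> h i x" using C3(2)[OF ik] by simp
  next
    fix i x assume i: "i \<in> {1..m}"
    show "0 \<le> g i x" unfolding g_def using C1 C2 s[OF i] by (intro mult_nonneg_nonneg) auto
    show "0 \<le> h i x" unfolding h_def using C3 s[OF i] by (intro mult_nonneg_nonneg) auto
  next
    fix i assume i: "i \<in> {1..m}"
    have "(\<lambda>x. (slo i / slo (Suc i)) powi x) summable_on {..a i}"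
      using s[OF i] by (intro powi_summable_le) auto
    then have "(\<lambda>x. ((C1 + C2) * (C3 + 1)) * (slo i / slo (Suc i)) powi x) summable_on {..a i}"
      by (rule summable_on_cmult_right)
    moreover have "g i x * h i x = ((C1 + C2) * (C3 + 1)) * (slo i / slo (Suc i)) powi x" for x
      unfolding g_def h_def power_int_divide_distrib power_int_minus by (simp add: divide_inverse mult_ac)
    ultimately show "(\<lambda>x. g i x * h i x) summable_on {..a i}" by simp
  qed
  then show ?thesis by blast
qed

text \<open>The relation is a strict partial order, being the product order with equality removed,
  and consecutive nodes are related.\<close>

lemma prec_iff:
  assumes "i \<in> {1..m}" "j \<in> {1..m}"
  shows "\<nn> i \<prec> \<nn> j \<longleftrightarrow> i < j"
proof -
  have lt: "\<nn> i \<prec> \<nn> j" if "1 \<le> i" "i < j" "j \<le> m" for i j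
    using that(2,3)
  proof (induction j)
    case 0
    then show ?case by simp
  next
    case (Suc j)
    have st: "\<nn> j \<prec> \<nn> (Suc j)" if "i \<le> j" using nn_step[of j] Suc.prems \<open>1 \<le> i\<close> that by auto
    show ?case
    proof (cases "i = j")
      case True
      then show ?thesis using st by simp
    next
      case False
      then have "\<nn> i \<prec> \<nn> j" using Suc by auto
      then show ?thesis using st Suc.prems by (auto simp: prec_def prod_eq_iff)
    qed
  qed
  show ?thesis
  proof
    assume p: "\<nn> i \<prec> \<nn> j"
    show "i < j"
    proof (rule ccontr)
      assume "\<not> i < j"
      then consider "i = j" | "j < i" by linarith
      then show False
      proof cases
        case 1
        then show False using p by (simp add: prec_def)
      next
        case 2
        then have "\<nn> j \<prec> \<nn> i" using lt[of j i] assms by auto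
        then show False using p by (auto simp: prec_def prod_eq_iff)
      qed
    qed
  next
    assume "i < j"
    then show "\<nn> i \<prec> \<nn> j" using lt[of i j] assms by auto
  qed
qed

lemma nn_inj: "inj_on \<nn> {1..m}"
proof (rule inj_onI, rule ccontr)
  fix i j assume ij: "i \<in> {1..m}" "j \<in> {1..m}" "\<nn> i = \<nn> j" "i \<noteq> j"
  then consider "i < j" | "j < i" by linarith
  then show False using prec_iff[OF ij(1,2)] prec_iff[OF ij(2,1)] ij by cases (auto simp: prec_def)
qed

definition KA :: "(nat \<times> real) \<times> int => (nat \<times> real) \<times> int => complex" where
  "KA u u' = chi_bar m \<nn> a u * K_kernel v \<rho> P T y \<Phi> u u' * chi_bar m \<nn> a u'"

lemma chi_path: "i \<in> {1..m} ==> chi_bar m \<nn> a (\<nn> i, x) = (if x \<le> a i then 1 else 0)"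
proof -
  assume i: "i \<in> {1..m}"
  have "(\<exists>j\<in>{1..m}. \<nn> j = \<nn> i \<and> x \<le> a j) \<longleftrightarrow> x \<le> a i" using inj_onD[OF nn_inj] i by blast
  then show ?thesis by (simp only: chi_bar_def case_prod_conv)
qed

lemma K_path:
  assumes i: "i \<in> {1..m}" and j: "j \<in> {1..m}"
  shows "K_kernel v \<rho> P T y \<Phi> (\<nn> i, x) (\<nn> j, x') =
    - (if i < j then phiP i j x x' else 0) + (\<Sum>k=1..nl m. PsiP i k x * kap0 j k x')"
proof -
  have fst: "fst (\<nn> j) = nl j" using j by (simp add: nl_def)
  have "(\<Sum>k=1..nl j. PsiP i k x * \<Phi> (\<nn> j) (nl j - k) x') = (\<Sum>k=1..nl m. PsiP i k x * kap0 j k x')"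
    by (rule sum.mono_neutral_cong_left) (use nl_mono[of j m] j in \<open>auto simp: kap0_def kap_def\<close>)
  then show ?thesis by (simp only: K_kernel_def case_prod_conv fst prec_iff[OF i j])
qed

lemma fredholm_path:
  "fredholm_convergent (\<nn> ` {1..m} \<times> UNIV) KA"
  "M_fun v R P N T m \<nn> y a = fredholm_det_I_minus (\<nn> ` {1..m} \<times> UNIV) KA"
proof -
  obtain g h where "block_kernel m (nl m) a phiP PsiP kap0 g h"
    using block_kernel_path by blast
  then interpret block_kernel m "nl m" a phiP PsiP kap0 g h .
  have A: "KA (\<nn> i, x) (\<nn> j, x') =
      - (if i < j then phiP i j x x' else 0) + (\<Sum>k=1..nl m. PsiP i k x * kap0 j k x')"
    if "i \<in> {1..m}" "j \<in> {1..m}" "x \<le> a i" "x' \<le> a j" for i j x x'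
    using that by (simp only: KA_def K_path chi_path if_True mult_1_left mult_1_right)
  have A0: "KA (\<nn> i, x) (\<nn> j, x') = 0" if "i \<in> {1..m}" "j \<in> {1..m}" "\<not> (x \<le> a i \<and> x' \<le> a j)" for i j x x'
    using that by (auto simp: KA_def chi_path)
  show "fredholm_convergent (\<nn> ` {1..m} \<times> UNIV) KA" by (rule fredholm_eq_det(1)[OF nn_inj A A0])
  show "M_fun v R P N T m \<nn> y a = fredholm_det_I_minus (\<nn> ` {1..m} \<times> UNIV) KA"
    using fredholm_eq_det(2)[OF nn_inj A A0] det_lam_eq by (simp add: lam_def)
qed

end

section \<open>Reality of the kernel\<close>

lemma circ_avg_real:
  assumes r: "0 < r" and f: "\<And>w. norm w = r ==> f (cnj w) = cnj (f w)"
  shows "circ_avg r f \<in> \<real>"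
proof -
  have rev: "cnj \<circ> circlepath 0 r = reversepath (circlepath 0 r)"
    by (auto simp: fun_eq_iff circlepath reversepath_def exp_cnj algebra_simps exp_diff exp_minus divide_inverse)
  define I where "I = contour_integral (circlepath 0 r) f"
  \<comment> \<open>Conjugation reverses the circle, so the integral is purely imaginary; the
    prefactor \<open>1 / (2 * of_real pi * \<i>)\<close> makes it real.\<close>
  have "- I = contour_integral (cnj \<circ> circlepath 0 r) f"
    by (simp add: rev contour_integral_reversepath I_def)
  also have "\<dots> = cnj (contour_integral (circlepath 0 r) (cnj \<circ> f \<circ> cnj))"
    by (simp add: contour_integral_cnj)
  also have "contour_integral (circlepath 0 r) (cnj \<circ> f \<circ> cnj) = I"
    unfolding I_def by (rule contour_integral_cong) (use r f in auto)
  finally have "cnj I = - I" by simp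
  then have "cnj (circ_avg r f) = circ_avg r f" by (simp add: circ_avg_def I_def[symmetric])
  then show ?thesis by (simp add: complex_is_Real_iff complex_eq_iff)
qed

context contour_setting
begin

lemma phi_kernel_real:
  assumes cnj: "\<And>t w. t \<in> TT ==> w \<in> annulus \<rho> R ==> P t (cnj w) = cnj (P t w)"
    and "snd p \<in> TT" "snd q \<in> TT"
  shows "phi_kernel v \<rho> P p q x x' \<in> \<real>"
  unfolding phi_kernel_def
proof (rule circ_avg_real[OF rho])
  fix w :: complex assume "norm w = \<rho>"
  from cnj[OF TT_diff[OF assms(2,3)] rho_annulus(2)[OF this]]
  show "P (snd p - snd q) (cnj w) / cnj w powi (x - x' - int (fst q) + int (fst p) + 1) * (\<Prod>k=fst p + 1..fst q. inverse (cv v k - cnj w)) =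
    cnj (P (snd p - snd q) w / w powi (x - x' - int (fst q) + int (fst p) + 1) * (\<Prod>k=fst p + 1..fst q. inverse (cv v k - w)))"
    by simp
qed

lemma Psi_real:
  assumes cnj: "\<And>t w. t \<in> TT ==> w \<in> annulus \<rho> R ==> P t (cnj w) = cnj (P t w)"
    and "t \<in> TT" "k \<in> {1..N}"
  shows "PsiN n t k x \<in> \<real>"
  unfolding Psi_def Let_def fst_conv snd_conv
proof (rule circ_avg_real[OF rho])
  fix w :: complex assume "norm w = \<rho>"
  from cnj[OF TT_diff[OF assms(2) T_in[OF assms(3)]] rho_annulus(2)[OF this]]
  show "P (t - T k) (cnj w) / cnj w powi (x - y k + int n - int k + 1) *
      (if k \<le> n then \<Prod>i=k + 1..n. cv v i - cnj w else (\<Prod>i=1..n. cv v i - cnj w) / (\<Prod>i=1..k. cv v i - cnj w)) =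
    cnj (P (t - T k) w / w powi (x - y k + int n - int k + 1) *
      (if k \<le> n then \<Prod>i=k + 1..n. cv v i - w else (\<Prod>i=1..n. cv v i - w) / (\<Prod>i=1..k. cv v i - w)))"
    by simp
qed

lemma DD_cnj: "DD (cv v) i n (\<lambda>x. cnj (f x)) = (\<lambda>x. cnj (DD (cv v) i n f x))"
proof (induction n arbitrary: f)
  case (Suc n)
  have "dop (cv v (Suc n)) (\<lambda>x. cnj (f x)) = (\<lambda>x. cnj (dop (cv v (Suc n)) f x))" by (simp add: dop_def[abs_def])
  then show ?case using Suc by simp
qed simp

text \<open>The conjugated family satisfies the same characterisation, since \<Psi> is real and
  \<open>VV n\<close> is stable under conjugation; uniqueness makes the two families equal.\<close>

lemma Phi_real:
  assumes cnj: "\<And>t w. t \<in> TT ==> w \<in> annulus \<rho> R ==> P t (cnj w) = cnj (P t w)"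
    and t: "t \<in> TT" and n: "n \<le> N" and \<Phi>: "is_Phi v \<rho> P T y (n, t) \<Phi>" and k: "k < n"
  shows "\<Phi> k x \<in> \<real>"
proof -
  define \<Phi>' where "\<Phi>' k x = cnj (\<Phi> k x)" for k x
  note iff = is_Phi_iff[OF t n]
  have "is_Phi v \<rho> P T y (n, t) \<Phi>'"
    unfolding iff
  proof (intro allI impI conjI ballI)
    fix k assume k: "k < n"
    then have V: "\<Phi> k \<in> VV n" and L: "\<And>l. l \<in> {1..n} ==> LL n t l (\<Phi> k) = (if k + l = n then 1 else 0)"
      using \<Phi> unfolding iff by auto
    show V': "\<Phi>' k \<in> VV n"
      using V VV_iff[OF n] DD_cnj[of 0 n "\<Phi> k"] by (simp add: \<Phi>'_def[abs_def])
    fix l assume l: "l \<in> {1..n}"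
    then have lN: "l \<in> {1..N}" using n by auto
    have pair: "((\<lambda>x. PsiN n t l x * f x) has_sum LL n t l f) UNIV" if "f \<in> VV n" for f
      by (rule Psi_pairing(2)[OF l n t VV_bounded[OF n that]]) (use lo_hi in auto)
    have "((\<lambda>x. cnj (PsiN n t l x * \<Phi> k x)) has_sum cnj (LL n t l (\<Phi> k))) UNIV"
      using pair[OF V] by (simp only: has_sum_cnj_iff)
    moreover have "cnj (PsiN n t l x * \<Phi> k x) = PsiN n t l x * \<Phi>' k x" for x
      using Psi_real[OF cnj t lN, of n x] by (simp add: \<Phi>'_def Reals_cnj_iff)
    ultimately have "LL n t l (\<Phi>' k) = cnj (LL n t l (\<Phi> k))"
      using has_sum_unique[OF pair[OF V']] by simp
    then show "LL n t l (\<Phi>' k) = (if k + l = n then 1 else 0)" using L[OF l] by simp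
  qed
  from fun_cong[OF is_Phi_unique[OF t n \<Phi> this k], of x] show ?thesis by (simp add: \<Phi>'_def Reals_cnj_iff)
qed

lemma K_kernel_real:
  assumes cnj: "\<And>t w. t \<in> TT ==> w \<in> annulus \<rho> R ==> P t (cnj w) = cnj (P t w)"
    and pq: "p \<in> {1..N} \<times> TT" "q \<in> {1..N} \<times> TT" and \<Phi>: "is_Phi v \<rho> P T y q (\<Phi> q)"
  shows "K_kernel v \<rho> P T y \<Phi> (p, x) (q, x') \<in> \<real>"
proof -
  obtain n t n' t' where p: "p = (n, t)" and q: "q = (n', t')" by (cases p, cases q)
  have "Psi v \<rho> P T y p k x * \<Phi> q (fst q - k) x' \<in> \<real>" if "k \<in> {1..fst q}" for k
    using that pq \<Phi> Psi_real[OF cnj, of t k n x] Phi_real[OF cnj, of t' n' "\<Phi> q" "n' - k" x']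
    by (intro Reals_mult) (auto simp: p q)
  moreover have "phi_kernel v \<rho> P p q x x' \<in> \<real>" using pq by (intro phi_kernel_real cnj) auto
  then have "(if p \<prec> q then phi_kernel v \<rho> P p q x x' else 0) \<in> \<real>" by simp
  ultimately show ?thesis unfolding K_kernel_def case_prod_conv by (intro Reals_add Reals_minus sum_in_Reals)
qed

lemma is_Phi_ex1:
  assumes "p \<in> {1..N} \<times> TT"
  shows "\<exists>!\<Phi>. \<Phi> \<in> {..<fst p} \<rightarrow>\<^sub>E UNIV \<and> is_Phi v \<rho> P T y p \<Phi>"
proof -
  obtain n t where p: "p = (n, t)" and t: "t \<in> TT" and n: "n \<le> N" using assms by auto
  obtain \<Phi> where \<Phi>: "\<Phi> \<in> {..<n} \<rightarrow>\<^sub>E UNIV" "is_Phi v \<rho> P T y (n, t) \<Phi>" using is_Phi_exists[OF t n] by blast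
  have uniq: "\<Phi>' = \<Phi>" if \<Phi>': "\<Phi>' \<in> {..<n} \<rightarrow>\<^sub>E UNIV" "is_Phi v \<rho> P T y (n, t) \<Phi>'" for \<Phi>'
    by (rule PiE_ext[OF \<Phi>'(1) \<Phi>(1)]) (rule is_Phi_unique[OF t n \<Phi>'(2) \<Phi>(2)], simp)
  show ?thesis unfolding p fst_conv
    by (rule ex1I[of _ \<Phi>]) (use \<Phi> in simp, elim conjE, rule uniq)
qed

end

section \<open>Powers of the symbol and conclusion\<close>

lemma analytic_on_power_int_nz:
  fixes f :: "complex => complex"
  assumes "f analytic_on A" "\<And>w. w \<in> A ==> f w \<noteq> 0"
  shows "(\<lambda>w. f w powi k) analytic_on A"
proof (cases "0 \<le> k")
  case True
  then show ?thesis using assms(1) by (simp add: power_int_def analytic_on_power)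
next
  case False
  then show ?thesis using analytic_on_power[OF analytic_on_inverse[OF assms], of "nat (- k)"] by (simp add: power_int_def)
qed

lemma phi_power_setting:
  fixes TT :: "real set"
  assumes times: "TT = UNIV \<or> TT = \<int>" and N: "1 \<le> N" and \<rho>: "0 < \<rho>" and v: "\<forall>i\<in>{1..N}. \<rho> < v i \<and> v i < R"
    and an: "\<phi> analytic_on annulus \<rho> R" and nz: "\<forall>w\<in>annulus \<rho> R. \<phi> w \<noteq> 0"
    and branch: "TT = UNIV ==> L analytic_on annulus \<rho> R" and T: "\<forall>i\<in>{1..N}. T i \<in> TT"
  shows "contour_setting TT v N R \<rho> (phi_power TT \<phi> L) T"
proof
  show "1 \<le> N" "0 < \<rho>" by fact+
  show "\<rho> < v i \<and> v i < R" if "i \<in> {1..N}" for i using v that by blast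
  show "phi_power TT \<phi> L t analytic_on annulus \<rho> R" for t
  proof (cases "TT = \<int>")
    case True
    then show ?thesis using analytic_on_power_int_nz[OF an, of "\<lfloor>t\<rfloor>"] nz by (simp add: phi_power_def[abs_def])
  next
    case False
    then have "L analytic_on annulus \<rho> R" using times branch by blast
    then have "(\<lambda>w. exp (of_real t * L w)) analytic_on annulus \<rho> R" by (intro analytic_intros)
    then show ?thesis using False by (simp add: phi_power_def[abs_def])
  qed
  show "phi_power TT \<phi> L t w \<noteq> 0" if "w \<in> annulus \<rho> R" for t w using nz that by (simp add: phi_power_def)
  show "phi_power TT \<phi> L s w * phi_power TT \<phi> L t w = phi_power TT \<phi> L (s + t) w"
    if st: "s \<in> TT" "t \<in> TT" and w: "w \<in> annulus \<rho> R" for s t w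
  proof (cases "TT = \<int>")
    case True
    \<comment> \<open>The floor only converts integer times to type \<open>int\<close>; on integers
      it is additive.\<close>
    then have "\<lfloor>s + t\<rfloor> = \<lfloor>s\<rfloor> + \<lfloor>t\<rfloor>" using st by (auto elim!: Ints_cases)
    then show ?thesis using True nz w by (simp add: phi_power_def power_int_add)
  next
    case False
    then show ?thesis by (simp add: phi_power_def exp_add distrib_right)
  qed
  show "0 \<in> TT" using times by auto
  show "s + t \<in> TT" if "s \<in> TT" "t \<in> TT" for s t using times that by auto
  show "s - t \<in> TT" if "s \<in> TT" "t \<in> TT" for s t using times that by auto
  show "T i \<in> TT" if "i \<in> {1..N}" for i using T that by blast
qed

theorem theorem4p3:
  fixes TT :: "real set" and U :: "complex set" and \<phi> L :: "complex \<Rightarrow> complex"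
    and P :: "real \<Rightarrow> complex \<Rightarrow> complex"
    and N m :: nat and v T :: "nat \<Rightarrow> real" and \<rho> R :: real
    and \<nn> :: "nat \<Rightarrow> nat \<times> real" and S :: "(nat \<times> real) set"
  assumes times: "TT = UNIV \<or> TT = \<int>"
    and domain: "open U" "connected U" "0 \<in> U" "1 \<in> U"
    and singularities: "\<exists>sing. finite sing \<and> sing \<subseteq> U \<and> \<phi> holomorphic_on (U - sing)"
    and radii: "0 < \<rho>" "\<forall>i\<in>{1..N}. \<rho> < v i \<and> v i < R"
    and annulus: "annulus \<rho> R \<subseteq> U" "\<phi> analytic_on annulus \<rho> R" "\<forall>w\<in>annulus \<rho> R. \<phi> w \<noteq> 0"
    and branch: "TT = UNIV \<Longrightarrow> L analytic_on annulus \<rho> R \<and> (\<forall>w\<in>annulus \<rho> R. exp (L w) = \<phi> w)"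
    and P_def: "P = phi_power TT \<phi> L"
    and T: "\<forall>i\<in>{1..N}. T i \<in> TT" "\<forall>i\<in>{1..N}. \<forall>j\<in>{1..N}. i \<le> j \<longrightarrow> T j \<le> T i"
    and path: "space_like_path TT N m \<nn>" "\<forall>i\<in>{1..m}. T 1 < snd (\<nn> i)"
    and S_def: "S = \<nn> ` {1..m}"
  shows "\<forall>y :: nat \<Rightarrow> int.
    (\<forall>p\<in>S. \<exists>!\<Phi>. \<Phi> \<in> {..<fst p} \<rightarrow>\<^sub>E UNIV \<and> is_Phi v \<rho> P T y p \<Phi>) \<and>
    (\<forall>\<Phi>. (\<forall>p\<in>S. is_Phi v \<rho> P T y p (\<Phi> p)) \<longrightarrow>
      (\<forall>a :: nat \<Rightarrow> int.
        let A = (\<lambda>u u'. chi_bar m \<nn> a u * K_kernel v \<rho> P T y \<Phi> u u' * chi_bar m \<nn> a u') in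
        fredholm_convergent (S \<times> UNIV) A \<and>
        M_fun v R P N T m \<nn> y a = fredholm_det_I_minus (S \<times> UNIV) A) \<and>
      ((\<forall>t\<in>TT. \<forall>w\<in>annulus \<rho> R. P t (cnj w) = cnj (P t w)) \<longrightarrow>
        (\<forall>u\<in>S \<times> UNIV. \<forall>u'\<in>S \<times> UNIV. K_kernel v \<rho> P T y \<Phi> u u' \<in> \<real>)))"
proof -
  have m: "1 \<le> m" and nn: "\<And>i. i \<in> {1..m} \<Longrightarrow> \<nn> i \<in> {1..N} \<times> TT"
    and step: "\<And>i. i \<in> {1..<m} \<Longrightarrow> \<nn> i \<prec> \<nn> (Suc i)" using path(1) by (auto simp: space_like_path_def)
  \<comment> \<open>A path has at least one node, and the level of that node forces
    \<open>N \<ge> 1\<close>.\<close>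
  have "\<nn> 1 \<in> {1..N} \<times> TT" using m by (intro nn) auto
  then have N: "1 \<le> N" by (cases "\<nn> 1") auto
  have SN: "p \<in> {1..N} \<times> TT" if "p \<in> S" for p using that nn unfolding S_def by blast
  have setting: "contour_setting TT v N R \<rho> P T"
    unfolding P_def by (rule phi_power_setting[OF times N radii annulus(2,3) _ T(1)]) (rule branch[THEN conjunct1])
  show ?thesis
  proof (intro allI conjI ballI impI, goal_cases)
    case (1 y p)
    show ?case by (rule contour_setting.is_Phi_ex1[OF setting SN[OF 1]])
  next
    case (2 y \<Phi> a)
    interpret contour_setting TT v N R \<rho> P T y by (rule setting)
    interpret path_setting TT v N R \<rho> P T y m \<nn> \<Phi> a
      by unfold_locales (use m nn step 2 in \<open>auto simp: S_def\<close>)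
    have KA: "KA = (\<lambda>u u'. chi_bar m \<nn> a u * K_kernel v \<rho> P T y \<Phi> u u' * chi_bar m \<nn> a u')"
      by (intro ext) (rule KA_def)
    show ?case unfolding Let_def KA[symmetric] S_def using fredholm_path by blast
  next
    case (3 y \<Phi> u u')
    obtain p x q x' where pq: "u = (p, x)" "u' = (q, x')" "p \<in> S" "q \<in> S" using 3 by (cases u, cases u') auto
    show ?case unfolding pq(1,2)
      by (rule contour_setting.K_kernel_real[OF setting]) (use 3 SN pq in auto)
  qed
qed

end
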